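(* Let $T>0$ and $H\in(\frac12,1)$. Let $\mathcal{L}$ be the generator of a symmetric Lévy process in $\mathbb{R}^d$ with characteristic exponent $\Psi$ and transition densities $p_t$, and let $B$ be a fractional-colored Gaussian noise with Hurst index $H$ in time and spatial covariance function $f$, where $f$ is the Fourier transform of a tempered measure $\mu$ on $\mathbb{R}^d$. Suppose that for every $t>0$ $$\int_{\mathbb{R}^d}\frac{\mu(d\xi)}{t^{-2H}+\Psi(\xi)^{2H}}<\infty.$$ Then the stochastic heat equation $$\partial_tu=\mathcal{L}u(t,x)+\dot B,\qquad u(0,x)=0,\qquad 0\le t\le T,\ x\in\mathbb{R}^d,$$ has a solution $\{u(t,x):(t,x)\in[0,T]\times\mathbb{R}^d\}$, and for all $(t,x)\in[0,T]\times\mathbb{R}^d$ $$u(t,x)=\int_0^t\int_{\mathbb{R}^d}g_{t,x}(s,y)\,B(ds\,dy),\qquad g_{t,x}(s,y)=p_{t-s}(x-y)\mathbf{1}_{\{s<t\}}.$$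
   Context: The Lévy process $X$ satisfies $X_0=0$ and $\mathbb{E}(e^{i\langle\xi,X_t\rangle})=e^{-t\Psi(\xi)}$. Symmetric means $\Psi(\xi)=\Psi(-\xi)$ (so $\Psi\ge0$ is real). $X_t$ is assumed to have the density $p_t(x)=(2\pi)^{-d}\int_{\mathbb{R}^d}e^{-i\langle x,\xi\rangle}e^{-t\Psi(\xi)}d\xi$ for every $t>0$. Fourier transform: $\mathcal{F}\varphi(\xi)=\int_{\mathbb{R}^d}e^{-i\langle\xi,x\rangle}\varphi(x)dx$. The function $f$ is the Fourier transform of $\mu$ in the sense that $\int f\varphi\,dx=\int\mathcal{F}\varphi\,d\mu$ for all Schwartz functions $\varphi$. The space $\mathcal{HP}$ is the completion of $C_c^\infty((0,T)\times\mathbb{R}^d)$ under $$\langle\varphi,\psi\rangle_{\mathcal{HP}}=H(2H-1)\int_0^T\int_0^T\int_{\mathbb{R}^d}\int_{\mathbb{R}^d}\varphi(u,x)|u-v|^{2H-2}f(x-y)\psi(v,y)\,dy\,dx\,du\,dv,$$ where the spatial double integral is understood through the Parseval identity $\int\int\varphi(x)f(x-y)\psi(y)dxdy=c_d\int\mathcal{F}\varphi(\xi)\overline{\mathcal{F}\psi(\xi)}\mu(d\xi)$, with $c_d>0$ a normalizing constant depending only on $d$. The noise $B=\{B(\varphi)\}$ is a centered Gaussian process with $\mathbb{E}[B(\varphi)B(\psi)]=\langle\varphi,\psi\rangle_{\mathcal{HP}}$ for $\varphi,\psi\in C_c^\infty((0,T)\times\mathbb{R}^d)$. It extends by isometry to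 $\varphi\in\mathcal{HP}$, and one writes $B(\varphi)=\int_0^T\int_{\mathbb{R}^d}\varphi(t,x)B(dt\,dx)$. In particular $B(t,A)=B(\mathbf{1}_{[0,t]\times A})$ has covariance $\mathbb{E}(B(t,A)B(s,C))=\frac12(t^{2H}+s^{2H}-|t-s|^{2H})\int_A\int_Cf(z-z')dz\,dz'$. Definition of solution: a random field $\{u(t,x):(t,x)\in[0,T]\times\mathbb{R}^d\}$ is a solution if for every $\eta\in C_c^\infty((0,T)\times\mathbb{R}^d)$, $$\int_0^T\int_{\mathbb{R}^d}u(t,x)\eta(t,x)\,dx\,dt=\int_0^T\int_{\mathbb{R}^d}(\eta*\tilde p)(s,y)\,B(ds\,dy)\quad\text{a.s.},$$ where $(\eta*\tilde p)(s,y)=\int_s^T\int_{\mathbb{R}^d}\eta(t,x)p_{t-s}(x-y)\,dx\,dt$. *)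

theory Defs
  imports "HOL-Probability.Probability"
begin

section \<open>Test functions and the Fourier transform\<close>

definition partial_deriv :: "'a::euclidean_space \<Rightarrow> ('a \<Rightarrow> 'b::real_normed_vector) \<Rightarrow> 'a \<Rightarrow> 'b" where
  "partial_deriv b f = (\<lambda>x. frechet_derivative f (at x) b)"

definition iter_partial :: "'a::euclidean_space list \<Rightarrow> ('a \<Rightarrow> 'b::real_normed_vector) \<Rightarrow> 'a \<Rightarrow> 'b" where
  "iter_partial bs f = foldr partial_deriv bs f"

text \<open>Class \<open>C\<^sup>\<infinity>\<close>. Differentiability of all iterated partial derivatives makes all of them
  continuous.\<close>
definition smooth :: "('a::euclidean_space \<Rightarrow> 'b::real_normed_vector) \<Rightarrow> bool" where
  "smooth f \<longleftrightarrow> (\<forall>bs. set bs \<subseteq> Basis \<longrightarrow> (\<forall>x. iter_partial bs f differentiable (at x)))"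

definition schwartz :: "('a::euclidean_space \<Rightarrow> complex) \<Rightarrow> bool" where
  "schwartz \<phi> \<longleftrightarrow> smooth \<phi> \<and>
     (\<forall>bs k. set bs \<subseteq> Basis \<longrightarrow> (\<exists>C. \<forall>x. (1 + norm x) ^ k * norm (iter_partial bs \<phi> x) \<le> C))"

text \<open>\<open>C\<^sub>c\<^sup>\<infinity>((0,T) \<times> \<real>\<^sup>d)\<close>, the functions being extended by zero to all of space-time.\<close>
definition test_functions :: "real \<Rightarrow> (real \<times> 'a::euclidean_space \<Rightarrow> real) set" where
  "test_functions T = {\<phi>. smooth \<phi> \<and> compact (closure {z. \<phi> z \<noteq> 0}) \<and>
      closure {z. \<phi> z \<noteq> 0} \<subseteq> {0<..<T} \<times> UNIV}"

definition fourier :: "('a::euclidean_space \<Rightarrow> complex) \<Rightarrow> 'a \<Rightarrow> complex" where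
  "fourier \<phi> \<xi> = (\<integral>x. exp (- (\<i> * complex_of_real (\<xi> \<bullet> x))) * \<phi> x \<partial>lborel)"

definition space_fourier :: "(real \<times> 'a::euclidean_space \<Rightarrow> real) \<Rightarrow> real \<Rightarrow> 'a \<Rightarrow> complex" where
  "space_fourier \<phi> u \<xi> = fourier (\<lambda>x. complex_of_real (\<phi> (u, x))) \<xi>"

definition tempered_measure :: "'a::euclidean_space measure \<Rightarrow> bool" where
  "tempered_measure \<mu> \<longleftrightarrow> sets \<mu> = sets borel \<and>
     (\<exists>k::nat. (\<integral>\<^sup>+\<xi>. ennreal (1 / (1 + (norm \<xi>)\<^sup>2) ^ k) \<partial>\<mu>) < \<infinity>)"

text \<open>Since \<open>f\<close> is real-valued, this forces \<open>\<mu>\<close> to be symmetric.\<close>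
definition is_fourier_transform_of :: "('a::euclidean_space \<Rightarrow> real) \<Rightarrow> 'a measure \<Rightarrow> bool" where
  "is_fourier_transform_of f \<mu> \<longleftrightarrow>
     (\<forall>\<phi>. schwartz \<phi> \<longrightarrow>
        integrable lborel (\<lambda>x. complex_of_real (f x) * \<phi> x) \<and>
        (\<integral>x. complex_of_real (f x) * \<phi> x \<partial>lborel) = (\<integral>\<xi>. fourier \<phi> \<xi> \<partial>\<mu>))"


section \<open>Symmetric Levy processes with densities\<close>

definition levy_process :: "'v measure \<Rightarrow> (real \<Rightarrow> 'v \<Rightarrow> 'a::euclidean_space) \<Rightarrow> bool" where
  "levy_process Q X \<longleftrightarrow> prob_space Q \<and>
     (\<forall>t\<ge>0. X t \<in> borel_measurable Q) \<and>
     (AE \<omega> in Q. X 0 \<omega> = 0) \<and>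
     (\<forall>(n::nat) \<tau>. 0 \<le> \<tau> 0 \<and> mono \<tau> \<longrightarrow>
        prob_space.indep_vars Q (\<lambda>_. borel) (\<lambda>i \<omega>. X (\<tau> (Suc i)) \<omega> - X (\<tau> i) \<omega>) {..<n}) \<and>
     (\<forall>s\<ge>0. \<forall>t\<ge>0. distr Q borel (\<lambda>\<omega>. X (s + t) \<omega> - X s \<omega>) = distr Q borel (X t)) \<and>
     (\<forall>e>0. ((\<lambda>t. measure Q {\<omega>\<in>space Q. norm (X t \<omega>) > e}) \<longlongrightarrow> 0) (at_right 0))"

definition has_char_exponent ::
    "'v measure \<Rightarrow> (real \<Rightarrow> 'v \<Rightarrow> 'a::euclidean_space) \<Rightarrow> ('a \<Rightarrow> complex) \<Rightarrow> bool" where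
  "has_char_exponent Q X \<Psi> \<longleftrightarrow>
     (\<forall>t\<ge>0. \<forall>\<xi>. (\<integral>\<omega>. exp (\<i> * complex_of_real (\<xi> \<bullet> X t \<omega>)) \<partial>Q) = exp (- (complex_of_real t * \<Psi> \<xi>)))"

definition has_transition_densities ::
    "'v measure \<Rightarrow> (real \<Rightarrow> 'v \<Rightarrow> 'a::euclidean_space) \<Rightarrow> ('a \<Rightarrow> complex) \<Rightarrow> (real \<Rightarrow> 'a \<Rightarrow> real) \<Rightarrow> bool" where
  "has_transition_densities Q X \<Psi> p \<longleftrightarrow>
     (\<forall>t>0. distributed Q lborel (X t) (\<lambda>x. ennreal (p t x)) \<and>
        integrable lborel (\<lambda>\<xi>. exp (- (complex_of_real t * \<Psi> \<xi>))) \<and>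
        (\<forall>x. complex_of_real (p t x) =
           complex_of_real (1 / (2 * pi) ^ DIM('a)) *
           (\<integral>\<xi>. exp (- (\<i> * complex_of_real (x \<bullet> \<xi>))) * exp (- (complex_of_real t * \<Psi> \<xi>)) \<partial>lborel)))"


section \<open>The Hilbert space of the noise\<close>

text \<open>The form \<open>\<langle>\<phi>,\<psi>\<rangle>\<close>, with the spatial double integral of \<open>\<phi>(u,x) f(x-y) \<psi>(v,y)\<close> read through
  the Parseval identity; \<open>c\<close> is the normalizing constant of that identity (it is 1 for the convention of \<^const>\<open>fourier\<close>,
  but is kept as an arbitrary positive parameter). The spatial integral is real when \<open>\<mu>\<close> is symmetric.\<close>
definition hp_inner :: "real \<Rightarrow> real \<Rightarrow> real \<Rightarrow> 'a::euclidean_space measure \<Rightarrow>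
    (real \<times> 'a \<Rightarrow> real) \<Rightarrow> (real \<times> 'a \<Rightarrow> real) \<Rightarrow> real" where
  "hp_inner T H c \<mu> \<phi> \<psi> = H * (2 * H - 1) *
     (LBINT u:{0..T}. (LBINT v:{0..T}. \<bar>u - v\<bar> powr (2 * H - 2) *
        (c * Re (\<integral>\<xi>. space_fourier \<phi> u \<xi> * cnj (space_fourier \<psi> v \<xi>) \<partial>\<mu>))))"

definition hp_norm :: "real \<Rightarrow> real \<Rightarrow> real \<Rightarrow> 'a::euclidean_space measure \<Rightarrow> (real \<times> 'a \<Rightarrow> real) \<Rightarrow> real" where
  "hp_norm T H c \<mu> \<phi> = sqrt (hp_inner T H c \<mu> \<phi> \<phi>)"

text \<open>The completion of the test functions: Cauchy sequences of test functions modulo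
  sequences tending to zero.\<close>
definition hp_Cauchy :: "real \<Rightarrow> real \<Rightarrow> real \<Rightarrow> 'a::euclidean_space measure \<Rightarrow>
    (nat \<Rightarrow> real \<times> 'a \<Rightarrow> real) \<Rightarrow> bool" where
  "hp_Cauchy T H c \<mu> \<Phi> \<longleftrightarrow> (\<forall>n. \<Phi> n \<in> test_functions T) \<and>
     (\<forall>e>0. \<exists>N. \<forall>m\<ge>N. \<forall>n\<ge>N. hp_norm T H c \<mu> (\<lambda>z. \<Phi> m z - \<Phi> n z) < e)"

definition hp_equiv :: "real \<Rightarrow> real \<Rightarrow> real \<Rightarrow> 'a::euclidean_space measure \<Rightarrow>
    ((nat \<Rightarrow> real \<times> 'a \<Rightarrow> real) \<times> (nat \<Rightarrow> real \<times> 'a \<Rightarrow> real)) set" where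
  "hp_equiv T H c \<mu> = {(\<Phi>, \<Phi>'). hp_Cauchy T H c \<mu> \<Phi> \<and> hp_Cauchy T H c \<mu> \<Phi>' \<and>
     (\<lambda>n. hp_norm T H c \<mu> (\<lambda>z. \<Phi> n z - \<Phi>' n z)) \<longlonglongrightarrow> 0}"

definition HP :: "real \<Rightarrow> real \<Rightarrow> real \<Rightarrow> 'a::euclidean_space measure \<Rightarrow>
    (nat \<Rightarrow> real \<times> 'a \<Rightarrow> real) set set" where
  "HP T H c \<mu> = Collect (hp_Cauchy T H c \<mu>) // hp_equiv T H c \<mu>"

text \<open>Functions for which the form \<open>\<langle>\<phi>,\<phi>\<rangle>\<close> converges absolutely. On these \<^const>\<open>hp_norm\<close> is a
  seminorm extending the one on test functions.\<close>
definition hp_function :: "real \<Rightarrow> real \<Rightarrow> 'a::euclidean_space measure \<Rightarrow> (real \<times> 'a \<Rightarrow> real) \<Rightarrow> bool" where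
  "hp_function T H \<mu> \<phi> \<longleftrightarrow>
     set_borel_measurable borel ({0<..<T} \<times> UNIV) \<phi> \<and>
     (AE u in lborel. u \<in> {0<..<T} \<longrightarrow> integrable lborel (\<lambda>x. \<phi> (u, x))) \<and>
     (\<integral>\<^sup>+u\<in>{0..T}. (\<integral>\<^sup>+v\<in>{0..T}. ennreal (\<bar>u - v\<bar> powr (2 * H - 2)) *
        (\<integral>\<^sup>+\<xi>. ennreal (norm (space_fourier \<phi> u \<xi>) * norm (space_fourier \<phi> v \<xi>)) \<partial>\<mu>) \<partial>lborel) \<partial>lborel) < \<infinity>"

text \<open>Identification of a function \<open>\<phi>\<close> with an element \<open>h\<close> of the completion. For a test function
  it gives the class of the constant sequence.\<close>
definition hp_represents :: "real \<Rightarrow> real \<Rightarrow> real \<Rightarrow> 'a::euclidean_space measure \<Rightarrow>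
    (nat \<Rightarrow> real \<times> 'a \<Rightarrow> real) set \<Rightarrow> (real \<times> 'a \<Rightarrow> real) \<Rightarrow> bool" where
  "hp_represents T H c \<mu> h \<phi> \<longleftrightarrow> h \<in> HP T H c \<mu> \<and> hp_function T H \<mu> \<phi> \<and>
     (\<forall>\<Phi>\<in>h. (\<lambda>n. hp_norm T H c \<mu> (\<lambda>z. \<Phi> n z - \<phi> z)) \<longlonglongrightarrow> 0)"


section \<open>Fractional-colored noise and its stochastic integral\<close>

definition centered_gaussian_rv :: "'w measure \<Rightarrow> ('w \<Rightarrow> real) \<Rightarrow> bool" where
  "centered_gaussian_rv P Y \<longleftrightarrow> Y \<in> borel_measurable P \<and>
     ((AE \<omega> in P. Y \<omega> = 0) \<or> (\<exists>\<sigma>>0. distributed P lborel Y (\<lambda>x. ennreal (normal_density 0 \<sigma> x))))"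

definition centered_gaussian_process :: "'w measure \<Rightarrow> 'i set \<Rightarrow> ('i \<Rightarrow> 'w \<Rightarrow> real) \<Rightarrow> bool" where
  "centered_gaussian_process P I B \<longleftrightarrow>
     (\<forall>S a. finite S \<and> S \<subseteq> I \<longrightarrow> centered_gaussian_rv P (\<lambda>\<omega>. \<Sum>i\<in>S. a i * B i \<omega>))"

definition fractional_colored_noise :: "'w measure \<Rightarrow> real \<Rightarrow> real \<Rightarrow> real \<Rightarrow> 'a::euclidean_space measure \<Rightarrow>
    ((real \<times> 'a \<Rightarrow> real) \<Rightarrow> 'w \<Rightarrow> real) \<Rightarrow> bool" where
  "fractional_colored_noise P T H c \<mu> B \<longleftrightarrow> prob_space P \<and>
     centered_gaussian_process P (test_functions T) B \<and>
     (\<forall>\<phi>\<in>test_functions T. \<forall>\<psi>\<in>test_functions T.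
        (\<integral>\<omega>. B \<phi> \<omega> * B \<psi> \<omega> \<partial>P) = hp_inner T H c \<mu> \<phi> \<psi>)"

text \<open>\<open>Z\<close> is (a version of) \<open>B(h)\<close>, where \<open>B\<close> is extended to the completion by isometry.\<close>
definition noise_extension :: "'w measure \<Rightarrow> ((real \<times> 'a::euclidean_space \<Rightarrow> real) \<Rightarrow> 'w \<Rightarrow> real) \<Rightarrow>
    (nat \<Rightarrow> real \<times> 'a \<Rightarrow> real) set \<Rightarrow> ('w \<Rightarrow> real) \<Rightarrow> bool" where
  "noise_extension P B h Z \<longleftrightarrow> Z \<in> borel_measurable P \<and> integrable P (\<lambda>\<omega>. (Z \<omega>)\<^sup>2) \<and>
     (\<forall>\<Phi>\<in>h. (\<lambda>n. \<integral>\<omega>. (B (\<Phi> n) \<omega> - Z \<omega>)\<^sup>2 \<partial>P) \<longlonglongrightarrow> 0)"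

text \<open>\<open>\<phi>\<close> belongs to the completion and \<open>Z = \<integral>\<integral> \<phi>(s,y) B(ds dy)\<close> almost surely.\<close>
definition has_noise_integral :: "'w measure \<Rightarrow> real \<Rightarrow> real \<Rightarrow> real \<Rightarrow> 'a::euclidean_space measure \<Rightarrow>
    ((real \<times> 'a \<Rightarrow> real) \<Rightarrow> 'w \<Rightarrow> real) \<Rightarrow> (real \<times> 'a \<Rightarrow> real) \<Rightarrow> ('w \<Rightarrow> real) \<Rightarrow> bool" where
  "has_noise_integral P T H c \<mu> B \<phi> Z \<longleftrightarrow>
     (\<exists>h. hp_represents T H c \<mu> h \<phi> \<and> noise_extension P B h Z)"


section \<open>The stochastic heat equation\<close>

definition heat_kernel_at :: "(real \<Rightarrow> 'a::euclidean_space \<Rightarrow> real) \<Rightarrow> real \<Rightarrow> 'a \<Rightarrow> real \<times> 'a \<Rightarrow> real" where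
  "heat_kernel_at p t x = (\<lambda>(s, y). if s < t then p (t - s) (x - y) else 0)"

definition backward_conv :: "real \<Rightarrow> (real \<Rightarrow> 'a::euclidean_space \<Rightarrow> real) \<Rightarrow> (real \<times> 'a \<Rightarrow> real) \<Rightarrow>
    real \<times> 'a \<Rightarrow> real" where
  "backward_conv T p \<eta> =
     (\<lambda>(s, y). LBINT t:{s..T}. (\<integral>x. \<eta> (t, x) * p (t - s) (x - y) \<partial>lborel))"

text \<open>Solution of \<open>\<partial>\<^sub>t u = L u + B'\<close>, \<open>u(0,x) = 0\<close>, in the weak sense. The generator \<open>L\<close> enters only
  through the transition densities \<open>p\<close> of the process it generates. Joint measurability and
  integrability are what the pathwise integral on the left-hand side needs.\<close>
definition heat_solution :: "'w measure \<Rightarrow> real \<Rightarrow> real \<Rightarrow> real \<Rightarrow> 'a::euclidean_space measure \<Rightarrow>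
    ((real \<times> 'a \<Rightarrow> real) \<Rightarrow> 'w \<Rightarrow> real) \<Rightarrow> (real \<Rightarrow> 'a \<Rightarrow> real) \<Rightarrow> (real \<Rightarrow> 'a \<Rightarrow> 'w \<Rightarrow> real) \<Rightarrow> bool" where
  "heat_solution P T H c \<mu> B p u \<longleftrightarrow>
     (\<lambda>((t, x), \<omega>). u t x \<omega>) \<in> borel_measurable (restrict_space borel ({0..T} \<times> UNIV) \<Otimes>\<^sub>M P) \<and>
     (\<forall>\<eta>\<in>test_functions T. \<exists>Z. has_noise_integral P T H c \<mu> B (backward_conv T p \<eta>) Z \<and>
        (AE \<omega> in P. set_integrable lborel ({0..T} \<times> UNIV) (\<lambda>(t, x). u t x \<omega> * \<eta> (t, x)) \<and>
           (LBINT t:{0..T}. (\<integral>x. u t x \<omega> * \<eta> (t, x) \<partial>lborel)) = Z \<omega>))"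

end

theory Submission
  imports Defs "HOL-Real_Asymp.Real_Asymp"
begin

text \<open>
  In frequency the inner product of the noise is the \<open>\<mu>\<close>-integral of a time form with kernel
  \<open>\<bar>u - v\<bar> powr (2 * H - 2)\<close>. That kernel is a superposition of indicators of squares on the diagonal, so the form is
  positive and continuous under weak convergence with domination. For the heat kernel the time form at frequency
  \<open>\<xi>\<close> is of order \<open>min T (1 / \<Psi> \<xi>) powr (2 * H)\<close>, which the hypothesis makes \<open>\<mu>\<close>-integrable. Functions
  with \<open>\<mu>\<close>-integrable time form are approximated by test functions through truncation and mollification, so
  their noise integrals exist. Finally let \<open>u z\<close> be a jointly measurable version of the noise integral of the heat kernel
  at \<open>z\<close>, let \<open>Y\<close> be the integral of \<open>u * \<eta>\<close> and \<open>Z\<close> the noise integral of the backward convolution of \<open>\<eta>\<close>. By Fubini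
  and the isometry the covariances of \<open>Y\<close> with itself, of \<open>Y\<close> with \<open>Z\<close> and of \<open>Z\<close> with itself agree, so \<open>Y = Z\<close>
  almost surely.
\<close>

text \<open>The density of test functions needs two limits in a fixed order. Truncating a function
  in space leaves no bound on its transform except a uniform one by an \<open>L1\<close> norm, and a
  constant need not be \<mu>-integrable. So the spatial mollifier is fixed first: its rapidly
  decaying transform gives a \<mu>-integrable majorant while truncation and time mollification pass
  to the limit, and only afterwards does its radius shrink. Time mollification is controlled only
  through integrals over intervals, and the representation of the kernel by squares turns this into
  convergence of the form. The exponent \<open>2 * H\<close> arises by cutting the kernel at a
  distance equal to the mass \<open>m\<close> of the integrand: the near and the far part are both
  of order \<open>m powr (2 * H - 1)\<close>, and the second time variable adds a factor
  \<open>m\<close>. The noise is not assumed linear in its argument, so every statement about it is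
  derived from covariances. The density enters its distribution only through \<open>ennreal\<close>,
  which hides negative values; its pointwise sign has to come from the inversion formula.\<close>

section \<open>Smooth functions and mollifiers\<close>

text \<open>A finite order of smoothness, peeling off the innermost derivative. Closure under sums,
  products and composition then becomes an induction on the order, which the quantification over
  lists of directions in \<open>smooth\<close> does not offer.\<close>

fun times_differentiable :: "nat \<Rightarrow> ('a::euclidean_space \<Rightarrow> 'b::real_normed_vector) \<Rightarrow> bool" where
  "times_differentiable 0 f = True"
| "times_differentiable (Suc n) f \<longleftrightarrow>
     (\<forall>x. f differentiable (at x)) \<and> (\<forall>b\<in>Basis. times_differentiable n (partial_deriv b f))"

lemma iter_partial_Cons: "iter_partial (b # bs) f = partial_deriv b (iter_partial bs f)"
  by (simp add: iter_partial_def)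

lemma iter_partial_append: "iter_partial (as @ bs) f = iter_partial as (iter_partial bs f)"
  by (simp add: iter_partial_def)

lemma times_differentiable_iter_partial:
  assumes "times_differentiable (n + length bs) f" "set bs \<subseteq> Basis"
  shows "times_differentiable n (iter_partial bs f)"
  using assms
proof (induction bs arbitrary: n)
  case Nil
  then show ?case by (simp add: iter_partial_def)
next
  case (Cons b bs)
  have "times_differentiable (Suc n) (iter_partial bs f)"
    using Cons.IH[of "Suc n"] Cons.prems by simp
  then show ?case using Cons.prems by (simp add: iter_partial_Cons)
qed

lemma smooth_partial_deriv:
  assumes "smooth f" "b \<in> Basis" shows "smooth (partial_deriv b f)"
  unfolding smooth_def
proof (intro allI impI)
  fix bs :: "'a list" and x assume "set bs \<subseteq> Basis"
  then have "iter_partial (bs @ [b]) f differentiable (at x)"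
    using assms unfolding smooth_def by (metis Un_subset_iff empty_set empty_subsetI insert_subset list.simps(15) set_append)
  then show "iter_partial bs (partial_deriv b f) differentiable (at x)"
    by (simp only: iter_partial_append) (simp add: iter_partial_def)
qed

lemma smooth_differentiable: "smooth f \<Longrightarrow> f differentiable (at x)"
  unfolding smooth_def iter_partial_def by (metis empty_set empty_subsetI foldr_Nil id_apply)

lemma smooth_iff_times_differentiable: "smooth f \<longleftrightarrow> (\<forall>n. times_differentiable n f)"
proof
  assume "smooth f"
  have "times_differentiable n f" if "smooth f" for n and f :: "'a \<Rightarrow> 'b"
    using that
    by (induction n arbitrary: f) (auto simp: smooth_differentiable smooth_partial_deriv)
  then show "\<forall>n. times_differentiable n f" using \<open>smooth f\<close> by blast
next
  assume *: "\<forall>n. times_differentiable n f"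
  show "smooth f"
    unfolding smooth_def
  proof (intro allI impI)
    fix bs :: "'a list" and x assume "set bs \<subseteq> Basis"
    then have "times_differentiable (Suc 0) (iter_partial bs f)"
      using * times_differentiable_iter_partial by blast
    then show "iter_partial bs f differentiable (at x)" by simp
  qed
qed

text \<open>Coinduction for smoothness. It serves convolutions, where each derivative falls on the
  kernel and so stays in the class of convolutions of the same shape.\<close>

lemma smooth_coinduct:
  assumes "f \<in> C"
    and "\<And>f x. f \<in> C \<Longrightarrow> f differentiable (at x)"
    and "\<And>f b. f \<in> C \<Longrightarrow> b \<in> Basis \<Longrightarrow> partial_deriv b f \<in> C"
  shows "smooth f"
proof -
  have "times_differentiable n f" if "f \<in> C" for n f
    using that by (induction n arbitrary: f) (auto simp: assms(2,3))
  then show ?thesis using assms(1) by (simp add: smooth_iff_times_differentiable)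
qed

lemma partial_deriv_eqI:
  assumes "\<And>x. (f has_derivative f' x) (at x)"
  shows "partial_deriv b f = (\<lambda>x. f' x b)"
  unfolding partial_deriv_def using frechet_derivative_at[OF assms] by metis

text \<open>Writes the total derivative through partial derivatives, the only objects to which the
  induction hypotheses on \<open>times_differentiable\<close> apply; this is the form of the chain
  rule used below.\<close>

lemma has_derivative_sum_partial_deriv:
  assumes "f differentiable (at x)"
  shows "(f has_derivative (\<lambda>h. \<Sum>b\<in>Basis. (h \<bullet> b) *\<^sub>R partial_deriv b f x)) (at x)"
proof -
  interpret bounded_linear "frechet_derivative f (at x)"
    using assms frechet_derivative_works has_derivative_bounded_linear by blast
  have "frechet_derivative f (at x) h = (\<Sum>b\<in>Basis. (h \<bullet> b) *\<^sub>R partial_deriv b f x)" for h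
    by (subst euclidean_representation[of h, symmetric]) (simp only: sum scaleR partial_deriv_def)
  then have "frechet_derivative f (at x) = (\<lambda>h. \<Sum>b\<in>Basis. (h \<bullet> b) *\<^sub>R partial_deriv b f x)"
    by (rule ext)
  with assms show ?thesis using frechet_derivative_works by metis
qed

lemma has_derivative_frechet: "f differentiable (at x) \<Longrightarrow> (f has_derivative frechet_derivative f (at x)) (at x)"
  using frechet_derivative_works by blast

section \<open>Closure properties of finite differentiability\<close>

lemma times_differentiable_const: "times_differentiable n (\<lambda>_::'a::euclidean_space. c)"
proof (induction n arbitrary: c)
  case (Suc n)
  have "partial_deriv b (\<lambda>_::'a. c) = (\<lambda>_. 0)" for b
    by (rule partial_deriv_eqI) (rule has_derivative_const)
  then show ?case using Suc by simp
qed simp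

lemma times_differentiable_add:
  "times_differentiable n f \<Longrightarrow> times_differentiable n g \<Longrightarrow> times_differentiable n (\<lambda>x. f x + g x)"
proof (induction n arbitrary: f g)
  case (Suc n)
  have "partial_deriv b (\<lambda>x. f x + g x) = (\<lambda>x. partial_deriv b f x + partial_deriv b g x)" for b
    unfolding partial_deriv_def[of b f] partial_deriv_def[of b g]
    by (rule partial_deriv_eqI) (use Suc.prems in \<open>auto intro!: has_derivative_add has_derivative_frechet\<close>)
  then show ?case using Suc by simp
qed simp

lemma times_differentiable_sum:
  "(\<And>i. i \<in> I \<Longrightarrow> times_differentiable n (f i)) \<Longrightarrow> times_differentiable n (\<lambda>x. \<Sum>i\<in>I. f i x)"
  by (induction I rule: infinite_finite_induct)
     (auto simp: times_differentiable_const intro!: times_differentiable_add)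

lemma times_differentiable_Suc_imp: "times_differentiable (Suc n) f \<Longrightarrow> times_differentiable n f"
  by (induction n arbitrary: f) auto

lemma times_differentiable_mult:
  fixes f g :: "'a::euclidean_space \<Rightarrow> 'b::real_normed_algebra"
  shows "times_differentiable n f \<Longrightarrow> times_differentiable n g \<Longrightarrow> times_differentiable n (\<lambda>x. f x * g x)"
proof (induction n arbitrary: f g)
  case (Suc n)
  have d: "((\<lambda>x. f x * g x) has_derivative
      (\<lambda>h. f x * frechet_derivative g (at x) h + frechet_derivative f (at x) h * g x)) (at x)" for x
    by (rule has_derivative_mult) (use Suc.prems in \<open>auto intro: has_derivative_frechet\<close>)
  have "partial_deriv b (\<lambda>x. f x * g x) = (\<lambda>x. f x * partial_deriv b g x + partial_deriv b f x * g x)" for b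
    using partial_deriv_eqI[OF d, of b] by (simp add: partial_deriv_def)
  moreover have "times_differentiable n f" "times_differentiable n g"
    using Suc.prems times_differentiable_Suc_imp by blast+
  moreover have "(\<lambda>x. f x * g x) differentiable (at x)" for x
    using d unfolding differentiable_def by blast
  moreover have "times_differentiable n (\<lambda>x. f x * partial_deriv b g x + partial_deriv b f x * g x)"
    if "b \<in> Basis" for b
    using Suc.prems that \<open>times_differentiable n f\<close> \<open>times_differentiable n g\<close>
    by (intro times_differentiable_add Suc.IH) simp_all
  ultimately show ?case by simp
qed simp

lemma times_differentiable_cmult:
  fixes f :: "'a::euclidean_space \<Rightarrow> 'b::real_normed_algebra"
  shows "times_differentiable n f \<Longrightarrow> times_differentiable n (\<lambda>x. c * f x)"
  by (intro times_differentiable_mult times_differentiable_const)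

lemma times_differentiable_affine:
  fixes f :: "'b::euclidean_space \<Rightarrow> real" and L :: "'a::euclidean_space \<Rightarrow> 'b"
  assumes "bounded_linear L"
  shows "times_differentiable n f \<Longrightarrow> times_differentiable n (\<lambda>x. f (L x + a))"
proof (induction n arbitrary: f)
  case (Suc n)
  have L: "((\<lambda>x. L x + a) has_derivative L) (at x)" for x
    using bounded_linear_imp_has_derivative[OF assms] by (rule has_derivative_add_const)
  have d: "((\<lambda>x. f (L x + a)) has_derivative
      (\<lambda>h. \<Sum>c\<in>Basis. (L h \<bullet> c) *\<^sub>R partial_deriv c f (L x + a))) (at x)" for x
    using has_derivative_compose[OF L has_derivative_sum_partial_deriv[of f "L x + a"]] Suc.prems
    by simp
  have "partial_deriv b (\<lambda>x. f (L x + a)) = (\<lambda>x. \<Sum>c\<in>Basis. (L b \<bullet> c) * partial_deriv c f (L x + a))" for b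
    using partial_deriv_eqI[OF d, of b] by simp
  then show ?case using Suc d
    by (auto simp: differentiable_def intro!: times_differentiable_sum times_differentiable_cmult)
qed simp

lemma times_differentiable_compose_real:
  fixes f :: "real \<Rightarrow> real" and g :: "'a::euclidean_space \<Rightarrow> real"
  shows "times_differentiable n f \<Longrightarrow> times_differentiable n g \<Longrightarrow> times_differentiable n (\<lambda>x. f (g x))"
proof (induction n arbitrary: f)
  case (Suc n)
  have d: "((\<lambda>x. f (g x)) has_derivative
      (\<lambda>h. frechet_derivative g (at x) h * partial_deriv 1 f (g x))) (at x)" for x
    using has_derivative_compose[OF has_derivative_frechet[of g x] has_derivative_sum_partial_deriv[of f "g x"]]
      Suc.prems by simp
  have "partial_deriv b (\<lambda>x. f (g x)) = (\<lambda>x. partial_deriv b g x * partial_deriv 1 f (g x))" for b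
    using partial_deriv_eqI[OF d, of b] by (simp add: partial_deriv_def)
  then show ?case using Suc d times_differentiable_Suc_imp[of n g]
    by (auto simp: differentiable_def intro!: times_differentiable_mult)
qed simp

lemma times_differentiable_inner_left: "times_differentiable n (\<lambda>x::'a::euclidean_space. x \<bullet> b)"
proof (cases n)
  case (Suc k)
  have "partial_deriv c (\<lambda>x::'a. x \<bullet> b) = (\<lambda>_. c \<bullet> b)" for c
    by (rule partial_deriv_eqI) (auto intro!: derivative_eq_intros)
  then show ?thesis using Suc
    by (auto simp: times_differentiable_const intro!: bounded_linear_imp_differentiable bounded_linear_inner_left)
qed simp

section \<open>A flat function and mollifiers\<close>

definition exp_inverse_bump :: "nat \<Rightarrow> real \<Rightarrow> real" where
  "exp_inverse_bump k x = (if x > 0 then exp (- inverse x) * inverse x ^ k else 0)"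

text \<open>The flat function of interest is the case \<open>k = 0\<close>. The powers of
  \<open>inverse x\<close> are included because differentiation maps the family into its own linear
  combinations, so smoothness follows by induction on the order for all \<open>k\<close> at
  once.\<close>

lemma exp_inverse_bump_DERIV:
  "(exp_inverse_bump k has_real_derivative
     - real k * exp_inverse_bump (Suc k) x + exp_inverse_bump (k + 2) x) (at x)"
proof -
  consider "x > 0" | "x < 0" | "x = 0" by linarith
  then show ?thesis
  proof cases
    case 1
    have d1: "((\<lambda>x. exp (- inverse x)) has_real_derivative exp (- inverse x) * (inverse x * inverse x)) (at x)"
      using 1 by (auto intro!: derivative_eq_intros)
    have d2: "((\<lambda>x. inverse x ^ k) has_real_derivative
        real k * (- (inverse x * inverse x) * inverse x ^ (k - Suc 0))) (at x)"
      by (rule DERIV_cong[OF DERIV_power[OF DERIV_inverse]]) (use 1 in auto)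
    \<comment> \<open>\<open>P\<close> stands for the power with exponent \<open>k - Suc 0\<close>
      and \<open>Q\<close> for the one with exponent \<open>k\<close>. The premise carries the
      factor \<open>n = k\<close>, so it survives the truncated subtraction at
      \<open>k = 0\<close>.\<close>
    have alg: "E * (I * I) * Q + n * (- (I * I) * P) * E = - n * (E * (I * Q)) + E * (I * (I * Q))"
      if "n * P * I = n * Q" for E I P Q n :: real
    proof -
      have "n * (- (I * I) * P) * E = - (n * P * I) * (E * I)" by algebra
      then show ?thesis unfolding that by algebra
    qed
    have "real k * inverse x ^ (k - Suc 0) * inverse x = real k * inverse x ^ k"
      by (cases k) auto
    from DERIV_cong[OF DERIV_mult[OF d1 d2] alg[OF this]]
    have "((\<lambda>x. exp (- inverse x) * inverse x ^ k) has_real_derivative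
        - real k * exp_inverse_bump (Suc k) x + exp_inverse_bump (k + 2) x) (at x)"
      using 1 by (simp only: exp_inverse_bump_def if_True power_Suc add_2_eq_Suc')
    moreover have "\<forall>\<^sub>F y in nhds x. exp (- inverse y) * inverse y ^ k = exp_inverse_bump k y"
      using eventually_nhds_in_open[of "{0<..}" x] 1
      by (auto elim!: eventually_mono simp: exp_inverse_bump_def)
    ultimately show ?thesis by (subst (asm) DERIV_cong_ev[OF refl _ refl])
  next
    case 2
    have "((\<lambda>x. 0) has_real_derivative 0) (at x)" by simp
    moreover have "\<forall>\<^sub>F y in nhds x. 0 = exp_inverse_bump k y"
      using eventually_nhds_in_open[of "{..<0}" x] 2
      by (auto elim!: eventually_mono simp: exp_inverse_bump_def)
    ultimately have "(exp_inverse_bump k has_real_derivative 0) (at x)"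
      by (subst (asm) DERIV_cong_ev[OF refl _ refl])
    then show ?thesis using 2 by (simp add: exp_inverse_bump_def)
  next
    case 3
    \<comment> \<open>With \<open>y = 1 / h\<close> the difference quotient at 0 from the right is
      \<open>y ^ Suc k / exp y\<close>; from the left it is 0.\<close>
    have lim: "((\<lambda>y::real. y ^ Suc k / exp y) \<longlongrightarrow> 0) at_top"
      by (rule tendsto_power_div_exp_0)
    have "((\<lambda>h. inverse h ^ Suc k / exp (inverse h)) \<longlongrightarrow> (0::real)) (at_right 0)"
      using filterlim_compose[OF lim filterlim_inverse_at_top_right] by simp
    moreover have "\<forall>\<^sub>F h in at_right 0. inverse h ^ Suc k / exp (inverse h) = exp_inverse_bump k h / (h::real)"
      by (rule eventually_at_right_less[THEN eventually_mono])
         (auto simp: exp_inverse_bump_def exp_minus field_simps)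
    ultimately have r: "((\<lambda>h. exp_inverse_bump k h / h) \<longlongrightarrow> 0) (at_right 0)"
      by (rule Lim_transform_eventually)
    have "\<forall>\<^sub>F h in at_left 0. 0 = exp_inverse_bump k h / (h::real)"
      by (auto simp: eventually_at_filter exp_inverse_bump_def)
    then have l: "((\<lambda>h. exp_inverse_bump k h / h) \<longlongrightarrow> 0) (at_left 0)"
      by (rule Lim_transform_eventually[OF tendsto_const])
    have "((\<lambda>h. exp_inverse_bump k h / h) \<longlongrightarrow> 0) (at 0)"
      using l r by (simp add: filterlim_split_at)
    then show ?thesis using 3 by (simp add: DERIV_def exp_inverse_bump_def)
  qed
qed

lemma times_differentiable_exp_inverse_bump: "times_differentiable n (exp_inverse_bump k)"
proof (induction n arbitrary: k)
  case (Suc n)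
  have "partial_deriv 1 (exp_inverse_bump k) = 
    (\<lambda>x. - real k * exp_inverse_bump (Suc k) x + exp_inverse_bump (k + 2) x)"
    using partial_deriv_eqI[OF exp_inverse_bump_DERIV[unfolded has_field_derivative_def], of 1 k] by simp
  moreover have "exp_inverse_bump k differentiable (at x)" for x
    using exp_inverse_bump_DERIV real_differentiable_def by blast
  moreover have "times_differentiable n (\<lambda>x. - real k * exp_inverse_bump (Suc k) x + exp_inverse_bump (k + 2) x)"
    by (intro times_differentiable_add times_differentiable_cmult Suc)
  ultimately show ?case by simp
qed simp

lemma smooth_imp_continuous_on: "smooth f \<Longrightarrow> continuous_on UNIV f"
  by (meson continuous_at_imp_continuous_on differentiable_imp_continuous_within smooth_differentiable)

lemma smooth_imp_borel: "smooth f \<Longrightarrow> f \<in> borel_measurable borel"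
  by (rule borel_measurable_continuous_onI) (rule smooth_imp_continuous_on)

definition mollifier :: "real \<Rightarrow> ('a::euclidean_space \<Rightarrow> real) \<Rightarrow> bool" where
  "mollifier e \<nu> \<longleftrightarrow> smooth \<nu> \<and> (\<forall>x. 0 \<le> \<nu> x) \<and> (\<forall>x. norm x \<ge> e \<longrightarrow> \<nu> x = 0) \<and>
     integrable lborel \<nu> \<and> (\<integral>x. \<nu> x \<partial>lborel) = 1"

lemma integrable_compact_support:
  fixes f :: "'a::euclidean_space \<Rightarrow> 'b::{banach, second_countable_topology}"
  assumes "continuous_on UNIV f" "\<And>x. norm x > R \<Longrightarrow> f x = 0"
  shows "integrable lborel f"
proof -
  have "set_integrable lborel (cball 0 R) f"
    unfolding set_integrable_def
    by (rule borel_integrable_compact) (use assms(1) continuous_on_subset in auto)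
  moreover have "indicator (cball 0 R) x *\<^sub>R f x = f x" for x
    using assms(2)[of x] by (auto simp: indicator_def)
  ultimately show ?thesis by (simp add: set_integrable_def)
qed

text \<open>Compose the flat function with \<open>e^2 - |z|^2\<close>, a polynomial in the
  coordinates, and divide by the integral. The integral is positive because the function is positive
  on an open ball, and a nonempty open set is not negligible.\<close>

lemma mollifier_exists:
  assumes "e > 0" shows "\<exists>\<nu>::'a::euclidean_space \<Rightarrow> real. mollifier e \<nu>"
proof -
  define g :: "'a \<Rightarrow> real" where "g z = exp_inverse_bump 0 (e\<^sup>2 - z \<bullet> z)" for z
  have q: "times_differentiable n (\<lambda>z::'a. e\<^sup>2 + (-1) * (\<Sum>b\<in>Basis. (z \<bullet> b) * (z \<bullet> b)))" for n
    by (intro times_differentiable_add times_differentiable_cmult times_differentiable_sum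
      times_differentiable_mult times_differentiable_const times_differentiable_inner_left)
  have qe: "e\<^sup>2 + (-1) * (\<Sum>b\<in>Basis. (z \<bullet> b) * (z \<bullet> b)) = e\<^sup>2 - z \<bullet> z" for z :: 'a
    by (simp add: euclidean_inner[of z z])
  have tg: "times_differentiable n g" for n
    unfolding g_def
    by (rule times_differentiable_compose_real[OF times_differentiable_exp_inverse_bump q, unfolded qe])
  then have sg: "smooth g" by (simp add: smooth_iff_times_differentiable)
  have g0: "g z \<ge> 0" for z by (simp add: g_def exp_inverse_bump_def)
  have gz: "g z = 0" if "norm z \<ge> e" for z
    using power_mono[OF that, of 2] assms by (simp add: g_def exp_inverse_bump_def power2_norm_eq_inner)
  have gp: "g z > 0" if "norm z < e" for z
    using power_strict_mono[OF that, of 2] by (simp add: g_def exp_inverse_bump_def power2_norm_eq_inner)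
  have ig: "integrable lborel g"
    by (rule integrable_compact_support[OF smooth_imp_continuous_on[OF sg], of e]) (simp add: gz)
  have "integral\<^sup>L lborel g > 0"
  proof (rule ccontr)
    assume "\<not> ?thesis"
    moreover have "integral\<^sup>L lborel g \<ge> 0" by (simp add: g0)
    ultimately have "integral\<^sup>L lborel g = 0" by linarith
    then have "AE z in lborel. g z = 0"
      using integral_nonneg_eq_0_iff_AE[OF ig] g0 by simp
    then have "AE z in lborel. z \<notin> ball (0::'a) e" 
      using gp by (auto elim!: eventually_mono) (metis less_irrefl)
    then have "emeasure lborel (ball (0::'a) e) = 0"
      by (subst (asm) AE_iff_measurable[OF _ refl]) (auto simp: ball_def)
    then have "ball (0::'a) e \<in> null_sets lborel" by auto
    then have "negligible (ball (0::'a) e)" by (simp add: negligible_iff_null_sets null_sets_completionI)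
    then show False using open_not_negligible[of "ball (0::'a) e"] assms by simp
  qed
  define I where "I = integral\<^sup>L lborel g"
  have "mollifier e (\<lambda>z. (1/I) * g z)"
    unfolding mollifier_def
    using times_differentiable_cmult[OF tg, of _ "1/I"] ig g0 gz \<open>integral\<^sup>L lborel g > 0\<close>
    by (simp add: smooth_iff_times_differentiable I_def)
  then show ?thesis by blast
qed

section \<open>Convolution with a smooth kernel\<close>

definition convolution :: "('a::euclidean_space \<Rightarrow> real) \<Rightarrow> ('a \<Rightarrow> real) \<Rightarrow> 'a \<Rightarrow> real" where
  "convolution K \<theta> z = (\<integral>w. K w * \<theta> (z - w) \<partial>lborel)"

lemma partial_deriv_support:
  fixes f :: "'a::euclidean_space \<Rightarrow> 'b::real_normed_vector"
  assumes "\<And>x. norm x > R \<Longrightarrow> f x = 0" "norm x > R"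
  shows "partial_deriv b f x = 0"
proof -
  have "open {x::'a. norm x > R}" by (intro open_Collect_less continuous_intros)
  then have "(f has_derivative (\<lambda>_. 0)) (at x)"
    by (rule has_derivative_transform_within_open[OF has_derivative_const[of 0]]) (use assms in auto)
  then show ?thesis using frechet_derivative_at unfolding partial_deriv_def by metis
qed

lemma smooth_compact_support_bounded:
  fixes f :: "'a::euclidean_space \<Rightarrow> 'b::real_normed_vector"
  assumes "continuous_on UNIV f" "\<And>x. norm x > R \<Longrightarrow> f x = 0"
  shows "\<exists>M\<ge>0. \<forall>x. norm (f x) \<le> M"
proof -
  have "bounded (f ` cball 0 R)"
    using assms(1) by (intro compact_imp_bounded compact_continuous_image) (auto intro: continuous_on_subset)
  then obtain M where M: "\<And>x. x \<in> cball 0 R \<Longrightarrow> norm (f x) \<le> M"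
    unfolding bounded_iff by blast
  have "norm (f x) \<le> max M 0" for x
    by (cases "norm x > R") (use assms(2) M[of x] in auto)
  then show ?thesis by (intro exI[of _ "max M 0"]) auto
qed

lemma integrable_mult_bounded:
  fixes f g :: "_ \<Rightarrow> 'b::{banach, real_normed_algebra, second_countable_topology}"
  assumes "integrable M f" "g \<in> borel_measurable M" "\<And>x. x \<in> space M \<Longrightarrow> norm (g x) \<le> C"
  shows "integrable M (\<lambda>x. f x * g x)"
proof (rule Bochner_Integration.integrable_bound)
  show "integrable M (\<lambda>x. norm (f x) * C)" using assms(1) by simp
  show "AE x in M. norm (f x * g x) \<le> norm (norm (f x) * C)"
  proof (rule AE_I2)
    fix x assume x: "x \<in> space M"
    have "norm (f x * g x) \<le> norm (f x) * norm (g x)" by (rule norm_mult_ineq)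
    also have "\<dots> \<le> norm (f x) * C" using assms(3)[OF x] by (simp add: mult_left_mono)
    also have "\<dots> \<le> norm (norm (f x) * C)" by simp
    finally show "norm (f x * g x) \<le> norm (norm (f x) * C)" .
  qed
qed (use assms in measurable)

text \<open>\<open>K\<close> is merely integrable, so all regularity comes from \<theta>. Its
  partial derivatives are bounded, hence \<theta> is Lipschitz and the remainder of its
  linearization, divided by \<open>norm h\<close>, is at most \<open>2 * B\<close> everywhere.
  Dominated convergence with majorant \<open>2 * B * |K|\<close> gives the derivative.\<close>

lemma convolution_has_derivative:
  fixes K \<theta> :: "'a::euclidean_space \<Rightarrow> real"
  assumes K: "integrable lborel K" and s: "smooth \<theta>" and R: "\<And>x. norm x > R \<Longrightarrow> \<theta> x = 0"
  shows "(convolution K \<theta> has_derivative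
     (\<lambda>h. \<Sum>b\<in>Basis. (h \<bullet> b) *\<^sub>R convolution K (partial_deriv b \<theta>) x)) (at x)"
proof -
  have sp: "smooth (partial_deriv b \<theta>)" if "b \<in> Basis" for b using s that by (rule smooth_partial_deriv)
  have Rp: "norm x > R \<Longrightarrow> partial_deriv b \<theta> x = 0" for x b
    by (rule partial_deriv_support[of R]) (use R in auto)
  have "\<exists>M\<ge>0. \<forall>x. norm (partial_deriv b \<theta> x) \<le> M" if "b \<in> Basis" for b
    using smooth_compact_support_bounded[OF smooth_imp_continuous_on[OF sp[OF that]] Rp] by blast
  then obtain M where M: "\<And>b x. b \<in> Basis \<Longrightarrow> norm (partial_deriv b \<theta> x) \<le> M b" by metis
  define D where "D x h = (\<Sum>b\<in>Basis. (h \<bullet> b) *\<^sub>R partial_deriv b \<theta> x)" for x h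
  have D: "(\<theta> has_derivative D x) (at x)" for x
    using has_derivative_sum_partial_deriv[OF smooth_differentiable[OF s]] unfolding D_def .
  define B where "B = (\<Sum>b\<in>(Basis::'a set). M b)"
  have DB: "norm (D x h) \<le> B * norm h" for x h
  proof -
    have "norm (D x h) \<le> (\<Sum>b\<in>Basis. norm ((h \<bullet> b) *\<^sub>R partial_deriv b \<theta> x))"
      unfolding D_def by (rule norm_sum)
    also have "\<dots> \<le> (\<Sum>b\<in>Basis. norm h * M b)"
      by (rule sum_mono) (use M in \<open>auto simp: abs_mult intro!: mult_mono Basis_le_norm\<close>)
    finally show ?thesis by (simp add: B_def sum_distrib_left mult.commute)
  qed
  have lip: "norm (\<theta> (x + h) - \<theta> x) \<le> B * norm h" for x h
  proof -
    have "norm (\<theta> (x + h) - \<theta> x) \<le> B * norm (x + h - x)"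
      by (rule differentiable_bound[of UNIV \<theta> D])
         (use D has_derivative_at_withinI in \<open>auto intro!: onorm_le DB[unfolded real_norm_def]\<close>)
    then show ?thesis by simp
  qed
  have bm[measurable]: "\<theta> \<in> borel_measurable borel" "b \<in> Basis \<Longrightarrow> partial_deriv b \<theta> \<in> borel_measurable borel" for b
    using s sp smooth_imp_borel by auto
  have Km[measurable]: "K \<in> borel_measurable borel" using K by auto
  obtain M0 where M0: "\<And>x. norm (\<theta> x) \<le> M0"
    using smooth_compact_support_bounded[OF smooth_imp_continuous_on[OF s] R] by blast
  have i1: "integrable lborel (\<lambda>w. K w * \<theta> (z - w))" for z
    by (rule integrable_mult_bounded[OF K _ M0]) measurable
  have i2: "integrable lborel (\<lambda>w. K w * partial_deriv b \<theta> (z - w))" if "b \<in> Basis" for b z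
    by (rule integrable_mult_bounded[OF K _ M[OF that]]) (use bm(2)[OF that] in measurable)
  have KD: "K w * D (z - w) h = (\<Sum>b\<in>Basis. (h \<bullet> b) * (K w * partial_deriv b \<theta> (z - w)))" for w z h
    unfolding D_def sum_distrib_left by (intro sum.cong refl) simp
  have i3: "integrable lborel (\<lambda>w. K w * D (z - w) h)" for z h
    unfolding KD by (intro Bochner_Integration.integrable_sum integrable_mult_right i2)
  have Dint: "(\<integral>w. K w * D (z - w) h \<partial>lborel) = (\<Sum>b\<in>Basis. (h \<bullet> b) *\<^sub>R convolution K (partial_deriv b \<theta>) z)" for z h
    unfolding KD convolution_def
    by (subst Bochner_Integration.integral_sum) (auto intro!: integrable_mult_right i2)
  have Dm[measurable]: "(\<lambda>w. D (z - w) h) \<in> borel_measurable borel" for z h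
    unfolding D_def by measurable
  show ?thesis
    unfolding has_derivative_at
  proof
    show "bounded_linear (\<lambda>h. \<Sum>b\<in>Basis. (h \<bullet> b) *\<^sub>R convolution K (partial_deriv b \<theta>) x)"
      by (intro bounded_linear_sum bounded_linear_scaleR_const bounded_linear_inner_left)
    show "(\<lambda>h. norm (convolution K \<theta> (x + h) - convolution K \<theta> x -
       (\<Sum>b\<in>Basis. (h \<bullet> b) *\<^sub>R convolution K (partial_deriv b \<theta>) x)) / norm h) \<midarrow>0\<rightarrow> 0"
      \<comment> \<open>Dominated convergence is available along sequences, so the limit in the
        definition of the derivative is tested on sequences tending to 0.\<close>
      unfolding tendsto_at_iff_sequentially comp_def
    proof (intro allI impI)
      fix h :: "nat \<Rightarrow> 'a" assume h0: "\<forall>i. h i \<in> UNIV - {0}" and hl: "h \<longlonglongrightarrow> 0"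
      define E where "E n w = (\<theta> (x - w + h n) - \<theta> (x - w) - D (x - w) (h n)) / norm (h n)" for n w
      have eq: "convolution K \<theta> (x + h n) - convolution K \<theta> x -
       (\<Sum>b\<in>Basis. (h n \<bullet> b) *\<^sub>R convolution K (partial_deriv b \<theta>) x) = norm (h n) * (\<integral>w. K w * E n w \<partial>lborel)" for n
      proof -
        have "norm (h n) * (K w * E n w) =
          K w * \<theta> (x + h n - w) - K w * \<theta> (x - w) - K w * D (x - w) (h n)" for w
        proof -
          have "norm (h n) * E n w = \<theta> (x - w + h n) - \<theta> (x - w) - D (x - w) (h n)"
            using h0 by (simp add: E_def)
          moreover have "norm (h n) * (K w * E n w) = K w * (norm (h n) * E n w)" by simp
          moreover have "x + h n - w = x - w + h n" by simp
          ultimately show ?thesis by (simp only: right_diff_distrib)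
        qed
        then have "norm (h n) * (\<integral>w. K w * E n w \<partial>lborel) =
          (\<integral>w. K w * \<theta> (x + h n - w) - K w * \<theta> (x - w) - K w * D (x - w) (h n) \<partial>lborel)"
          by (subst integral_mult_right_zero[symmetric]) simp
        also have "\<dots> = (\<integral>w. K w * \<theta> (x + h n - w) \<partial>lborel) - (\<integral>w. K w * \<theta> (x - w) \<partial>lborel) - (\<integral>w. K w * D (x - w) (h n) \<partial>lborel)"
          by (simp add: i1 i3)
        finally show ?thesis by (simp add: convolution_def Dint)
      qed
      have "(\<lambda>n. (\<integral>w. K w * E n w \<partial>lborel)) \<longlonglongrightarrow> (\<integral>w. 0 \<partial>(lborel :: 'a measure))"
      proof (rule integral_dominated_convergence[where w="\<lambda>w. norm (K w) * (2 * B)"])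
        show "integrable lborel (\<lambda>w. norm (K w) * (2 * B))" using K by simp
        show "AE w in lborel. (\<lambda>n. K w * E n w) \<longlonglongrightarrow> 0"
        proof (intro AE_I2)
          fix w
          have "(\<lambda>h. norm (\<theta> (x - w + h) - \<theta> (x - w) - D (x - w) h) / norm h) \<midarrow>0\<rightarrow> 0"
            using D[of "x - w"] unfolding has_derivative_at by blast
          then have "(\<lambda>n. norm (\<theta> (x - w + h n) - \<theta> (x - w) - D (x - w) (h n)) / norm (h n)) \<longlonglongrightarrow> 0"
            unfolding tendsto_at_iff_sequentially comp_def using h0 hl by blast
          then have "(\<lambda>n. norm (E n w)) \<longlonglongrightarrow> 0" by (simp add: E_def)
          then have "(\<lambda>n. E n w) \<longlonglongrightarrow> 0" by (rule tendsto_norm_zero_cancel)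
          then show "(\<lambda>n. K w * E n w) \<longlonglongrightarrow> 0" by (rule tendsto_mult_right_zero)
        qed
        show "AE w in lborel. norm (K w * E n w) \<le> norm (K w) * (2 * B)" for n
        proof (intro AE_I2)
          fix w
          have "norm (\<theta> (x - w + h n) - \<theta> (x - w) - D (x - w) (h n)) \<le> 2 * B * norm (h n)"
            using norm_triangle_ineq4[of "\<theta> (x - w + h n) - \<theta> (x - w)" "D (x - w) (h n)"]
              lip[of "x - w" "h n"] DB[of "x - w" "h n"] by linarith
          then have "norm (E n w) \<le> 2 * B" using h0 by (simp add: E_def divide_le_eq)
          then show "norm (K w * E n w) \<le> norm (K w) * (2 * B)"
            by (simp add: abs_mult mult_left_mono)
        qed
        show "(\<lambda>w. K w * E n w) \<in> borel_measurable lborel" for n unfolding E_def by measurable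
      qed simp
      then have "(\<lambda>n. norm (\<integral>w. K w * E n w \<partial>lborel)) \<longlonglongrightarrow> 0"
        by (intro tendsto_norm_zero) simp
      moreover have "norm (convolution K \<theta> (x + h n) - convolution K \<theta> x -
       (\<Sum>b\<in>Basis. (h n \<bullet> b) *\<^sub>R convolution K (partial_deriv b \<theta>) x)) / norm (h n) =
         norm (\<integral>w. K w * E n w \<partial>lborel)" for n
        unfolding eq norm_mult using h0 by simp
      ultimately show "(\<lambda>n. norm (convolution K \<theta> (x + h n) - convolution K \<theta> x -
       (\<Sum>b\<in>Basis. (h n \<bullet> b) *\<^sub>R convolution K (partial_deriv b \<theta>) x)) / norm (h n)) \<longlonglongrightarrow> 0"
        by simp
    qed
  qed
qed

lemma smooth_convolution:
  fixes K \<theta> :: "'a::euclidean_space \<Rightarrow> real"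
  assumes K: "integrable lborel K" and s: "smooth \<theta>" and R: "\<And>x. norm x > R \<Longrightarrow> \<theta> x = 0"
  shows "smooth (convolution K \<theta>)"
proof (rule smooth_coinduct)
  let ?C = "{convolution K \<theta> | \<theta>. smooth \<theta> \<and> (\<forall>x. norm x > R \<longrightarrow> \<theta> x = 0)}"
  show "convolution K \<theta> \<in> ?C" using assms by blast
  fix f :: "'a \<Rightarrow> real" assume "f \<in> ?C"
  then obtain \<theta> where th: "f = convolution K \<theta>" "smooth \<theta>" "\<And>x. norm x > R \<Longrightarrow> \<theta> x = 0" by blast
  have d: "(convolution K \<theta> has_derivative
     (\<lambda>h. \<Sum>b\<in>Basis. (h \<bullet> b) *\<^sub>R convolution K (partial_deriv b \<theta>) x)) (at x)" for x
    using K th(2,3) by (rule convolution_has_derivative)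
  show "f differentiable (at x)" for x :: 'a using d[of x] th(1) unfolding differentiable_def by blast
  fix b :: 'a assume b: "b \<in> Basis"
  have "partial_deriv b f x = convolution K (partial_deriv b \<theta>) x" for x :: 'a
    unfolding th(1) partial_deriv_eqI[OF d] using b
    by (simp add: inner_Basis if_distrib[of "\<lambda>a. a * _"] cong: if_cong)
  then have "partial_deriv b f = convolution K (partial_deriv b \<theta>)" by (rule ext)
  then show "partial_deriv b f \<in> ?C"
    using smooth_partial_deriv[OF th(2) b] partial_deriv_support[of R \<theta>, OF th(3)] by blast
qed

section \<open>Fourier transforms of test functions\<close>

lemma lborel_integral_translate:
  fixes F :: "'a::euclidean_space \<Rightarrow> 'b::{banach, second_countable_topology}"
  assumes [measurable]: "F \<in> borel_measurable borel"
  shows "(\<integral>x. F (a + x) \<partial>lborel) = (\<integral>x. F x \<partial>lborel)"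
proof -
  have "(\<integral>x. F x \<partial>distr lborel borel ((+) a)) = (\<integral>x. F (a + x) \<partial>lborel)"
    by (rule integral_distr) auto
  then show ?thesis by (simp add: lborel_distr_plus)
qed

lemma lborel_integrable_translate:
  fixes F :: "'a::euclidean_space \<Rightarrow> 'b::{banach, second_countable_topology}"
  assumes "integrable lborel F"
  shows "integrable lborel (\<lambda>x. F (a + x))"
proof -
  have "integrable (distr lborel borel ((+) a)) F" using assms by (simp add: lborel_distr_plus)
  then show ?thesis by (rule integrable_distr[rotated]) simp
qed

lemma integrable_fourier_kernel:
  assumes "integrable lborel g"
  shows "integrable lborel (\<lambda>x. exp (- (\<i> * complex_of_real (\<xi> \<bullet> x))) * g x)"
proof (rule Bochner_Integration.integrable_bound[OF assms])
  show "AE x in lborel. norm (exp (- (\<i> * complex_of_real (\<xi> \<bullet> x))) * g x) \<le> norm (g x)"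
    by (simp add: norm_mult)
qed (use assms in measurable)

lemma norm_fourier_le: "norm (fourier g \<xi>) \<le> (\<integral>x. norm (g x) \<partial>lborel)"
proof -
  have "norm (fourier g \<xi>) \<le> (\<integral>x. norm (exp (- (\<i> * complex_of_real (\<xi> \<bullet> x))) * g x) \<partial>lborel)"
    unfolding fourier_def by (rule integral_norm_bound)
  then show ?thesis by (simp add: norm_mult)
qed

text \<open>Integration by parts carried out with translations. The transform of the difference
  quotient with step \<open>h\<close> in direction \<open>b\<close> is
  \<open>(exp (i h (\<xi> . b)) - 1) / h\<close> times the transform of \<open>g\<close>; letting
  \<open>h\<close> tend to 0 on both sides gives the factor.\<close>

lemma fourier_directional_derivative:
  fixes g g' :: "'a::euclidean_space \<Rightarrow> real"
  assumes cg: "continuous_on UNIV g" and cg': "continuous_on UNIV g'"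
    and sg: "\<And>x. norm x > R \<Longrightarrow> g x = 0" and sg': "\<And>x. norm x > R \<Longrightarrow> g' x = 0"
    and d: "\<And>x t. ((\<lambda>t. g (x + t *\<^sub>R b)) has_real_derivative g' (x + t *\<^sub>R b)) (at t)"
  shows "fourier (\<lambda>x. complex_of_real (g' x)) \<xi> = \<i> * (\<xi> \<bullet> b) * fourier (\<lambda>x. complex_of_real (g x)) \<xi>"
proof -
  let ?e = "\<lambda>x. exp (- (\<i> * complex_of_real (\<xi> \<bullet> x)))"
  \<comment> \<open>Steps at most 1 keep the supports of all translates in the single ball of radius
    \<open>R + norm b\<close>, which yields an integrable majorant.\<close>
  define h where "h n = 1 / real (Suc n)" for n
  have h: "h n > 0" "h n \<le> 1" for n by (auto simp: h_def)
  have hl: "h \<longlonglongrightarrow> 0" unfolding h_def by real_asymp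
  have [measurable]: "g \<in> borel_measurable borel" "g' \<in> borel_measurable borel"
    using cg cg' by (auto intro: borel_measurable_continuous_onI)
  obtain M where M: "M \<ge> 0" "\<And>x. norm (g' x) \<le> M"
    using smooth_compact_support_bounded[OF cg' sg'] by blast
  have ig: "integrable lborel g" by (rule integrable_compact_support[OF cg sg])
  define D where "D n x = (g (h n *\<^sub>R b + x) - g x) / h n" for n x
  have D_bound: "\<bar>D n x\<bar> \<le> M" for n x
  proof -
    obtain z where "g (x + h n *\<^sub>R b) - g (x + 0 *\<^sub>R b) = (h n - 0) * g' (x + z *\<^sub>R b)"
      using MVT2[OF h(1)[of n], of "\<lambda>t. g (x + t *\<^sub>R b)" "\<lambda>t. g' (x + t *\<^sub>R b)"] d by auto
    then have "D n x = g' (x + z *\<^sub>R b)"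
      using h(1)[of n] by (simp add: D_def add.commute field_simps)
    then show ?thesis using M(2) by simp
  qed
  have D_supp: "D n x = 0" if "norm x > R + norm b" for n x
  proof -
    have "norm (h n *\<^sub>R b) \<le> norm b" using h[of n] by (simp add: mult_left_le_one_le)
    then have "norm (h n *\<^sub>R b + x) > R"
      using norm_triangle_ineq4[of "h n *\<^sub>R b + x" "h n *\<^sub>R b"] that by simp
    moreover have "norm x > R" using that norm_ge_zero[of b] by linarith
    ultimately show ?thesis by (simp add: D_def sg)
  qed
  have lim1: "(\<lambda>n. \<integral>x. ?e x * complex_of_real (D n x) \<partial>lborel) \<longlonglongrightarrow> (\<integral>x. ?e x * complex_of_real (g' x) \<partial>lborel)"
  proof (rule integral_dominated_convergence[where w="\<lambda>x. M * indicator (cball 0 (R + norm b)) x"])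
    show "integrable lborel (\<lambda>x::'a. M * indicator (cball 0 (R + norm b)) x)"
      by (intro integrable_mult_right integrable_real_indicator emeasure_bounded_finite) auto
    show "AE x in lborel. (\<lambda>n. ?e x * complex_of_real (D n x)) \<longlonglongrightarrow> ?e x * complex_of_real (g' x)"
    proof (intro AE_I2 tendsto_intros)
      fix x
      have "(\<lambda>t. (g (x + t *\<^sub>R b) - g (x + 0 *\<^sub>R b)) / (t - 0)) \<midarrow>0\<rightarrow> g' (x + 0 *\<^sub>R b)"
        using d[of x 0] unfolding has_field_derivative_iff .
      then have "(\<lambda>n. (g (x + h n *\<^sub>R b) - g (x + 0 *\<^sub>R b)) / (h n - 0)) \<longlonglongrightarrow> g' (x + 0 *\<^sub>R b)"
        by (rule filterlim_compose) (use h(1) hl in \<open>simp add: filterlim_at less_imp_neq[THEN not_sym]\<close>)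
      then show "(\<lambda>n. D n x) \<longlonglongrightarrow> g' x" by (simp add: D_def add.commute)
    qed
    show "AE x in lborel. norm (?e x * complex_of_real (D n x)) \<le> M * indicator (cball 0 (R + norm b)) x" for n
      using D_bound D_supp by (auto simp: norm_mult indicator_def not_le)
    show "(\<lambda>x. ?e x * complex_of_real (D n x)) \<in> borel_measurable lborel" for n
      unfolding D_def by measurable
  qed measurable
  have icg: "integrable lborel (\<lambda>x. ?e x * complex_of_real (g x))"
    by (intro integrable_fourier_kernel integrable_of_real ig)
  have eq: "(\<integral>x. ?e x * complex_of_real (D n x) \<partial>lborel) =
    (exp (\<i> * (complex_of_real (\<xi> \<bullet> b) * h n)) - 1) / h n * fourier (\<lambda>x. complex_of_real (g x)) \<xi>" for n
  proof -
    have sh: "(\<integral>x. ?e (h n *\<^sub>R b + x) * complex_of_real (g (h n *\<^sub>R b + x)) \<partial>lborel) = fourier (\<lambda>x. complex_of_real (g x)) \<xi>"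
      unfolding fourier_def by (rule lborel_integral_translate) measurable
    have ee: "?e x = exp (\<i> * (complex_of_real (\<xi> \<bullet> b) * h n)) * ?e (h n *\<^sub>R b + x)" for x
      by (simp add: exp_add[symmetric] inner_add_right algebra_simps)
    have "(\<integral>x. ?e x * complex_of_real (g (h n *\<^sub>R b + x)) \<partial>lborel) =
        (\<integral>x. exp (\<i> * (complex_of_real (\<xi> \<bullet> b) * h n)) *
          (?e (h n *\<^sub>R b + x) * complex_of_real (g (h n *\<^sub>R b + x))) \<partial>lborel)"
      by (intro Bochner_Integration.integral_cong refl) (subst ee, simp only: mult.assoc)
    then have t: "(\<integral>x. ?e x * complex_of_real (g (h n *\<^sub>R b + x)) \<partial>lborel) =
       exp (\<i> * (complex_of_real (\<xi> \<bullet> b) * h n)) * fourier (\<lambda>x. complex_of_real (g x)) \<xi>"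
      by (simp only: integral_mult_right_zero sh)
    have "integrable lborel (\<lambda>x. g (h n *\<^sub>R b + x))"
      by (rule lborel_integrable_translate[OF ig])
    then have i2: "integrable lborel (\<lambda>x. ?e x * complex_of_real (g (h n *\<^sub>R b + x)))"
      by (intro integrable_fourier_kernel integrable_of_real)
    have alg: "(a * b - a * c) / r = a * ((b - c) / r)" for a b c r :: complex
      by (simp add: right_diff_distrib)
    have "(\<integral>x. ?e x * complex_of_real (D n x) \<partial>lborel) =
      (\<integral>x. (?e x * complex_of_real (g (h n *\<^sub>R b + x)) - ?e x * complex_of_real (g x)) / h n \<partial>lborel)"
      unfolding alg by (rule Bochner_Integration.integral_cong) (simp_all add: D_def)
    also have "\<dots> = (exp (\<i> * (complex_of_real (\<xi> \<bullet> b) * h n)) * fourier (\<lambda>x. complex_of_real (g x)) \<xi>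
        - fourier (\<lambda>x. complex_of_real (g x)) \<xi>) / h n"
      using i2 icg by (simp add: t) (simp add: fourier_def)
    finally show ?thesis by (simp add: algebra_simps diff_divide_distrib)
  qed
  have "((\<lambda>t. exp (\<i> * (complex_of_real (\<xi> \<bullet> b) * t))) has_field_derivative \<i> * (\<xi> \<bullet> b)) (at 0)"
    by (auto intro!: derivative_eq_intros)
  then have "(\<lambda>t. (exp (\<i> * (complex_of_real (\<xi> \<bullet> b) * t)) - 1) / t) \<midarrow>0\<rightarrow> \<i> * (\<xi> \<bullet> b)"
    unfolding has_field_derivative_iff by simp
  then have "(\<lambda>n. (exp (\<i> * (complex_of_real (\<xi> \<bullet> b) * complex_of_real (h n))) - 1) / complex_of_real (h n)) \<longlonglongrightarrow> \<i> * (\<xi> \<bullet> b)"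
  proof (rule filterlim_compose)
    show "filterlim (\<lambda>n. complex_of_real (h n)) (at 0) sequentially"
      unfolding filterlim_at using h(1) tendsto_of_real[OF hl, where 'a=complex]
      by (auto simp: less_imp_neq[THEN not_sym])
  qed
  then have "(\<lambda>n. \<integral>x. ?e x * complex_of_real (D n x) \<partial>lborel) \<longlonglongrightarrow> \<i> * (\<xi> \<bullet> b) * fourier (\<lambda>x. complex_of_real (g x)) \<xi>"
    unfolding eq by (rule tendsto_mult[OF _ tendsto_const])
  from LIMSEQ_unique[OF lim1 this] show ?thesis by (simp add: fourier_def)
qed

lemma smooth_has_partial_derivative_slice:
  fixes \<phi> :: "real \<times> 'a::euclidean_space \<Rightarrow> real"
  assumes "smooth \<phi>" "b \<in> Basis"
  shows "((\<lambda>t. \<phi> (u, x + t *\<^sub>R b)) has_real_derivative partial_deriv (0, b) \<phi> (u, x + t *\<^sub>R b)) (at t)"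
proof -
  have "((\<lambda>t. (u, x + t *\<^sub>R b)) has_derivative (\<lambda>h. (0, h *\<^sub>R b))) (at t)"
    by (auto intro!: derivative_eq_intros)
  from has_derivative_compose[OF this has_derivative_frechet[OF smooth_differentiable[OF assms(1)]]]
  have "((\<lambda>t. \<phi> (u, x + t *\<^sub>R b)) has_derivative (\<lambda>h. frechet_derivative \<phi> (at (u, x + t *\<^sub>R b)) (h *\<^sub>R (0, b)))) (at t)"
    by simp
  moreover have "frechet_derivative \<phi> (at (u, x + t *\<^sub>R b)) (h *\<^sub>R (0, b)) = partial_deriv (0, b) \<phi> (u, x + t *\<^sub>R b) * h" for h
    using linear_scale[OF linear_frechet_derivative[OF smooth_differentiable[OF assms(1)]], of "(u, x + t *\<^sub>R b)" h "(0,b)"]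
    by (simp add: partial_deriv_def mult.commute)
  ultimately show ?thesis unfolding has_field_derivative_def by simp
qed

text \<open>Take the coordinate of largest absolute value. Thanks to this choice, pure derivatives
  in one direction are enough to bound the full polynomial weight.\<close>

lemma sq_norm_power_le:
  fixes \<xi> :: "'a::euclidean_space"
  shows "\<exists>b\<in>Basis. (1 + (norm \<xi>)\<^sup>2) ^ k \<le> (1 + real DIM('a)) ^ k * (1 + \<bar>\<xi> \<bullet> b\<bar> ^ (2 * k))"
proof -
  have "Max ((\<lambda>b. \<bar>\<xi> \<bullet> b\<bar>) ` Basis) \<in> (\<lambda>b. \<bar>\<xi> \<bullet> b\<bar>) ` Basis" by (rule Max_in) auto
  then obtain b where b: "Max ((\<lambda>b. \<bar>\<xi> \<bullet> b\<bar>) ` Basis) = \<bar>\<xi> \<bullet> b\<bar>" "b \<in> Basis" by (rule imageE)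
  have m: "\<bar>\<xi> \<bullet> c\<bar> \<le> \<bar>\<xi> \<bullet> b\<bar>" if "c \<in> Basis" for c
    unfolding b(1)[symmetric] using that by (intro Max_ge) auto
  have "(norm \<xi>)\<^sup>2 = (\<Sum>c\<in>Basis. \<bar>\<xi> \<bullet> c\<bar>\<^sup>2)"
    unfolding power2_norm_eq_inner by (subst euclidean_inner) (simp add: power2_eq_square)
  also have "\<dots> \<le> (\<Sum>c\<in>(Basis::'a set). \<bar>\<xi> \<bullet> b\<bar>\<^sup>2)" by (intro sum_mono power_mono m) auto
  finally have n: "(norm \<xi>)\<^sup>2 \<le> DIM('a) * \<bar>\<xi> \<bullet> b\<bar>\<^sup>2" by simp
  define m where "m = max 1 (\<bar>\<xi> \<bullet> b\<bar>\<^sup>2)"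
  have "1 + (norm \<xi>)\<^sup>2 \<le> m + DIM('a) * m"
    using n unfolding m_def by (intro add_mono order_trans[OF n] mult_left_mono) auto
  then have "(1 + (norm \<xi>)\<^sup>2) ^ k \<le> ((1 + DIM('a)) * m) ^ k"
    by (intro power_mono) (auto simp: algebra_simps)
  also have "\<dots> = (1 + real DIM('a)) ^ k * m ^ k" by (simp add: power_mult_distrib)
  also have "m ^ k \<le> 1 + \<bar>\<xi> \<bullet> b\<bar> ^ (2 * k)"
    unfolding m_def power_mult by (auto simp: max_def)
  finally show ?thesis using b(2) by (auto simp: mult_left_mono)
qed

text \<open>The transform of the \<open>2 * k\<close>-fold spatial derivative is bounded and equals
  the transform of \<phi> times the \<open>2 * k\<close>-th power of a coordinate, up to modulus.
  The constant sums over the basis because the dominant coordinate depends on \<xi>.\<close>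

lemma smooth_space_fourier_decay:
  fixes \<phi> :: "real \<times> 'a::euclidean_space \<Rightarrow> real"
  assumes s: "smooth \<phi>" and R: "\<And>z. norm z > R \<Longrightarrow> \<phi> z = 0"
  shows "\<exists>C\<ge>0. \<forall>u \<xi>. norm (space_fourier \<phi> u \<xi>) * (1 + (norm \<xi>)\<^sup>2) ^ k \<le> C"
proof -
  define G where "G b j = ((partial_deriv (0::real, b)) ^^ j) \<phi>" for b and j :: nat
  have G: "smooth (G b j) \<and> (\<forall>z. norm z > R \<longrightarrow> G b j z = 0)" if "b \<in> Basis" for b j
  proof (induction j)
    case 0 then show ?case using s R by (simp add: G_def)
  next
    case (Suc j)
    have e: "G b (Suc j) = partial_deriv (0, b) (G b j)" by (simp add: G_def)
    show ?case unfolding e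
      using Suc that by (auto intro!: smooth_partial_deriv partial_deriv_support[of R] simp: Basis_prod_def)
  qed
  have cont: "continuous_on UNIV (\<lambda>x. G b j (u, x))" if "b \<in> Basis" for b j u
    by (rule continuous_on_compose2[OF smooth_imp_continuous_on[of "G b j"]])
       (use G[OF that] in \<open>auto intro!: continuous_intros\<close>)
  have supp: "G b j (u, x) = 0" if "b \<in> Basis" "norm x > R" for b j u x
  proof -
    have "norm x \<le> norm (u, x)" by (simp add: norm_Pair real_le_rsqrt)
    then show ?thesis using G[OF that(1)] that(2) by auto
  qed
  have step: "space_fourier (G b (Suc j)) u \<xi> = \<i> * (\<xi> \<bullet> b) * space_fourier (G b j) u \<xi>" if "b \<in> Basis" for b j u \<xi>
    unfolding space_fourier_def
  proof (rule fourier_directional_derivative[of _ _ R])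
    fix x t
    have e: "G b (Suc j) = partial_deriv (0, b) (G b j)" by (simp add: G_def)
    show "((\<lambda>t. G b j (u, x + t *\<^sub>R b)) has_real_derivative G b (Suc j) (u, x + t *\<^sub>R b)) (at t)"
      unfolding e using G[OF that] that by (intro smooth_has_partial_derivative_slice) auto
  qed (use that cont supp in auto)
  have pow: "norm (space_fourier (G b j) u \<xi>) = \<bar>\<xi> \<bullet> b\<bar> ^ j * norm (space_fourier \<phi> u \<xi>)" if "b \<in> Basis" for b j u \<xi>
    by (induction j) (simp_all add: step that norm_mult, simp add: G_def)
  have bnd: "\<exists>C\<ge>0. \<forall>u \<xi>. norm (space_fourier (G b j) u \<xi>) \<le> C" if "b \<in> Basis" for b j
  proof -
    note Gs = G[OF that, of j, THEN conjunct1] and Gz = G[OF that, of j, THEN conjunct2, rule_format]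
    obtain M where M: "M \<ge> 0" "\<And>z. norm (G b j z) \<le> M"
      using smooth_compact_support_bounded[OF smooth_imp_continuous_on[OF Gs] Gz] by metis
    have "norm (space_fourier (G b j) u \<xi>) \<le> M * measure lborel (cball (0::'a) R)" for u \<xi>
    proof -
      have "norm (space_fourier (G b j) u \<xi>) \<le> (\<integral>x. norm (complex_of_real (G b j (u, x))) \<partial>lborel)"
        unfolding space_fourier_def by (rule norm_fourier_le)
      also have "\<dots> \<le> (\<integral>x. M * indicator (cball (0::'a) R) x \<partial>lborel)"
      proof (rule integral_mono)
        show "integrable lborel (\<lambda>x. norm (complex_of_real (G b j (u, x))))"
          by (intro integrable_norm integrable_of_real integrable_compact_support[OF cont[OF that] supp[OF that]])
        show "integrable lborel (\<lambda>x::'a. M * indicator (cball 0 R) x)"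
          by (intro integrable_mult_right integrable_real_indicator emeasure_bounded_finite) auto
      qed (use M supp[OF that] in \<open>auto simp: indicator_def not_le\<close>)
      finally show ?thesis by simp
    qed
    then show ?thesis using M(1) by (intro exI[of _ "M * measure lborel (cball (0::'a) R)"]) auto
  qed
  then obtain C where C: "\<And>b j. b \<in> Basis \<Longrightarrow> C b j \<ge> 0"
      "\<And>b j u \<xi>. b \<in> Basis \<Longrightarrow> norm (space_fourier (G b j) u \<xi>) \<le> C b j" by metis
  define K where "K = (1 + real DIM('a)) ^ k * (\<Sum>b\<in>(Basis::'a set). C b 0 + C b (2 * k))"
  have "norm (space_fourier \<phi> u \<xi>) * (1 + (norm \<xi>)\<^sup>2) ^ k \<le> K" for u and \<xi> :: 'a
  proof -
    obtain b where b: "b \<in> Basis" "(1 + (norm \<xi>)\<^sup>2) ^ k \<le> (1 + real DIM('a)) ^ k * (1 + \<bar>\<xi> \<bullet> b\<bar> ^ (2 * k))"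
      using sq_norm_power_le by blast
    have "norm (space_fourier \<phi> u \<xi>) * (1 + (norm \<xi>)\<^sup>2) ^ k
      \<le> norm (space_fourier \<phi> u \<xi>) * ((1 + real DIM('a)) ^ k * (1 + \<bar>\<xi> \<bullet> b\<bar> ^ (2 * k)))"
      by (rule mult_left_mono[OF b(2)]) simp
    also have "\<dots> = (1 + real DIM('a)) ^ k * (norm (space_fourier (G b 0) u \<xi>) + norm (space_fourier (G b (2 * k)) u \<xi>))"
      unfolding pow[OF b(1)] by (simp add: algebra_simps)
    also have "\<dots> \<le> (1 + real DIM('a)) ^ k * (C b 0 + C b (2 * k))"
      by (intro mult_left_mono add_mono C b(1)) auto
    also have "\<dots> \<le> K" unfolding K_def
      by (intro mult_left_mono member_le_sum) (use b(1) C(1) in auto)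
    finally show ?thesis .
  qed
  moreover have "K \<ge> 0" unfolding K_def using C(1) by (intro mult_nonneg_nonneg sum_nonneg add_nonneg_nonneg) auto
  ultimately show ?thesis by blast
qed

lemma smooth_tensor:
  fixes m :: "real \<Rightarrow> real" and \<nu> :: "'a::euclidean_space \<Rightarrow> real"
  assumes "smooth m" "smooth \<nu>"
  shows "smooth (\<lambda>z. m (fst z) * \<nu> (snd z))"
proof -
  have "times_differentiable n (\<lambda>z::real \<times> 'a. m (fst z + 0) * \<nu> (snd z + 0))" for n
    using assms by (intro times_differentiable_mult times_differentiable_affine bounded_linear_fst bounded_linear_snd)
      (auto simp: smooth_iff_times_differentiable)
  then show ?thesis by (simp add: smooth_iff_times_differentiable)
qed

text \<open>The decay estimate is stated on space-time, so \<nu> is lifted to the tensor product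
  with a bump \<open>m\<close> in time and read off at a time \<open>s\<close> with
  \<open>m s\<close> nonzero.\<close>

lemma mollifier_fourier_decay:
  fixes \<nu> :: "'a::euclidean_space \<Rightarrow> real"
  assumes "mollifier e \<nu>" "e > 0"
  shows "\<exists>C\<ge>0. \<forall>\<xi>. norm (fourier (\<lambda>x. complex_of_real (\<nu> x)) \<xi>) * (1 + (norm \<xi>)\<^sup>2) ^ k \<le> C"
proof -
  obtain m :: "real \<Rightarrow> real" where m: "mollifier 1 m" using mollifier_exists[of 1] by auto
  obtain s where s: "m s \<noteq> 0"
  proof -
    have "\<not> (\<forall>s. m s = 0)"
    proof
      assume "\<forall>s. m s = 0"
      then have "m = (\<lambda>_. 0)" by auto
      then show False using m by (simp add: mollifier_def)
    qed
    then show ?thesis using that by blast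
  qed
  define \<phi> where "\<phi> = (\<lambda>z::real \<times> 'a. m (fst z) * \<nu> (snd z))"
  have "smooth \<phi>" unfolding \<phi>_def using m assms(1) by (intro smooth_tensor) (auto simp: mollifier_def)
  moreover have "\<phi> z = 0" if "norm z > 1 + e" for z
  proof -
    have "norm z \<le> norm (fst z) + norm (snd z)" by (metis norm_Pair_le surjective_pairing)
    then have "norm (fst z) \<ge> 1 \<or> norm (snd z) \<ge> e" using that by linarith
    then show ?thesis using m assms(1) by (auto simp: \<phi>_def mollifier_def)
  qed
  ultimately obtain C where C: "C \<ge> 0" "\<And>u \<xi>. norm (space_fourier \<phi> u \<xi>) * (1 + (norm \<xi>)\<^sup>2) ^ k \<le> C"
    using smooth_space_fourier_decay[of \<phi> "1 + e" k] by blast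
  have "space_fourier \<phi> s \<xi> = m s * fourier (\<lambda>x. complex_of_real (\<nu> x)) \<xi>" for \<xi>
  proof -
    have "space_fourier \<phi> s \<xi> = (\<integral>x. complex_of_real (m s) * (exp (- (\<i> * complex_of_real (\<xi> \<bullet> x))) * complex_of_real (\<nu> x)) \<partial>lborel)"
      unfolding space_fourier_def fourier_def \<phi>_def
      by (intro Bochner_Integration.integral_cong) (auto simp: mult_ac)
    then show ?thesis by (simp add: fourier_def)
  qed
  then have "norm (fourier (\<lambda>x. complex_of_real (\<nu> x)) \<xi>) * (1 + (norm \<xi>)\<^sup>2) ^ k \<le> C / \<bar>m s\<bar>" for \<xi>
    using C(2)[of s \<xi>] s by (simp add: norm_mult pos_le_divide_eq mult_ac)
  then show ?thesis using C(1) by (intro exI[of _ "C / \<bar>m s\<bar>"]) auto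
qed

lemma mollifier_fourier_le:
  assumes "mollifier e \<nu>"
  shows "norm (fourier (\<lambda>x. complex_of_real (\<nu> x)) \<xi>) \<le> 1"
proof -
  have "(\<integral>x. norm (complex_of_real (\<nu> x)) \<partial>lborel) = (\<integral>x. \<nu> x \<partial>lborel)"
    using assms by (intro Bochner_Integration.integral_cong) (auto simp: mollifier_def)
  then show ?thesis using norm_fourier_le[of "\<lambda>x. complex_of_real (\<nu> x)" \<xi>] assms by (simp add: mollifier_def)
qed

lemma norm_exp_i_minus_one_le: "norm (exp (- (\<i> * complex_of_real r)) - 1) \<le> \<bar>r\<bar>"
  using iexp_approx1[of "-r" 0] by simp

lemma mollifier_fourier_near_one:
  assumes "mollifier e \<nu>"
  shows "norm (fourier (\<lambda>x. complex_of_real (\<nu> x)) \<xi> - 1) \<le> norm \<xi> * e"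
proof -
  let ?e = "\<lambda>x. exp (- (\<i> * complex_of_real (\<xi> \<bullet> x)))"
  have i: "integrable lborel \<nu>" and I: "(\<integral>x. \<nu> x \<partial>lborel) = 1" using assms by (auto simp: mollifier_def)
  have "fourier (\<lambda>x. complex_of_real (\<nu> x)) \<xi> - 1 = (\<integral>x. ?e x * complex_of_real (\<nu> x) \<partial>lborel) - (\<integral>x. complex_of_real (\<nu> x) \<partial>lborel)"
    by (simp add: fourier_def I)
  also have "\<dots> = (\<integral>x. ?e x * complex_of_real (\<nu> x) - complex_of_real (\<nu> x) \<partial>lborel)"
    by (intro Bochner_Integration.integral_diff[symmetric] integrable_fourier_kernel integrable_of_real i)
  finally have "norm (fourier (\<lambda>x. complex_of_real (\<nu> x)) \<xi> - 1) \<le> (\<integral>x. norm (?e x * complex_of_real (\<nu> x) - complex_of_real (\<nu> x)) \<partial>lborel)"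
    by (simp only: integral_norm_bound)
  also have "\<dots> \<le> (\<integral>x. (norm \<xi> * e) * \<nu> x \<partial>lborel)"
  proof (rule integral_mono)
    show "integrable lborel (\<lambda>x. norm (?e x * complex_of_real (\<nu> x) - complex_of_real (\<nu> x)))"
      by (intro integrable_norm Bochner_Integration.integrable_diff integrable_fourier_kernel integrable_of_real i)
    show "integrable lborel (\<lambda>x. (norm \<xi> * e) * \<nu> x)" using i by simp
    fix x
    show "norm (?e x * complex_of_real (\<nu> x) - complex_of_real (\<nu> x)) \<le> (norm \<xi> * e) * \<nu> x"
    proof (cases "norm x \<ge> e")
      case True then show ?thesis using assms by (simp add: mollifier_def)
    next
      case False
      have "norm (?e x * complex_of_real (\<nu> x) - complex_of_real (\<nu> x)) = norm (?e x - 1) * \<nu> x"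
        using assms by (simp add: mollifier_def norm_mult[symmetric] left_diff_distrib[symmetric] flip: norm_of_real[where 'a=complex] del: norm_of_real) (metis (no_types) mult_1 left_diff_distrib norm_mult norm_of_real abs_of_nonneg)
      also have "\<dots> \<le> (norm \<xi> * e) * \<nu> x"
      proof (rule mult_right_mono)
        have "norm (?e x - 1) \<le> \<bar>\<xi> \<bullet> x\<bar>" by (rule norm_exp_i_minus_one_le)
        also have "\<dots> \<le> norm \<xi> * norm x" by (rule Cauchy_Schwarz_ineq2)
        also have "\<dots> \<le> norm \<xi> * e" using False by (intro mult_left_mono) auto
        finally show "norm (?e x - 1) \<le> norm \<xi> * e" .
      qed (use assms in \<open>simp add: mollifier_def\<close>)
      finally show ?thesis .
    qed
  qed
  finally show ?thesis by (simp add: I)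
qed

section \<open>The fractional kernel in time\<close>

abbreviation lborel2 :: "(real \<times> real) measure" where
  "lborel2 \<equiv> lborel \<Otimes>\<^sub>M lborel"

lemma sigma_finite_lborel2: "sigma_finite_measure lborel2"
  by (simp add: lborel_prod lborel.sigma_finite_measure_axioms)

text \<open>The weight of the interval from \<open>a\<close> to \<open>b\<close>. Integrating over
  both endpoints of all intervals containing two given points raises the exponent by two, from
  \<open>2 * H - 4\<close> to that of the fractional kernel.\<close>

definition window_weight :: "real \<Rightarrow> real \<Rightarrow> real \<Rightarrow> real" where
  "window_weight H a b = (if a < b then (b - a) powr (2 * H - 4) else 0)"

definition in_window :: "real \<Rightarrow> real \<Rightarrow> real \<Rightarrow> real" where
  "in_window a b u = (if a \<le> u \<and> u \<le> b then 1 else 0)"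

definition window :: "real \<Rightarrow> (real \<Rightarrow> complex) \<Rightarrow> real \<times> real \<Rightarrow> complex" where
  "window T f y = (\<integral>u. (in_window 0 T u * in_window (fst y) (snd y) u) *\<^sub>R f u \<partial>lborel)"

definition time_kernel :: "real \<Rightarrow> real \<Rightarrow> real \<times> real \<Rightarrow> real" where
  "time_kernel T H z = in_window 0 T (fst z) * in_window 0 T (snd z) * \<bar>fst z - snd z\<bar> powr (2 * H - 2)"

definition time_form :: "real \<Rightarrow> real \<Rightarrow> (real \<Rightarrow> complex) \<Rightarrow> (real \<Rightarrow> complex) \<Rightarrow> real" where
  "time_form T H f g = (\<integral>z. time_kernel T H z * Re (f (fst z) * cnj (g (snd z))) \<partial>lborel2)"

definition bounded_borel :: "(real \<Rightarrow> complex) \<Rightarrow> bool" where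
  "bounded_borel f \<longleftrightarrow> f \<in> borel_measurable borel \<and> (\<exists>M. \<forall>u. norm (f u) \<le> M)"

lemma in_window_nonneg [simp]: "0 \<le> in_window a b u" and in_window_le_one [simp]: "in_window a b u \<le> 1"
  by (simp_all add: in_window_def)

lemma time_kernel_nonneg [simp]: "0 \<le> time_kernel T H z"
  by (simp add: time_kernel_def)

lemma window_weight_nonneg [simp]: "0 \<le> window_weight H a b"
  by (simp add: window_weight_def)

lemma in_window_measurable [measurable (raw)]:
  assumes [measurable]: "f \<in> borel_measurable M" "g \<in> borel_measurable M" "h \<in> borel_measurable M"
  shows "(\<lambda>x. in_window (f x) (g x) (h x)) \<in> borel_measurable M"
  unfolding in_window_def by measurable

lemma window_weight_measurable [measurable (raw)]:
  assumes [measurable]: "f \<in> borel_measurable M" "g \<in> borel_measurable M"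
  shows "(\<lambda>x. window_weight H (f x) (g x)) \<in> borel_measurable M"
  unfolding window_weight_def by measurable

lemma time_kernel_measurable [measurable]: "time_kernel T H \<in> borel_measurable (borel \<Otimes>\<^sub>M borel)"
  unfolding time_kernel_def by measurable

lemma nn_integral_powr_tail:
  assumes "d > 0" "e < -1"
  shows "(\<integral>\<^sup>+x. ennreal (x powr e) * indicator {d..} x \<partial>lborel) = ennreal (d powr (e + 1) / - (e + 1))"
  using nn_integral_has_integral_lebesgue'[OF _ has_integral_powr_to_inf[OF assms(2,1)]] by (simp add: minus_divide_right)

text \<open>The singular kernel as a superposition of indicators of squares \<open>[a, b] \<times> [a, b]\<close>; it makes the time form
  a weighted \<open>L\<^sup>2\<close> norm of the window integrals, hence nonnegative.\<close>
lemma powr_eq_window_integral: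
  assumes H: "1/2 < H" "H < 1" and uv: "u \<noteq> v"
  shows "(\<integral>\<^sup>+y. ennreal (window_weight H (fst y) (snd y) * in_window (fst y) (snd y) u * in_window (fst y) (snd y) v) \<partial>lborel2)
    = ennreal (\<bar>u - v\<bar> powr (2 * H - 2) / ((2 - 2 * H) * (3 - 2 * H)))"
proof -
  define m M where "m = min u v" and "M = max u v"
  have mM: "m < M" and d: "\<bar>u - v\<bar> = M - m" using uv by (auto simp: m_def M_def)
  define c where "c = 3 - 2 * H"
  have c: "c > 0" using H by (simp add: c_def)
  have fac: "window_weight H a b * in_window a b u * in_window a b v =
      (if a \<le> m \<and> M \<le> b then (b - a) powr (2 * H - 4) else 0)" for a b
    using mM by (auto simp: window_weight_def in_window_def m_def M_def)
  have inner: "(\<integral>\<^sup>+b. ennreal (if a \<le> m \<and> M \<le> b then (b - a) powr (2 * H - 4) else 0) \<partial>lborel)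
      = ennreal (if a \<le> m then (M - a) powr (2 * H - 3) / c else 0)" for a
  proof (cases "a \<le> m")
    case True
    have "(\<integral>\<^sup>+b. ennreal (if a \<le> m \<and> M \<le> b then (b - a) powr (2 * H - 4) else 0) \<partial>lborel) =
      (\<integral>\<^sup>+x. ennreal (if a \<le> m \<and> M \<le> a + 1 * x then (a + 1 * x - a) powr (2 * H - 4) else 0) \<partial>lborel)"
      by (subst nn_integral_real_affine[where c=1 and t=a]) auto
    also have "\<dots> = (\<integral>\<^sup>+x. ennreal (x powr (2 * H - 4)) * indicator {M - a..} x \<partial>lborel)"
      using True by (intro nn_integral_cong) (auto simp: indicator_def)
    also have "\<dots> = ennreal ((M - a) powr (2 * H - 3) / c)"
      using nn_integral_powr_tail[of "M - a" "2 * H - 4"] True mM H by (simp add: c_def)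
    finally show ?thesis using True by simp
  qed simp
  have "(\<integral>\<^sup>+y. ennreal (window_weight H (fst y) (snd y) * in_window (fst y) (snd y) u * in_window (fst y) (snd y) v) \<partial>lborel2)
    = (\<integral>\<^sup>+a. \<integral>\<^sup>+b. ennreal (window_weight H a b * in_window a b u * in_window a b v) \<partial>lborel \<partial>lborel)"
    by (subst lborel.nn_integral_fst[symmetric]) simp_all
  also have "\<dots> = (\<integral>\<^sup>+a. ennreal (if a \<le> m then (M - a) powr (2 * H - 3) / c else 0) \<partial>lborel)"
    unfolding fac inner ..
  also have "\<dots> = (\<integral>\<^sup>+x. ennreal (if M + (-1) * x \<le> m then (M - (M + (-1) * x)) powr (2 * H - 3) / c else 0) \<partial>lborel)"
    by (subst nn_integral_real_affine[where c="-1" and t=M]) auto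
  also have "\<dots> = (\<integral>\<^sup>+x. ennreal (1 / c) * (ennreal (x powr (2 * H - 3)) * indicator {M - m..} x) \<partial>lborel)"
    using c by (intro nn_integral_cong) (auto simp: indicator_def ennreal_mult[symmetric])
  also have "\<dots> = ennreal (1 / c) * (\<integral>\<^sup>+x. ennreal (x powr (2 * H - 3)) * indicator {M - m..} x \<partial>lborel)"
    by (rule nn_integral_cmult) simp
  also have "\<dots> = ennreal (1 / c) * ennreal ((M - m) powr (2 * H - 2) / (2 - 2 * H))"
    using nn_integral_powr_tail[of "M - m" "2 * H - 3"] mM H by simp
  also have "\<dots> = ennreal (\<bar>u - v\<bar> powr (2 * H - 2) / ((2 - 2 * H) * (3 - 2 * H)))"
    unfolding d using c H by (simp add: ennreal_mult[symmetric] c_def mult.commute)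
  finally show ?thesis .
qed

section \<open>Size of the time form\<close>

lemma nn_integral_powr_near_zero:
  assumes "m \<ge> 0" "1/2 < H"
  shows "(\<integral>\<^sup>+u. ennreal (if \<bar>u - v\<bar> \<le> m then \<bar>u - v\<bar> powr (2 * H - 2) else 0) \<partial>lborel) = ennreal (2 / (2 * H - 1) * m powr (2 * H - 1))"
proof -
  let ?p = "2 * H - 2"
  have half: "(\<integral>\<^sup>+x. ennreal (x powr ?p) * indicator {0..m} x \<partial>lborel) = ennreal (m powr (2 * H - 1) / (2 * H - 1))"
    using nn_integral_has_integral_lebesgue'[OF _ has_integral_powr_from_0[of ?p m]] assms by (simp add: add.commute)
  have "(\<integral>\<^sup>+x. ennreal (x powr ?p) * indicator {0..m} x \<partial>lborel) =
     (\<integral>\<^sup>+x. ennreal ((0 + (-1) * x) powr ?p) * indicator {0..m} (0 + (-1) * x) \<partial>lborel)"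
    by (subst nn_integral_real_affine[where c="-1" and t=0]) auto
  then have half': "(\<integral>\<^sup>+x. ennreal ((- x) powr ?p) * indicator {0..m} (- x) \<partial>lborel) = ennreal (m powr (2 * H - 1) / (2 * H - 1))"
    using half by simp
  have "(\<integral>\<^sup>+u. ennreal (if \<bar>u - v\<bar> \<le> m then \<bar>u - v\<bar> powr ?p else 0) \<partial>lborel) =
    (\<integral>\<^sup>+x. ennreal (if \<bar>v + 1 * x - v\<bar> \<le> m then \<bar>v + 1 * x - v\<bar> powr ?p else 0) \<partial>lborel)"
    by (subst nn_integral_real_affine[where c=1 and t=v]) auto
  also have "\<dots> = (\<integral>\<^sup>+x. ennreal (x powr ?p) * indicator {0..m} x + ennreal ((- x) powr ?p) * indicator {0..m} (- x) \<partial>lborel)"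
  proof (rule nn_integral_cong_AE)
    have "AE x in lborel. x \<noteq> (0::real)" by (rule AE_lborel_singleton)
    then show "AE x in lborel. ennreal (if \<bar>v + 1 * x - v\<bar> \<le> m then \<bar>v + 1 * x - v\<bar> powr ?p else 0) =
       ennreal (x powr ?p) * indicator {0..m} x + ennreal ((- x) powr ?p) * indicator {0..m} (- x)"
      by eventually_elim (auto simp: indicator_def)
  qed
  also have "\<dots> = ennreal (m powr (2 * H - 1) / (2 * H - 1)) + ennreal (m powr (2 * H - 1) / (2 * H - 1))"
    by (subst nn_integral_add) (simp_all add: half half')
  also have "\<dots> = ennreal (2 / (2 * H - 1) * m powr (2 * H - 1))"
    using assms by (simp add: ennreal_plus[symmetric] del: ennreal_plus)
  finally show ?thesis .
qed

text \<open>The fraction is the mass of the kernel near the diagonal and the 1 accounts for the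
  region away from it, both in units of \<open>m powr (2 * H - 1)\<close>.\<close>

definition time_bound :: "real \<Rightarrow> real" where
  "time_bound H = 2 / (2 * H - 1) + 1"

text \<open>Split at \<open>|u - v| = m\<close>. Near \<open>v\<close> use \<open>e <= 1\<close> and
  integrate the kernel; away from \<open>v\<close> the kernel is at most
  \<open>m powr (2 * H - 2)\<close> and \<open>e\<close> has mass at most \<open>m\<close>. This cut
  balances the two parts.\<close>

lemma time_kernel_bound_one:
  fixes e :: "real \<Rightarrow> real"
  assumes H: "1/2 < H" "H < 1" and [measurable]: "e \<in> borel_measurable borel"
    and e: "\<And>u. 0 \<le> e u" "\<And>u. e u \<le> 1" and m: "0 \<le> m" "(\<integral>\<^sup>+u. e u \<partial>lborel) \<le> ennreal m"
  shows "(\<integral>\<^sup>+u. ennreal (\<bar>u - v\<bar> powr (2 * H - 2) * e u) \<partial>lborel) \<le> ennreal (time_bound H * m powr (2 * H - 1))"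
proof (cases "m = 0")
  \<comment> \<open>Mass zero is separate because \<open>0 powr (2 * H - 2)\<close> is 0 instead of
    infinite, which would break the bound of the kernel in the far region.\<close>
  case True
  then have "(\<integral>\<^sup>+u. e u \<partial>lborel) = 0" using m by simp
  then have "AE u in lborel. ennreal (e u) = 0" by (subst (asm) nn_integral_0_iff_AE) auto
  then have "AE u in lborel. ennreal (\<bar>u - v\<bar> powr (2 * H - 2) * e u) = 0"
    by eventually_elim (use e(1) in \<open>simp add: ennreal_eq_0_iff mult_nonneg_nonpos\<close>)
  then have "(\<integral>\<^sup>+u. ennreal (\<bar>u - v\<bar> powr (2 * H - 2) * e u) \<partial>lborel) = 0"
    by (subst nn_integral_0_iff_AE) auto
  then show ?thesis by simp
next
  case False
  then have mp: "m > 0" using m by simp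
  let ?p = "2 * H - 2"
  have "\<bar>u - v\<bar> powr ?p * e u \<le> (if \<bar>u - v\<bar> \<le> m then \<bar>u - v\<bar> powr ?p else 0) + m powr ?p * e u" for u
  proof (cases "\<bar>u - v\<bar> \<le> m")
    case True
    have "\<bar>u - v\<bar> powr ?p * e u \<le> \<bar>u - v\<bar> powr ?p * 1" by (intro mult_left_mono e) auto
    moreover have "0 \<le> m powr ?p * e u" using e(1) by simp
    ultimately show ?thesis using True by simp
  next
    case False
    have "\<bar>u - v\<bar> powr ?p \<le> m powr ?p" using False mp H by (intro powr_mono2') auto
    then show ?thesis using False e(1) by (simp add: mult_right_mono)
  qed
  then have "(\<integral>\<^sup>+u. ennreal (\<bar>u - v\<bar> powr ?p * e u) \<partial>lborel)
      \<le> (\<integral>\<^sup>+u. ennreal (if \<bar>u - v\<bar> \<le> m then \<bar>u - v\<bar> powr ?p else 0) + ennreal (m powr ?p) * ennreal (e u) \<partial>lborel)"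
    by (intro nn_integral_mono) (use e(1) in \<open>simp add: ennreal_mult[symmetric] ennreal_plus[symmetric] ennreal_leI del: ennreal_plus\<close>)
  also have "\<dots> = ennreal (2 / (2 * H - 1) * m powr (2 * H - 1)) + ennreal (m powr ?p) * (\<integral>\<^sup>+u. e u \<partial>lborel)"
    using nn_integral_powr_near_zero[OF m(1) H(1), of v] by (subst nn_integral_add) (auto simp: nn_integral_cmult)
  also have "\<dots> \<le> ennreal (2 / (2 * H - 1) * m powr (2 * H - 1)) + ennreal (m powr ?p) * ennreal m"
    by (intro add_left_mono mult_left_mono m(2)) simp
  also have "\<dots> = ennreal (2 / (2 * H - 1) * m powr (2 * H - 1) + m powr ?p * m)"
    using H mp by (simp add: ennreal_mult[symmetric] ennreal_plus[symmetric] del: ennreal_plus)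
  also have "m powr ?p * m = m powr (2 * H - 1)"
    using mp powr_add[of m ?p 1] by simp
  finally show ?thesis by (simp add: time_bound_def distrib_right)
qed

text \<open>An elementary substitute for the Hardy-Littlewood-Sobolev inequality in terms of a
  supremum \<open>M\<close> and a mass \<open>M * m\<close>. After division by \<open>M\<close> the
  one-variable bound handles \<open>u\<close>, and integrating the remaining variable contributes
  one more factor \<open>m\<close>.\<close>

lemma time_kernel_bound:
  fixes e :: "real \<Rightarrow> real"
  assumes H: "1/2 < H" "H < 1" and em[measurable]: "e \<in> borel_measurable borel"
    and e: "\<And>u. 0 \<le> e u" "\<And>u. e u \<le> M" and M: "0 < M"
    and m: "0 \<le> m" "(\<integral>\<^sup>+u. ennreal (in_window 0 T u * e u) \<partial>lborel) \<le> ennreal (M * m)"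
  shows "(\<integral>\<^sup>+z. ennreal (time_kernel T H z * (e (fst z) * e (snd z))) \<partial>lborel2) \<le> ennreal (time_bound H * M\<^sup>2 * m powr (2 * H))"
proof -
  define k where "k u = in_window 0 T u * e u / M" for u
  have km[measurable]: "k \<in> borel_measurable borel" unfolding k_def by measurable
  have k: "0 \<le> k u" "k u \<le> 1" for u
    using e[of u] M by (auto simp: k_def in_window_def divide_le_eq)
  have ki: "(\<integral>\<^sup>+u. k u \<partial>lborel) \<le> ennreal m"
  proof -
    have "(\<integral>\<^sup>+u. k u \<partial>lborel) = (\<integral>\<^sup>+u. ennreal (1 / M) * ennreal (in_window 0 T u * e u) \<partial>lborel)"
      using M e(1) by (intro nn_integral_cong) (simp add: k_def ennreal_mult[symmetric])
    also have "\<dots> = ennreal (1 / M) * (\<integral>\<^sup>+u. ennreal (in_window 0 T u * e u) \<partial>lborel)"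
      by (rule nn_integral_cmult) measurable
    also have "\<dots> \<le> ennreal (1 / M) * ennreal (M * m)" by (intro mult_left_mono m) simp
    also have "\<dots> = ennreal m" using M m by (simp add: ennreal_mult[symmetric])
    finally show ?thesis .
  qed
  have T0: "time_bound H \<ge> 0" using H by (simp add: time_bound_def)
  have "(\<integral>\<^sup>+z. ennreal (time_kernel T H z * (e (fst z) * e (snd z))) \<partial>lborel2)
     = (\<integral>\<^sup>+v. \<integral>\<^sup>+u. ennreal (time_kernel T H (u, v) * (e u * e v)) \<partial>lborel \<partial>lborel)"
    by (subst lborel_pair.nn_integral_snd[symmetric]) simp_all
  also have "\<dots> = (\<integral>\<^sup>+v. ennreal (M\<^sup>2 * k v) * (\<integral>\<^sup>+u. ennreal (\<bar>u - v\<bar> powr (2 * H - 2) * k u) \<partial>lborel) \<partial>lborel)"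
  proof (intro nn_integral_cong, subst nn_integral_cmult[symmetric])
    fix v :: real
    show "(\<integral>\<^sup>+u. ennreal (time_kernel T H (u, v) * (e u * e v)) \<partial>lborel) =
      (\<integral>\<^sup>+u. ennreal (M\<^sup>2 * k v) * ennreal (\<bar>u - v\<bar> powr (2 * H - 2) * k u) \<partial>lborel)"
    proof (rule nn_integral_cong)
      fix u
      have "time_kernel T H (u, v) * (e u * e v) = (M\<^sup>2 * k v) * (\<bar>u - v\<bar> powr (2 * H - 2) * k u)"
        using M by (simp add: k_def time_kernel_def power2_eq_square)
      then show "ennreal (time_kernel T H (u, v) * (e u * e v)) =
          ennreal (M\<^sup>2 * k v) * ennreal (\<bar>u - v\<bar> powr (2 * H - 2) * k u)"
        using k(1) by (simp add: ennreal_mult[symmetric])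
    qed
  qed simp
  also have "\<dots> \<le> (\<integral>\<^sup>+v. ennreal (M\<^sup>2 * k v) * ennreal (time_bound H * m powr (2 * H - 1)) \<partial>lborel)"
    by (intro nn_integral_mono mult_left_mono time_kernel_bound_one H km k m(1) ki) simp
  also have "\<dots> = (\<integral>\<^sup>+v. ennreal (M\<^sup>2 * (time_bound H * m powr (2 * H - 1))) * k v \<partial>lborel)"
    using k T0 by (intro nn_integral_cong) (simp add: ennreal_mult[symmetric] mult_ac)
  also have "\<dots> = ennreal (M\<^sup>2 * (time_bound H * m powr (2 * H - 1))) * (\<integral>\<^sup>+v. k v \<partial>lborel)"
    by (rule nn_integral_cmult) measurable
  also have "\<dots> \<le> ennreal (M\<^sup>2 * (time_bound H * m powr (2 * H - 1))) * ennreal m"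
    by (intro mult_left_mono ki) simp
  also have "\<dots> = ennreal (time_bound H * M\<^sup>2 * m powr (2 * H))"
  proof -
    have "m powr (2 * H - 1) * m = m powr (2 * H)"
      using m(1) powr_add[of m "2 * H - 1" 1] by (cases "m = 0") auto
    then show ?thesis using m(1) T0 by (simp add: ennreal_mult[symmetric] mult.assoc mult.left_commute)
  qed
  finally show ?thesis .
qed

lemma integrable_time_kernel:
  assumes H: "1/2 < H" "H < 1"
  shows "integrable lborel2 (time_kernel T H)"
proof (rule integrableI_nonneg)
  have "(\<integral>\<^sup>+u. ennreal (in_window 0 T u * 1) \<partial>lborel) = (\<integral>\<^sup>+u. indicator {0..T} u \<partial>lborel)"
    by (intro nn_integral_cong) (auto simp: in_window_def indicator_def)
  also have "\<dots> \<le> ennreal (1 * \<bar>T\<bar>)" by (cases "T \<ge> 0") (auto simp: emeasure_lborel_Icc_eq)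
  finally have "(\<integral>\<^sup>+z. ennreal (time_kernel T H z * (1 * 1)) \<partial>lborel2) \<le> ennreal (time_bound H * 1\<^sup>2 * \<bar>T\<bar> powr (2 * H))"
    by (intro time_kernel_bound H) auto
  then show "(\<integral>\<^sup>+z. ennreal (time_kernel T H z) \<partial>lborel2) < \<infinity>"
    by (simp add: order_le_less_trans)
qed auto

section \<open>The time form on bounded Borel functions\<close>

lemma bounded_borel_measurable: "bounded_borel f \<Longrightarrow> f \<in> borel_measurable borel"
  by (simp add: bounded_borel_def)

lemma bounded_borel_add: "bounded_borel f \<Longrightarrow> bounded_borel g \<Longrightarrow> bounded_borel (\<lambda>u. f u + g u)"
  unfolding bounded_borel_def by (auto intro: borel_measurable_add) (meson add_mono norm_triangle_le)

lemma bounded_borel_diff: "bounded_borel f \<Longrightarrow> bounded_borel g \<Longrightarrow> bounded_borel (\<lambda>u. f u - g u)"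
  unfolding bounded_borel_def by (auto intro: borel_measurable_diff) (meson add_mono norm_triangle_le_diff)

lemma bounded_borel_mult: "bounded_borel f \<Longrightarrow> bounded_borel g \<Longrightarrow> bounded_borel (\<lambda>u. f u * g u)"
  unfolding bounded_borel_def
  by (auto simp: norm_mult intro: borel_measurable_times) (meson mult_mono' norm_ge_zero)

lemma bounded_borel_const: "bounded_borel (\<lambda>u. c)"
  unfolding bounded_borel_def by auto

lemma bounded_borel_norm: "bounded_borel f \<Longrightarrow> bounded_borel (\<lambda>u. complex_of_real (norm (f u)))"
  unfolding bounded_borel_def by auto

lemma cnj_measurable [measurable (raw)]:
  "f \<in> borel_measurable M \<Longrightarrow> (\<lambda>x. cnj (f x)) \<in> borel_measurable M"
  by (rule measurable_compose[OF _ borel_measurable_continuous_onI[OF continuous_on_cnj[OF continuous_on_id]]])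

lemma abs_Re_mult_cnj_le:
  assumes "norm a \<le> M" "norm b \<le> N" shows "\<bar>Re (a * cnj b)\<bar> \<le> M * N"
proof -
  have "\<bar>Re (a * cnj b)\<bar> \<le> norm (a * cnj b)" by (rule abs_Re_le_cmod)
  also have "\<dots> \<le> M * N" using assms by (auto simp: norm_mult intro!: mult_mono intro: order_trans[OF norm_ge_zero])
  finally show ?thesis .
qed

lemma integrable_time_form:
  assumes H: "1/2 < H" "H < 1" and f: "bounded_borel f" and g: "bounded_borel g"
  shows "integrable lborel2 (\<lambda>z. time_kernel T H z * Re (f (fst z) * cnj (g (snd z))))"
proof -
  obtain M N where M: "\<And>u. norm (f u) \<le> M" and N: "\<And>u. norm (g u) \<le> N"
    using f g by (auto simp: bounded_borel_def)
  have [measurable]: "f \<in> borel_measurable borel" "g \<in> borel_measurable borel"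
    using f g by (auto simp: bounded_borel_def)
  show ?thesis
  proof (rule Bochner_Integration.integrable_bound)
    show "integrable lborel2 (\<lambda>z. time_kernel T H z * (M * N))"
      using integrable_time_kernel[OF H] by simp
    show "AE z in lborel2. norm (time_kernel T H z * Re (f (fst z) * cnj (g (snd z)))) \<le> norm (time_kernel T H z * (M * N))"
    proof (rule AE_I2)
      fix z
      have "\<bar>Re (f (fst z) * cnj (g (snd z)))\<bar> \<le> \<bar>M * N\<bar>"
        using abs_Re_mult_cnj_le[OF M N, of "fst z" "snd z"] by linarith
      then show "norm (time_kernel T H z * Re (f (fst z) * cnj (g (snd z)))) \<le> norm (time_kernel T H z * (M * N))"
        unfolding real_norm_def abs_mult[of "time_kernel T H z"] by (intro mult_left_mono) simp_all
    qed
  qed measurable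
qed

lemma integrable_window:
  assumes f: "bounded_borel f"
  shows "integrable lborel (\<lambda>u. (in_window 0 T u * in_window a b u) *\<^sub>R f u)"
proof -
  obtain M where M: "\<And>u. norm (f u) \<le> M" using f by (auto simp: bounded_borel_def)
  have [measurable]: "f \<in> borel_measurable borel" using f by (auto simp: bounded_borel_def)
  show ?thesis
  proof (rule Bochner_Integration.integrable_bound)
    show "integrable lborel (\<lambda>u. M * indicator {0..T} u)"
      by (intro integrable_mult_right integrable_real_indicator) (auto simp: emeasure_lborel_Icc_eq)
    show "AE u in lborel. norm ((in_window 0 T u * in_window a b u) *\<^sub>R f u) \<le> norm (M * indicator {0..T} u)"
      using M by (intro AE_I2) (auto simp: in_window_def indicator_def intro: order_trans[OF _ abs_ge_self])
  qed measurable
qed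

lemma window_measurable [measurable]:
  assumes [measurable]: "f \<in> borel_measurable borel"
  shows "window T f \<in> borel_measurable lborel2"
  unfolding window_def[abs_def] by measurable

context
  fixes H T :: real and f g :: "real \<Rightarrow> complex"
  assumes H: "1/2 < H" "H < 1" and f: "bounded_borel f" and g: "bounded_borel g"
begin

definition window_integrand :: "(real \<times> real) \<times> (real \<times> real) \<Rightarrow> real" where
  "window_integrand x = (case x of (z, y) \<Rightarrow>
     in_window 0 T (fst z) * in_window 0 T (snd z) *
     (window_weight H (fst y) (snd y) * in_window (fst y) (snd y) (fst z) * in_window (fst y) (snd y) (snd z)) *
     Re (f (fst z) * cnj (g (snd z))))"

text \<open>Fubini for a function of the two times and of the interval \<open>y\<close>. Integrating
  out \<open>y\<close> restores the fractional kernel up to the constant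
  \<open>(2 - 2 * H) * (3 - 2 * H)\<close>; integrating out the times factorizes into a product of
  two integrals over the interval.\<close>

lemma time_form_window_aux:
  "integrable lborel2 (\<lambda>y. window_weight H (fst y) (snd y) * Re (window T f y * cnj (window T g y)))"
  "time_form T H f g = (2 - 2 * H) * (3 - 2 * H) *
     (\<integral>y. window_weight H (fst y) (snd y) * Re (window T f y * cnj (window T g y)) \<partial>lborel2)"
proof -
  interpret P: pair_sigma_finite lborel2 lborel2
    by (intro pair_sigma_finite.intro sigma_finite_lborel2)
  obtain M N where M: "\<And>u. norm (f u) \<le> M" and N: "\<And>u. norm (g u) \<le> N"
    using f g by (auto simp: bounded_borel_def)
  have M0: "M \<ge> 0" "N \<ge> 0" using order_trans[OF norm_ge_zero M] order_trans[OF norm_ge_zero N] by auto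
  have [measurable]: "f \<in> borel_measurable borel" "g \<in> borel_measurable borel"
    using f g by (auto simp: bounded_borel_def)
  let ?\<kappa> = "(2 - 2 * H) * (3 - 2 * H)"
  have k0: "?\<kappa> > 0" using H by simp
  \<comment> \<open>On the diagonal the superposition diverges while
    \<open>0 powr (2 * H - 2)\<close> is 0, so the two kernels agree only off this null set.\<close>
  have off: "AE z in lborel2. fst z \<noteq> snd z"
  proof -
    have "AE u in lborel. AE v in lborel. u \<noteq> (v::real)"
      using AE_lborel_singleton by (auto simp: eq_commute)
    moreover have "{z \<in> space lborel2. fst z \<noteq> snd z} \<in> sets lborel2" by measurable
    ultimately show ?thesis
      by (intro lborel_pair.AE_pair_measure) auto
  qed
  define W where "W z y = window_weight H (fst y) (snd y) * in_window (fst y) (snd y) (fst z) * in_window (fst y) (snd y) (snd z)" for z y :: "real \<times> real"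
  have W0: "W z y \<ge> 0" for z y by (simp add: W_def)
  have Wm[measurable]: "(\<lambda>x. W (fst x) (snd x)) \<in> borel_measurable (lborel2 \<Otimes>\<^sub>M lborel2)"
    unfolding W_def by measurable
  have Wm'[measurable]: "W z \<in> borel_measurable lborel2" for z
    unfolding W_def by measurable
  have Wn: "(\<integral>\<^sup>+y. ennreal (W z y) \<partial>lborel2) = ennreal (\<bar>fst z - snd z\<bar> powr (2 * H - 2) / ?\<kappa>)" if "fst z \<noteq> snd z" for z
    unfolding W_def using powr_eq_window_integral[OF H that] by simp
  define R where "R z = Re (f (fst z) * cnj (g (snd z)))" for z
  have Rm[measurable]: "R \<in> borel_measurable lborel2" unfolding R_def by measurable
  have Rb: "\<bar>R z\<bar> \<le> M * N" for z
    unfolding R_def by (rule abs_Re_mult_cnj_le[OF M N])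
  define I where "I z = in_window 0 T (fst z) * in_window 0 T (snd z)" for z
  have Im[measurable]: "I \<in> borel_measurable lborel2" unfolding I_def by measurable
  have I0: "I z \<ge> 0" for z by (simp add: I_def)
  have int: "integrable (lborel2 \<Otimes>\<^sub>M lborel2) (\<lambda>(z, y). I z * W z y * R z)"
  proof (rule integrableI_bounded)
    have "(\<integral>\<^sup>+x. norm (case x of (z, y) \<Rightarrow> I z * W z y * R z) \<partial>(lborel2 \<Otimes>\<^sub>M lborel2)) \<le>
      (\<integral>\<^sup>+x. ennreal (I (fst x) * (M * N)) * ennreal (W (fst x) (snd x)) \<partial>(lborel2 \<Otimes>\<^sub>M lborel2))"
    proof (rule nn_integral_mono)
      fix x
      have "I (fst x) * W (fst x) (snd x) * \<bar>R (fst x)\<bar> \<le> I (fst x) * W (fst x) (snd x) * (M * N)"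
        by (intro mult_left_mono Rb mult_nonneg_nonneg I0 W0)
      then show "ennreal (norm (case x of (z, y) \<Rightarrow> I z * W z y * R z)) \<le> ennreal (I (fst x) * (M * N)) * ennreal (W (fst x) (snd x))"
        using W0 I0 M0 by (simp add: case_prod_unfold abs_mult ennreal_mult[symmetric] mult_ac ennreal_leI)
    qed
    also have "\<dots> = (\<integral>\<^sup>+z. \<integral>\<^sup>+y. ennreal (I z * (M * N)) * ennreal (W z y) \<partial>lborel2 \<partial>lborel2)"
      by (subst sigma_finite_measure.nn_integral_fst[OF sigma_finite_lborel2, symmetric]) simp_all
    also have "\<dots> = (\<integral>\<^sup>+z. ennreal (I z * (M * N)) * (\<integral>\<^sup>+y. ennreal (W z y) \<partial>lborel2) \<partial>lborel2)"
      by (intro nn_integral_cong nn_integral_cmult) measurable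
    also have "\<dots> = (\<integral>\<^sup>+z. ennreal (M * N / ?\<kappa> * time_kernel T H z) \<partial>lborel2)"
    proof (rule nn_integral_cong_AE, use off in eventually_elim)
      case (elim z)
      then show ?case using k0 M0 I0
        by (simp add: Wn ennreal_mult[symmetric] time_kernel_def I_def)
    qed
    also have "\<dots> < \<infinity>"
    proof -
      have "integrable lborel2 (\<lambda>z. M * N / ?\<kappa> * time_kernel T H z)"
        by (intro integrable_mult_right integrable_time_kernel H)
      moreover have "0 \<le> M * N / ?\<kappa> * time_kernel T H z" for z using M0 k0 by simp
      ultimately show ?thesis using nn_integral_eq_integral[of lborel2 "\<lambda>z. M * N / ?\<kappa> * time_kernel T H z"] by simp
    qed
    finally show "(\<integral>\<^sup>+x. norm (case x of (z, y) \<Rightarrow> I z * W z y * R z) \<partial>(lborel2 \<Otimes>\<^sub>M lborel2)) < \<infinity>" .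
  qed measurable
  have zside: "(\<integral>y. I z * W z y * R z \<partial>lborel2) = time_kernel T H z * R z / ?\<kappa>" if "fst z \<noteq> snd z" for z
  proof -
    have "(\<integral>y. W z y \<partial>lborel2) = \<bar>fst z - snd z\<bar> powr (2 * H - 2) / ?\<kappa>"
      using Wn[OF that] W0 k0 by (intro integral_eq_nn_integral[THEN trans]) auto
    then show ?thesis by (simp add: time_kernel_def I_def)
  qed
  have yside: "(\<integral>z. I z * W z y * R z \<partial>lborel2) = window_weight H (fst y) (snd y) * Re (window T f y * cnj (window T g y))" for y
  proof -
    define F where "F u = (in_window 0 T u * in_window (fst y) (snd y) u) *\<^sub>R f u" for u
    define G where "G u = cnj ((in_window 0 T u * in_window (fst y) (snd y) u) *\<^sub>R g u)" for u
    have iF: "integrable lborel F" unfolding F_def by (rule integrable_window[OF f])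
    have iG: "integrable lborel G" unfolding G_def by (intro integrable_cnj integrable_window[OF g])
    have iFG: "integrable lborel2 (\<lambda>(u, v). F u * G v)"
      using iF iG by (intro lborel_pair.Fubini_integrable) (auto simp: norm_mult)
    have "(\<integral>z. F (fst z) * G (snd z) \<partial>lborel2) = (\<integral>u. \<integral>v. F u * G v \<partial>lborel \<partial>lborel)"
      using lborel_pair.integral_fst[OF iFG] by (simp add: case_prod_unfold)
    also have "\<dots> = (\<integral>u. F u \<partial>lborel) * (\<integral>v. G v \<partial>lborel)"
      by (simp only: integral_mult_right_zero integral_mult_left_zero)
    also have "\<dots> = window T f y * cnj (window T g y)"
      unfolding window_def F_def G_def by (subst Bochner_Integration.integral_cnj) (rule refl)
    finally have e: "(\<integral>z. F (fst z) * G (snd z) \<partial>lborel2) = window T f y * cnj (window T g y)" .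
    have "Re (\<integral>z. F (fst z) * G (snd z) \<partial>lborel2) = (\<integral>z. Re (F (fst z) * G (snd z)) \<partial>lborel2)"
      using iFG by (intro integral_Re[symmetric]) (simp add: case_prod_unfold)
    then have "window_weight H (fst y) (snd y) * Re (window T f y * cnj (window T g y)) =
       (\<integral>z. window_weight H (fst y) (snd y) * Re (F (fst z) * G (snd z)) \<partial>lborel2)"
      by (simp add: e)
    also have "\<dots> = (\<integral>z. I z * W z y * R z \<partial>lborel2)"
      by (intro Bochner_Integration.integral_cong) (auto simp: I_def W_def R_def F_def G_def in_window_def)
    finally show ?thesis ..
  qed
  show "integrable lborel2 (\<lambda>y. window_weight H (fst y) (snd y) * Re (window T f y * cnj (window T g y)))"
    using P.integrable_snd[OF int] by (simp add: yside)
  have "time_form T H f g = ?\<kappa> * (\<integral>z. time_kernel T H z * R z / ?\<kappa> \<partial>lborel2)"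
    unfolding time_form_def R_def[symmetric] using H by (subst integral_divide_zero) simp
  also have "(\<integral>z. time_kernel T H z * R z / ?\<kappa> \<partial>lborel2) = (\<integral>z. \<integral>y. I z * W z y * R z \<partial>lborel2 \<partial>lborel2)"
  proof (rule integral_cong_AE)
    show "AE z in lborel2. time_kernel T H z * R z / ?\<kappa> = (\<integral>y. I z * W z y * R z \<partial>lborel2)"
      using off by eventually_elim (rule zside[symmetric])
  qed measurable
  also have "\<dots> = (\<integral>y. \<integral>z. I z * W z y * R z \<partial>lborel2 \<partial>lborel2)"
    using P.integral_fst[OF int] P.integral_snd[OF int] by simp
  finally show "time_form T H f g = ?\<kappa> *
     (\<integral>y. window_weight H (fst y) (snd y) * Re (window T f y * cnj (window T g y)) \<partial>lborel2)"
    by (simp add: yside)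
qed

end

lemma time_form_eq_window:
  assumes "1/2 < H" "H < 1" "bounded_borel f" "bounded_borel g"
  shows "time_form T H f g = (2 - 2 * H) * (3 - 2 * H) *
     (\<integral>y. window_weight H (fst y) (snd y) * Re (window T f y * cnj (window T g y)) \<partial>lborel2)"
  using assms by (rule time_form_window_aux(2))

lemma time_form_commute:
  assumes "1/2 < H" "H < 1" "bounded_borel f" "bounded_borel g"
  shows "time_form T H f g = time_form T H g f"
proof -
  have "Re (a * cnj b) = Re (b * cnj a)" for a b by (simp add: mult.commute)
  then show ?thesis
    unfolding time_form_eq_window[OF assms] time_form_eq_window[OF assms(1,2,4,3)] by metis
qed

lemma time_form_nonneg:
  assumes "1/2 < H" "H < 1" "bounded_borel f"
  shows "0 \<le> time_form T H f f"
  unfolding time_form_eq_window[OF assms assms(3)] using assms(1,2)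
  by (intro mult_nonneg_nonneg integral_nonneg) (auto simp: complex_mult_cnj)

lemma time_form_add_left:
  assumes "1/2 < H" "H < 1" "bounded_borel f" "bounded_borel f'" "bounded_borel g"
  shows "time_form T H (\<lambda>u. f u + f' u) g = time_form T H f g + time_form T H f' g"
proof -
  have "time_form T H (\<lambda>u. f u + f' u) g =
    (\<integral>z. time_kernel T H z * Re (f (fst z) * cnj (g (snd z))) + time_kernel T H z * Re (f' (fst z) * cnj (g (snd z))) \<partial>lborel2)"
    unfolding time_form_def by (intro Bochner_Integration.integral_cong refl) (simp add: algebra_simps)
  also have "\<dots> = time_form T H f g + time_form T H f' g"
    unfolding time_form_def using assms by (intro Bochner_Integration.integral_add integrable_time_form)
  finally show ?thesis .
qed

lemma time_form_diff_left:
  assumes "1/2 < H" "H < 1" "bounded_borel f" "bounded_borel f'" "bounded_borel g"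
  shows "time_form T H (\<lambda>u. f u - f' u) g = time_form T H f g - time_form T H f' g"
  using time_form_add_left[OF assms(1,2) bounded_borel_diff[OF assms(3,4)] assms(4,5)] by simp

lemma time_form_diff_square:
  assumes H: "1/2 < H" "H < 1" and f: "bounded_borel f" and g: "bounded_borel g"
  shows "time_form T H (\<lambda>u. f u - g u) (\<lambda>u. f u - g u) =
    time_form T H f f - 2 * time_form T H f g + time_form T H g g"
proof -
  note d = bounded_borel_diff[OF f g]
  show ?thesis
    unfolding time_form_diff_left[OF H f g d] time_form_commute[OF H f d] time_form_commute[OF H g d]
      time_form_diff_left[OF H f g f] time_form_diff_left[OF H f g g]
    using time_form_commute[OF H g f] by simp
qed

text \<open>Parallelogram law: the right side minus the left side is the form at
  \<open>f - g\<close>.\<close>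

lemma time_form_add_square_le:
  assumes H: "1/2 < H" "H < 1" and f: "bounded_borel f" and g: "bounded_borel g"
  shows "time_form T H (\<lambda>u. f u + g u) (\<lambda>u. f u + g u) \<le> 2 * time_form T H f f + 2 * time_form T H g g"
proof -
  note d = bounded_borel_add[OF f g]
  have "time_form T H (\<lambda>u. f u + g u) (\<lambda>u. f u + g u) = time_form T H f f + 2 * time_form T H f g + time_form T H g g"
    unfolding time_form_add_left[OF H f g d] time_form_commute[OF H f d] time_form_commute[OF H g d]
      time_form_add_left[OF H f g f] time_form_add_left[OF H f g g]
    using time_form_commute[OF H g f] by simp
  moreover have "0 \<le> time_form T H f f - 2 * time_form T H f g + time_form T H g g"
    using time_form_nonneg[OF H d] time_form_nonneg[OF H bounded_borel_diff[OF f g]]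
      time_form_diff_square[OF H f g] by simp
  ultimately show ?thesis by simp
qed

lemma time_form_cmult_square:
  "time_form T H (\<lambda>u. c * f u) (\<lambda>u. c * f u) = (norm c)\<^sup>2 * time_form T H f f"
proof -
  have "Re (c * a * cnj (c * b)) = (norm c)\<^sup>2 * Re (a * cnj b)" for a b
  proof -
    have "c * a * cnj (c * b) = (c * cnj c) * (a * cnj b)" by (simp add: mult_ac)
    also have "c * cnj c = complex_of_real ((norm c)\<^sup>2)" by (simp only: complex_norm_square)
    finally show ?thesis by (simp only: Re_complex_of_real mult_zero_left complex.sel(1) times_complex.sel Im_complex_of_real diff_zero)
  qed
  then show ?thesis
    unfolding time_form_def by (simp only: mult.left_commute[of _ "(norm c)\<^sup>2"] integral_mult_right_zero)
qed

lemma abs_time_form_le: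
  assumes "1/2 < H" "H < 1" "bounded_borel f" "bounded_borel g"
  shows "\<bar>time_form T H f g\<bar> \<le> time_form T H (\<lambda>u. complex_of_real (norm (f u))) (\<lambda>u. complex_of_real (norm (g u)))"
proof -
  have "\<bar>time_form T H f g\<bar> \<le> (\<integral>z. norm (time_kernel T H z * Re (f (fst z) * cnj (g (snd z)))) \<partial>lborel2)"
    unfolding time_form_def real_norm_def[symmetric] by (rule integral_norm_bound)
  also have "\<dots> \<le> time_form T H (\<lambda>u. complex_of_real (norm (f u))) (\<lambda>u. complex_of_real (norm (g u)))"
    unfolding time_form_def
  proof (rule integral_mono)
    fix z
    have "\<bar>Re (f (fst z) * cnj (g (snd z)))\<bar> \<le> norm (f (fst z)) * norm (g (snd z))"
      by (rule abs_Re_mult_cnj_le) auto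
    then have "time_kernel T H z * \<bar>Re (f (fst z) * cnj (g (snd z)))\<bar> \<le> time_kernel T H z * (norm (f (fst z)) * norm (g (snd z)))"
      by (intro mult_left_mono) auto
    then show "norm (time_kernel T H z * Re (f (fst z) * cnj (g (snd z)))) \<le>
       time_kernel T H z * Re (complex_of_real (norm (f (fst z))) * cnj (complex_of_real (norm (g (snd z)))))"
      unfolding real_norm_def abs_mult[of "time_kernel T H z"] by simp
  next
    show "integrable lborel2 (\<lambda>z. norm (time_kernel T H z * Re (f (fst z) * cnj (g (snd z)))))"
      by (intro integrable_norm integrable_time_form assms)
    show "integrable lborel2 (\<lambda>z. time_kernel T H z * Re (complex_of_real (norm (f (fst z))) * cnj (complex_of_real (norm (g (snd z))))))"
      by (intro integrable_time_form bounded_borel_norm assms)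
  qed
  finally show ?thesis .
qed

lemma time_form_norm_eq_nn_integral:
  assumes "1/2 < H" "H < 1" "bounded_borel f" "bounded_borel g"
  shows "ennreal (time_form T H (\<lambda>u. complex_of_real (norm (f u))) (\<lambda>u. complex_of_real (norm (g u)))) =
    (\<integral>\<^sup>+z. ennreal (time_kernel T H z * (norm (f (fst z)) * norm (g (snd z)))) \<partial>lborel2)"
  using nn_integral_eq_integral[OF integrable_time_form[OF assms(1,2) bounded_borel_norm[OF assms(3)] bounded_borel_norm[OF assms(4)], of T]]
  by (simp add: time_form_def)

lemma time_form_norm_bound:
  assumes H: "1/2 < H" "H < 1" and f: "bounded_borel f"
    and M: "\<And>u. norm (f u) \<le> M" "0 < M"
    and m: "0 \<le> m" "(\<integral>\<^sup>+u. ennreal (in_window 0 T u * norm (f u)) \<partial>lborel) \<le> ennreal (M * m)"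
  shows "time_form T H (\<lambda>u. complex_of_real (norm (f u))) (\<lambda>u. complex_of_real (norm (f u))) \<le> time_bound H * M\<^sup>2 * m powr (2 * H)"
proof -
  have [measurable]: "f \<in> borel_measurable borel" by (rule bounded_borel_measurable[OF f])
  have "ennreal (time_form T H (\<lambda>u. complex_of_real (norm (f u))) (\<lambda>u. complex_of_real (norm (f u))))
    \<le> ennreal (time_bound H * M\<^sup>2 * m powr (2 * H))"
    unfolding time_form_norm_eq_nn_integral[OF H f f]
    by (rule time_kernel_bound[OF H]) (use M m in auto)
  moreover have "0 \<le> time_bound H * M\<^sup>2 * m powr (2 * H)" using H by (simp add: time_bound_def)
  ultimately show ?thesis by (simp add: ennreal_le_iff)
qed

lemma time_form_bound:
  assumes "1/2 < H" "H < 1" "bounded_borel f"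
    and "\<And>u. norm (f u) \<le> M" "0 < M"
    and "0 \<le> m" "(\<integral>\<^sup>+u. ennreal (in_window 0 T u * norm (f u)) \<partial>lborel) \<le> ennreal (M * m)"
  shows "time_form T H f f \<le> time_bound H * M\<^sup>2 * m powr (2 * H)"
  using order_trans[OF order_trans[OF abs_ge_self abs_time_form_le[OF assms(1,2,3,3)]] time_form_norm_bound[OF assms]] .

text \<open>By the window representation, weak convergence of \<open>f n\<close> to zero is enough.\<close>
lemma time_form_tendsto_0:
  assumes H: "1/2 < H" "H < 1" and T: "0 \<le> T" and f: "\<And>n. bounded_borel (f n)"
    and M: "\<And>n u. norm (f n u) \<le> M"
    and lim: "\<And>a b. a < b \<Longrightarrow> (\<lambda>n. window T (f n) (a, b)) \<longlonglongrightarrow> 0"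
  shows "(\<lambda>n. time_form T H (f n) (f n)) \<longlonglongrightarrow> 0"
proof -
  let ?c = "\<lambda>_::real. complex_of_real M"
  have c: "bounded_borel ?c" by (rule bounded_borel_const)
  have M0: "M \<ge> 0" using order_trans[OF norm_ge_zero M] .
  have sq: "Re (w * cnj w) = (norm w)\<^sup>2" for w by (simp add: cmod_power2) (simp add: power2_eq_square)
  \<comment> \<open>The majorant is the same expression for the constant function \<open>M\<close>,
    whose weighted square of window integrals is integrable because the constant is itself bounded
    and Borel.\<close>
  have wle: "norm (window T (f n) y) \<le> norm (window T ?c y)" for n y
  proof -
    have "norm (window T (f n) y) \<le> (\<integral>u. norm ((in_window 0 T u * in_window (fst y) (snd y) u) *\<^sub>R f n u) \<partial>lborel)"
      unfolding window_def by (rule integral_norm_bound)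
    also have "\<dots> \<le> (\<integral>u. in_window 0 T u * in_window (fst y) (snd y) u * M \<partial>lborel)"
    proof (rule integral_mono)
      show "integrable lborel (\<lambda>u. norm ((in_window 0 T u * in_window (fst y) (snd y) u) *\<^sub>R f n u))"
        by (intro integrable_norm integrable_window f)
      show "integrable lborel (\<lambda>u. in_window 0 T u * in_window (fst y) (snd y) u * M)"
        using integrable_norm[OF integrable_window[OF c, of T "fst y" "snd y"]] M0 by simp
    qed (use M in \<open>simp add: mult_left_mono\<close>)
    also have "\<dots> = Re (window T ?c y)"
      unfolding window_def using integrable_window[OF c, of T "fst y" "snd y"]
      by (subst integral_Re[symmetric]) (auto simp: scaleR_conv_of_real)
    also have "\<dots> \<le> norm (window T ?c y)" by (rule complex_Re_le_cmod)
    finally show ?thesis .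
  qed
  have "(\<lambda>n. \<integral>y. window_weight H (fst y) (snd y) * Re (window T (f n) y * cnj (window T (f n) y)) \<partial>lborel2) \<longlonglongrightarrow> (\<integral>y. 0 \<partial>lborel2)"
  proof (rule integral_dominated_convergence)
    show "integrable lborel2 (\<lambda>y. window_weight H (fst y) (snd y) * Re (window T ?c y * cnj (window T ?c y)))"
      by (rule time_form_window_aux(1)[OF H c c])
    show "AE y in lborel2. norm (window_weight H (fst y) (snd y) * Re (window T (f n) y * cnj (window T (f n) y)))
        \<le> window_weight H (fst y) (snd y) * Re (window T ?c y * cnj (window T ?c y))" for n
      unfolding sq by (intro AE_I2) (auto simp: abs_mult intro!: mult_left_mono power_mono wle)
    show "AE y in lborel2. (\<lambda>n. window_weight H (fst y) (snd y) * Re (window T (f n) y * cnj (window T (f n) y))) \<longlonglongrightarrow> 0"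
    proof (rule AE_I2)
      fix y
      show "(\<lambda>n. window_weight H (fst y) (snd y) * Re (window T (f n) y * cnj (window T (f n) y))) \<longlonglongrightarrow> 0"
      proof (cases "fst y < snd y")
        case True
        have "(\<lambda>n. (norm (window T (f n) y))\<^sup>2) \<longlonglongrightarrow> 0\<^sup>2"
          using lim[OF True] by (intro tendsto_power tendsto_norm_zero) simp
        then show ?thesis unfolding sq by (intro tendsto_mult_right_zero) simp
      qed (simp add: window_weight_def)
    qed
  qed (use bounded_borel_measurable[OF f] in measurable)
  then have "(\<lambda>n. (2 - 2 * H) * (3 - 2 * H) * (\<integral>y. window_weight H (fst y) (snd y) * Re (window T (f n) y * cnj (window T (f n) y)) \<partial>lborel2)) \<longlonglongrightarrow> 0"
    by (intro tendsto_mult_right_zero) simp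
  then show ?thesis unfolding time_form_eq_window[OF H f f] .
qed

section \<open>The inner product in frequency\<close>

text \<open>The spatial transform with the roles of time and frequency exchanged, so that fixing
  \<xi> leaves a function of time. It is 0 off the open interval because the functions considered
  are only controlled there.\<close>

definition profile :: "real \<Rightarrow> (real \<times> 'a::euclidean_space \<Rightarrow> real) \<Rightarrow> 'a \<Rightarrow> real \<Rightarrow> complex" where
  "profile T \<phi> \<xi> u = (if 0 < u \<and> u < T then space_fourier \<phi> u \<xi> else 0)"

locale noise_space =
  fixes T H c :: real and \<mu> :: "'a::euclidean_space measure"
  assumes T: "0 < T" and H: "1 / 2 < H" "H < 1" and c: "0 < c" and tempered: "tempered_measure \<mu>"
begin

lemma sets_\<mu> [measurable_cong]: "sets \<mu> = sets borel"
  using tempered by (simp add: tempered_measure_def)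

lemma space_\<mu> [simp]: "space \<mu> = UNIV"
  using sets_eq_imp_space_eq[OF sets_\<mu>] by simp

lemma tempered_integrable:
  obtains k :: nat where "integrable \<mu> (\<lambda>\<xi>. 1 / (1 + (norm \<xi>)\<^sup>2) ^ k)"
proof -
  obtain k :: nat where k: "(\<integral>\<^sup>+\<xi>. ennreal (1 / (1 + (norm \<xi>)\<^sup>2) ^ k) \<partial>\<mu>) < \<infinity>"
    using tempered by (auto simp: tempered_measure_def)
  have "integrable \<mu> (\<lambda>\<xi>. 1 / (1 + (norm \<xi>)\<^sup>2) ^ k)"
    by (rule integrableI_nonneg) (use k in auto)
  then show ?thesis by (rule that)
qed

text \<open>On each closed ball the tempered weight is bounded below by a positive constant, so
  balls have finite measure.\<close>

lemma sigma_finite_\<mu>: "sigma_finite_measure \<mu>"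
proof -
  obtain k where k: "integrable \<mu> (\<lambda>\<xi>. 1 / (1 + (norm \<xi>)\<^sup>2) ^ k)" by (rule tempered_integrable)
  have fin: "emeasure \<mu> (cball 0 (real n)) \<noteq> \<infinity>" for n
  proof -
    have "(1 + (norm \<xi>)\<^sup>2) ^ k \<le> (1 + (real n)\<^sup>2) ^ k" if "norm \<xi> \<le> real n" for \<xi> :: 'a
      using that by (intro power_mono add_left_mono) auto
    moreover have [measurable]: "cball (0::'a) (real n) \<in> sets \<mu>" using sets_\<mu> by simp
    ultimately have "integrable \<mu> (indicator (cball 0 (real n)) :: 'a \<Rightarrow> real)"
      by (intro Bochner_Integration.integrable_bound[OF integrable_mult_right[OF k, of "(1 + (real n)\<^sup>2) ^ k"]])
         (auto simp: indicator_def pos_le_divide_eq add_pos_nonneg)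
    then show ?thesis by (auto simp: integrable_indicator_iff)
  qed
  show ?thesis
  proof
    show "\<exists>A. countable A \<and> A \<subseteq> sets \<mu> \<and> \<Union>A = space \<mu> \<and> (\<forall>a\<in>A. emeasure \<mu> a \<noteq> \<infinity>)"
    proof (intro exI[of _ "range (\<lambda>n::nat. cball 0 (real n))"] conjI)
      show "(\<Union>(range (\<lambda>n::nat. cball (0::'a) (real n)))) = space \<mu>"
        using real_arch_simple by auto
    qed (use fin sets_\<mu> in auto)
  qed
qed

sublocale \<mu>: sigma_finite_measure \<mu> by (rule sigma_finite_\<mu>)

sublocale pair_\<mu>: pair_sigma_finite lborel2 \<mu>
  by (intro pair_sigma_finite.intro sigma_finite_lborel2 sigma_finite_\<mu>)

abbreviation "tf \<equiv> time_form T H"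
abbreviation "nm f \<equiv> (\<lambda>u. complex_of_real (norm (f u)))"

text \<open>Integrability is imposed on the form of the moduli. This is absolute convergence: it
  legitimates every exchange of time and frequency integrals and, through positivity, all mixed
  terms.\<close>

definition profiles :: "('a \<Rightarrow> real \<Rightarrow> complex) set" where
  "profiles = {F. (\<lambda>x. F (fst x) (snd x)) \<in> borel_measurable (borel \<Otimes>\<^sub>M borel) \<and>
     (\<exists>M. \<forall>\<xi> u. norm (F \<xi> u) \<le> M) \<and> integrable \<mu> (\<lambda>\<xi>. tf (nm (F \<xi>)) (nm (F \<xi>)))}"

definition profile_form :: "('a \<Rightarrow> real \<Rightarrow> complex) \<Rightarrow> ('a \<Rightarrow> real \<Rightarrow> complex) \<Rightarrow> real" where
  "profile_form F G = (\<integral>\<xi>. tf (F \<xi>) (G \<xi>) \<partial>\<mu>)"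

lemma profile_slice_bounded_borel:
  assumes [measurable]: "(\<lambda>x. F (fst x) (snd x)) \<in> borel_measurable (borel \<Otimes>\<^sub>M borel)" and "\<And>\<xi> u. norm (F \<xi> u) \<le> M"
  shows "bounded_borel (F \<xi>)"
proof -
  have "(\<lambda>u. (\<lambda>x. F (fst x) (snd x)) (\<xi>, u)) \<in> borel_measurable borel" by measurable
  then show ?thesis using assms(2) by (auto simp: bounded_borel_def)
qed

lemma profiles_bounded_borel: "F \<in> profiles \<Longrightarrow> bounded_borel (F \<xi>)"
  using profile_slice_bounded_borel unfolding profiles_def by blast

lemma time_form_profile_measurable:
  assumes [measurable]: "(\<lambda>x. F (fst x) (snd x)) \<in> borel_measurable (borel \<Otimes>\<^sub>M borel)"
    "(\<lambda>x. G (fst x) (snd x)) \<in> borel_measurable (borel \<Otimes>\<^sub>M borel)"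
  shows "(\<lambda>\<xi>. tf (F \<xi>) (G \<xi>)) \<in> borel_measurable \<mu>"
proof -
  have [measurable]: "(\<lambda>x. F (f x) (g x)) \<in> borel_measurable M" "(\<lambda>x. G (f x) (g x)) \<in> borel_measurable M"
    if [measurable]: "f \<in> borel_measurable M" "g \<in> borel_measurable M" for f g and M :: "'m measure"
    using measurable_compose[of "\<lambda>x. (f x, g x)" M _ "\<lambda>x. F (fst x) (snd x)"]
      measurable_compose[of "\<lambda>x. (f x, g x)" M _ "\<lambda>x. G (fst x) (snd x)"] assms by auto
  show ?thesis unfolding time_form_def
    by (rule sigma_finite_measure.borel_measurable_lebesgue_integral[OF sigma_finite_lborel2]) measurable
qed

text \<open>The criterion through which test functions, heat kernels and backward convolutions
  enter. A uniform bound and a time mass proportional to \<open>m \<xi>\<close> make the form at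
  frequency \<xi> of order \<open>m \<xi> powr (2 * H)\<close>.\<close>

lemma profilesI:
  assumes F: "(\<lambda>x. F (fst x) (snd x)) \<in> borel_measurable (borel \<Otimes>\<^sub>M borel)"
    and M: "\<And>\<xi> u. norm (F \<xi> u) \<le> M" "0 < M"
    and m: "\<And>\<xi>. 0 \<le> m \<xi>" "\<And>\<xi>. (\<integral>\<^sup>+u. ennreal (in_window 0 T u * norm (F \<xi> u)) \<partial>lborel) \<le> ennreal (M * m \<xi>)"
    and i: "integrable \<mu> (\<lambda>\<xi>. m \<xi> powr (2 * H))"
  shows "F \<in> profiles"
proof -
  note b = profile_slice_bounded_borel[OF F M(1)]
  have [measurable]: "(\<lambda>x. complex_of_real (norm (F (fst x) (snd x)))) \<in> borel_measurable (borel \<Otimes>\<^sub>M borel)"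
    using F by measurable
  have "integrable \<mu> (\<lambda>\<xi>. tf (nm (F \<xi>)) (nm (F \<xi>)))"
  proof (rule Bochner_Integration.integrable_bound)
    show "integrable \<mu> (\<lambda>\<xi>. time_bound H * M\<^sup>2 * m \<xi> powr (2 * H))" using i by simp
    show "(\<lambda>\<xi>. tf (nm (F \<xi>)) (nm (F \<xi>))) \<in> borel_measurable \<mu>"
      by (rule time_form_profile_measurable) measurable
    show "AE \<xi> in \<mu>. norm (tf (nm (F \<xi>)) (nm (F \<xi>))) \<le> norm (time_bound H * M\<^sup>2 * m \<xi> powr (2 * H))"
    proof (rule AE_I2)
      fix \<xi>
      have "tf (nm (F \<xi>)) (nm (F \<xi>)) \<le> time_bound H * M\<^sup>2 * m \<xi> powr (2 * H)"
        by (rule time_form_norm_bound[OF H b M m])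
      moreover have "0 \<le> tf (nm (F \<xi>)) (nm (F \<xi>))" by (rule time_form_nonneg[OF H bounded_borel_norm[OF b]])
      ultimately show "norm (tf (nm (F \<xi>)) (nm (F \<xi>))) \<le> norm (time_bound H * M\<^sup>2 * m \<xi> powr (2 * H))" by simp
    qed
  qed
  then show ?thesis using F M(1) by (auto simp: profiles_def)
qed

lemma profiles_measurable: "F \<in> profiles \<Longrightarrow> (\<lambda>x. F (fst x) (snd x)) \<in> borel_measurable (borel \<Otimes>\<^sub>M borel)"
  by (simp add: profiles_def)

lemma time_form_norm_mono:
  assumes "bounded_borel f" "bounded_borel g" "\<And>u. norm (f u) \<le> norm (g u)"
  shows "tf (nm f) (nm f) \<le> tf (nm g) (nm g)"
proof -
  have "ennreal (tf (nm f) (nm f)) \<le> ennreal (tf (nm g) (nm g))"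
    unfolding time_form_norm_eq_nn_integral[OF H assms(1,1)] time_form_norm_eq_nn_integral[OF H assms(2,2)]
    by (intro nn_integral_mono ennreal_leI mult_left_mono mult_mono assms(3)) auto
  then show ?thesis using time_form_nonneg[OF H bounded_borel_norm[OF assms(2)]] by (simp add: ennreal_le_iff)
qed

text \<open>Positivity of the form at the difference of the two moduli bounds twice the mixed term
  by the sum of the squares.\<close>

lemma time_form_cross_le:
  assumes f: "bounded_borel f" and g: "bounded_borel g"
  shows "\<bar>tf f g\<bar> \<le> tf (nm f) (nm f) + tf (nm g) (nm g)"
    and "tf (nm f) (nm g) \<le> tf (nm f) (nm f) + tf (nm g) (nm g)"
proof -
  note b = bounded_borel_norm[OF f] bounded_borel_norm[OF g]
  have "0 \<le> tf (nm f) (nm f) - 2 * tf (nm f) (nm g) + tf (nm g) (nm g)"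
    unfolding time_form_diff_square[OF H b, symmetric] by (rule time_form_nonneg[OF H bounded_borel_diff[OF b]])
  moreover have "0 \<le> tf (nm f) (nm g)"
    using abs_time_form_le[OF H f g, of T] by linarith
  ultimately show "tf (nm f) (nm g) \<le> tf (nm f) (nm f) + tf (nm g) (nm g)" by linarith
  then show "\<bar>tf f g\<bar> \<le> tf (nm f) (nm f) + tf (nm g) (nm g)"
    using abs_time_form_le[OF H f g, of T] by linarith
qed

lemma integrable_profile_form:
  assumes F: "F \<in> profiles" and G: "G \<in> profiles"
  shows "integrable \<mu> (\<lambda>\<xi>. tf (F \<xi>) (G \<xi>))" "integrable \<mu> (\<lambda>\<xi>. tf (nm (F \<xi>)) (nm (G \<xi>)))"
proof -
  note b = profiles_bounded_borel[OF F] profiles_bounded_borel[OF G]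
  note [measurable] = profiles_measurable[OF F] profiles_measurable[OF G]
  have i: "integrable \<mu> (\<lambda>\<xi>. tf (nm (F \<xi>)) (nm (F \<xi>)) + tf (nm (G \<xi>)) (nm (G \<xi>)))"
    using F G by (simp add: profiles_def)
  show "integrable \<mu> (\<lambda>\<xi>. tf (F \<xi>) (G \<xi>))"
    by (rule Bochner_Integration.integrable_bound[OF i time_form_profile_measurable])
       (use time_form_cross_le(1)[OF b] in \<open>measurable, auto intro!: AE_I2 intro: order_trans[OF _ abs_ge_self]\<close>)
  have n: "0 \<le> tf (nm (F \<xi>)) (nm (G \<xi>))" for \<xi>
    using abs_time_form_le[OF H b, of T] abs_ge_zero order_trans by blast
  show "integrable \<mu> (\<lambda>\<xi>. tf (nm (F \<xi>)) (nm (G \<xi>)))"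
    by (rule Bochner_Integration.integrable_bound[OF i time_form_profile_measurable])
       (use time_form_cross_le(2)[OF b] n in \<open>measurable, auto intro!: AE_I2 intro: order_trans[OF _ abs_ge_self]\<close>)
qed

lemma profiles_add:
  assumes F: "F \<in> profiles" and G: "G \<in> profiles"
  shows "(\<lambda>\<xi> u. F \<xi> u + G \<xi> u) \<in> profiles"
proof -
  note b = profiles_bounded_borel[OF F] profiles_bounded_borel[OF G]
  note [measurable] = profiles_measurable[OF F] profiles_measurable[OF G]
  note ba = bounded_borel_add[OF b]
  obtain M N where M: "\<And>\<xi> u. norm (F \<xi> u) \<le> M" and N: "\<And>\<xi> u. norm (G \<xi> u) \<le> N"
    using F G by (auto simp: profiles_def)
  have i: "integrable \<mu> (\<lambda>\<xi>. 2 * tf (nm (F \<xi>)) (nm (F \<xi>)) + 2 * tf (nm (G \<xi>)) (nm (G \<xi>)))"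
    using F G by (simp add: profiles_def)
  have le: "tf (nm (\<lambda>u. F \<xi> u + G \<xi> u)) (nm (\<lambda>u. F \<xi> u + G \<xi> u)) \<le> 2 * tf (nm (F \<xi>)) (nm (F \<xi>)) + 2 * tf (nm (G \<xi>)) (nm (G \<xi>))" for \<xi>
  proof -
    \<comment> \<open>The form of the moduli is monotone, so the modulus of the sum is replaced by
      the sum of the moduli; only then does the parallelogram bound apply.\<close>
    let ?s = "\<lambda>u. complex_of_real (norm (F \<xi> u)) + complex_of_real (norm (G \<xi> u))"
    have bs: "bounded_borel ?s" by (intro bounded_borel_add bounded_borel_norm b)
    have s: "nm ?s = ?s" by (rule ext) (simp add: of_real_add[symmetric] del: of_real_add)
    have "tf (nm (\<lambda>u. F \<xi> u + G \<xi> u)) (nm (\<lambda>u. F \<xi> u + G \<xi> u)) \<le> tf (nm ?s) (nm ?s)"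
      by (rule time_form_norm_mono[OF ba bs])
         (simp add: of_real_add[symmetric] norm_triangle_ineq del: of_real_add)
    also have "\<dots> \<le> 2 * tf (nm (F \<xi>)) (nm (F \<xi>)) + 2 * tf (nm (G \<xi>)) (nm (G \<xi>))"
      unfolding s by (intro time_form_add_square_le H bounded_borel_norm b)
    finally show ?thesis .
  qed
  have "integrable \<mu> (\<lambda>\<xi>. tf (nm (\<lambda>u. F \<xi> u + G \<xi> u)) (nm (\<lambda>u. F \<xi> u + G \<xi> u)))"
  proof (rule Bochner_Integration.integrable_bound[OF i])
    show "(\<lambda>\<xi>. tf (nm (\<lambda>u. F \<xi> u + G \<xi> u)) (nm (\<lambda>u. F \<xi> u + G \<xi> u))) \<in> borel_measurable \<mu>"
      by (rule time_form_profile_measurable) measurable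
    show "AE \<xi> in \<mu>. norm (tf (nm (\<lambda>u. F \<xi> u + G \<xi> u)) (nm (\<lambda>u. F \<xi> u + G \<xi> u))) \<le>
       norm (2 * tf (nm (F \<xi>)) (nm (F \<xi>)) + 2 * tf (nm (G \<xi>)) (nm (G \<xi>)))"
      using le time_form_nonneg[OF H bounded_borel_norm[OF ba], of T] by (intro AE_I2) (simp add: order_trans[OF _ abs_ge_self])
  qed
  moreover have "norm (F \<xi> u + G \<xi> u) \<le> M + N" for \<xi> u using M N by (meson add_mono norm_triangle_le)
  ultimately show ?thesis unfolding profiles_def by (auto intro!: exI[of _ "M + N"])
qed

lemma profiles_uminus: "F \<in> profiles \<Longrightarrow> (\<lambda>\<xi> u. - F \<xi> u) \<in> profiles"
  unfolding profiles_def by auto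

lemma profiles_diff: "F \<in> profiles \<Longrightarrow> G \<in> profiles \<Longrightarrow> (\<lambda>\<xi> u. F \<xi> u - G \<xi> u) \<in> profiles"
  using profiles_add[OF _ profiles_uminus, of F G] by simp

lemma profile_form_nonneg: "F \<in> profiles \<Longrightarrow> 0 \<le> profile_form F F"
  unfolding profile_form_def by (intro Bochner_Integration.integral_nonneg time_form_nonneg H profiles_bounded_borel)

lemma profile_form_commute: "F \<in> profiles \<Longrightarrow> G \<in> profiles \<Longrightarrow> profile_form F G = profile_form G F"
  unfolding profile_form_def using time_form_commute[OF H] profiles_bounded_borel by metis

lemma profile_form_diff_left:
  assumes "F \<in> profiles" "F' \<in> profiles" "G \<in> profiles"
  shows "profile_form (\<lambda>\<xi> u. F \<xi> u - F' \<xi> u) G = profile_form F G - profile_form F' G"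
  unfolding profile_form_def
  using assms by (simp add: time_form_diff_left[OF H] profiles_bounded_borel integrable_profile_form)

lemma profile_form_diff_square:
  assumes "F \<in> profiles" "G \<in> profiles"
  shows "profile_form (\<lambda>\<xi> u. F \<xi> u - G \<xi> u) (\<lambda>\<xi> u. F \<xi> u - G \<xi> u) =
    profile_form F F - 2 * profile_form F G + profile_form G G"
  unfolding profile_form_def
  using assms by (simp add: time_form_diff_square[OF H] profiles_bounded_borel integrable_profile_form)

lemma profile_form_add_square_le:
  assumes "F \<in> profiles" "G \<in> profiles"
  shows "profile_form (\<lambda>\<xi> u. F \<xi> u + G \<xi> u) (\<lambda>\<xi> u. F \<xi> u + G \<xi> u) \<le>
    2 * profile_form F F + 2 * profile_form G G"
proof -
  have "profile_form (\<lambda>\<xi> u. F \<xi> u + G \<xi> u) (\<lambda>\<xi> u. F \<xi> u + G \<xi> u) \<le>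
     (\<integral>\<xi>. 2 * tf (F \<xi>) (F \<xi>) + 2 * tf (G \<xi>) (G \<xi>) \<partial>\<mu>)"
    unfolding profile_form_def
    using assms by (intro integral_mono time_form_add_square_le[OF H] profiles_bounded_borel
      integrable_profile_form(1) profiles_add) (auto intro!: integrable_profile_form(1))
  also have "\<dots> = 2 * profile_form F F + 2 * profile_form G G"
    unfolding profile_form_def using assms by (simp add: integrable_profile_form)
  finally show ?thesis .
qed

lemma nn_integral_profile:
  assumes F: "F \<in> profiles" and G: "G \<in> profiles"
  shows "(\<integral>\<^sup>+z. (\<integral>\<^sup>+\<xi>. ennreal (time_kernel T H z * (norm (F \<xi> (fst z)) * norm (G \<xi> (snd z)))) \<partial>\<mu>) \<partial>lborel2)
    = ennreal (\<integral>\<xi>. tf (nm (F \<xi>)) (nm (G \<xi>)) \<partial>\<mu>)"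
proof -
  note b = profiles_bounded_borel[OF F] profiles_bounded_borel[OF G]
  have [measurable]: "(\<lambda>x. F (snd x) (fst (fst x))) \<in> borel_measurable (lborel2 \<Otimes>\<^sub>M \<mu>)"
    by (rule measurable_compose[of "\<lambda>x. (snd x, fst (fst x))" _ "borel \<Otimes>\<^sub>M borel" "\<lambda>x. F (fst x) (snd x)", simplified])
       (use profiles_measurable[OF F] in measurable)
  have [measurable]: "(\<lambda>x. G (snd x) (snd (fst x))) \<in> borel_measurable (lborel2 \<Otimes>\<^sub>M \<mu>)"
    by (rule measurable_compose[of "\<lambda>x. (snd x, snd (fst x))" _ "borel \<Otimes>\<^sub>M borel" "\<lambda>x. G (fst x) (snd x)", simplified])
       (use profiles_measurable[OF G] in measurable)
  have n: "0 \<le> tf (nm (F \<xi>)) (nm (G \<xi>))" for \<xi>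
    using abs_time_form_le[OF H b, of T] abs_ge_zero order_trans by blast
  have "(\<integral>\<^sup>+z. (\<integral>\<^sup>+\<xi>. ennreal (time_kernel T H z * (norm (F \<xi> (fst z)) * norm (G \<xi> (snd z)))) \<partial>\<mu>) \<partial>lborel2)
    = (\<integral>\<^sup>+\<xi>. (\<integral>\<^sup>+z. ennreal (time_kernel T H z * (norm (F \<xi> (fst z)) * norm (G \<xi> (snd z)))) \<partial>lborel2) \<partial>\<mu>)"
    by (rule pair_\<mu>.Fubini'[symmetric]) measurable
  also have "\<dots> = (\<integral>\<^sup>+\<xi>. ennreal (tf (nm (F \<xi>)) (nm (G \<xi>))) \<partial>\<mu>)"
    by (simp only: time_form_norm_eq_nn_integral[OF H b])
  also have "\<dots> = ennreal (\<integral>\<xi>. tf (nm (F \<xi>)) (nm (G \<xi>)) \<partial>\<mu>)"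
    using n by (intro nn_integral_eq_integral integrable_profile_form F G) auto
  finally show ?thesis .
qed

text \<open>\<open>hp_inner\<close> has the frequency integral innermost,
  \<open>profile_form\<close> has it outermost. Absolute convergence from
  \<open>nn_integral_profile\<close> permits the exchange, with complex values kept until the real
  part is taken at the end.\<close>

lemma profile_form_Fubini:
  assumes F: "F \<in> profiles" and G: "G \<in> profiles"
  shows "integrable (lborel2 \<Otimes>\<^sub>M \<mu>) (\<lambda>x. time_kernel T H (fst x) *\<^sub>R (F (snd x) (fst (fst x)) * cnj (G (snd x) (snd (fst x)))))" (is ?I)
    and "profile_form F G = (\<integral>z. time_kernel T H z * Re (\<integral>\<xi>. F \<xi> (fst z) * cnj (G \<xi> (snd z)) \<partial>\<mu>) \<partial>lborel2)"
    and "integrable lborel2 (\<lambda>z. time_kernel T H z * Re (\<integral>\<xi>. F \<xi> (fst z) * cnj (G \<xi> (snd z)) \<partial>\<mu>))"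
proof -
  have [measurable]: "(\<lambda>x. F (snd x) (fst (fst x))) \<in> borel_measurable (lborel2 \<Otimes>\<^sub>M \<mu>)"
    by (rule measurable_compose[of "\<lambda>x. (snd x, fst (fst x))" _ "borel \<Otimes>\<^sub>M borel" "\<lambda>x. F (fst x) (snd x)", simplified])
       (use profiles_measurable[OF F] in measurable)
  have [measurable]: "(\<lambda>x. G (snd x) (snd (fst x))) \<in> borel_measurable (lborel2 \<Otimes>\<^sub>M \<mu>)"
    by (rule measurable_compose[of "\<lambda>x. (snd x, snd (fst x))" _ "borel \<Otimes>\<^sub>M borel" "\<lambda>x. G (fst x) (snd x)", simplified])
       (use profiles_measurable[OF G] in measurable)
  let ?K = "\<lambda>z \<xi>. time_kernel T H z *\<^sub>R (F \<xi> (fst z) * cnj (G \<xi> (snd z)))"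
  show I: ?I
  proof (rule integrableI_bounded)
    have "(\<integral>\<^sup>+x. norm (?K (fst x) (snd x)) \<partial>(lborel2 \<Otimes>\<^sub>M \<mu>)) = (\<integral>\<^sup>+z. \<integral>\<^sup>+\<xi>. norm (?K z \<xi>) \<partial>\<mu> \<partial>lborel2)"
      by (subst \<mu>.nn_integral_fst[symmetric]) simp_all
    also have "\<dots> = ennreal (\<integral>\<xi>. tf (nm (F \<xi>)) (nm (G \<xi>)) \<partial>\<mu>)"
      unfolding nn_integral_profile[OF F G, symmetric] by (simp add: norm_mult)
    finally show "(\<integral>\<^sup>+x. norm (?K (fst x) (snd x)) \<partial>(lborel2 \<Otimes>\<^sub>M \<mu>)) < \<infinity>" by simp
  qed measurable
  have I': "integrable (lborel2 \<Otimes>\<^sub>M \<mu>) (\<lambda>(z, \<xi>). ?K z \<xi>)" using I by (simp add: case_prod_unfold)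
  have z: "Re (\<integral>\<xi>. ?K z \<xi> \<partial>\<mu>) = time_kernel T H z * Re (\<integral>\<xi>. F \<xi> (fst z) * cnj (G \<xi> (snd z)) \<partial>\<mu>)" for z
    by (subst integral_scaleR_right) (simp add: scaleR_conv_of_real)
  have x: "Re (\<integral>z. ?K z \<xi> \<partial>lborel2) = tf (F \<xi>) (G \<xi>)" if "integrable lborel2 (\<lambda>z. ?K z \<xi>)" for \<xi>
    unfolding integral_Re[OF that, symmetric] time_form_def by (simp add: scaleR_conv_of_real)
  have "profile_form F G = (\<integral>\<xi>. Re (\<integral>z. ?K z \<xi> \<partial>lborel2) \<partial>\<mu>)"
    unfolding profile_form_def
  proof (rule integral_cong_AE)
    show "(\<lambda>\<xi>. tf (F \<xi>) (G \<xi>)) \<in> borel_measurable \<mu>"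
      by (intro time_form_profile_measurable profiles_measurable F G)
    show "(\<lambda>\<xi>. Re (\<integral>z. ?K z \<xi> \<partial>lborel2)) \<in> borel_measurable \<mu>"
      using borel_measurable_integrable[OF pair_\<mu>.integrable_snd[OF I']] by measurable
    show "AE \<xi> in \<mu>. tf (F \<xi>) (G \<xi>) = Re (\<integral>z. ?K z \<xi> \<partial>lborel2)"
      using pair_\<mu>.AE_integrable_snd[OF I'] by eventually_elim (rule x[symmetric])
  qed
  also have "\<dots> = Re (\<integral>\<xi>. (\<integral>z. ?K z \<xi> \<partial>lborel2) \<partial>\<mu>)"
    by (rule integral_Re[OF pair_\<mu>.integrable_snd[OF I']])
  also have "\<dots> = Re (\<integral>z. (\<integral>\<xi>. ?K z \<xi> \<partial>\<mu>) \<partial>lborel2)"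
    using pair_\<mu>.integral_fst[OF I'] pair_\<mu>.integral_snd[OF I'] by simp
  also have "\<dots> = (\<integral>z. Re (\<integral>\<xi>. ?K z \<xi> \<partial>\<mu>) \<partial>lborel2)"
    by (rule integral_Re[OF pair_\<mu>.integrable_fst[OF I'], symmetric])
  finally show "profile_form F G = (\<integral>z. time_kernel T H z * Re (\<integral>\<xi>. F \<xi> (fst z) * cnj (G \<xi> (snd z)) \<partial>\<mu>) \<partial>lborel2)"
    by (simp only: z)
  show "integrable lborel2 (\<lambda>z. time_kernel T H z * Re (\<integral>\<xi>. F \<xi> (fst z) * cnj (G \<xi> (snd z)) \<partial>\<mu>))"
    using integrable_Re[OF pair_\<mu>.integrable_fst[OF I']] by (simp only: z)
qed

text \<open>Slices are integrable at every time of the open interval, which makes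
  \<open>profile\<close> additive at every point and not merely almost everywhere; the calculus of
  \<open>hp_inner\<close> on differences rests on this.\<close>

definition regular :: "(real \<times> 'a \<Rightarrow> real) set" where
  "regular = {\<phi>. set_borel_measurable borel ({0<..<T} \<times> UNIV) \<phi> \<and>
     (\<forall>u\<in>{0<..<T}. integrable lborel (\<lambda>x. \<phi> (u, x))) \<and> profile T \<phi> \<in> profiles}"

abbreviation "hp \<equiv> hp_inner T H c \<mu>"


text \<open>The form integrates \<open>space_fourier\<close> over the closed interval while
  \<open>profile\<close> vanishes at 0 and \<open>T\<close>. The two endpoints are removed as a null
  set in each time variable.\<close>

lemma hp_inner_eq_profile_form:
  assumes "\<phi> \<in> regular" "\<psi> \<in> regular"
  shows "hp \<phi> \<psi> = H * (2 * H - 1) * c * profile_form (profile T \<phi>) (profile T \<psi>)"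
proof -
  let ?F = "profile T \<phi>" and ?G = "profile T \<psi>"
  have FG: "?F \<in> profiles" "?G \<in> profiles" using assms by (auto simp: regular_def)
  let ?R = "\<lambda>u v. Re (\<integral>\<xi>. ?F \<xi> u * cnj (?G \<xi> v) \<partial>\<mu>)"
  let ?S = "\<lambda>u v. Re (\<integral>\<xi>. space_fourier \<phi> u \<xi> * cnj (space_fourier \<psi> v \<xi>) \<partial>\<mu>)"
  have i: "integrable lborel2 (\<lambda>(u, v). time_kernel T H (u, v) * ?R u v)"
    using profile_form_Fubini(3)[OF FG] by (simp add: case_prod_unfold)
  have ind: "indicator {0..T} u = in_window 0 T u" for u by (auto simp: indicator_def in_window_def)
  have inner: "in_window 0 T u *\<^sub>R (\<integral>v. in_window 0 T v *\<^sub>R (\<bar>u - v\<bar> powr (2 * H - 2) * (c * ?S u v)) \<partial>lborel)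
      = c * (\<integral>v. time_kernel T H (u, v) * ?R u v \<partial>lborel)" (is "?l = ?r")
    if u: "u \<noteq> 0" "u \<noteq> T" for u
  proof (cases "in_window 0 T u = 0")
    case True then show ?thesis by (simp add: time_kernel_def)
  next
    case False
    then have u': "0 < u" "u < T" "in_window 0 T u = 1" using u by (auto simp: in_window_def split: if_splits)
    have eq: "in_window 0 T v *\<^sub>R (\<bar>u - v\<bar> powr (2 * H - 2) * (c * ?S u v)) = c * (time_kernel T H (u, v) * ?R u v)"
      if v: "v \<noteq> 0" "v \<noteq> T" for v
    proof (cases "0 < v \<and> v < T")
      case True
      then have "in_window 0 T v = 1" by (simp add: in_window_def)
      then show ?thesis using True u' by (simp add: time_kernel_def profile_def)
    next
      case False
      then have "in_window 0 T v = 0" using v by (auto simp: in_window_def)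
      then show ?thesis by (simp add: time_kernel_def)
    qed
    have "?l = (\<integral>v. in_window 0 T v *\<^sub>R (\<bar>u - v\<bar> powr (2 * H - 2) * (c * ?S u v)) \<partial>lborel)" using u' by simp
    also have "\<dots> = (\<integral>v. c * (time_kernel T H (u, v) * ?R u v) \<partial>lborel)"
      by (rule integral_discrete_difference[of "{0, T}"]) (use eq in auto)
    finally show ?thesis by simp
  qed
  have "hp \<phi> \<psi> = H * (2 * H - 1) * (\<integral>u. in_window 0 T u *\<^sub>R (\<integral>v. in_window 0 T v *\<^sub>R (\<bar>u - v\<bar> powr (2 * H - 2) * (c * ?S u v)) \<partial>lborel) \<partial>lborel)"
    unfolding hp_inner_def set_lebesgue_integral_def ind ..
  also have "\<dots> = H * (2 * H - 1) * (\<integral>u. c * (\<integral>v. time_kernel T H (u, v) * ?R u v \<partial>lborel) \<partial>lborel)"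
    by (intro arg_cong[where f="(*) (H * (2 * H - 1))"] integral_discrete_difference[of "{0, T}"]) (use inner in auto)
  also have "\<dots> = H * (2 * H - 1) * c * profile_form ?F ?G"
    unfolding profile_form_Fubini(2)[OF FG] using lborel_pair.integral_fst[OF i]
    by (simp add: case_prod_unfold)
  finally show ?thesis .
qed

text \<open>Since \<phi> is measurable only on the strip, it is replaced by its extension by zero,
  which has the same profile; the rest is measurability of a parameter integral.\<close>

lemma space_fourier_measurable:
  assumes m: "set_borel_measurable borel ({0<..<T} \<times> UNIV) \<phi>"
  shows "(\<lambda>x. profile T \<phi> (fst x) (snd x)) \<in> borel_measurable (borel \<Otimes>\<^sub>M borel)"
proof -
  define \<phi>' where "\<phi>' z = indicator ({0<..<T} \<times> UNIV) z *\<^sub>R \<phi> z" for z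
  have "\<phi>' \<in> borel_measurable borel" using m unfolding set_borel_measurable_def \<phi>'_def .
  then have [measurable]: "\<phi>' \<in> borel_measurable (borel \<Otimes>\<^sub>M borel)" by (simp add: borel_prod)
  have "profile T \<phi> \<xi> u = (\<integral>x. exp (- (\<i> * complex_of_real (\<xi> \<bullet> x))) * complex_of_real (\<phi>' (u, x)) \<partial>lborel)" for \<xi> u
    by (auto simp: profile_def space_fourier_def fourier_def \<phi>'_def intro!: Bochner_Integration.integral_cong)
  then show ?thesis by simp
qed

lemma norm_profile_le:
  "norm (profile T \<phi> \<xi> u) \<le> (if 0 < u \<and> u < T then \<integral>x. \<bar>\<phi> (u, x)\<bar> \<partial>lborel else 0)"
  using norm_fourier_le[of "\<lambda>x. complex_of_real (\<phi> (u, x))" \<xi>] by (simp add: profile_def space_fourier_def)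

lemma nn_integral_window_const:
  assumes "0 \<le> r" shows "(\<integral>\<^sup>+u. ennreal (in_window 0 T u * r) \<partial>lborel) = ennreal (T * r)"
proof -
  have "(\<integral>\<^sup>+u. ennreal (in_window 0 T u * r) \<partial>lborel) = (\<integral>\<^sup>+u. ennreal r * indicator {0..T} u \<partial>lborel)"
    by (intro nn_integral_cong) (auto simp: in_window_def indicator_def)
  then show ?thesis using T assms by (simp add: nn_integral_cmult ennreal_mult[symmetric] mult.commute)
qed

lemma test_function_bounded_support:
  assumes "\<phi> \<in> test_functions T"
  obtains R where "\<And>z. norm z > R \<Longrightarrow> \<phi> z = 0"
proof -
  have "bounded (closure {z. \<phi> z \<noteq> 0})" using assms by (intro compact_imp_bounded) (simp add: test_functions_def)
  then have "bounded {z. \<phi> z \<noteq> 0}" using bounded_subset closure_subset by blast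
  then obtain R where R: "\<And>z. z \<in> {z. \<phi> z \<noteq> 0} \<Longrightarrow> norm z \<le> R" unfolding bounded_iff by blast
  show ?thesis by (rule that[of R]) (use R in force)
qed

lemma test_function_regular:
  assumes \<phi>: "\<phi> \<in> test_functions T" shows "\<phi> \<in> regular"
proof -
  have s: "smooth \<phi>" using \<phi> by (simp add: test_functions_def)
  obtain R where R: "\<And>z. norm z > R \<Longrightarrow> \<phi> z = 0" using test_function_bounded_support[OF \<phi>] by blast
  have [measurable]: "\<phi> \<in> borel_measurable borel" by (rule smooth_imp_borel[OF s])
  have m: "set_borel_measurable borel ({0<..<T} \<times> UNIV) \<phi>"
  proof -
    have "open ({0<..<T} \<times> (UNIV :: 'a set))" by (intro open_Times) auto
    then have [measurable]: "{0<..<T} \<times> (UNIV :: 'a set) \<in> sets borel" by (rule borel_open)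
    show ?thesis unfolding set_borel_measurable_def by measurable
  qed
  have i: "integrable lborel (\<lambda>x. \<phi> (u, x))" for u
  proof (rule integrable_compact_support[of _ R])
    show "continuous_on UNIV (\<lambda>x. \<phi> (u, x))"
      by (rule continuous_on_compose2[OF smooth_imp_continuous_on[OF s]]) (auto intro!: continuous_intros)
    show "\<phi> (u, x) = 0" if "norm x > R" for x
    proof -
      have "norm x \<le> norm (u, x)" by (simp add: norm_Pair real_le_rsqrt)
      then show ?thesis using R that by auto
    qed
  qed
  obtain k where k: "integrable \<mu> (\<lambda>\<xi>. 1 / (1 + (norm \<xi>)\<^sup>2) ^ k)" by (rule tempered_integrable)
  obtain C where C: "C \<ge> 0" "\<And>u \<xi>. norm (space_fourier \<phi> u \<xi>) * (1 + (norm \<xi>)\<^sup>2) ^ k \<le> C"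
  proof -
    have "\<exists>C\<ge>0. \<forall>u \<xi>. norm (space_fourier \<phi> u \<xi>) * (1 + (norm \<xi>)\<^sup>2) ^ k \<le> C"
      using s R by (rule smooth_space_fourier_decay)
    then show ?thesis using that by auto
  qed
  \<comment> \<open>The exponent \<open>k\<close> is the one for which this weight is
    \<mu>-integrable; the transform of \<phi> decays at the same rate. Below, \<open>C + 1\<close>
    serves as a bound that is strictly positive.\<close>
  define D where "D \<xi> = 1 / (1 + (norm \<xi>)\<^sup>2) ^ k" for \<xi> :: 'a
  have D: "0 \<le> D \<xi>" "D \<xi> \<le> 1" for \<xi>
    by (auto simp: D_def divide_le_eq add_pos_nonneg one_le_power not_less)
  have F: "norm (profile T \<phi> \<xi> u) \<le> (C + 1) * D \<xi>" for \<xi> u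
  proof -
    have "norm (space_fourier \<phi> u \<xi>) \<le> C * D \<xi>"
      using C(2)[of u \<xi>] by (simp add: D_def pos_le_divide_eq add_pos_nonneg)
    also have "\<dots> \<le> (C + 1) * D \<xi>" using D(1)[of \<xi>] by (intro mult_right_mono) auto
    finally show ?thesis using C(1) D(1)[of \<xi>] by (simp add: profile_def)
  qed
  have "profile T \<phi> \<in> profiles"
  proof (rule profilesI[where M="C + 1" and m="\<lambda>\<xi>. T * D \<xi>"])
    show "norm (profile T \<phi> \<xi> u) \<le> C + 1" for \<xi> u
      using order_trans[OF F[of \<xi> u] mult_left_mono[OF D(2)[of \<xi>], of "C + 1"]] C(1) by simp
    show "(\<integral>\<^sup>+u. ennreal (in_window 0 T u * norm (profile T \<phi> \<xi> u)) \<partial>lborel) \<le> ennreal ((C + 1) * (T * D \<xi>))" for \<xi>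
    proof -
      have "(\<integral>\<^sup>+u. ennreal (in_window 0 T u * norm (profile T \<phi> \<xi> u)) \<partial>lborel) \<le> (\<integral>\<^sup>+u. ennreal (in_window 0 T u * ((C + 1) * D \<xi>)) \<partial>lborel)"
        by (intro nn_integral_mono ennreal_leI mult_left_mono F) simp
      also have "\<dots> = ennreal (T * ((C + 1) * D \<xi>))" using C(1) D(1) by (intro nn_integral_window_const) simp
      also have "T * ((C + 1) * D \<xi>) = (C + 1) * (T * D \<xi>)" by simp
      finally show ?thesis .
    qed
    show "integrable \<mu> (\<lambda>\<xi>. (T * D \<xi>) powr (2 * H))"
    proof (rule Bochner_Integration.integrable_bound)
      show "integrable \<mu> (\<lambda>\<xi>. T powr (2 * H) * D \<xi>)" unfolding D_def by (rule integrable_mult_right[OF k])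
      show "AE \<xi> in \<mu>. norm ((T * D \<xi>) powr (2 * H)) \<le> norm (T powr (2 * H) * D \<xi>)"
      proof (rule AE_I2)
        fix \<xi>
        \<comment> \<open>Since \<open>D\<close> is at most 1 and \<open>2 * H\<close> exceeds 1,
          the power is dominated by the integrable weight itself.\<close>
        have "D \<xi> powr (2 * H) \<le> D \<xi> powr 1"
          using D[of \<xi>] H by (intro powr_mono') auto
        then show "norm ((T * D \<xi>) powr (2 * H)) \<le> norm (T powr (2 * H) * D \<xi>)"
          using T D(1)[of \<xi>] by (simp add: powr_mult mult_left_mono)
      qed
    qed (auto simp: D_def)
  qed (use C(1) T D(1) space_fourier_measurable[OF m] in auto)
  then show ?thesis using m i by (simp add: regular_def)
qed

lemma profile_diff:
  assumes "\<phi> \<in> regular" "\<psi> \<in> regular"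
  shows "profile T (\<lambda>z. \<phi> z - \<psi> z) = (\<lambda>\<xi> u. profile T \<phi> \<xi> u - profile T \<psi> \<xi> u)"
proof (intro ext)
  fix \<xi> u
  show "profile T (\<lambda>z. \<phi> z - \<psi> z) \<xi> u = profile T \<phi> \<xi> u - profile T \<psi> \<xi> u"
  proof (cases "0 < u \<and> u < T")
    case True
    then have i: "integrable lborel (\<lambda>x. exp (- (\<i> * complex_of_real (\<xi> \<bullet> x))) * complex_of_real (\<phi> (u, x)))"
        "integrable lborel (\<lambda>x. exp (- (\<i> * complex_of_real (\<xi> \<bullet> x))) * complex_of_real (\<psi> (u, x)))"
      using assms by (auto simp: regular_def intro!: integrable_fourier_kernel integrable_of_real)
    show ?thesis using True
      by (simp add: profile_def space_fourier_def fourier_def Bochner_Integration.integral_diff[OF i, symmetric] right_diff_distrib)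
  next
    case False
    show ?thesis by (simp only: profile_def False if_False diff_self)
  qed
qed

lemma regular_diff:
  assumes "\<phi> \<in> regular" "\<psi> \<in> regular" shows "(\<lambda>z. \<phi> z - \<psi> z) \<in> regular"
proof -
  have "set_borel_measurable borel ({0<..<T} \<times> UNIV) (\<lambda>z. \<phi> z - \<psi> z)"
    using assms borel_measurable_diff unfolding regular_def set_borel_measurable_def scaleR_diff_right by blast
  then show ?thesis using assms by (auto simp: regular_def profile_diff[OF assms] intro!: profiles_diff)
qed

abbreviation "hp_const \<equiv> H * (2 * H - 1) * c"

lemma hp_const_pos: "hp_const > 0" using H c by simp

lemma hp_inner_nonneg: "\<phi> \<in> regular \<Longrightarrow> 0 \<le> hp \<phi> \<phi>"
  using hp_const_pos profile_form_nonneg by (simp add: hp_inner_eq_profile_form regular_def mult_nonneg_nonneg)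

lemma hp_inner_commute: "\<phi> \<in> regular \<Longrightarrow> \<psi> \<in> regular \<Longrightarrow> hp \<phi> \<psi> = hp \<psi> \<phi>"
  using profile_form_commute by (simp add: hp_inner_eq_profile_form regular_def)

lemma hp_inner_diff_left:
  "\<phi> \<in> regular \<Longrightarrow> \<phi>' \<in> regular \<Longrightarrow> \<psi> \<in> regular \<Longrightarrow> hp (\<lambda>z. \<phi> z - \<phi>' z) \<psi> = hp \<phi> \<psi> - hp \<phi>' \<psi>"
  by (simp add: hp_inner_eq_profile_form regular_diff profile_diff) (simp add: regular_def profile_form_diff_left right_diff_distrib)

lemma hp_inner_diff_square:
  "\<phi> \<in> regular \<Longrightarrow> \<psi> \<in> regular \<Longrightarrow> hp (\<lambda>z. \<phi> z - \<psi> z) (\<lambda>z. \<phi> z - \<psi> z) = hp \<phi> \<phi> - 2 * hp \<phi> \<psi> + hp \<psi> \<psi>"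
  by (simp add: hp_inner_eq_profile_form regular_diff profile_diff) (simp add: regular_def profile_form_diff_square algebra_simps)

lemma hp_inner_triangle:
  assumes "\<phi> \<in> regular" "\<psi> \<in> regular" "\<theta> \<in> regular"
  shows "hp (\<lambda>z. \<phi> z - \<theta> z) (\<lambda>z. \<phi> z - \<theta> z) \<le> 2 * hp (\<lambda>z. \<phi> z - \<psi> z) (\<lambda>z. \<phi> z - \<psi> z) + 2 * hp (\<lambda>z. \<psi> z - \<theta> z) (\<lambda>z. \<psi> z - \<theta> z)"
proof -
  let ?F = "\<lambda>\<xi> u. profile T \<phi> \<xi> u - profile T \<psi> \<xi> u" and ?G = "\<lambda>\<xi> u. profile T \<psi> \<xi> u - profile T \<theta> \<xi> u"
  have "?F \<in> profiles" "?G \<in> profiles" using assms by (auto simp: regular_def intro!: profiles_diff)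
  from profile_form_add_square_le[OF this]
  have "profile_form (profile T (\<lambda>z. \<phi> z - \<theta> z)) (profile T (\<lambda>z. \<phi> z - \<theta> z)) \<le> 2 * profile_form ?F ?F + 2 * profile_form ?G ?G"
    by (simp add: profile_diff assms)
  from mult_left_mono[OF this, of hp_const] show ?thesis using hp_const_pos assms
    by (simp add: hp_inner_eq_profile_form regular_diff profile_diff algebra_simps)
qed

lemma regular_hp_function:
  assumes "\<phi> \<in> regular" shows "hp_function T H \<mu> \<phi>"
proof -
  let ?F = "profile T \<phi>"
  have F: "?F \<in> profiles" using assms by (simp add: regular_def)
  let ?N = "\<lambda>u v. (\<integral>\<^sup>+\<xi>. ennreal (norm (space_fourier \<phi> u \<xi>) * norm (space_fourier \<phi> v \<xi>)) \<partial>\<mu>)"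
  have [measurable]: "(\<lambda>x. ?F (snd x) (fst (fst x))) \<in> borel_measurable (lborel2 \<Otimes>\<^sub>M \<mu>)"
    by (rule measurable_compose[of "\<lambda>x. (snd x, fst (fst x))" _ "borel \<Otimes>\<^sub>M borel" "\<lambda>x. ?F (fst x) (snd x)", simplified])
       (use profiles_measurable[OF F] in measurable)
  have [measurable]: "(\<lambda>x. ?F (snd x) (snd (fst x))) \<in> borel_measurable (lborel2 \<Otimes>\<^sub>M \<mu>)"
    by (rule measurable_compose[of "\<lambda>x. (snd x, snd (fst x))" _ "borel \<Otimes>\<^sub>M borel" "\<lambda>x. ?F (fst x) (snd x)", simplified])
       (use profiles_measurable[OF F] in measurable)
  let ?K = "\<lambda>u v. (\<integral>\<^sup>+\<xi>. ennreal (time_kernel T H (u, v) * (norm (?F \<xi> u) * norm (?F \<xi> v))) \<partial>\<mu>)"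
  have Km: "(\<lambda>z. \<integral>\<^sup>+\<xi>. ennreal (time_kernel T H z * (norm (?F \<xi> (fst z)) * norm (?F \<xi> (snd z)))) \<partial>\<mu>) \<in> borel_measurable lborel2"
    by measurable
  have AE: "AE u in lborel. u \<noteq> 0 \<and> u \<noteq> T"
    using AE_lborel_singleton[of 0] AE_lborel_singleton[of T] by eventually_elim auto
  have Fm: "(\<lambda>\<xi>. ?F \<xi> u) \<in> borel_measurable \<mu>" for u
    using measurable_compose[of "\<lambda>\<xi>. (\<xi>, u)" \<mu> "borel \<Otimes>\<^sub>M borel" "\<lambda>x. ?F (fst x) (snd x)"] profiles_measurable[OF F] by simp
  have eq: "ennreal (\<bar>u - v\<bar> powr (2 * H - 2)) * ?N u v * indicator {0..T} v * indicator {0..T} u = ?K u v"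
    if "u \<noteq> 0 \<and> u \<noteq> T" "v \<noteq> 0 \<and> v \<noteq> T" for u v
  proof (cases "(0 < u \<and> u < T) \<and> (0 < v \<and> v < T)")
    case True
    note [measurable] = Fm[of u] Fm[of v]
    have "?K u v = (\<integral>\<^sup>+\<xi>. ennreal (\<bar>u - v\<bar> powr (2 * H - 2)) * ennreal (norm (?F \<xi> u) * norm (?F \<xi> v)) \<partial>\<mu>)"
      using True by (intro nn_integral_cong) (simp add: time_kernel_def in_window_def ennreal_mult)
    also have "\<dots> = ennreal (\<bar>u - v\<bar> powr (2 * H - 2)) * (\<integral>\<^sup>+\<xi>. ennreal (norm (?F \<xi> u) * norm (?F \<xi> v)) \<partial>\<mu>)"
      by (rule nn_integral_cmult) measurable
    also have "\<dots> = ennreal (\<bar>u - v\<bar> powr (2 * H - 2)) * ?N u v" using True by (simp add: profile_def)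
    finally show ?thesis using True by simp
  next
    case False
    then show ?thesis using that by (auto simp: indicator_def time_kernel_def in_window_def)
  qed
  have "(\<integral>\<^sup>+u\<in>{0..T}. (\<integral>\<^sup>+v\<in>{0..T}. ennreal (\<bar>u - v\<bar> powr (2 * H - 2)) * ?N u v \<partial>lborel) \<partial>lborel) =
     (\<integral>\<^sup>+u. \<integral>\<^sup>+v. ?K u v \<partial>lborel \<partial>lborel)"
  proof (rule nn_integral_cong_AE, use AE in eventually_elim)
    fix u assume u: "u \<noteq> 0 \<and> u \<noteq> T"
    have "(\<integral>\<^sup>+v. ?K u v \<partial>lborel) = (\<integral>\<^sup>+v. (ennreal (\<bar>u - v\<bar> powr (2 * H - 2)) * ?N u v * indicator {0..T} v) * indicator {0..T} u \<partial>lborel)"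
      by (rule nn_integral_cong_AE, use AE in eventually_elim) (use eq[OF u] in simp)
    also have "\<dots> = (\<integral>\<^sup>+v\<in>{0..T}. ennreal (\<bar>u - v\<bar> powr (2 * H - 2)) * ?N u v \<partial>lborel) * indicator {0..T} u"
      by (cases "u \<in> {0..T}") auto
    finally show "(\<integral>\<^sup>+v\<in>{0..T}. ennreal (\<bar>u - v\<bar> powr (2 * H - 2)) * ?N u v \<partial>lborel) * indicator {0..T} u = (\<integral>\<^sup>+v. ?K u v \<partial>lborel)" ..
  qed
  also have "\<dots> = (\<integral>\<^sup>+z. \<integral>\<^sup>+\<xi>. ennreal (time_kernel T H z * (norm (?F \<xi> (fst z)) * norm (?F \<xi> (snd z)))) \<partial>\<mu> \<partial>lborel2)"
    using lborel.nn_integral_fst[OF Km] by simp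
  also have "\<dots> < \<infinity>" unfolding nn_integral_profile[OF F F] by simp
  finally show ?thesis using assms by (auto simp: hp_function_def regular_def)
qed

end

section \<open>Density of test functions\<close>

lemma mollifier_bounded:
  assumes "mollifier e \<nu>" shows "\<exists>B\<ge>0. \<forall>x. \<bar>\<nu> x\<bar> \<le> B"
  using smooth_compact_support_bounded[of \<nu> e] assms smooth_imp_continuous_on[of \<nu>]
  by (auto simp: mollifier_def)

lemma mollifier_measurable: "mollifier e \<nu> \<Longrightarrow> \<nu> \<in> borel_measurable borel"
  by (simp add: mollifier_def smooth_imp_borel)

text \<open>Shifting the space variable by the spatial part of the convolution variable splits the
  exponential. The spatial mollifier comes out as a multiplier, and the time mollifier remains as a
  convolution in \<open>u\<close>.\<close>

lemma space_fourier_convolution: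
  fixes K :: "real \<times> 'a::euclidean_space \<Rightarrow> real"
  assumes K: "integrable lborel K" and m: "mollifier d m" and \<nu>: "mollifier e \<nu>"
  shows "space_fourier (convolution K (\<lambda>z. m (fst z) * \<nu> (snd z))) u \<xi> =
    fourier (\<lambda>x. complex_of_real (\<nu> x)) \<xi> * (\<integral>r. fourier (\<lambda>z. complex_of_real (K (r, z))) \<xi> * m (u - r) \<partial>lborel)"
proof -
  let ?e = "\<lambda>x. exp (- (\<i> * complex_of_real (\<xi> \<bullet> x)))"
  let ?N = "fourier (\<lambda>x. complex_of_real (\<nu> x)) \<xi>"
  note [measurable] = mollifier_measurable[OF m] mollifier_measurable[OF \<nu>]
  have Km[measurable]: "K \<in> borel_measurable (borel \<Otimes>\<^sub>M borel)"
    using borel_measurable_integrable[OF K] by (simp add: borel_prod)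
  have \<nu>i: "integrable lborel \<nu>" "(\<integral>x. \<nu> x \<partial>lborel) = 1" "\<nu> x \<ge> 0" for x using \<nu> by (auto simp: mollifier_def)
  obtain B where B: "B \<ge> 0" "\<And>x. \<bar>m x\<bar> \<le> B" using mollifier_bounded[OF m] by auto
  define J where "J w y = ?e y * complex_of_real (K w * (m (u - fst w) * \<nu> (y - snd w)))" for w y
  have Jm[measurable]: "(\<lambda>(w, y). J w y) \<in> borel_measurable ((borel \<Otimes>\<^sub>M borel) \<Otimes>\<^sub>M borel)"
    unfolding J_def by measurable
  have tr: "integrable lborel (\<lambda>y. \<nu> (y - a))" "(\<integral>y. \<nu> (y - a) \<partial>lborel) = 1" for a
    using lborel_integrable_translate[OF \<nu>i(1), of "- a"] lborel_integral_translate[of \<nu> "- a"] \<nu>i(2) by simp_all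
  have nJ: "norm (J w y) = (\<bar>K w\<bar> * \<bar>m (u - fst w)\<bar>) * \<nu> (y - snd w)" for w y
    using \<nu>i(3)[of "y - snd w"] by (simp add: J_def norm_mult abs_mult)
  have iK: "integrable lborel (\<lambda>w. \<bar>K w\<bar> * \<bar>m (u - fst w)\<bar>)"
  proof (rule integrable_mult_bounded[where C=B])
    show "(\<lambda>w::real \<times> 'a. \<bar>m (u - fst w)\<bar>) \<in> borel_measurable lborel"
      unfolding lborel_prod[symmetric] by measurable
  qed (use K B in auto)
  have int: "integrable (lborel \<Otimes>\<^sub>M lborel) (\<lambda>(w, y). J w y)"
  proof (rule lborel_pair.Fubini_integrable)
    show "(\<lambda>(w, y). J w y) \<in> borel_measurable (lborel \<Otimes>\<^sub>M lborel)"
      unfolding J_def lborel_prod[symmetric] by measurable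
    show "integrable lborel (\<lambda>w. \<integral>y. norm (case (w, y) of (w, y) \<Rightarrow> J w y) \<partial>lborel)"
      using iK by (simp add: nJ tr)
    have "integrable lborel (J w)" for w
    proof (rule Bochner_Integration.integrable_bound)
      show "integrable lborel (\<lambda>y. (\<bar>K w\<bar> * \<bar>m (u - fst w)\<bar>) * \<nu> (y - snd w))" using tr(1) by simp
      show "AE y in lborel. norm (J w y) \<le> norm ((\<bar>K w\<bar> * \<bar>m (u - fst w)\<bar>) * \<nu> (y - snd w))"
        unfolding nJ by simp
      show "J w \<in> borel_measurable lborel" unfolding J_def by measurable
    qed
    then show "AE w in lborel. integrable lborel (\<lambda>y. case (w, y) of (w, y) \<Rightarrow> J w y)" by simp
  qed
  have inner: "(\<integral>y. J w y \<partial>lborel) = (?e (snd w) * K w * m (u - fst w)) * ?N" for w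
  proof -
    have "(\<integral>y. J w y \<partial>lborel) = (\<integral>y. J w (snd w + y) \<partial>lborel)"
      by (rule lborel_integral_translate[symmetric]) (simp add: J_def)
    also have "\<dots> = (\<integral>y. (?e (snd w) * K w * m (u - fst w)) * (?e y * complex_of_real (\<nu> y)) \<partial>lborel)"
    proof (rule Bochner_Integration.integral_cong[OF refl])
      fix y
      have "?e (snd w + y) = ?e (snd w) * ?e y" by (simp add: exp_add[symmetric] inner_add_right algebra_simps)
      then show "J w (snd w + y) = (?e (snd w) * K w * m (u - fst w)) * (?e y * complex_of_real (\<nu> y))"
        unfolding J_def by (simp only: add_diff_cancel_left' of_real_mult mult_ac)
    qed
    finally show ?thesis by (simp add: fourier_def)
  qed
  have "space_fourier (convolution K (\<lambda>z. m (fst z) * \<nu> (snd z))) u \<xi> = (\<integral>y. \<integral>w. J w y \<partial>lborel \<partial>lborel)"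
    unfolding space_fourier_def fourier_def convolution_def J_def
    by (simp flip: integral_complex_of_real)
  also have "\<dots> = (\<integral>w. \<integral>y. J w y \<partial>lborel \<partial>lborel)"
    using lborel_pair.integral_fst[OF int] lborel_pair.integral_snd[OF int] by simp
  also have "\<dots> = ?N * (\<integral>w. ?e (snd w) * K w * m (u - fst w) \<partial>lborel)"
    unfolding inner by (simp add: mult.commute)
  also have "(\<integral>w. ?e (snd w) * K w * m (u - fst w) \<partial>lborel) = (\<integral>r. \<integral>z. ?e z * K (r, z) * m (u - r) \<partial>lborel \<partial>lborel)"
  proof -
    have "integrable lborel (\<lambda>w. ?e (snd w) * K w * m (u - fst w))"
    proof (rule Bochner_Integration.integrable_bound[OF iK])
      show "(\<lambda>w. ?e (snd w) * K w * m (u - fst w)) \<in> borel_measurable lborel"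
        unfolding lborel_prod[symmetric] by measurable
    qed (auto simp: norm_mult)
    then have "integrable (lborel \<Otimes>\<^sub>M lborel) (\<lambda>(r, z). ?e z * K (r, z) * m (u - r))"
      by (simp add: lborel_prod case_prod_unfold)
    from lborel_pair.integral_fst[OF this] show ?thesis by (simp add: lborel_prod case_prod_unfold)
  qed
  also have "\<dots> = (\<integral>r. fourier (\<lambda>z. complex_of_real (K (r, z))) \<xi> * m (u - r) \<partial>lborel)"
    by (simp add: fourier_def)
  finally show ?thesis .
qed

text \<open>The sequence is eventually constant: once the support radius is below the distance of
  \<open>r\<close> to both endpoints, the indicator does not change on the support of the
  mollifier.\<close>

lemma mollifier_window_tendsto:
  assumes m: "\<And>n. mollifier (h n) (m n)" and h: "h \<longlonglongrightarrow> 0" and ab: "r \<noteq> a" "r \<noteq> b"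
  shows "(\<lambda>n. \<integral>u. in_window a b u * m n (u - r) \<partial>lborel) \<longlonglongrightarrow> in_window a b r"
proof -
  define \<delta> where "\<delta> = min \<bar>r - a\<bar> \<bar>r - b\<bar>"
  have "\<delta> > 0" using ab by (simp add: \<delta>_def)
  then have "\<forall>\<^sub>F n in sequentially. h n < \<delta>" using h by (simp add: order_tendstoD)
  then have "\<forall>\<^sub>F n in sequentially. in_window a b r = (\<integral>u. in_window a b u * m n (u - r) \<partial>lborel)"
  proof eventually_elim
    case (elim n)
    have mi: "integrable lborel (m n)" "(\<integral>x. m n x \<partial>lborel) = 1" "\<And>x. \<bar>x\<bar> \<ge> h n \<Longrightarrow> m n x = 0"
      using m[of n] by (auto simp: mollifier_def)
    have tr: "(\<integral>u. m n (u - r) \<partial>lborel) = 1"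
      using lborel_integral_translate[OF mollifier_measurable[OF m[of n]], of "- r"] mi(2) by simp
    have e: "in_window a b u * m n (u - r) = in_window a b r * m n (u - r)" for u
    proof (cases "\<bar>u - r\<bar> \<ge> h n")
      case False
      then have "\<bar>u - r\<bar> < \<delta>" using elim by linarith
      then have "in_window a b u = in_window a b r" by (auto simp: in_window_def \<delta>_def)
      then show ?thesis by simp
    qed (simp add: mi(3))
    show ?case by (simp only: e integral_mult_right_zero tr mult_1_right)
  qed
  then show ?thesis by (rule Lim_transform_eventually[OF tendsto_const])
qed

context noise_space
begin

section \<open>Truncation and mollification of a function\<close>

context
  fixes \<phi> :: "real \<times> 'a \<Rightarrow> real" and M :: real and h :: "nat \<Rightarrow> real" and m :: "nat \<Rightarrow> real \<Rightarrow> real" and \<nu> :: "'a \<Rightarrow> real" and \<delta> :: real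
  assumes \<phi>: "\<phi> \<in> regular" and M: "\<And>u. 0 < u \<Longrightarrow> u < T \<Longrightarrow> (\<integral>x. \<bar>\<phi> (u, x)\<bar> \<partial>lborel) \<le> M" "M > 0"
    and h: "h \<longlonglongrightarrow> 0" "\<And>n. h n > 0" and m: "\<And>n. mollifier (h n) (m n)"
    and \<nu>: "mollifier \<delta> \<nu>" "\<delta> > 0"
begin

text \<open>The time margin is twice the mollification radius. Mollifying uses up one radius, so the
  result is supported in \<open>{h n..T - h n}\<close>, inside the open interval; the spatial cut
  makes the support bounded.\<close>

definition cut :: "nat \<Rightarrow> real \<times> 'a \<Rightarrow> real" where
  "cut n w = (if 2 * h n < fst w \<and> fst w < T - 2 * h n \<and> norm (snd w) \<le> real n then \<phi> w else 0)"

lemma cut_measurable: "cut n \<in> borel_measurable (borel \<Otimes>\<^sub>M borel)"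
proof -
  define \<phi>' where "\<phi>' z = indicator ({0<..<T} \<times> UNIV) z *\<^sub>R \<phi> z" for z
  have "\<phi>' \<in> borel_measurable borel" using \<phi> unfolding regular_def set_borel_measurable_def \<phi>'_def by blast
  then have [measurable]: "\<phi>' \<in> borel_measurable (borel \<Otimes>\<^sub>M borel)" by (simp add: borel_prod)
  have "cut n = (\<lambda>w. if 2 * h n < fst w \<and> fst w < T - 2 * h n \<and> norm (snd w) \<le> real n then \<phi>' w else 0)"
  proof
    fix w :: "real \<times> 'a"
    have "2 * h n < fst w \<Longrightarrow> fst w < T - 2 * h n \<Longrightarrow> w \<in> {0<..<T} \<times> UNIV"
      using h(2)[of n] by (cases w) auto
    then show "cut n w = (if 2 * h n < fst w \<and> fst w < T - 2 * h n \<and> norm (snd w) \<le> real n then \<phi>' w else 0)"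
      by (auto simp: cut_def \<phi>'_def)
  qed
  then show ?thesis by simp
qed

lemma cut_slice: "integrable lborel (\<lambda>x. cut n (u, x))" "(\<integral>x. \<bar>cut n (u, x)\<bar> \<partial>lborel) \<le> M"
    "\<not> (0 < u \<and> u < T) \<Longrightarrow> cut n (u, x) = 0"
proof -
  have hn: "h n > 0" by (rule h(2))
  show z: "\<not> (0 < u \<and> u < T) \<Longrightarrow> cut n (u, x) = 0" for u x using hn by (auto simp: cut_def)
  have [measurable]: "(\<lambda>x. cut n (u, x)) \<in> borel_measurable lborel"
    using measurable_compose[of "\<lambda>x. (u, x)" lborel "borel \<Otimes>\<^sub>M borel" "cut n"] cut_measurable by simp
  have "integrable lborel (\<lambda>x. cut n (u, x)) \<and> (\<integral>x. \<bar>cut n (u, x)\<bar> \<partial>lborel) \<le> M"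
  proof (cases "0 < u \<and> u < T")
    case True
    then have i: "integrable lborel (\<lambda>x. \<phi> (u, x))" using \<phi> by (auto simp: regular_def)
    have c: "\<bar>cut n (u, x)\<bar> \<le> \<bar>\<phi> (u, x)\<bar>" for x by (simp add: cut_def)
    have ic: "integrable lborel (\<lambda>x. cut n (u, x))"
      by (rule Bochner_Integration.integrable_bound[OF i]) (use c in auto)
    have "(\<integral>x. \<bar>cut n (u, x)\<bar> \<partial>lborel) \<le> (\<integral>x. \<bar>\<phi> (u, x)\<bar> \<partial>lborel)"
      using ic i c by (intro integral_mono integrable_abs) auto
    then show ?thesis using ic M(1)[of u] True by linarith
  next
    case False
    then show ?thesis using z[OF False] M(2) by simp
  qed
  then show "integrable lborel (\<lambda>x. cut n (u, x))" "(\<integral>x. \<bar>cut n (u, x)\<bar> \<partial>lborel) \<le> M" by auto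
qed

lemma cut_integrable: "integrable lborel (cut n)"
proof -
  note [measurable] = cut_measurable
  have "integrable (lborel \<Otimes>\<^sub>M lborel) (cut n)"
  proof (rule lborel_pair.Fubini_integrable)
    show "integrable lborel (\<lambda>u. \<integral>x. norm (cut n (u, x)) \<partial>lborel)"
    proof (rule Bochner_Integration.integrable_bound)
      show "integrable lborel (\<lambda>u. M * indicator {0..T} u)"
        by (intro integrable_mult_right integrable_real_indicator) (auto simp: emeasure_lborel_Icc_eq)
      show "AE u in lborel. norm (\<integral>x. norm (cut n (u, x)) \<partial>lborel) \<le> norm (M * indicator {0..T} u)"
      proof (rule AE_I2)
        fix u
        show "norm (\<integral>x. norm (cut n (u, x)) \<partial>lborel) \<le> norm (M * indicator {0..T} u)"
          using cut_slice(2)[of n u] cut_slice(3)[of u n] M(2) by (cases "0 < u \<and> u < T") (auto simp: indicator_def)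
      qed
    qed measurable
    show "AE u in lborel. integrable lborel (\<lambda>x. cut n (u, x))" using cut_slice(1) by simp
  qed measurable
  then show ?thesis by (simp add: lborel_prod)
qed

definition approx :: "nat \<Rightarrow> real \<times> 'a \<Rightarrow> real" where
  "approx n = convolution (cut n) (\<lambda>z. m n (fst z) * \<nu> (snd z))"

lemma tensor_support: "norm z > h n + \<delta> \<Longrightarrow> m n (fst z) * \<nu> (snd z) = 0"
proof -
  assume z: "norm z > h n + \<delta>"
  have "norm z \<le> norm (fst z) + norm (snd z)" by (metis norm_Pair_le surjective_pairing)
  then have "norm (fst z) \<ge> h n \<or> norm (snd z) \<ge> \<delta>" using z by linarith
  then show ?thesis using m[of n] \<nu>(1) by (auto simp: mollifier_def)
qed

lemma approx_test: "approx n \<in> test_functions T"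
proof -
  have "smooth (\<lambda>z. m n (fst z) * \<nu> (snd z))"
    using m[of n] \<nu>(1) by (intro smooth_tensor) (auto simp: mollifier_def)
  then have s: "smooth (approx n)" unfolding approx_def
    by (intro smooth_convolution[OF cut_integrable, where R="h n + \<delta>"] tensor_support)
  let ?C = "{h n..T - h n} \<times> cball (0::'a) (real n + \<delta>)"
  have "z \<in> ?C" if "approx n z \<noteq> 0" for z
  proof (rule ccontr)
    assume z: "z \<notin> ?C"
    have e: "cut n w * (m n (fst (z - w)) * \<nu> (snd (z - w))) = 0" for w
    proof (rule ccontr)
      assume *: "cut n w * (m n (fst (z - w)) * \<nu> (snd (z - w))) \<noteq> 0"
      then have w: "2 * h n < fst w" "fst w < T - 2 * h n" "norm (snd w) \<le> real n" by (auto simp: cut_def split: if_splits)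
      have "\<not> \<bar>fst (z - w)\<bar> \<ge> h n" "\<not> norm (snd (z - w)) \<ge> \<delta>"
        using * m[of n] \<nu>(1) by (auto simp: mollifier_def)
      moreover have "norm (snd z) \<le> norm (snd w) + norm (snd (z - w))"
        using norm_triangle_ineq[of "snd w" "snd (z - w)"] by simp
      ultimately have "z \<in> ?C" using w by (cases z) (auto simp: mem_Times_iff)
      then show False using z by simp
    qed
    have "approx n z = 0" unfolding approx_def convolution_def e by simp
    then show False using that by simp
  qed
  then have sub: "closure {z. approx n z \<noteq> 0} \<subseteq> ?C"
    by (intro closure_minimal closed_Times) auto
  moreover have "compact ?C" by (intro compact_Times) auto
  ultimately have "compact (closure {z. approx n z \<noteq> 0})"
    using compact_Int_closed[OF _ closed_closure, of ?C "{z. approx n z \<noteq> 0}"] by (simp only: inf_absorb2)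
  moreover have "?C \<subseteq> {0<..<T} \<times> UNIV" using h(2)[of n] by auto
  ultimately show ?thesis using s sub by (auto simp: test_functions_def)
qed

text \<open>What remains of the transform of \<open>approx n\<close> after the multiplier coming
  from \<nu> has been split off.\<close>

definition smoothed :: "nat \<Rightarrow> 'a \<Rightarrow> real \<Rightarrow> complex" where
  "smoothed n \<xi> u = (\<integral>r. fourier (\<lambda>z. complex_of_real (cut n (r, z))) \<xi> * m n (u - r) \<partial>lborel)"

abbreviation "Nu \<xi> \<equiv> fourier (\<lambda>x. complex_of_real (\<nu> x)) \<xi>"

lemma fourier_cut_measurable [measurable]:
  "(\<lambda>x. fourier (\<lambda>z. complex_of_real (cut n (snd x, z))) (fst x)) \<in> borel_measurable (borel \<Otimes>\<^sub>M borel)"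
proof -
  note [measurable] = cut_measurable
  show ?thesis unfolding fourier_def by measurable
qed

lemma fourier_cut_le: "norm (fourier (\<lambda>z. complex_of_real (cut n (r, z))) \<xi>) \<le> M * in_window 0 T r"
proof (cases "0 < r \<and> r < T")
  case True
  have "norm (fourier (\<lambda>z. complex_of_real (cut n (r, z))) \<xi>) \<le> (\<integral>z. norm (complex_of_real (cut n (r, z))) \<partial>lborel)"
    by (rule norm_fourier_le)
  then show ?thesis using cut_slice(2)[of n r] True by (simp add: in_window_def)
next
  case False
  then show ?thesis using cut_slice(3)[OF False] M(2) by (simp add: fourier_def in_window_def)
qed

lemma m_translate: "integrable lborel (\<lambda>r. m n (u - r))" "(\<integral>r. m n (u - r) \<partial>lborel) = 1"
  "integrable lborel (\<lambda>u. m n (u - r))"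
proof -
  have mi: "integrable lborel (m n)" "(\<integral>x. m n x \<partial>lborel) = 1" using m[of n] by (auto simp: mollifier_def)
  show "integrable lborel (\<lambda>r. m n (u - r))"
    using lborel_integrable_real_affine[OF mi(1), of "-1" u] by simp
  show "(\<integral>r. m n (u - r) \<partial>lborel) = 1"
    using lborel_integral_real_affine[of "-1" "m n" u] mi(2) by simp
  show "integrable lborel (\<lambda>u. m n (u - r))"
    using lborel_integrable_translate[OF mi(1), of "- r"] by simp
qed

lemma smoothed_measurable [measurable]: "(\<lambda>x. smoothed n (fst x) (snd x)) \<in> borel_measurable (borel \<Otimes>\<^sub>M borel)"
proof -
  note [measurable] = mollifier_measurable[OF m]
  have [measurable]: "(\<lambda>x. fourier (\<lambda>z. complex_of_real (cut n (f x, z))) (g x)) \<in> borel_measurable N"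
    if [measurable]: "f \<in> borel_measurable N" "g \<in> borel_measurable N" for f g and N :: "'m measure"
    using measurable_compose[of "\<lambda>x. (g x, f x)" N _ "\<lambda>x. fourier (\<lambda>z. complex_of_real (cut n (snd x, z))) (fst x)"] fourier_cut_measurable by simp
  show ?thesis unfolding smoothed_def by measurable
qed

lemma smoothed_le: "norm (smoothed n \<xi> u) \<le> M"
proof -
  note [measurable] = mollifier_measurable[OF m]
  have m0: "m n x \<ge> 0" for x using m[of n] by (simp add: mollifier_def)
  have "norm (smoothed n \<xi> u) \<le> (\<integral>r. norm (fourier (\<lambda>z. complex_of_real (cut n (r, z))) \<xi> * m n (u - r)) \<partial>lborel)"
    unfolding smoothed_def by (rule integral_norm_bound)
  also have "\<dots> \<le> (\<integral>r. M * m n (u - r) \<partial>lborel)"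
  proof (rule integral_mono')
    show "integrable lborel (\<lambda>r. M * m n (u - r))" using m_translate(1) by simp
    fix r
    have "norm (fourier (\<lambda>z. complex_of_real (cut n (r, z))) \<xi>) \<le> M"
      using order_trans[OF fourier_cut_le[of n r \<xi>], of M] M(2) by (simp add: in_window_def split: if_splits)
    then show "norm (fourier (\<lambda>z. complex_of_real (cut n (r, z))) \<xi> * m n (u - r)) \<le> M * m n (u - r)"
      using m0 by (simp add: norm_mult mult_right_mono)
  qed (use m0 M(2) in simp)
  also have "\<dots> = M" by (simp add: m_translate)
  finally show ?thesis .
qed

lemma profile_approx: "profile T (approx n) \<xi> u = Nu \<xi> * smoothed n \<xi> u"
proof (cases "0 < u \<and> u < T")
  case True
  then show ?thesis
    unfolding profile_def approx_def smoothed_def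
    by (simp add: space_fourier_convolution[OF cut_integrable m \<nu>(1)])
next
  \<comment> \<open>Here \<open>profile\<close> is 0 by definition. The other side vanishes because
    a time outside the interval is further than the mollification radius from every time where
    \<open>cut n\<close> lives.\<close>
  case False
  have e: "fourier (\<lambda>z. complex_of_real (cut n (r, z))) \<xi> * m n (u - r) = 0" for r
  proof (cases "2 * h n < r \<and> r < T - 2 * h n")
    case True
    then have "\<bar>u - r\<bar> \<ge> h n" using False h(2)[of n] by linarith
    then show ?thesis using m[of n] by (simp add: mollifier_def)
  next
    case False
    then have "cut n (r, z) = 0" for z by (auto simp: cut_def)
    then show ?thesis by (simp add: fourier_def)
  qed
  have "smoothed n \<xi> u = 0" unfolding smoothed_def e by simp
  then show ?thesis by (simp only: profile_def False if_False mult_zero_right)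
qed

lemma fourier_cut_tendsto:
  assumes r: "0 < r" "r < T"
  shows "(\<lambda>n. fourier (\<lambda>z. complex_of_real (cut n (r, z))) \<xi>) \<longlonglongrightarrow> profile T \<phi> \<xi> r"
proof -
  have i: "integrable lborel (\<lambda>z. \<phi> (r, z))" using \<phi> r by (auto simp: regular_def)
  have "(\<lambda>n. fourier (\<lambda>z. complex_of_real (cut n (r, z))) \<xi>) \<longlonglongrightarrow> fourier (\<lambda>z. complex_of_real (\<phi> (r, z))) \<xi>"
    unfolding fourier_def
  proof (rule integral_dominated_convergence[where w="\<lambda>z. \<bar>\<phi> (r, z)\<bar>"])
    show "AE z in lborel. (\<lambda>n. exp (- (\<i> * complex_of_real (\<xi> \<bullet> z))) * complex_of_real (cut n (r, z)))
      \<longlonglongrightarrow> exp (- (\<i> * complex_of_real (\<xi> \<bullet> z))) * complex_of_real (\<phi> (r, z))"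
    proof (intro AE_I2 tendsto_intros)
      fix z :: 'a
      have "\<forall>\<^sub>F n in sequentially. h n < min (r / 2) ((T - r) / 2)" using r h(1) by (intro order_tendstoD) auto
      moreover have "\<forall>\<^sub>F n in sequentially. norm z \<le> real n" by (rule filterlim_at_top[THEN iffD1, OF filterlim_real_sequentially, rule_format])
      ultimately have "\<forall>\<^sub>F n in sequentially. \<phi> (r, z) = cut n (r, z)"
        by eventually_elim (auto simp: cut_def)
      then show "(\<lambda>n. cut n (r, z)) \<longlonglongrightarrow> \<phi> (r, z)" by (rule Lim_transform_eventually[OF tendsto_const])
    qed
    have m1: "(\<lambda>z. cut n (r, z)) \<in> borel_measurable lborel" for n by (rule borel_measurable_integrable[OF cut_slice(1)])
    show "(\<lambda>z. exp (- (\<i> * complex_of_real (\<xi> \<bullet> z))) * complex_of_real (cut n (r, z))) \<in> borel_measurable lborel" for n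
      using m1 by measurable
    show "(\<lambda>z. exp (- (\<i> * complex_of_real (\<xi> \<bullet> z))) * complex_of_real (\<phi> (r, z))) \<in> borel_measurable lborel"
      using borel_measurable_integrable[OF i] by measurable
    show "AE z in lborel. norm (exp (- (\<i> * complex_of_real (\<xi> \<bullet> z))) * complex_of_real (cut n (r, z))) \<le> \<bar>\<phi> (r, z)\<bar>" for n
      by (auto simp: norm_mult cut_def)
  qed (use i in simp)
  then show ?thesis using r by (simp add: profile_def space_fourier_def)
qed

text \<open>Fubini moves the time mollifier from the transform onto the indicator of the interval.
  The mollified indicator \<open>q n\<close> converges off the two endpoints, and the transforms of
  the truncations converge at each time, dominated by \<open>M\<close> on the bounded time
  interval.\<close>

lemma window_smoothed_tendsto:
  assumes ab: "a < b"
  shows "(\<lambda>n. window T (smoothed n \<xi>) (a, b)) \<longlonglongrightarrow> window T (profile T \<phi> \<xi>) (a, b)"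
proof -
  note [measurable] = mollifier_measurable[OF m]
  let ?c = "\<lambda>n r. fourier (\<lambda>z. complex_of_real (cut n (r, z))) \<xi>"
  have cm[measurable]: "?c n \<in> borel_measurable borel" for n
    using measurable_compose[of "\<lambda>r. (\<xi>, r)" borel "borel \<Otimes>\<^sub>M borel" "\<lambda>x. fourier (\<lambda>z. complex_of_real (cut n (snd x, z))) (fst x)"] fourier_cut_measurable by simp
  define q where "q n r = (\<integral>u. in_window (max 0 a) (min T b) u * m n (u - r) \<partial>lborel)" for n r
  have W: "in_window 0 T u * in_window a b u = in_window (max 0 a) (min T b) u" for u by (auto simp: in_window_def)
  have m0: "m n x \<ge> 0" for n x using m[of n] by (simp add: mollifier_def)
  have swap: "window T (smoothed n \<xi>) (a, b) = (\<integral>r. ?c n r * q n r \<partial>lborel)" for n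
  proof -
    define J where "J r u = in_window (max 0 a) (min T b) u *\<^sub>R (?c n r * m n (u - r))" for r u
    have int: "integrable (lborel \<Otimes>\<^sub>M lborel) (\<lambda>(r, u). J r u)"
    proof (rule integrableI_bounded)
      have "(\<integral>\<^sup>+x. norm (case x of (r, u) \<Rightarrow> J r u) \<partial>lborel2) \<le> (\<integral>\<^sup>+x. ennreal (M * in_window 0 T (fst x)) * ennreal (m n (snd x - fst x)) \<partial>lborel2)"
      proof (rule nn_integral_mono)
        fix x
        have "norm (J (fst x) (snd x)) \<le> 1 * (norm (?c n (fst x)) * m n (snd x - fst x))"
          unfolding J_def using m0 by (simp add: norm_mult mult_left_le_one_le)
        also have "\<dots> \<le> (M * in_window 0 T (fst x)) * m n (snd x - fst x)"
          using fourier_cut_le[of n "fst x" \<xi>] m0 by (simp add: mult_right_mono)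
        finally show "ennreal (norm (case x of (r, u) \<Rightarrow> J r u)) \<le> ennreal (M * in_window 0 T (fst x)) * ennreal (m n (snd x - fst x))"
          using m0 M(2) by (simp add: case_prod_unfold ennreal_mult[symmetric] ennreal_leI)
      qed
      also have "\<dots> = (\<integral>\<^sup>+r. \<integral>\<^sup>+u. ennreal (M * in_window 0 T r) * ennreal (m n (u - r)) \<partial>lborel \<partial>lborel)"
        by (subst lborel.nn_integral_fst[symmetric]) simp_all
      also have "\<dots> = (\<integral>\<^sup>+r. ennreal (M * in_window 0 T r) * ennreal 1 \<partial>lborel)"
      proof (rule nn_integral_cong)
        fix r
        have "(\<integral>u. m n (u - r) \<partial>lborel) = 1"
          using lborel_integral_translate[OF mollifier_measurable[OF m[of n]], of "- r"] m[of n] by (simp add: mollifier_def)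
        then have "(\<integral>\<^sup>+u. ennreal (m n (u - r)) \<partial>lborel) = ennreal 1"
          using nn_integral_eq_integral[OF m_translate(3)] m0 by simp
        then show "(\<integral>\<^sup>+u. ennreal (M * in_window 0 T r) * ennreal (m n (u - r)) \<partial>lborel) = ennreal (M * in_window 0 T r) * ennreal 1"
          by (subst nn_integral_cmult) auto
      qed
      also have "\<dots> = ennreal (T * M)" using nn_integral_window_const[of M] M(2) by (simp add: mult.commute)
      finally show "(\<integral>\<^sup>+x. norm (case x of (r, u) \<Rightarrow> J r u) \<partial>lborel2) < \<infinity>" by (simp add: order_le_less_trans)
    qed (simp add: J_def)
    have "window T (smoothed n \<xi>) (a, b) = (\<integral>u. \<integral>r. J r u \<partial>lborel \<partial>lborel)"
      unfolding window_def smoothed_def J_def by (simp add: W)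
    also have "\<dots> = (\<integral>r. \<integral>u. J r u \<partial>lborel \<partial>lborel)"
      using lborel_pair.integral_fst[OF int] lborel_pair.integral_snd[OF int] by simp
    also have "\<dots> = (\<integral>r. ?c n r * q n r \<partial>lborel)"
    proof (rule Bochner_Integration.integral_cong[OF refl])
      fix r
      have "(\<integral>u. J r u \<partial>lborel) = (\<integral>u. ?c n r * complex_of_real (in_window (max 0 a) (min T b) u * m n (u - r)) \<partial>lborel)"
        unfolding J_def by (intro Bochner_Integration.integral_cong) (auto simp: scaleR_conv_of_real)
      then show "(\<integral>u. J r u \<partial>lborel) = ?c n r * q n r" unfolding q_def by (simp flip: of_real_mult)
    qed
    finally show ?thesis .
  qed
  have q1: "\<bar>q n r\<bar> \<le> 1" for n r
  proof -
    have "\<bar>q n r\<bar> \<le> (\<integral>u. \<bar>in_window (max 0 a) (min T b) u * m n (u - r)\<bar> \<partial>lborel)"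
      unfolding q_def by (rule integral_abs_bound)
    also have "\<dots> \<le> (\<integral>u. m n (u - r) \<partial>lborel)"
      by (rule integral_mono'[OF m_translate(3)]) (use m0 in \<open>auto simp: abs_mult mult_left_le_one_le\<close>)
    also have "\<dots> = 1"
      using lborel_integral_translate[OF mollifier_measurable[OF m[of n]], of "- r"] m[of n] by (simp add: mollifier_def)
    finally show ?thesis .
  qed
  have qm[measurable]: "q n \<in> borel_measurable borel" for n unfolding q_def by measurable
  have [measurable]: "profile T \<phi> \<xi> \<in> borel_measurable borel"
    using \<phi> by (intro bounded_borel_measurable profiles_bounded_borel) (simp add: regular_def)
  have "(\<lambda>n. \<integral>r. ?c n r * q n r \<partial>lborel) \<longlonglongrightarrow> (\<integral>r. profile T \<phi> \<xi> r * in_window (max 0 a) (min T b) r \<partial>lborel)"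
  proof (rule integral_dominated_convergence[where w="\<lambda>r. M * indicator {0..T} r"])
    show "integrable lborel (\<lambda>r. M * indicator {0..T} r)"
      by (intro integrable_mult_right integrable_real_indicator) (auto simp: emeasure_lborel_Icc_eq)
    show "AE r in lborel. norm (?c n r * q n r) \<le> M * indicator {0..T} r" for n
    proof (rule AE_I2)
      fix r
      have "norm (?c n r * q n r) \<le> (M * in_window 0 T r) * 1"
        unfolding norm_mult norm_of_real using M(2) by (intro mult_mono fourier_cut_le q1) auto
      also have "(M * in_window 0 T r) * 1 = M * indicator {0..T} r" by (simp add: in_window_def indicator_def)
      finally show "norm (?c n r * q n r) \<le> M * indicator {0..T} r" .
    qed
    have "AE r in lborel. r \<noteq> max 0 a" "AE r in lborel. r \<noteq> min T b" by (rule AE_lborel_singleton)+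
    then show "AE r in lborel. (\<lambda>n. ?c n r * q n r) \<longlonglongrightarrow> profile T \<phi> \<xi> r * in_window (max 0 a) (min T b) r"
    proof eventually_elim
      case (elim r)
      have ql: "(\<lambda>n. q n r) \<longlonglongrightarrow> in_window (max 0 a) (min T b) r"
        unfolding q_def by (rule mollifier_window_tendsto[OF m h(1) elim])
      show ?case
      proof (cases "0 < r \<and> r < T")
        case True
        then show ?thesis by (intro tendsto_mult fourier_cut_tendsto tendsto_of_real ql) auto
      next
        case False
        have "?c n r = 0" for n using cut_slice(3)[OF False] by (simp add: fourier_def)
        moreover have "profile T \<phi> \<xi> r = 0" by (simp only: profile_def False if_False)
        ultimately show ?thesis by simp
      qed
    qed
  qed measurable
  also have "(\<integral>r. profile T \<phi> \<xi> r * in_window (max 0 a) (min T b) r \<partial>lborel) = window T (profile T \<phi> \<xi>) (a, b)"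
    unfolding window_def by (simp add: W scaleR_conv_of_real mult.commute)
  finally show ?thesis unfolding swap .
qed

lemma norm_profile_M: "norm (profile T \<phi> \<xi> u) \<le> M"
  using order_trans[OF norm_profile_le[of \<phi> \<xi> u], of M] M by (auto split: if_splits)

lemma smoothed_bounded_borel: "bounded_borel (smoothed n \<xi>)"
  by (rule profile_slice_bounded_borel[OF smoothed_measurable smoothed_le])

text \<open>At each frequency the form tends to 0 by convergence of the window integrals. Uniformly
  in \<open>n\<close> and \<xi> it is only bounded by a constant \<open>K\<close>; the decay of the
  transform of the fixed \<nu>, faster than the tempered weight, supplies
  \<mu>-integrability.\<close>

lemma profile_form_approx_tendsto:
  "(\<lambda>n. \<integral>\<xi>. (norm (Nu \<xi>))\<^sup>2 * tf (\<lambda>u. smoothed n \<xi> u - profile T \<phi> \<xi> u) (\<lambda>u. smoothed n \<xi> u - profile T \<phi> \<xi> u) \<partial>\<mu>) \<longlonglongrightarrow> 0"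
  "integrable \<mu> (\<lambda>\<xi>. (norm (Nu \<xi>))\<^sup>2 * tf (\<lambda>u. smoothed n \<xi> u - profile T \<phi> \<xi> u) (\<lambda>u. smoothed n \<xi> u - profile T \<phi> \<xi> u))"
proof -
  have F: "profile T \<phi> \<in> profiles" using \<phi> by (simp add: regular_def)
  note [measurable] = profiles_measurable[OF F] mollifier_measurable[OF \<nu>(1)]
  note Fb = profiles_bounded_borel[OF F]
  let ?D = "\<lambda>n \<xi> u. smoothed n \<xi> u - profile T \<phi> \<xi> u"
  have Db: "bounded_borel (?D n \<xi>)" for n \<xi> by (rule bounded_borel_diff[OF smoothed_bounded_borel Fb])
  have Dn: "norm (?D n \<xi> u) \<le> 2 * M" for n \<xi> u
    using norm_triangle_ineq4[of "smoothed n \<xi> u" "profile T \<phi> \<xi> u"] smoothed_le[of n \<xi> u] norm_profile_M[of \<xi> u] by linarith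
  define K where "K = time_bound H * (2 * M)\<^sup>2 * T powr (2 * H)"
  have Dk: "tf (?D n \<xi>) (?D n \<xi>) \<le> K" for n \<xi>
    unfolding K_def
  proof (rule time_form_bound[OF H Db Dn])
    have "(\<integral>\<^sup>+u. ennreal (in_window 0 T u * norm (?D n \<xi> u)) \<partial>lborel) \<le> (\<integral>\<^sup>+u. ennreal (in_window 0 T u * (2 * M)) \<partial>lborel)"
      by (intro nn_integral_mono ennreal_leI mult_left_mono Dn) simp
    then show "(\<integral>\<^sup>+u. ennreal (in_window 0 T u * norm (?D n \<xi> u)) \<partial>lborel) \<le> ennreal (2 * M * T)"
      using nn_integral_window_const[of "2 * M"] M(2) by (simp add: mult_ac)
  qed (use M(2) T in auto)
  have D0: "0 \<le> tf (?D n \<xi>) (?D n \<xi>)" for n \<xi> by (rule time_form_nonneg[OF H Db])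
  obtain k where k: "integrable \<mu> (\<lambda>\<xi>. 1 / (1 + (norm \<xi>)\<^sup>2) ^ k)" by (rule tempered_integrable)
  obtain C where C: "C \<ge> 0" "\<And>\<xi>. norm (Nu \<xi>) * (1 + (norm \<xi>)\<^sup>2) ^ k \<le> C"
    using mollifier_fourier_decay[OF \<nu>, of k] by auto
  have Nu: "(norm (Nu \<xi>))\<^sup>2 \<le> C * (1 / (1 + (norm \<xi>)\<^sup>2) ^ k)" for \<xi>
  proof -
    have "(norm (Nu \<xi>))\<^sup>2 \<le> norm (Nu \<xi>)"
      using mollifier_fourier_le[OF \<nu>(1), of \<xi>] by (simp add: power2_eq_square mult_left_le_one_le)
    also have "\<dots> \<le> C * (1 / (1 + (norm \<xi>)\<^sup>2) ^ k)" using C(2)[of \<xi>] by (simp add: pos_le_divide_eq add_pos_nonneg)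
    finally show ?thesis .
  qed
  have Num[measurable]: "(\<lambda>\<xi>. Nu \<xi>) \<in> borel_measurable \<mu>" unfolding fourier_def by measurable
  have tfm[measurable]: "(\<lambda>\<xi>. tf (?D n \<xi>) (?D n \<xi>)) \<in> borel_measurable \<mu>" for n
    by (rule time_form_profile_measurable) measurable
  have dom: "norm ((norm (Nu \<xi>))\<^sup>2 * tf (?D n \<xi>) (?D n \<xi>)) \<le> C * (1 / (1 + (norm \<xi>)\<^sup>2) ^ k) * K" for n \<xi>
  proof -
    have "(norm (Nu \<xi>))\<^sup>2 * tf (?D n \<xi>) (?D n \<xi>) \<le> C * (1 / (1 + (norm \<xi>)\<^sup>2) ^ k) * K"
      using D0 C(1) by (intro mult_mono Nu Dk) auto
    then show ?thesis using D0[of n \<xi>] by simp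
  qed
  have ik: "integrable \<mu> (\<lambda>\<xi>. C * (1 / (1 + (norm \<xi>)\<^sup>2) ^ k) * K)"
    by (intro integrable_mult_left integrable_mult_right k)
  have "(\<lambda>n. \<integral>\<xi>. (norm (Nu \<xi>))\<^sup>2 * tf (?D n \<xi>) (?D n \<xi>) \<partial>\<mu>) \<longlonglongrightarrow> (\<integral>\<xi>. 0 \<partial>\<mu>)"
  proof (rule integral_dominated_convergence[OF _ _ ik])
    show "AE \<xi> in \<mu>. (\<lambda>n. (norm (Nu \<xi>))\<^sup>2 * tf (?D n \<xi>) (?D n \<xi>)) \<longlonglongrightarrow> 0"
    proof (intro AE_I2 tendsto_mult_right_zero time_form_tendsto_0[OF H _ Db Dn])
      fix \<xi> :: 'a and a b :: real assume "a < b"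
      have wd: "window T (?D n \<xi>) (a, b) = window T (smoothed n \<xi>) (a, b) - window T (profile T \<phi> \<xi>) (a, b)" for n
        unfolding window_def scaleR_diff_right using integrable_window[OF smoothed_bounded_borel] integrable_window[OF Fb]
        by (intro Bochner_Integration.integral_diff) auto
      show "(\<lambda>n. window T (?D n \<xi>) (a, b)) \<longlonglongrightarrow> 0"
        using tendsto_diff[OF window_smoothed_tendsto[OF \<open>a < b\<close>, of \<xi>] tendsto_const[of "window T (profile T \<phi> \<xi>) (a, b)"]]
        unfolding wd by simp
    qed (use T in simp)
    show "AE \<xi> in \<mu>. norm ((norm (Nu \<xi>))\<^sup>2 * tf (?D n \<xi>) (?D n \<xi>)) \<le> C * (1 / (1 + (norm \<xi>)\<^sup>2) ^ k) * K" for n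
      using dom by simp
  qed measurable
  then show "(\<lambda>n. \<integral>\<xi>. (norm (Nu \<xi>))\<^sup>2 * tf (?D n \<xi>) (?D n \<xi>) \<partial>\<mu>) \<longlonglongrightarrow> 0" by simp
  show "integrable \<mu> (\<lambda>\<xi>. (norm (Nu \<xi>))\<^sup>2 * tf (?D n \<xi>) (?D n \<xi>))"
  proof (rule Bochner_Integration.integrable_bound[OF ik])
    show "AE \<xi> in \<mu>. norm ((norm (Nu \<xi>))\<^sup>2 * tf (?D n \<xi>) (?D n \<xi>)) \<le> norm (C * (1 / (1 + (norm \<xi>)\<^sup>2) ^ k) * K)"
      unfolding real_norm_def by (intro AE_I2 order_trans[OF dom[unfolded real_norm_def] abs_ge_self])
  qed measurable
qed

lemma profile_form_approx_le:
  "profile_form (\<lambda>\<xi> u. profile T (approx n) \<xi> u - profile T \<phi> \<xi> u) (\<lambda>\<xi> u. profile T (approx n) \<xi> u - profile T \<phi> \<xi> u) \<le>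
    2 * (\<integral>\<xi>. (norm (Nu \<xi>))\<^sup>2 * tf (\<lambda>u. smoothed n \<xi> u - profile T \<phi> \<xi> u) (\<lambda>u. smoothed n \<xi> u - profile T \<phi> \<xi> u) \<partial>\<mu>)
    + 2 * (\<integral>\<xi>. (norm (Nu \<xi> - 1))\<^sup>2 * tf (profile T \<phi> \<xi>) (profile T \<phi> \<xi>) \<partial>\<mu>)"
proof -
  have F: "profile T \<phi> \<in> profiles" using \<phi> by (simp add: regular_def)
  have A: "profile T (approx n) \<in> profiles" using test_function_regular[OF approx_test] by (simp add: regular_def)
  note [measurable] = mollifier_measurable[OF \<nu>(1)]
  note Fb = profiles_bounded_borel[OF F]
  have Num[measurable]: "(\<lambda>\<xi>. Nu \<xi>) \<in> borel_measurable \<mu>" unfolding fourier_def by measurable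
  let ?D = "\<lambda>\<xi> u. smoothed n \<xi> u - profile T \<phi> \<xi> u"
  have Db: "bounded_borel (?D \<xi>)" for \<xi> by (rule bounded_borel_diff[OF smoothed_bounded_borel Fb])
  have le: "tf (\<lambda>u. profile T (approx n) \<xi> u - profile T \<phi> \<xi> u) (\<lambda>u. profile T (approx n) \<xi> u - profile T \<phi> \<xi> u)
     \<le> 2 * ((norm (Nu \<xi>))\<^sup>2 * tf (?D \<xi>) (?D \<xi>)) + 2 * ((norm (Nu \<xi> - 1))\<^sup>2 * tf (profile T \<phi> \<xi>) (profile T \<phi> \<xi>))" for \<xi>
  proof -
    \<comment> \<open>The first term is small for large \<open>n\<close> with \<nu> fixed. The
      second measures the effect of the spatial mollifier on the full profile and depends only on
      its radius.\<close>
    have e: "profile T (approx n) \<xi> u - profile T \<phi> \<xi> u = Nu \<xi> * ?D \<xi> u + (Nu \<xi> - 1) * profile T \<phi> \<xi> u" for u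
      unfolding profile_approx by (simp add: algebra_simps)
    show ?thesis
      unfolding e time_form_cmult_square[symmetric]
      by (intro time_form_add_square_le H bounded_borel_mult bounded_borel_const Db Fb)
  qed
  have i: "integrable \<mu> (\<lambda>\<xi>. (norm (Nu \<xi> - 1))\<^sup>2 * tf (profile T \<phi> \<xi>) (profile T \<phi> \<xi>))"
  proof (rule Bochner_Integration.integrable_bound)
    show "integrable \<mu> (\<lambda>\<xi>. 4 * tf (profile T \<phi> \<xi>) (profile T \<phi> \<xi>))" using integrable_profile_form(1)[OF F F] by simp
    show "(\<lambda>\<xi>. (norm (Nu \<xi> - 1))\<^sup>2 * tf (profile T \<phi> \<xi>) (profile T \<phi> \<xi>)) \<in> borel_measurable \<mu>"
      using borel_measurable_integrable[OF integrable_profile_form(1)[OF F F]] by measurable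
    show "AE \<xi> in \<mu>. norm ((norm (Nu \<xi> - 1))\<^sup>2 * tf (profile T \<phi> \<xi>) (profile T \<phi> \<xi>)) \<le> norm (4 * tf (profile T \<phi> \<xi>) (profile T \<phi> \<xi>))"
    proof (rule AE_I2)
      fix \<xi>
      have "norm (Nu \<xi> - 1) \<le> 2" using norm_triangle_ineq4[of "Nu \<xi>" 1] mollifier_fourier_le[OF \<nu>(1), of \<xi>] by simp
      then have "(norm (Nu \<xi> - 1))\<^sup>2 \<le> 2\<^sup>2" by (intro power_mono) auto
      then show "norm ((norm (Nu \<xi> - 1))\<^sup>2 * tf (profile T \<phi> \<xi>) (profile T \<phi> \<xi>)) \<le> norm (4 * tf (profile T \<phi> \<xi>) (profile T \<phi> \<xi>))"
        by (simp add: abs_mult mult_right_mono)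
    qed
  qed
  have "profile_form (\<lambda>\<xi> u. profile T (approx n) \<xi> u - profile T \<phi> \<xi> u) (\<lambda>\<xi> u. profile T (approx n) \<xi> u - profile T \<phi> \<xi> u) \<le>
     (\<integral>\<xi>. 2 * ((norm (Nu \<xi>))\<^sup>2 * tf (?D \<xi>) (?D \<xi>)) + 2 * ((norm (Nu \<xi> - 1))\<^sup>2 * tf (profile T \<phi> \<xi>) (profile T \<phi> \<xi>)) \<partial>\<mu>)"
    unfolding profile_form_def
    by (intro integral_mono le integrable_profile_form(1) profiles_diff A F)
       (auto intro!: profile_form_approx_tendsto(2) i)
  then show ?thesis using profile_form_approx_tendsto(2)[of n] i by simp
qed

end

text \<open>The multiplier tends to 1 at each frequency and differs from 1 by at most 2, so four
  times the form of \<phi> is an integrable majorant.\<close>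

lemma mollified_form_tendsto:
  assumes \<phi>: "\<phi> \<in> regular" and \<nu>: "\<And>j. mollifier (\<delta> j) (\<nu> j)" and \<delta>: "\<delta> \<longlonglongrightarrow> 0"
  shows "(\<lambda>j. \<integral>\<xi>. (norm (fourier (\<lambda>x. complex_of_real (\<nu> j x)) \<xi> - 1))\<^sup>2 * tf (profile T \<phi> \<xi>) (profile T \<phi> \<xi>) \<partial>\<mu>) \<longlonglongrightarrow> 0"
proof -
  have F: "profile T \<phi> \<in> profiles" using \<phi> by (simp add: regular_def)
  note [measurable] = mollifier_measurable[OF \<nu>] borel_measurable_integrable[OF integrable_profile_form(1)[OF F F]]
  let ?N = "\<lambda>j \<xi>. fourier (\<lambda>x. complex_of_real (\<nu> j x)) \<xi>"
  have [measurable]: "?N j \<in> borel_measurable \<mu>" for j unfolding fourier_def by measurable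
  have "(\<lambda>j. \<integral>\<xi>. (norm (?N j \<xi> - 1))\<^sup>2 * tf (profile T \<phi> \<xi>) (profile T \<phi> \<xi>) \<partial>\<mu>) \<longlonglongrightarrow> (\<integral>\<xi>. 0 \<partial>\<mu>)"
  proof (rule integral_dominated_convergence[where w="\<lambda>\<xi>. 4 * tf (profile T \<phi> \<xi>) (profile T \<phi> \<xi>)"])
    show "integrable \<mu> (\<lambda>\<xi>. 4 * tf (profile T \<phi> \<xi>) (profile T \<phi> \<xi>))" using integrable_profile_form(1)[OF F F] by simp
    show "AE \<xi> in \<mu>. norm ((norm (?N j \<xi> - 1))\<^sup>2 * tf (profile T \<phi> \<xi>) (profile T \<phi> \<xi>)) \<le> 4 * tf (profile T \<phi> \<xi>) (profile T \<phi> \<xi>)" for j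
    proof (rule AE_I2)
      fix \<xi>
      have "norm (?N j \<xi> - 1) \<le> 2" using norm_triangle_ineq4[of "?N j \<xi>" 1] mollifier_fourier_le[OF \<nu>, of j \<xi>] by simp
      then have "(norm (?N j \<xi> - 1))\<^sup>2 \<le> 2\<^sup>2" by (intro power_mono) auto
      then show "norm ((norm (?N j \<xi> - 1))\<^sup>2 * tf (profile T \<phi> \<xi>) (profile T \<phi> \<xi>)) \<le> 4 * tf (profile T \<phi> \<xi>) (profile T \<phi> \<xi>)"
        using time_form_nonneg[OF H profiles_bounded_borel[OF F], of T \<xi>] by (simp add: abs_mult mult_right_mono)
    qed
    show "AE \<xi> in \<mu>. (\<lambda>j. (norm (?N j \<xi> - 1))\<^sup>2 * tf (profile T \<phi> \<xi>) (profile T \<phi> \<xi>)) \<longlonglongrightarrow> 0"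
    proof (intro AE_I2 tendsto_mult_left_zero)
      fix \<xi> :: 'a
      have "(\<lambda>j. norm \<xi> * \<delta> j) \<longlonglongrightarrow> 0" using \<delta> by (rule tendsto_mult_right_zero)
      then have "(\<lambda>j. norm (?N j \<xi> - 1)) \<longlonglongrightarrow> 0"
        by (rule tendsto_sandwich[OF _ _ tendsto_const, rotated 2]) (use mollifier_fourier_near_one[OF \<nu>] in auto)
      then show "(\<lambda>j. (norm (?N j \<xi> - 1))\<^sup>2) \<longlonglongrightarrow> 0" using tendsto_power[of _ 0 _ 2] by fastforce
    qed
  qed measurable
  then show ?thesis by simp
qed

theorem test_functions_dense:
  assumes \<phi>: "\<phi> \<in> regular" and M: "\<And>u. 0 < u \<Longrightarrow> u < T \<Longrightarrow> (\<integral>x. \<bar>\<phi> (u, x)\<bar> \<partial>lborel) \<le> M" and e: "0 < e"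
  shows "\<exists>\<psi>\<in>test_functions T. hp (\<lambda>z. \<psi> z - \<phi> z) (\<lambda>z. \<psi> z - \<phi> z) < e"
proof -
  define h where "h n = 1 / real (Suc n)" for n
  have h: "h \<longlonglongrightarrow> 0" "\<And>n. h n > 0" unfolding h_def by (real_asymp, simp)
  have "\<exists>m. \<forall>n. mollifier (h n) (m n :: real \<Rightarrow> real)" using mollifier_exists[OF h(2)] by metis
  then obtain m :: "nat \<Rightarrow> real \<Rightarrow> real" where m: "\<And>n. mollifier (h n) (m n)" by auto
  have "\<exists>\<nu>. \<forall>n. mollifier (h n) (\<nu> n :: 'a \<Rightarrow> real)" using mollifier_exists[OF h(2)] by metis
  then obtain \<nu> :: "nat \<Rightarrow> 'a \<Rightarrow> real" where \<nu>: "\<And>n. mollifier (h n) (\<nu> n)" by auto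
  \<comment> \<open>The final estimate is twice the sum of two errors below \<open>d\<close>, scaled
    by \<open>hp_const\<close>; hence the division by 4 and by \<open>hp_const\<close>. The radius
    index \<open>j\<close> is fixed before \<open>n\<close>, whose choice depends on it.\<close>
  define d where "d = e / hp_const / 4"
  have d: "d > 0" using e hp_const_pos by (simp add: d_def)
  have "\<forall>\<^sub>F j in sequentially. (\<integral>\<xi>. (norm (fourier (\<lambda>x. complex_of_real (\<nu> j x)) \<xi> - 1))\<^sup>2 * tf (profile T \<phi> \<xi>) (profile T \<phi> \<xi>) \<partial>\<mu>) < d"
    by (rule order_tendstoD(2)[OF mollified_form_tendsto[OF \<phi> \<nu> h(1)] d])
  then obtain j where j: "(\<integral>\<xi>. (norm (fourier (\<lambda>x. complex_of_real (\<nu> j x)) \<xi> - 1))\<^sup>2 * tf (profile T \<phi> \<xi>) (profile T \<phi> \<xi>) \<partial>\<mu>) < d"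
    by (auto simp: eventually_sequentially)
  \<comment> \<open>The construction asks for a strictly positive bound, so \<open>M\<close> is
    enlarged.\<close>
  have M': "(\<integral>x. \<bar>\<phi> (u, x)\<bar> \<partial>lborel) \<le> \<bar>M\<bar> + 1" if "0 < u" "u < T" for u using M[OF that] by linarith
  have M0: "\<bar>M\<bar> + 1 > 0" by simp
  note ctx = \<phi> M' M0 h(1,2) m \<nu>[of j] h(2)[of j]
  have ev: "\<forall>\<^sub>F n in sequentially. (\<integral>\<xi>. (norm (fourier (\<lambda>x. complex_of_real (\<nu> j x)) \<xi>))\<^sup>2 *
     tf (\<lambda>u. smoothed \<phi> h m n \<xi> u - profile T \<phi> \<xi> u) (\<lambda>u. smoothed \<phi> h m n \<xi> u - profile T \<phi> \<xi> u) \<partial>\<mu>) < d"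
    by (rule order_tendstoD(2)[OF profile_form_approx_tendsto(1)[OF ctx] d]) auto
  then obtain n where n: "(\<integral>\<xi>. (norm (fourier (\<lambda>x. complex_of_real (\<nu> j x)) \<xi>))\<^sup>2 *
     tf (\<lambda>u. smoothed \<phi> h m n \<xi> u - profile T \<phi> \<xi> u) (\<lambda>u. smoothed \<phi> h m n \<xi> u - profile T \<phi> \<xi> u) \<partial>\<mu>) < d"
    by (auto simp: eventually_sequentially)
  let ?\<psi> = "approx \<phi> h m (\<nu> j) n"
  have t: "?\<psi> \<in> test_functions T" by (rule approx_test[OF ctx]) auto
  note tr = test_function_regular[OF t]
  have "profile_form (\<lambda>\<xi> u. profile T ?\<psi> \<xi> u - profile T \<phi> \<xi> u) (\<lambda>\<xi> u. profile T ?\<psi> \<xi> u - profile T \<phi> \<xi> u) < 4 * d"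
    using profile_form_approx_le[OF ctx, of n] n j by auto
  from mult_strict_left_mono[OF this hp_const_pos]
  have "hp (\<lambda>z. ?\<psi> z - \<phi> z) (\<lambda>z. ?\<psi> z - \<phi> z) < hp_const * (4 * d)"
    unfolding hp_inner_eq_profile_form[OF regular_diff[OF tr \<phi>] regular_diff[OF tr \<phi>]] profile_diff[OF tr \<phi>] .
  also have "hp_const * (4 * d) = e"
  proof -
    have "k * (4 * (e / k / 4)) = e" if "k > 0" for k :: real using that by simp
    from this[OF hp_const_pos] show ?thesis unfolding d_def .
  qed
  finally show ?thesis using t by (rule bexI)
qed

end

section \<open>Square integrable random variables\<close>

text \<open>Cauchy-Schwarz in discriminant form, including degenerate forms. If
  \<open>c = 0\<close>, an affine function bounded below has slope 0; if \<open>c\<close> were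
  negative, a large \<open>t\<close> would give a contradiction; otherwise evaluate at the minimum
  \<open>- b / c\<close>.\<close>

lemma quadratic_nonneg_imp:
  fixes a b c :: real
  assumes "\<And>t. 0 \<le> a + 2 * t * b + t\<^sup>2 * c"
  shows "b\<^sup>2 \<le> a * c"
proof (cases "c = 0")
  case True
  have "b = 0"
  proof (rule ccontr)
    assume "b \<noteq> 0"
    then have "a + 2 * (- (a + 1) / (2 * b)) * b = -1" by (simp add: field_simps)
    then show False using assms[of "- (a + 1) / (2 * b)"] True by simp
  qed
  then show ?thesis using True by simp
next
  case False
  have "c \<ge> 0"
  proof (rule ccontr)
    assume "\<not> c \<ge> 0"
    then have c: "c < 0" by simp
    \<comment> \<open>Large enough that \<open>2 * b + t * c\<close> falls below
      \<open>- (|a| + 1)\<close>, and at least 1, so that multiplying by \<open>t\<close> preserves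
      this bound and outweighs \<open>a\<close>.\<close>
    define t where "t = (\<bar>a\<bar> + 1 + 2 * \<bar>b\<bar>) / - c + 1"
    have "0 \<le> (\<bar>a\<bar> + 1 + 2 * \<bar>b\<bar>) / - c" using c by (intro divide_nonneg_pos) auto
    then have t1: "t \<ge> 1" unfolding t_def by linarith
    have "t * c = - (\<bar>a\<bar> + 1 + 2 * \<bar>b\<bar>) + c" using c by (simp add: t_def field_simps)
    then have "2 * b + t * c \<le> - (\<bar>a\<bar> + 1)" using c by (simp add: abs_if split: if_splits)
    then have "t * (2 * b + t * c) \<le> t * - (\<bar>a\<bar> + 1)" using t1 by (intro mult_left_mono) auto
    also have "\<dots> \<le> - (\<bar>a\<bar> + 1)"
      using mult_right_mono[OF t1, of "\<bar>a\<bar> + 1"] by (simp only: mult_1_left mult_minus_right neg_le_iff_le)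
    finally have "a + t * (2 * b + t * c) < 0" by linarith
    then show False using assms[of t] by (simp add: power2_eq_square algebra_simps)
  qed
  then have c: "c > 0" using False by simp
  have "0 \<le> a + 2 * (- b / c) * b + (- b / c)\<^sup>2 * c" by (rule assms)
  also have "\<dots> = a - b\<^sup>2 / c" using c by (simp add: field_simps power2_eq_square)
  finally show ?thesis using c by (simp add: field_simps)
qed

text \<open>Continuity of a squared norm, stated with numbers so that it serves both random
  variables and \<open>hp_inner\<close>: \<open>a\<close> is the squared norm of the limit,
  \<open>p n\<close> the squared distance, and \<open>d n\<close> the inner product of the limit
  with the difference.\<close>

lemma square_norm_limit:
  fixes p d :: "nat \<Rightarrow> real"
  assumes p: "p \<longlonglongrightarrow> 0" and d: "\<And>n. (d n)\<^sup>2 \<le> a * p n"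
  shows "(\<lambda>n. a + 2 * d n + p n) \<longlonglongrightarrow> a"
proof -
  have "(\<lambda>n. a * p n) \<longlonglongrightarrow> 0" using p by (rule tendsto_mult_right_zero)
  then have "(\<lambda>n. (d n)\<^sup>2) \<longlonglongrightarrow> 0"
    by (rule tendsto_sandwich[OF _ _ tendsto_const, rotated 2]) (use d in auto)
  then have "(\<lambda>n. sqrt ((d n)\<^sup>2)) \<longlonglongrightarrow> sqrt 0" by (rule tendsto_real_sqrt)
  then have "(\<lambda>n. \<bar>d n\<bar>) \<longlonglongrightarrow> 0" by simp
  then have "d \<longlonglongrightarrow> 0" by (simp add: tendsto_rabs_zero_iff)
  then have "(\<lambda>n. a + 2 * d n + p n) \<longlonglongrightarrow> a + 2 * 0 + 0" using p by (intro tendsto_intros)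
  then show ?thesis by simp
qed

definition square_integrable :: "'w measure \<Rightarrow> ('w \<Rightarrow> real) set" where
  "square_integrable P = {Y. Y \<in> borel_measurable P \<and> integrable P (\<lambda>\<omega>. (Y \<omega>)\<^sup>2)}"

lemma square_integrable_measurable: "Y \<in> square_integrable P \<Longrightarrow> Y \<in> borel_measurable P"
  by (simp add: square_integrable_def)

lemma abs_mult_le_squares: "\<bar>a * b\<bar> \<le> a\<^sup>2 + b\<^sup>2" for a b :: real
proof -
  have "0 \<le> (\<bar>a\<bar> - \<bar>b\<bar>)\<^sup>2" by simp
  then have "2 * \<bar>a * b\<bar> \<le> a\<^sup>2 + b\<^sup>2" by (simp add: power2_diff abs_mult)
  moreover have "0 \<le> \<bar>a * b\<bar>" by simp
  ultimately show ?thesis by linarith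
qed

lemma square_integrable_mult:
  assumes Y: "Y \<in> square_integrable P" and Z: "Z \<in> square_integrable P"
  shows "integrable P (\<lambda>\<omega>. Y \<omega> * Z \<omega>)"
proof (rule Bochner_Integration.integrable_bound)
  show "integrable P (\<lambda>\<omega>. (Y \<omega>)\<^sup>2 + (Z \<omega>)\<^sup>2)" using assms by (simp add: square_integrable_def)
  show "(\<lambda>\<omega>. Y \<omega> * Z \<omega>) \<in> borel_measurable P"
    using Y Z by (intro borel_measurable_times) (auto simp: square_integrable_def)
  show "AE \<omega> in P. norm (Y \<omega> * Z \<omega>) \<le> norm ((Y \<omega>)\<^sup>2 + (Z \<omega>)\<^sup>2)"
    using abs_mult_le_squares by simp
qed

lemma square_integrable_linear:
  assumes Y: "Y \<in> square_integrable P" and Z: "Z \<in> square_integrable P"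
  shows "(\<lambda>\<omega>. Y \<omega> + t * Z \<omega>) \<in> square_integrable P"
    and "(\<integral>\<omega>. (Y \<omega> + t * Z \<omega>)\<^sup>2 \<partial>P) = (\<integral>\<omega>. (Y \<omega>)\<^sup>2 \<partial>P) + 2 * t * (\<integral>\<omega>. Y \<omega> * Z \<omega> \<partial>P) + t\<^sup>2 * (\<integral>\<omega>. (Z \<omega>)\<^sup>2 \<partial>P)"
proof -
  note i = square_integrable_mult[OF Y Z]
  have iY: "integrable P (\<lambda>\<omega>. (Y \<omega>)\<^sup>2)" and iZ: "integrable P (\<lambda>\<omega>. (Z \<omega>)\<^sup>2)"
    using assms by (auto simp: square_integrable_def)
  have e: "(Y \<omega> + t * Z \<omega>)\<^sup>2 = (Y \<omega>)\<^sup>2 + 2 * t * (Y \<omega> * Z \<omega>) + t\<^sup>2 * (Z \<omega>)\<^sup>2" for \<omega>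
    by (simp add: power2_sum power_mult_distrib)
  show "(\<lambda>\<omega>. Y \<omega> + t * Z \<omega>) \<in> square_integrable P"
    using assms i unfolding square_integrable_def mem_Collect_eq e
    by (intro conjI borel_measurable_add borel_measurable_times Bochner_Integration.integrable_add integrable_mult_right) auto
  show "(\<integral>\<omega>. (Y \<omega> + t * Z \<omega>)\<^sup>2 \<partial>P) = (\<integral>\<omega>. (Y \<omega>)\<^sup>2 \<partial>P) + 2 * t * (\<integral>\<omega>. Y \<omega> * Z \<omega> \<partial>P) + t\<^sup>2 * (\<integral>\<omega>. (Z \<omega>)\<^sup>2 \<partial>P)"
    unfolding e using i iY iZ by simp
qed

lemma square_integrable_diff:
  assumes Y: "Y \<in> square_integrable P" and Z: "Z \<in> square_integrable P"
  shows "(\<lambda>\<omega>. Y \<omega> - Z \<omega>) \<in> square_integrable P"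
    and "(\<integral>\<omega>. (Y \<omega> - Z \<omega>)\<^sup>2 \<partial>P) = (\<integral>\<omega>. (Y \<omega>)\<^sup>2 \<partial>P) - 2 * (\<integral>\<omega>. Y \<omega> * Z \<omega> \<partial>P) + (\<integral>\<omega>. (Z \<omega>)\<^sup>2 \<partial>P)"
  using square_integrable_linear[OF assms, of "-1"] by simp_all

lemma square_integrable_Cauchy_Schwarz:
  assumes Y: "Y \<in> square_integrable P" and Z: "Z \<in> square_integrable P"
  shows "(\<integral>\<omega>. Y \<omega> * Z \<omega> \<partial>P)\<^sup>2 \<le> (\<integral>\<omega>. (Y \<omega>)\<^sup>2 \<partial>P) * (\<integral>\<omega>. (Z \<omega>)\<^sup>2 \<partial>P)"
  by (rule quadratic_nonneg_imp) (simp flip: square_integrable_linear(2)[OF assms])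

lemma square_integrable_triangle:
  assumes "X \<in> square_integrable P" "Y \<in> square_integrable P" "Z \<in> square_integrable P"
  shows "(\<integral>\<omega>. (X \<omega> - Z \<omega>)\<^sup>2 \<partial>P) \<le> 2 * (\<integral>\<omega>. (X \<omega> - Y \<omega>)\<^sup>2 \<partial>P) + 2 * (\<integral>\<omega>. (Y \<omega> - Z \<omega>)\<^sup>2 \<partial>P)"
proof -
  have i: "integrable P (\<lambda>\<omega>. (X \<omega> - Z \<omega>)\<^sup>2)" "integrable P (\<lambda>\<omega>. (X \<omega> - Y \<omega>)\<^sup>2)" "integrable P (\<lambda>\<omega>. (Y \<omega> - Z \<omega>)\<^sup>2)"
    using square_integrable_diff(1) assms unfolding square_integrable_def by blast+
  have "(x - z)\<^sup>2 \<le> 2 * (x - y)\<^sup>2 + 2 * (y - z)\<^sup>2" for x y z :: real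
  proof -
    have "0 \<le> ((x - y) - (y - z))\<^sup>2" by simp
    then show ?thesis by (simp add: power2_eq_square algebra_simps)
  qed
  then have "(\<integral>\<omega>. (X \<omega> - Z \<omega>)\<^sup>2 \<partial>P) \<le> (\<integral>\<omega>. 2 * (X \<omega> - Y \<omega>)\<^sup>2 + 2 * (Y \<omega> - Z \<omega>)\<^sup>2 \<partial>P)"
    using i by (intro integral_mono) auto
  then show ?thesis using i by simp
qed

lemma square_integrable_limit:
  assumes Y: "\<And>n. Y n \<in> square_integrable P" and Z: "Z \<in> square_integrable P"
    and l: "(\<lambda>n. \<integral>\<omega>. (Y n \<omega> - Z \<omega>)\<^sup>2 \<partial>P) \<longlonglongrightarrow> 0"
  shows "(\<lambda>n. \<integral>\<omega>. (Y n \<omega>)\<^sup>2 \<partial>P) \<longlonglongrightarrow> (\<integral>\<omega>. (Z \<omega>)\<^sup>2 \<partial>P)"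
proof -
  note D = square_integrable_diff(1)[OF Y Z]
  have "(\<lambda>n. (\<integral>\<omega>. (Z \<omega>)\<^sup>2 \<partial>P) + 2 * (\<integral>\<omega>. Z \<omega> * (Y n \<omega> - Z \<omega>) \<partial>P) + (\<integral>\<omega>. (Y n \<omega> - Z \<omega>)\<^sup>2 \<partial>P)) \<longlonglongrightarrow> (\<integral>\<omega>. (Z \<omega>)\<^sup>2 \<partial>P)"
    by (rule square_norm_limit[OF l square_integrable_Cauchy_Schwarz[OF Z D]])
  then show ?thesis using square_integrable_linear(2)[OF Z D, of 1] by simp
qed

context prob_space
begin

text \<open>Riesz-Fischer with a rate. Geometric decay makes the increments summable in
  \<open>L1\<close>, so the whole sequence converges almost surely, and Fatou transfers the bound.
  Naming the limit explicitly by \<open>lim\<close> preserves joint measurability when the sequence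
  depends on a parameter.\<close>

lemma square_integrable_lim:
  assumes Y: "\<And>n. Y n \<in> square_integrable M" and C: "C \<ge> 0"
    and b: "\<And>n m. n \<le> m \<Longrightarrow> (\<integral>\<omega>. (Y n \<omega> - Y m \<omega>)\<^sup>2 \<partial>M) \<le> C * (1 / 4) ^ n"
  shows "(\<lambda>\<omega>. lim (\<lambda>n. Y n \<omega>)) \<in> square_integrable M"
    and "(\<integral>\<omega>. (Y n \<omega> - lim (\<lambda>n. Y n \<omega>))\<^sup>2 \<partial>M) \<le> C * (1 / 4) ^ n"
proof -
  define Z where "Z = (\<lambda>\<omega>. lim (\<lambda>n. Y n \<omega>))"
  have [measurable]: "Y n \<in> borel_measurable M" for n using Y by (simp add: square_integrable_def)
  have Zm[measurable]: "Z \<in> borel_measurable M" unfolding Z_def by measurable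
  have i2: "integrable M (\<lambda>\<omega>. (Y n \<omega> - Y m \<omega>)\<^sup>2)" for n m
    using square_integrable_diff(1)[OF Y Y] by (simp add: square_integrable_def)
  have step: "(\<integral>\<^sup>+\<omega>. ennreal \<bar>Y (Suc n) \<omega> - Y n \<omega>\<bar> \<partial>M) \<le> ennreal ((C + 1) * (1 / 2) ^ n)" for n
  proof -
    \<comment> \<open>Passes from \<open>L1\<close> to \<open>L2\<close> without Hoelder. The
      weights are tuned to second moments of order \<open>(1 / 4) ^ n\<close>, so that both terms
      contribute order \<open>(1 / 2) ^ n\<close>.\<close>
    have le: "\<bar>x\<bar> \<le> 2 ^ n * x\<^sup>2 + (1 / 2) ^ n" for x :: real
    proof (cases "\<bar>x\<bar> \<le> (1 / 2) ^ n")
      case False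
      have "\<bar>x\<bar> = 2 ^ n * ((1 / 2) ^ n * \<bar>x\<bar>)" by (simp add: power_divide)
      also have "\<dots> \<le> 2 ^ n * (\<bar>x\<bar> * \<bar>x\<bar>)" using False by (intro mult_left_mono mult_right_mono) auto
      finally show ?thesis by (simp add: power2_eq_square add_increasing2)
    qed (simp add: add_increasing)
    have "(\<integral>\<^sup>+\<omega>. ennreal \<bar>Y (Suc n) \<omega> - Y n \<omega>\<bar> \<partial>M) \<le> (\<integral>\<^sup>+\<omega>. ennreal (2 ^ n * (Y n \<omega> - Y (Suc n) \<omega>)\<^sup>2 + (1 / 2) ^ n) \<partial>M)"
      by (intro nn_integral_mono ennreal_leI) (use le in \<open>metis abs_minus_commute\<close>)
    also have "\<dots> = ennreal (\<integral>\<omega>. 2 ^ n * (Y n \<omega> - Y (Suc n) \<omega>)\<^sup>2 + (1 / 2) ^ n \<partial>M)"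
      by (rule nn_integral_eq_integral) (auto simp: i2)
    also have "(\<integral>\<omega>. 2 ^ n * (Y n \<omega> - Y (Suc n) \<omega>)\<^sup>2 + (1 / 2) ^ n \<partial>M) = 2 ^ n * (\<integral>\<omega>. (Y n \<omega> - Y (Suc n) \<omega>)\<^sup>2 \<partial>M) + (1 / 2) ^ n"
      by (simp add: i2 prob_space)
    also have "\<dots> \<le> 2 ^ n * (C * (1 / 4) ^ n) + (1 / 2) ^ n"
      by (intro add_right_mono mult_left_mono b) auto
    also have "\<dots> = (C + 1) * (1 / 2) ^ n"
    proof -
      have "(2::real) ^ n * (1 / 4) ^ n = (1 / 2) ^ n" by (simp add: power_mult_distrib[symmetric])
      then show ?thesis by (simp add: algebra_simps)
    qed
    finally show ?thesis by (simp add: ennreal_leI)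
  qed
  have "(\<integral>\<^sup>+\<omega>. (\<Sum>n. ennreal \<bar>Y (Suc n) \<omega> - Y n \<omega>\<bar>) \<partial>M) = (\<Sum>n. \<integral>\<^sup>+\<omega>. ennreal \<bar>Y (Suc n) \<omega> - Y n \<omega>\<bar> \<partial>M)"
    by (rule nn_integral_suminf) simp
  also have "\<dots> \<le> (\<Sum>n. ennreal ((C + 1) * (1 / 2) ^ n))" by (intro suminf_le step) auto
  also have "\<dots> < \<infinity>"
    using C by (subst suminf_ennreal2) (auto intro!: summable_mult summable_geometric)
  finally have "AE \<omega> in M. (\<Sum>n. ennreal \<bar>Y (Suc n) \<omega> - Y n \<omega>\<bar>) \<noteq> \<infinity>"
    by (intro nn_integral_PInf_AE) auto
  then have conv: "AE \<omega> in M. (\<lambda>n. Y n \<omega>) \<longlonglongrightarrow> Z \<omega>"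
  proof eventually_elim
    case (elim \<omega>)
    then have "summable (\<lambda>n. \<bar>Y (Suc n) \<omega> - Y n \<omega>\<bar>)" by (intro summable_suminf_not_top) auto
    then have "summable (\<lambda>n. Y (Suc n) \<omega> - Y n \<omega>)" by (rule summable_rabs_cancel)
    moreover have t: "(\<Sum>i<n. Y (Suc i) \<omega> - Y i \<omega>) = Y n \<omega> - Y 0 \<omega>" for n
      by (rule sum_lessThan_telescope)
    ultimately have "(\<lambda>n. Y n \<omega> - Y 0 \<omega>) \<longlonglongrightarrow> (\<Sum>n. Y (Suc n) \<omega> - Y n \<omega>)"
      using summable_LIMSEQ[of "\<lambda>n. Y (Suc n) \<omega> - Y n \<omega>"] unfolding t by blast
    from tendsto_add[OF this tendsto_const[of "Y 0 \<omega>"]] have "convergent (\<lambda>n. Y n \<omega>)" by (auto simp: convergent_def)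
    then show ?case by (simp add: Z_def convergent_LIMSEQ_iff)
  qed
  have bound: "(\<integral>\<^sup>+\<omega>. ennreal ((Y n \<omega> - Z \<omega>)\<^sup>2) \<partial>M) \<le> ennreal (C * (1 / 4) ^ n)" for n
  proof -
    have "(\<integral>\<^sup>+\<omega>. ennreal ((Y n \<omega> - Z \<omega>)\<^sup>2) \<partial>M) = (\<integral>\<^sup>+\<omega>. liminf (\<lambda>m. ennreal ((Y n \<omega> - Y m \<omega>)\<^sup>2)) \<partial>M)"
    proof (rule nn_integral_cong_AE, use conv in eventually_elim)
      case (elim \<omega>)
      have "(\<lambda>m. ennreal ((Y n \<omega> - Y m \<omega>)\<^sup>2)) \<longlonglongrightarrow> ennreal ((Y n \<omega> - Z \<omega>)\<^sup>2)"
        by (intro tendsto_ennrealI tendsto_intros elim)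
      then show ?case by (intro lim_imp_Liminf[symmetric]) simp_all
    qed
    also have "\<dots> \<le> liminf (\<lambda>m. \<integral>\<^sup>+\<omega>. ennreal ((Y n \<omega> - Y m \<omega>)\<^sup>2) \<partial>M)"
      by (rule nn_integral_liminf) measurable
    also have "\<dots> \<le> limsup (\<lambda>m. \<integral>\<^sup>+\<omega>. ennreal ((Y n \<omega> - Y m \<omega>)\<^sup>2) \<partial>M)" by (rule Liminf_le_Limsup) simp
    also have "\<dots> \<le> ennreal (C * (1 / 4) ^ n)"
    proof (rule Limsup_bounded)
      show "\<forall>\<^sub>F m in sequentially. (\<integral>\<^sup>+\<omega>. ennreal ((Y n \<omega> - Y m \<omega>)\<^sup>2) \<partial>M) \<le> ennreal (C * (1 / 4) ^ n)"
        using eventually_ge_at_top[of n]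
        by eventually_elim (use b in \<open>simp add: nn_integral_eq_integral[OF i2] ennreal_leI\<close>)
    qed
    finally show ?thesis .
  qed
  have sq: "integrable M (\<lambda>\<omega>. (Y n \<omega> - Z \<omega>)\<^sup>2)" for n
    by (rule integrableI_nonneg) (use bound[of n] in \<open>auto simp: order_le_less_trans\<close>)
  have D: "(\<lambda>\<omega>. Y 0 \<omega> - Z \<omega>) \<in> square_integrable M" using sq by (simp add: square_integrable_def)
  from square_integrable_diff(1)[OF Y[of 0] this] show "(\<lambda>\<omega>. lim (\<lambda>n. Y n \<omega>)) \<in> square_integrable M" by (simp add: Z_def)
  have "ennreal (\<integral>\<omega>. (Y n \<omega> - Z \<omega>)\<^sup>2 \<partial>M) \<le> ennreal (C * (1 / 4) ^ n)"
    using bound[of n] nn_integral_eq_integral[OF sq[of n]] by simp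
  then show "(\<integral>\<omega>. (Y n \<omega> - lim (\<lambda>n. Y n \<omega>))\<^sup>2 \<partial>M) \<le> C * (1 / 4) ^ n"
    using C by (simp add: Z_def ennreal_le_iff)
qed

lemma square_integrable_complete:
  assumes Y: "\<And>n. Y n \<in> square_integrable M"
    and b: "\<And>e. 0 < e \<Longrightarrow> \<exists>N. \<forall>m\<ge>N. \<forall>n\<ge>N. (\<integral>\<omega>. (Y m \<omega> - Y n \<omega>)\<^sup>2 \<partial>M) < e"
  shows "\<exists>Z\<in>square_integrable M. (\<lambda>n. \<integral>\<omega>. (Y n \<omega> - Z \<omega>)\<^sup>2 \<partial>M) \<longlonglongrightarrow> 0"
proof -
  have "\<exists>N. \<forall>m\<ge>N. \<forall>n\<ge>N. (\<integral>\<omega>. (Y m \<omega> - Y n \<omega>)\<^sup>2 \<partial>M) < (1 / 4) ^ k" for k :: nat by (rule b) simp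
  then obtain N where N: "\<And>k m n. m \<ge> N k \<Longrightarrow> n \<ge> N k \<Longrightarrow> (\<integral>\<omega>. (Y m \<omega> - Y n \<omega>)\<^sup>2 \<partial>M) < (1 / 4) ^ k" by metis
  \<comment> \<open>Partial sums dominate every threshold \<open>N j\<close> with
    \<open>j <= k\<close>, so \<open>r m\<close> passes the threshold \<open>N k\<close> for all
    \<open>m >= k\<close>, with no monotonicity of \<open>N\<close>.\<close>
  define r where "r k = (\<Sum>i\<le>k. N i)" for k
  have r: "N k \<le> r m" if "k \<le> m" for k m
    unfolding r_def using member_le_sum[of k "{..m}" N] that by simp
  let ?Y = "\<lambda>k. Y (r k)"
  have b': "(\<integral>\<omega>. (?Y n \<omega> - ?Y m \<omega>)\<^sup>2 \<partial>M) \<le> 1 * (1 / 4) ^ n" if "n \<le> m" for n m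
    using N[OF r[of n n] r[OF that]] by simp
  define Z where "Z = (\<lambda>\<omega>. lim (\<lambda>n. ?Y n \<omega>))"
  have Z: "Z \<in> square_integrable M" "\<And>n. (\<integral>\<omega>. (?Y n \<omega> - Z \<omega>)\<^sup>2 \<partial>M) \<le> 1 * (1 / 4) ^ n"
    unfolding Z_def by (rule square_integrable_lim[OF Y _ b']; simp)+
  have "(\<lambda>n. \<integral>\<omega>. (Y n \<omega> - Z \<omega>)\<^sup>2 \<partial>M) \<longlonglongrightarrow> 0"
  proof (rule LIMSEQ_I)
    fix e :: real assume e: "e > 0"
    \<comment> \<open>The squared triangle inequality doubles the two errors, each at most
      \<open>(1 / 4) ^ k\<close>.\<close>
    have "(\<lambda>k. 4 * (1 / 4 :: real) ^ k) \<longlonglongrightarrow> 0" by (intro tendsto_mult_right_zero LIMSEQ_realpow_zero) auto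
    then have "\<forall>\<^sub>F k in sequentially. 4 * (1 / 4) ^ k < e" using e by (rule order_tendstoD)
    then obtain k :: nat where k: "4 * (1 / 4) ^ k < e" by (auto simp: eventually_sequentially)
    show "\<exists>no. \<forall>n\<ge>no. norm ((\<integral>\<omega>. (Y n \<omega> - Z \<omega>)\<^sup>2 \<partial>M) - 0) < e"
    proof (intro exI[of _ "N k"] allI impI)
      fix n assume "n \<ge> N k"
      then have "(\<integral>\<omega>. (Y n \<omega> - Z \<omega>)\<^sup>2 \<partial>M) < e"
        using square_integrable_triangle[OF Y[of n] Y[of "r k"] Z(1)] N[of k n "r k"] r[of k k] Z(2)[of k] k by simp
      then show "norm ((\<integral>\<omega>. (Y n \<omega> - Z \<omega>)\<^sup>2 \<partial>M) - 0) < e" by simp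
    qed
  qed
  then show ?thesis using Z(1) by blast
qed

end

lemma centered_gaussian_square_integrable:
  assumes "prob_space P" "centered_gaussian_rv P Y"
  shows "Y \<in> square_integrable P"
proof -
  have m: "Y \<in> borel_measurable P" using assms(2) by (simp add: centered_gaussian_rv_def)
  consider "AE \<omega> in P. Y \<omega> = 0" | \<sigma> where "\<sigma> > 0" "distributed P lborel Y (\<lambda>x. ennreal (normal_density 0 \<sigma> x))"
    using assms(2) by (auto simp: centered_gaussian_rv_def)
  then have "integrable P (\<lambda>\<omega>. (Y \<omega>)\<^sup>2)"
  proof cases
    case 1
    then have "AE \<omega> in P. (Y \<omega>)\<^sup>2 = 0" by eventually_elim simp
    then have "integrable P (\<lambda>\<omega>. (Y \<omega>)\<^sup>2) \<longleftrightarrow> integrable P (\<lambda>\<omega>. 0 :: real)"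
      using m by (intro integrable_cong_AE) auto
    then show ?thesis by simp
  next
    case 2
    have "integrable lborel (\<lambda>x. normal_density 0 \<sigma> x * x\<^sup>2)"
      using integrable_normal_moment[OF 2(1), of 0 2] by simp
    then show ?thesis
      using distributed_integrable[OF 2(2), of "\<lambda>x. x\<^sup>2"] by simp
  qed
  then show ?thesis using m by (simp add: square_integrable_def)
qed

section \<open>The noise integral\<close>

lemma time_form_cmult_left: "time_form T H (\<lambda>u. complex_of_real t * f u) g = t * time_form T H f g"
proof -
  have "Re (complex_of_real t * a * cnj b) = t * Re (a * cnj b)" for a b by (simp add: algebra_simps)
  then show ?thesis
    unfolding time_form_def by (simp only: mult.left_commute[of _ t] integral_mult_right_zero)
qed

context noise_space
begin

lemma profiles_cmult:
  assumes F: "F \<in> profiles" shows "(\<lambda>\<xi> u. complex_of_real t * F \<xi> u) \<in> profiles"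
proof -
  note [measurable] = profiles_measurable[OF F]
  obtain M where M: "\<And>\<xi> u. norm (F \<xi> u) \<le> M" using F by (auto simp: profiles_def)
  have e: "nm (\<lambda>u. complex_of_real t * f u) = (\<lambda>u. complex_of_real \<bar>t\<bar> * nm f u)" for f :: "real \<Rightarrow> complex"
    by (simp add: norm_mult)
  have "norm (complex_of_real t * F \<xi> u) \<le> \<bar>t\<bar> * M" for \<xi> u using M by (simp add: norm_mult mult_left_mono)
  moreover have "integrable \<mu> (\<lambda>\<xi>. tf (nm (\<lambda>u. complex_of_real t * F \<xi> u)) (nm (\<lambda>u. complex_of_real t * F \<xi> u)))"
    unfolding e time_form_cmult_square using F by (simp add: profiles_def)
  ultimately show ?thesis unfolding profiles_def by (auto intro!: exI[of _ "\<bar>t\<bar> * M"])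
qed

lemma profile_cmult: "profile T (\<lambda>z. t * \<phi> z) = (\<lambda>\<xi> u. complex_of_real t * profile T \<phi> \<xi> u)"
  by (intro ext) (simp add: profile_def space_fourier_def fourier_def mult.left_commute[of _ "complex_of_real t"])

lemma regular_cmult:
  assumes "\<phi> \<in> regular" shows "(\<lambda>z. t * \<phi> z) \<in> regular"
proof -
  have "set_borel_measurable borel ({0<..<T} \<times> UNIV) (\<lambda>z. t * \<phi> z)"
    using assms unfolding regular_def set_borel_measurable_def
    by (auto simp: mult.left_commute[of _ t] intro: borel_measurable_times)
  then show ?thesis using assms by (auto simp: regular_def profile_cmult intro!: profiles_cmult)
qed

lemma hp_inner_cmult_left:
  "\<phi> \<in> regular \<Longrightarrow> \<psi> \<in> regular \<Longrightarrow> hp (\<lambda>z. t * \<phi> z) \<psi> = t * hp \<phi> \<psi>"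
  by (simp add: hp_inner_eq_profile_form regular_cmult profile_cmult profile_form_def time_form_cmult_left)

end

locale noise = noise_space T H c \<mu> for T H c :: real and \<mu> :: "'a::euclidean_space measure" +
  fixes P :: "'w measure" and B :: "(real \<times> 'a \<Rightarrow> real) \<Rightarrow> 'w \<Rightarrow> real"
  assumes noise: "fractional_colored_noise P T H c \<mu> B"
begin

sublocale prob_space P using noise by (simp add: fractional_colored_noise_def)

lemma B_square_integrable:
  assumes "\<phi> \<in> test_functions T" shows "B \<phi> \<in> square_integrable P"
proof -
  have "\<forall>S a. finite S \<and> S \<subseteq> test_functions T \<longrightarrow> centered_gaussian_rv P (\<lambda>\<omega>. \<Sum>i\<in>S. a i * B i \<omega>)"
    using noise by (simp add: fractional_colored_noise_def centered_gaussian_process_def)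
  from this[rule_format, of "{\<phi>}" "\<lambda>_. 1"] have "centered_gaussian_rv P (\<lambda>\<omega>. B \<phi> \<omega>)"
    using assms by simp
  then show ?thesis by (rule centered_gaussian_square_integrable[OF prob_space_axioms])
qed

lemma B_covariance:
  "\<phi> \<in> test_functions T \<Longrightarrow> \<psi> \<in> test_functions T \<Longrightarrow> (\<integral>\<omega>. B \<phi> \<omega> * B \<psi> \<omega> \<partial>P) = hp \<phi> \<psi>"
  using noise by (simp add: fractional_colored_noise_def)

lemma B_square: "\<phi> \<in> test_functions T \<Longrightarrow> (\<integral>\<omega>. (B \<phi> \<omega>)\<^sup>2 \<partial>P) = hp \<phi> \<phi>"
  using B_covariance[of \<phi> \<phi>] by (simp add: power2_eq_square)

lemma B_isometry:
  assumes "\<phi> \<in> test_functions T" "\<psi> \<in> test_functions T"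
  shows "(\<integral>\<omega>. (B \<phi> \<omega> - B \<psi> \<omega>)\<^sup>2 \<partial>P) = hp (\<lambda>z. \<phi> z - \<psi> z) (\<lambda>z. \<phi> z - \<psi> z)"
  using assms by (simp add: square_integrable_diff(2) B_square_integrable hp_inner_diff_square
    test_function_regular B_square B_covariance)

text \<open>The bound uniform in time is what survives truncation and mollification, and is the
  input to the approximation by test functions.\<close>

definition admissible :: "(real \<times> 'a \<Rightarrow> real) set" where
  "admissible = {\<phi>\<in>regular. \<exists>M. \<forall>u. 0 < u \<longrightarrow> u < T \<longrightarrow> (\<integral>x. \<bar>\<phi> (u, x)\<bar> \<partial>lborel) \<le> M}"

lemma admissible_regular: "\<phi> \<in> admissible \<Longrightarrow> \<phi> \<in> regular" by (simp add: admissible_def)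

abbreviation "hpd \<phi> \<psi> \<equiv> hp (\<lambda>z. \<phi> z - \<psi> z) (\<lambda>z. \<phi> z - \<psi> z)"

lemma hpd_commute: "\<phi> \<in> regular \<Longrightarrow> \<psi> \<in> regular \<Longrightarrow> hpd \<phi> \<psi> = hpd \<psi> \<phi>"
  by (simp add: hp_inner_diff_square hp_inner_commute)

lemma hpd_nonneg: "\<phi> \<in> regular \<Longrightarrow> \<psi> \<in> regular \<Longrightarrow> 0 \<le> hpd \<phi> \<psi>"
  by (intro hp_inner_nonneg regular_diff)

lemma hp_norm_tendsto_iff:
  assumes "\<And>n. \<Phi> n \<in> regular" "\<phi> \<in> regular"
  shows "(\<lambda>n. hp_norm T H c \<mu> (\<lambda>z. \<Phi> n z - \<phi> z)) \<longlonglongrightarrow> 0 \<longleftrightarrow> (\<lambda>n. hpd (\<Phi> n) \<phi>) \<longlonglongrightarrow> 0"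
proof
  assume "(\<lambda>n. hp_norm T H c \<mu> (\<lambda>z. \<Phi> n z - \<phi> z)) \<longlonglongrightarrow> 0"
  then have "(\<lambda>n. (hp_norm T H c \<mu> (\<lambda>z. \<Phi> n z - \<phi> z))\<^sup>2) \<longlonglongrightarrow> 0\<^sup>2" by (rule tendsto_power)
  then show "(\<lambda>n. hpd (\<Phi> n) \<phi>) \<longlonglongrightarrow> 0" using hpd_nonneg[OF assms] by (simp add: hp_norm_def)
next
  assume "(\<lambda>n. hpd (\<Phi> n) \<phi>) \<longlonglongrightarrow> 0"
  then have "(\<lambda>n. sqrt (hpd (\<Phi> n) \<phi>)) \<longlonglongrightarrow> sqrt 0" by (rule tendsto_real_sqrt)
  then show "(\<lambda>n. hp_norm T H c \<mu> (\<lambda>z. \<Phi> n z - \<phi> z)) \<longlonglongrightarrow> 0" by (simp add: hp_norm_def)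
qed

lemma hp_limit:
  assumes \<Phi>: "\<And>n. \<Phi> n \<in> regular" and \<phi>: "\<phi> \<in> regular" and l: "(\<lambda>n. hpd (\<Phi> n) \<phi>) \<longlonglongrightarrow> 0"
  shows "(\<lambda>n. hp (\<Phi> n) (\<Phi> n)) \<longlonglongrightarrow> hp \<phi> \<phi>"
proof -
  let ?D = "\<lambda>n z. \<Phi> n z - \<phi> z"
  have D: "?D n \<in> regular" for n by (rule regular_diff[OF \<Phi> \<phi>])
  \<comment> \<open>The expansion of squares is available for differences, so the quadratic in
    \<open>t\<close> is formed from \<phi> minus a multiple of the difference. This flips the sign
    of the middle coefficient, harmlessly since it is squared.\<close>
  have cs: "(- hp \<phi> (?D n))\<^sup>2 \<le> hp \<phi> \<phi> * hpd (\<Phi> n) \<phi>" for n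
  proof (rule quadratic_nonneg_imp)
    fix t
    note tD = regular_cmult[OF D[of n], of t]
    have "0 \<le> hp \<phi> \<phi> - 2 * hp \<phi> (\<lambda>z. t * ?D n z) + hp (\<lambda>z. t * ?D n z) (\<lambda>z. t * ?D n z)"
      unfolding hp_inner_diff_square[OF \<phi> tD, symmetric] by (rule hp_inner_nonneg[OF regular_diff[OF \<phi> tD]])
    also have "\<dots> = hp \<phi> \<phi> + 2 * t * - hp \<phi> (?D n) + t\<^sup>2 * hpd (\<Phi> n) \<phi>"
      unfolding hp_inner_commute[OF \<phi> tD] hp_inner_cmult_left[OF D tD] hp_inner_cmult_left[OF D \<phi>]
        hp_inner_commute[OF D tD] hp_inner_cmult_left[OF D D] hp_inner_commute[OF D \<phi>]
      by (simp add: power2_eq_square)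
    finally show "0 \<le> hp \<phi> \<phi> + 2 * t * - hp \<phi> (?D n) + t\<^sup>2 * hpd (\<Phi> n) \<phi>" .
  qed
  have "(\<lambda>n. hp \<phi> \<phi> + 2 * hp \<phi> (?D n) + hpd (\<Phi> n) \<phi>) \<longlonglongrightarrow> hp \<phi> \<phi>"
    by (rule square_norm_limit[OF l]) (use cs in simp)
  moreover have "hp (\<Phi> n) (\<Phi> n) = hp \<phi> \<phi> + 2 * hp \<phi> (?D n) + hpd (\<Phi> n) \<phi>" for n
  proof -
    have "hp \<phi> (?D n) = hp (\<Phi> n) \<phi> - hp \<phi> \<phi>"
      using hp_inner_commute[OF \<phi> D] hp_inner_diff_left[OF \<Phi> \<phi> \<phi>] by simp
    then show ?thesis using hp_inner_diff_square[OF \<Phi> \<phi>] by simp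
  qed
  ultimately show ?thesis by simp
qed

lemma test_approximation:
  assumes "\<phi> \<in> admissible"
  obtains \<Phi> where "\<And>n. \<Phi> n \<in> test_functions T" "(\<lambda>n. hpd (\<Phi> n) \<phi>) \<longlonglongrightarrow> 0"
proof -
  obtain M where M: "\<phi> \<in> regular" "\<And>u. 0 < u \<Longrightarrow> u < T \<Longrightarrow> (\<integral>x. \<bar>\<phi> (u, x)\<bar> \<partial>lborel) \<le> M"
    using assms by (auto simp: admissible_def)
  have "\<exists>\<psi>\<in>test_functions T. hpd \<psi> \<phi> < 1 / real (Suc n)" for n
    by (rule test_functions_dense[OF M]) auto
  then obtain \<Phi> where \<Phi>: "\<And>n. \<Phi> n \<in> test_functions T" "\<And>n. hpd (\<Phi> n) \<phi> < 1 / real (Suc n)" by metis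
  have "(\<lambda>n. 1 / real (Suc n)) \<longlonglongrightarrow> 0" by real_asymp
  then have "(\<lambda>n. hpd (\<Phi> n) \<phi>) \<longlonglongrightarrow> 0"
    by (rule tendsto_sandwich[OF _ _ tendsto_const, rotated 2])
       (use \<Phi> hpd_nonneg[OF test_function_regular M(1)] in \<open>auto intro!: always_eventually less_imp_le\<close>)
  with \<Phi>(1) show ?thesis by (rule that)
qed

lemma hp_Cauchy_iff:
  "hp_Cauchy T H c \<mu> \<Phi> \<longleftrightarrow> (\<forall>n. \<Phi> n \<in> test_functions T) \<and> (\<forall>e>0. \<exists>N. \<forall>m\<ge>N. \<forall>n\<ge>N. hpd (\<Phi> m) (\<Phi> n) < e)"
proof -
  have 1: "hp_norm T H c \<mu> (\<lambda>z. \<Phi> m z - \<Phi> n z) < sqrt e \<longleftrightarrow> hpd (\<Phi> m) (\<Phi> n) < e" for m n e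
    by (simp add: hp_norm_def)
  have 2: "(\<forall>e>0. \<exists>N. \<forall>m\<ge>N. \<forall>n\<ge>N. a m n < e) \<longleftrightarrow> (\<forall>e>0. \<exists>N. \<forall>m\<ge>N. \<forall>n\<ge>N. a m n < sqrt e)"
    for a :: "nat \<Rightarrow> nat \<Rightarrow> real"
  proof (intro iffI allI impI)
    fix e :: real assume *: "\<forall>e>0. \<exists>N. \<forall>m\<ge>N. \<forall>n\<ge>N. a m n < sqrt e" and e: "e > 0"
    then show "\<exists>N. \<forall>m\<ge>N. \<forall>n\<ge>N. a m n < e" using *[rule_format, of "e\<^sup>2"] by simp
  qed simp
  show ?thesis unfolding hp_Cauchy_def 2 1 ..
qed

lemma tendsto_imp_hp_Cauchy:
  assumes \<Phi>: "\<And>n. \<Phi> n \<in> test_functions T" and \<phi>: "\<phi> \<in> regular" and l: "(\<lambda>n. hpd (\<Phi> n) \<phi>) \<longlonglongrightarrow> 0"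
  shows "hp_Cauchy T H c \<mu> \<Phi>"
  unfolding hp_Cauchy_iff
proof (intro conjI allI impI \<Phi>)
  fix e :: real assume "e > 0"
  then have "0 < e / 4" by simp
  then have "\<forall>\<^sub>F n in sequentially. hpd (\<Phi> n) \<phi> < e / 4" by (rule order_tendstoD(2)[OF l])
  then obtain N where N: "\<And>n. n \<ge> N \<Longrightarrow> hpd (\<Phi> n) \<phi> < e / 4" by (auto simp: eventually_sequentially)
  show "\<exists>N. \<forall>m\<ge>N. \<forall>n\<ge>N. hpd (\<Phi> m) (\<Phi> n) < e"
  proof (intro exI[of _ N] allI impI)
    fix m n assume "m \<ge> N" "n \<ge> N"
    note r = test_function_regular[OF \<Phi>]
    show "hpd (\<Phi> m) (\<Phi> n) < e"
      using hp_inner_triangle[OF r[of m] \<phi> r[of n]] hpd_commute[OF \<phi> r[of n]] N[OF \<open>m \<ge> N\<close>] N[OF \<open>n \<ge> N\<close>] by linarith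
  qed
qed

text \<open>The element of the completion is the class of an approximating sequence of test
  functions. Any equivalent sequence converges to \<phi> as well, by the squared triangle
  inequality.\<close>

lemma hp_represents_exists:
  assumes "\<phi> \<in> admissible" obtains h \<Phi> where "hp_represents T H c \<mu> h \<phi>" "\<Phi> \<in> h" "\<And>n. \<Phi> n \<in> test_functions T"
    "\<And>\<Phi>'. \<Phi>' \<in> h \<Longrightarrow> hp_Cauchy T H c \<mu> \<Phi>' \<and> (\<lambda>n. hpd (\<Phi> n) (\<Phi>' n)) \<longlonglongrightarrow> 0" "hp_Cauchy T H c \<mu> \<Phi>"
proof -
  note r = admissible_regular[OF assms]
  obtain \<Phi> where \<Phi>: "\<And>n. \<Phi> n \<in> test_functions T" "(\<lambda>n. hpd (\<Phi> n) \<phi>) \<longlonglongrightarrow> 0" using test_approximation[OF assms] by blast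
  note C = tendsto_imp_hp_Cauchy[OF \<Phi>(1) r \<Phi>(2)]
  define h where "h = hp_equiv T H c \<mu> `` {\<Phi>}"
  \<comment> \<open>Needed for reflexivity of \<open>hp_equiv\<close>, which places the chosen
    sequence in its own class.\<close>
  have hp0: "hp (\<lambda>z. 0) (\<lambda>z. 0) = 0" by (simp add: hp_inner_def space_fourier_def fourier_def)
  have 1: "h \<in> HP T H c \<mu>" unfolding HP_def h_def using C by (intro quotientI) simp
  have 2: "\<Phi> \<in> h" unfolding h_def hp_equiv_def using C by (simp add: hp_norm_def hp0)
  have 3: "hp_Cauchy T H c \<mu> \<Phi>' \<and> (\<lambda>n. hpd (\<Phi> n) (\<Phi>' n)) \<longlonglongrightarrow> 0" if "\<Phi>' \<in> h" for \<Phi>'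
  proof -
    have C': "hp_Cauchy T H c \<mu> \<Phi>'" and l: "(\<lambda>n. hp_norm T H c \<mu> (\<lambda>z. \<Phi> n z - \<Phi>' n z)) \<longlonglongrightarrow> 0"
      using that unfolding h_def hp_equiv_def by auto
    have t: "\<Phi>' n \<in> regular" for n using C' by (intro test_function_regular) (simp add: hp_Cauchy_def)
    from l have "(\<lambda>n. (hp_norm T H c \<mu> (\<lambda>z. \<Phi> n z - \<Phi>' n z))\<^sup>2) \<longlonglongrightarrow> 0\<^sup>2" by (rule tendsto_power)
    then have "(\<lambda>n. hpd (\<Phi> n) (\<Phi>' n)) \<longlonglongrightarrow> 0"
      using hpd_nonneg[OF test_function_regular[OF \<Phi>(1)] t] by (simp add: hp_norm_def)
    then show ?thesis using C' by blast
  qed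
  have 4: "hp_represents T H c \<mu> h \<phi>"
    unfolding hp_represents_def
  proof (intro conjI ballI 1 regular_hp_function r)
    fix \<Phi>' assume "\<Phi>' \<in> h"
    note \<Phi>' = 3[OF this]
    have t: "\<Phi>' n \<in> regular" for n using \<Phi>' by (intro test_function_regular) (simp add: hp_Cauchy_def)
    have "(\<lambda>n. 2 * hpd (\<Phi>' n) (\<Phi> n) + 2 * hpd (\<Phi> n) \<phi>) \<longlonglongrightarrow> 2 * 0 + 2 * 0"
      using \<Phi>' \<Phi>(2) hpd_commute[OF t test_function_regular[OF \<Phi>(1)]] by (intro tendsto_intros) simp_all
    then have l: "(\<lambda>n. 2 * hpd (\<Phi>' n) (\<Phi> n) + 2 * hpd (\<Phi> n) \<phi>) \<longlonglongrightarrow> 0" by simp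
    have "(\<lambda>n. hpd (\<Phi>' n) \<phi>) \<longlonglongrightarrow> 0"
      by (rule tendsto_sandwich[OF _ _ tendsto_const l])
         (use hpd_nonneg[OF t r] hp_inner_triangle[OF t test_function_regular[OF \<Phi>(1)] r] in auto)
    then show "(\<lambda>n. hp_norm T H c \<mu> (\<lambda>z. \<Phi>' n z - \<phi> z)) \<longlonglongrightarrow> 0"
      by (subst hp_norm_tendsto_iff[OF t r])
  qed
  show ?thesis by (rule that[OF 4 2 \<Phi>(1) 3 C])
qed

section \<open>Existence, isometry and stability of noise integrals\<close>

abbreviation "hni \<equiv> has_noise_integral P T H c \<mu> B"

text \<open>The isometry makes the noises of an approximating sequence Cauchy in \<open>L2\<close>.
  Their limit is shared by all sequences of the class, because equivalent sequences have noises at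
  vanishing distance.\<close>

lemma noise_integral_exists:
  assumes "\<phi> \<in> admissible" shows "\<exists>Z. hni \<phi> Z"
proof -
  obtain h \<Phi> where h: "hp_represents T H c \<mu> h \<phi>" "\<Phi> \<in> h" "\<And>n. \<Phi> n \<in> test_functions T"
    "\<And>\<Phi>'. \<Phi>' \<in> h \<Longrightarrow> hp_Cauchy T H c \<mu> \<Phi>' \<and> (\<lambda>n. hpd (\<Phi> n) (\<Phi>' n)) \<longlonglongrightarrow> 0" "hp_Cauchy T H c \<mu> \<Phi>"
    using hp_represents_exists[OF assms] by blast
  note BI = B_square_integrable[OF h(3)]
  obtain Z where Z: "Z \<in> square_integrable P" "(\<lambda>n. \<integral>\<omega>. (B (\<Phi> n) \<omega> - Z \<omega>)\<^sup>2 \<partial>P) \<longlonglongrightarrow> 0"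
    using square_integrable_complete[of "\<lambda>n. B (\<Phi> n)"] BI h(5) by (auto simp: B_isometry[OF h(3) h(3)] hp_Cauchy_iff)
  have "noise_extension P B h Z"
    unfolding noise_extension_def
  proof (intro conjI ballI)
    fix \<Phi>' assume "\<Phi>' \<in> h"
    note \<Phi>' = h(4)[OF this]
    have t: "\<Phi>' n \<in> test_functions T" for n using \<Phi>' by (simp add: hp_Cauchy_def)
    note BI' = B_square_integrable[OF t]
    have "(\<integral>\<omega>. (B (\<Phi>' n) \<omega> - Z \<omega>)\<^sup>2 \<partial>P) \<le> 2 * hpd (\<Phi> n) (\<Phi>' n) + 2 * (\<integral>\<omega>. (B (\<Phi> n) \<omega> - Z \<omega>)\<^sup>2 \<partial>P)" for n
      using square_integrable_triangle[OF BI' BI Z(1), of n n]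
      unfolding B_isometry[OF t h(3)] hpd_commute[OF test_function_regular[OF t] test_function_regular[OF h(3)]] .
    moreover have "(\<lambda>n. 2 * hpd (\<Phi> n) (\<Phi>' n) + 2 * (\<integral>\<omega>. (B (\<Phi> n) \<omega> - Z \<omega>)\<^sup>2 \<partial>P)) \<longlonglongrightarrow> 2 * 0 + 2 * 0"
      using \<Phi>' Z(2) by (intro tendsto_intros) auto
    ultimately have le: "(\<integral>\<omega>. (B (\<Phi>' n) \<omega> - Z \<omega>)\<^sup>2 \<partial>P) \<le> 2 * hpd (\<Phi> n) (\<Phi>' n) + 2 * (\<integral>\<omega>. (B (\<Phi> n) \<omega> - Z \<omega>)\<^sup>2 \<partial>P)"
      and l: "(\<lambda>n. 2 * hpd (\<Phi> n) (\<Phi>' n) + 2 * (\<integral>\<omega>. (B (\<Phi> n) \<omega> - Z \<omega>)\<^sup>2 \<partial>P)) \<longlonglongrightarrow> 0" for n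
      by simp_all
    show "(\<lambda>n. \<integral>\<omega>. (B (\<Phi>' n) \<omega> - Z \<omega>)\<^sup>2 \<partial>P) \<longlonglongrightarrow> 0"
      by (rule tendsto_sandwich[OF _ _ tendsto_const l]) (use le in auto)
  qed (use Z in \<open>auto simp: square_integrable_def\<close>)
  then show ?thesis using h(1) unfolding has_noise_integral_def by blast
qed

lemma noise_integral_sequence:
  assumes "hni \<phi> Z" "\<phi> \<in> regular"
  obtains \<Phi> where "\<And>n. \<Phi> n \<in> test_functions T" "(\<lambda>n. hpd (\<Phi> n) \<phi>) \<longlonglongrightarrow> 0"
    "(\<lambda>n. \<integral>\<omega>. (B (\<Phi> n) \<omega> - Z \<omega>)\<^sup>2 \<partial>P) \<longlonglongrightarrow> 0"
proof -
  obtain h where h: "hp_represents T H c \<mu> h \<phi>" "noise_extension P B h Z"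
    using assms(1) by (auto simp: has_noise_integral_def)
  have hp0: "hp (\<lambda>z. 0) (\<lambda>z. 0) = 0" by (simp add: hp_inner_def space_fourier_def fourier_def)
  obtain \<Phi> where \<Phi>: "hp_Cauchy T H c \<mu> \<Phi>" "h = hp_equiv T H c \<mu> `` {\<Phi>}"
    using h(1) by (auto simp: hp_represents_def HP_def quotient_def)
  have in_h: "\<Phi> \<in> h" unfolding \<Phi>(2) hp_equiv_def using \<Phi>(1) by (simp add: hp_norm_def hp0)
  have t: "\<Phi> n \<in> test_functions T" for n using \<Phi>(1) by (simp add: hp_Cauchy_def)
  show ?thesis
  proof (rule that[OF t])
    show "(\<lambda>n. hpd (\<Phi> n) \<phi>) \<longlonglongrightarrow> 0"
      by (subst hp_norm_tendsto_iff[OF test_function_regular[OF t] assms(2), symmetric])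
         (use h(1) in_h in \<open>simp add: hp_represents_def\<close>)
    show "(\<lambda>n. \<integral>\<omega>. (B (\<Phi> n) \<omega> - Z \<omega>)\<^sup>2 \<partial>P) \<longlonglongrightarrow> 0"
      using h(2) in_h by (simp add: noise_extension_def)
  qed
qed

lemma noise_integral_square_integrable: "hni \<phi> Z \<Longrightarrow> Z \<in> square_integrable P"
  by (auto simp: has_noise_integral_def noise_extension_def square_integrable_def)

lemma noise_integral_square:
  assumes "hni \<phi> Z" "\<phi> \<in> regular"
  shows "(\<integral>\<omega>. (Z \<omega>)\<^sup>2 \<partial>P) = hp \<phi> \<phi>"
proof -
  obtain \<Phi> where \<Phi>: "\<And>n. \<Phi> n \<in> test_functions T" "(\<lambda>n. hpd (\<Phi> n) \<phi>) \<longlonglongrightarrow> 0"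
    "(\<lambda>n. \<integral>\<omega>. (B (\<Phi> n) \<omega> - Z \<omega>)\<^sup>2 \<partial>P) \<longlonglongrightarrow> 0" using noise_integral_sequence[OF assms] by blast
  have "(\<lambda>n. hp (\<Phi> n) (\<Phi> n)) \<longlonglongrightarrow> (\<integral>\<omega>. (Z \<omega>)\<^sup>2 \<partial>P)"
    using square_integrable_limit[OF B_square_integrable[OF \<Phi>(1)] noise_integral_square_integrable[OF assms(1)] \<Phi>(3)]
    by (simp add: B_square \<Phi>(1))
  with hp_limit[OF test_function_regular[OF \<Phi>(1)] assms(2) \<Phi>(2)] show ?thesis by (rule LIMSEQ_unique[symmetric])
qed

text \<open>The distance identity for test functions passes to the limit on both sides. The
  covariance is then read off by polarization from distances and variances.\<close>

lemma noise_integral_isometry: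
  assumes Z: "hni \<phi> Z" and \<phi>: "\<phi> \<in> regular" and Y: "hni \<psi> Y" and \<psi>: "\<psi> \<in> regular"
  shows "(\<integral>\<omega>. (Z \<omega> - Y \<omega>)\<^sup>2 \<partial>P) = hpd \<phi> \<psi>" "(\<integral>\<omega>. Z \<omega> * Y \<omega> \<partial>P) = hp \<phi> \<psi>"
proof -
  obtain \<Phi> where \<Phi>: "\<And>n. \<Phi> n \<in> test_functions T" "(\<lambda>n. hpd (\<Phi> n) \<phi>) \<longlonglongrightarrow> 0"
    "(\<lambda>n. \<integral>\<omega>. (B (\<Phi> n) \<omega> - Z \<omega>)\<^sup>2 \<partial>P) \<longlonglongrightarrow> 0" using noise_integral_sequence[OF Z \<phi>] by blast
  obtain \<Psi> where \<Psi>: "\<And>n. \<Psi> n \<in> test_functions T" "(\<lambda>n. hpd (\<Psi> n) \<psi>) \<longlonglongrightarrow> 0"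
    "(\<lambda>n. \<integral>\<omega>. (B (\<Psi> n) \<omega> - Y \<omega>)\<^sup>2 \<partial>P) \<longlonglongrightarrow> 0" using noise_integral_sequence[OF Y \<psi>] by blast
  note r\<Phi> = test_function_regular[OF \<Phi>(1)] and r\<Psi> = test_function_regular[OF \<Psi>(1)]
  note L = B_square_integrable[OF \<Phi>(1)] B_square_integrable[OF \<Psi>(1)]
    noise_integral_square_integrable[OF Z] noise_integral_square_integrable[OF Y]
  let ?X = "\<lambda>n \<omega>. B (\<Phi> n) \<omega> - B (\<Psi> n) \<omega>" and ?W = "\<lambda>\<omega>. Z \<omega> - Y \<omega>"
  let ?\<theta> = "\<lambda>n z. \<Phi> n z - \<Psi> n z" and ?\<theta>' = "\<lambda>z. \<phi> z - \<psi> z"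
  have 1: "(\<lambda>n. \<integral>\<omega>. (?X n \<omega> - ?W \<omega>)\<^sup>2 \<partial>P) \<longlonglongrightarrow> 0"
  proof (rule tendsto_sandwich[OF _ _ tendsto_const])
    show "(\<lambda>n. 2 * (\<integral>\<omega>. (B (\<Phi> n) \<omega> - Z \<omega>)\<^sup>2 \<partial>P) + 2 * (\<integral>\<omega>. (B (\<Psi> n) \<omega> - Y \<omega>)\<^sup>2 \<partial>P)) \<longlonglongrightarrow> 0"
      using tendsto_add[OF tendsto_mult_right_zero[OF \<Phi>(3), of 2] tendsto_mult_right_zero[OF \<Psi>(3), of 2]] by simp
    have "(\<integral>\<omega>. (?X n \<omega> - ?W \<omega>)\<^sup>2 \<partial>P) \<le> 2 * (\<integral>\<omega>. (B (\<Phi> n) \<omega> - Z \<omega>)\<^sup>2 \<partial>P) + 2 * (\<integral>\<omega>. (B (\<Psi> n) \<omega> - Y \<omega>)\<^sup>2 \<partial>P)" for n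
    proof -
      have "(a - b - (z - b))\<^sup>2 = (a - z)\<^sup>2" "(z - b - (z - y))\<^sup>2 = (b - y)\<^sup>2" for a b y z :: real
        by (simp_all add: power2_commute)
      then show ?thesis
        using square_integrable_triangle[OF square_integrable_diff(1)[OF L(1)[of n] L(2)[of n]]
          square_integrable_diff(1)[OF L(3) L(2)[of n]] square_integrable_diff(1)[OF L(3,4)]] by simp
    qed
    then show "\<forall>\<^sub>F n in sequentially. (\<integral>\<omega>. (?X n \<omega> - ?W \<omega>)\<^sup>2 \<partial>P) \<le> 2 * (\<integral>\<omega>. (B (\<Phi> n) \<omega> - Z \<omega>)\<^sup>2 \<partial>P) + 2 * (\<integral>\<omega>. (B (\<Psi> n) \<omega> - Y \<omega>)\<^sup>2 \<partial>P)" by simp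
  qed simp
  have 2: "(\<lambda>n. hpd (?\<theta> n) ?\<theta>') \<longlonglongrightarrow> 0"
  proof (rule tendsto_sandwich[OF _ _ tendsto_const])
    show "(\<lambda>n. 2 * hpd (\<Phi> n) \<phi> + 2 * hpd (\<Psi> n) \<psi>) \<longlonglongrightarrow> 0"
      using tendsto_add[OF tendsto_mult_right_zero[OF \<Phi>(2), of 2] tendsto_mult_right_zero[OF \<Psi>(2), of 2]] by simp
    have "hpd (?\<theta> n) ?\<theta>' \<le> 2 * hpd (\<Phi> n) \<phi> + 2 * hpd (\<Psi> n) \<psi>" for n
    proof -
      have e: "a - b - (z - b) = a - z" "z - b - (z - y) = y - b" for a b y z :: real by simp_all
      have "hpd (?\<theta> n) ?\<theta>' \<le> 2 * hpd (\<Phi> n) \<phi> + 2 * hpd \<psi> (\<Psi> n)"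
        using hp_inner_triangle[OF regular_diff[OF r\<Phi>[of n] r\<Psi>[of n]] regular_diff[OF \<phi> r\<Psi>[of n]] regular_diff[OF \<phi> \<psi>]]
        unfolding e .
      then show ?thesis using hpd_commute[OF \<psi> r\<Psi>[of n]] by simp
    qed
    then show "\<forall>\<^sub>F n in sequentially. hpd (?\<theta> n) ?\<theta>' \<le> 2 * hpd (\<Phi> n) \<phi> + 2 * hpd (\<Psi> n) \<psi>" by simp
    show "\<forall>\<^sub>F n in sequentially. 0 \<le> hpd (?\<theta> n) ?\<theta>'"
      by (intro always_eventually allI hpd_nonneg regular_diff r\<Phi> r\<Psi> \<phi> \<psi>)
  qed
  have "(\<lambda>n. hpd (\<Phi> n) (\<Psi> n)) \<longlonglongrightarrow> (\<integral>\<omega>. (?W \<omega>)\<^sup>2 \<partial>P)"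
    using square_integrable_limit[OF square_integrable_diff(1)[OF L(1,2)] square_integrable_diff(1)[OF L(3,4)] 1]
    by (simp add: B_isometry[OF \<Phi>(1) \<Psi>(1)])
  with hp_limit[OF regular_diff[OF r\<Phi> r\<Psi>] regular_diff[OF \<phi> \<psi>] 2]
  show d: "(\<integral>\<omega>. (Z \<omega> - Y \<omega>)\<^sup>2 \<partial>P) = hpd \<phi> \<psi>" by (rule LIMSEQ_unique[symmetric])
  show "(\<integral>\<omega>. Z \<omega> * Y \<omega> \<partial>P) = hp \<phi> \<psi>"
    using d square_integrable_diff(2)[OF L(3,4)] hp_inner_diff_square[OF \<phi> \<psi>]
      noise_integral_square[OF Z \<phi>] noise_integral_square[OF Y \<psi>] by simp
qed

lemma noise_integral_cong:
  assumes Z: "hni \<phi> Z" and Z': "Z' \<in> square_integrable P" and e: "AE \<omega> in P. Z \<omega> = Z' \<omega>"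
  shows "hni \<phi> Z'"
proof -
  obtain h where h: "hp_represents T H c \<mu> h \<phi>" "noise_extension P B h Z"
    using Z by (auto simp: has_noise_integral_def)
  have "noise_extension P B h Z'"
    unfolding noise_extension_def
  proof (intro conjI ballI)
    fix \<Phi> assume \<Phi>: "\<Phi> \<in> h"
    then have "hp_Cauchy T H c \<mu> \<Phi>" using h(1) by (auto simp: hp_represents_def HP_def quotient_def hp_equiv_def)
    then have [measurable]: "B (\<Phi> n) \<in> borel_measurable P" for n
      by (intro square_integrable_measurable B_square_integrable) (simp add: hp_Cauchy_def)
    have [measurable]: "Z \<in> borel_measurable P" "Z' \<in> borel_measurable P"
      using noise_integral_square_integrable[OF Z] Z' by (auto simp: square_integrable_def)
    have i: "(\<integral>\<omega>. (B (\<Phi> n) \<omega> - Z' \<omega>)\<^sup>2 \<partial>P) = (\<integral>\<omega>. (B (\<Phi> n) \<omega> - Z \<omega>)\<^sup>2 \<partial>P)" for n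
      by (rule integral_cong_AE) (use e in \<open>auto elim!: eventually_mono\<close>)
    show "(\<lambda>n. \<integral>\<omega>. (B (\<Phi> n) \<omega> - Z' \<omega>)\<^sup>2 \<partial>P) \<longlonglongrightarrow> 0"
      unfolding i using h(2) \<Phi> by (simp add: noise_extension_def)
  qed (use Z' in \<open>auto simp: square_integrable_def\<close>)
  then show ?thesis using h(1) unfolding has_noise_integral_def by blast
qed

lemma AE_eq_of_square_zero:
  assumes "Y \<in> square_integrable P" "Z \<in> square_integrable P" "(\<integral>\<omega>. (Y \<omega> - Z \<omega>)\<^sup>2 \<partial>P) = 0"
  shows "AE \<omega> in P. Y \<omega> = Z \<omega>"
proof -
  have "integrable P (\<lambda>\<omega>. (Y \<omega> - Z \<omega>)\<^sup>2)"
    using square_integrable_diff(1)[OF assms(1,2)] by (simp add: square_integrable_def)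
  from integral_nonneg_eq_0_iff_AE[OF this] show ?thesis using assms(3) by simp
qed

text \<open>Compare \<open>Z\<close> with some noise integral \<open>Y\<close> of \<phi>. By the
  isometry \<open>Y\<close> is also an \<open>L2\<close> limit of the \<open>Z' k\<close>, so
  \<open>Y = Z\<close> almost surely, and being a noise integral is insensitive to null
  sets.\<close>

lemma noise_integral_limit:
  assumes \<phi>: "\<phi> \<in> admissible" and Z: "Z \<in> square_integrable P"
    and k: "\<And>k. hni (\<phi>' k) (Z' k)" "\<And>k. \<phi>' k \<in> regular"
    and l: "(\<lambda>k. hpd (\<phi>' k) \<phi>) \<longlonglongrightarrow> 0" "(\<lambda>k. \<integral>\<omega>. (Z' k \<omega> - Z \<omega>)\<^sup>2 \<partial>P) \<longlonglongrightarrow> 0"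
  shows "hni \<phi> Z"
proof -
  obtain Y where Y: "hni \<phi> Y" using noise_integral_exists[OF \<phi>] by blast
  note L = noise_integral_square_integrable[OF Y] noise_integral_square_integrable[OF k(1)]
  have "(\<lambda>k. 2 * hpd (\<phi>' k) \<phi> + 2 * (\<integral>\<omega>. (Z' k \<omega> - Z \<omega>)\<^sup>2 \<partial>P)) \<longlonglongrightarrow> 2 * 0 + 2 * 0"
    using l by (intro tendsto_intros)
  moreover have "(\<integral>\<omega>. (Y \<omega> - Z \<omega>)\<^sup>2 \<partial>P) \<le> 2 * hpd (\<phi>' k) \<phi> + 2 * (\<integral>\<omega>. (Z' k \<omega> - Z \<omega>)\<^sup>2 \<partial>P)" for k
    using square_integrable_triangle[OF L(1) L(2)[of k] Z]
      noise_integral_isometry(1)[OF Y admissible_regular[OF \<phi>] k(1)[of k] k(2)[of k]] hpd_commute[OF admissible_regular[OF \<phi>] k(2)[of k]] by simp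
  ultimately have "(\<integral>\<omega>. (Y \<omega> - Z \<omega>)\<^sup>2 \<partial>P) \<le> 0" by (intro LIMSEQ_le_const) auto
  moreover have "0 \<le> (\<integral>\<omega>. (Y \<omega> - Z \<omega>)\<^sup>2 \<partial>P)" by simp
  ultimately have "AE \<omega> in P. Y \<omega> = Z \<omega>" by (intro AE_eq_of_square_zero L(1) Z) linarith
  then show ?thesis by (rule noise_integral_cong[OF Y Z])
qed

end

section \<open>Transition densities\<close>

locale symmetric_levy =
  fixes Q :: "'v measure" and X :: "real \<Rightarrow> 'v \<Rightarrow> 'a::euclidean_space" and \<Psi> :: "'a \<Rightarrow> complex" and p :: "real \<Rightarrow> 'a \<Rightarrow> real"
  assumes levy: "levy_process Q X" and char_exponent: "has_char_exponent Q X \<Psi>"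
    and symmetric: "\<Psi> (- \<xi>) = \<Psi> \<xi>" and densities: "has_transition_densities Q X \<Psi> p"
begin

sublocale Q: prob_space Q using levy by (simp add: levy_process_def)

lemma X_measurable [measurable]: "0 \<le> t \<Longrightarrow> X t \<in> borel_measurable Q"
  using levy by (simp add: levy_process_def)

lemma char_fun: "0 \<le> t \<Longrightarrow> (\<integral>\<omega>. exp (\<i> * complex_of_real (\<xi> \<bullet> X t \<omega>)) \<partial>Q) = exp (- (complex_of_real t * \<Psi> \<xi>))"
  using char_exponent by (simp add: has_char_exponent_def)

definition \<psi> :: "'a \<Rightarrow> real" where "\<psi> \<xi> = Re (\<Psi> \<xi>)"

text \<open>By symmetry \<open>exp (- t * \<Psi> \<xi>)\<close> equals its conjugate for every
  \<open>t >= 0\<close>. A real value at one time would leave multiples of \<pi> for the imaginary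
  part, so the time is adapted to it.\<close>

lemma \<Psi>_eq: "\<Psi> \<xi> = complex_of_real (\<psi> \<xi>)"
proof -
  have "Im (\<Psi> \<xi>) = 0"
  proof (rule ccontr)
    assume n: "Im (\<Psi> \<xi>) \<noteq> 0"
    \<comment> \<open>At this time the phase is a quarter turn, where the sine is 1 or -1.\<close>
    define t where "t = pi / (2 * \<bar>Im (\<Psi> \<xi>)\<bar>)"
    have t: "t \<ge> 0" by (simp add: t_def)
    have "cnj (exp (- (complex_of_real t * \<Psi> \<xi>))) = (\<integral>\<omega>. cnj (exp (\<i> * complex_of_real (\<xi> \<bullet> X t \<omega>))) \<partial>Q)"
      unfolding char_fun[OF t, symmetric] by (rule Bochner_Integration.integral_cnj[symmetric])
    also have "\<dots> = (\<integral>\<omega>. exp (\<i> * complex_of_real ((- \<xi>) \<bullet> X t \<omega>)) \<partial>Q)"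
      by (simp add: exp_cnj)
    also have "\<dots> = exp (- (complex_of_real t * \<Psi> \<xi>))" using char_fun[OF t, of "- \<xi>"] by (simp add: symmetric)
    finally have "Im (exp (- (complex_of_real t * \<Psi> \<xi>))) = 0" by (simp add: complex_eq_iff)
    then have "sin (t * Im (\<Psi> \<xi>)) = 0" by (simp add: Im_exp)
    moreover have "t * Im (\<Psi> \<xi>) = pi / 2 \<or> t * Im (\<Psi> \<xi>) = - (pi / 2)"
      using n by (auto simp: t_def abs_if)
    then have "sin (t * Im (\<Psi> \<xi>)) = 1 \<or> sin (t * Im (\<Psi> \<xi>)) = - 1"
      by (elim disjE) (simp_all only: sin_minus sin_pi_half simp_thms)
    ultimately show False by linarith
  qed
  then show ?thesis by (simp add: \<psi>_def complex_eq_iff)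
qed

lemma char_fun_real: "0 \<le> t \<Longrightarrow> (\<integral>\<omega>. exp (\<i> * complex_of_real (\<xi> \<bullet> X t \<omega>)) \<partial>Q) = complex_of_real (exp (- (t * \<psi> \<xi>)))"
  using char_fun[of t \<xi>] by (simp add: \<Psi>_eq exp_of_real[symmetric])

lemma \<psi>_nonneg: "0 \<le> \<psi> \<xi>"
proof -
  have "norm (\<integral>\<omega>. exp (\<i> * complex_of_real (\<xi> \<bullet> X 1 \<omega>)) \<partial>Q) \<le> (\<integral>\<omega>. norm (exp (\<i> * complex_of_real (\<xi> \<bullet> X 1 \<omega>))) \<partial>Q)"
    by (rule integral_norm_bound)
  also have "\<dots> = 1" by (simp add: Q.prob_space)
  finally show ?thesis using char_fun_real[of 1 \<xi>] by simp
qed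

text \<open>Recovered from the characteristic function at time 1, which is measurable as a parameter
  integral.\<close>

lemma \<psi>_measurable [measurable]: "\<psi> \<in> borel_measurable borel"
proof -
  have "\<psi> \<xi> = - ln (norm (\<integral>\<omega>. exp (\<i> * complex_of_real (\<xi> \<bullet> X 1 \<omega>)) \<partial>Q))" for \<xi>
    using char_fun_real[of 1 \<xi>] by simp
  moreover have "(\<lambda>\<xi>. - ln (norm (\<integral>\<omega>. exp (\<i> * complex_of_real (\<xi> \<bullet> X 1 \<omega>)) \<partial>Q))) \<in> borel_measurable borel"
    by measurable
  ultimately show ?thesis by presburger
qed

lemma exp_\<psi>_integrable: "0 < t \<Longrightarrow> integrable lborel (\<lambda>\<xi>. exp (- (t * \<psi> \<xi>)))"
proof -
  assume "0 < t"
  then have "integrable lborel (\<lambda>\<xi>. exp (- (complex_of_real t * \<Psi> \<xi>)))"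
    using densities by (simp add: has_transition_densities_def)
  then have "integrable lborel (\<lambda>\<xi>. norm (exp (- (complex_of_real t * \<Psi> \<xi>))))" by (rule integrable_norm)
  then show ?thesis by (simp add: \<Psi>_eq)
qed

definition inversion_integrand :: "real \<Rightarrow> 'a \<Rightarrow> 'a \<Rightarrow> complex" where
  "inversion_integrand t x \<xi> = exp (- (\<i> * complex_of_real (x \<bullet> \<xi>))) * complex_of_real (exp (- (t * \<psi> \<xi>)))"

lemma density_eq:
  assumes "0 < t"
  shows "complex_of_real (p t x) = complex_of_real (1 / (2 * pi) ^ DIM('a)) * (\<integral>\<xi>. inversion_integrand t x \<xi> \<partial>lborel)"
proof -
  have "complex_of_real (exp (- (t * \<psi> \<xi>))) = exp (- (complex_of_real t * \<Psi> \<xi>))" for \<xi>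
    by (simp add: \<Psi>_eq exp_of_real[symmetric])
  then show ?thesis using densities assms by (simp add: has_transition_densities_def inversion_integrand_def)
qed

lemma density_eq_Re:
  assumes "0 < t"
  shows "p t x = 1 / (2 * pi) ^ DIM('a) * Re (\<integral>\<xi>. inversion_integrand t x \<xi> \<partial>lborel)"
proof -
  have r: "Re (complex_of_real r * I) = r * Re I" for r I by simp
  have "p t x = Re (complex_of_real (p t x))" by simp
  then show ?thesis unfolding density_eq[OF assms] r .
qed

lemma norm_inversion_integrand: "norm (inversion_integrand t x \<xi>) = exp (- (t * \<psi> \<xi>))"
  by (simp add: inversion_integrand_def norm_mult)

lemma inversion_integrand_measurable [measurable]:
  "(\<lambda>y. inversion_integrand (fst (fst y)) (snd (fst y)) (snd y)) \<in> borel_measurable ((borel \<Otimes>\<^sub>M borel) \<Otimes>\<^sub>M borel)"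
  "inversion_integrand t x \<in> borel_measurable borel"
  unfolding inversion_integrand_def by measurable

definition density :: "real \<times> 'a \<Rightarrow> real" where
  "density z = (if 0 < fst z then p (fst z) (snd z) else 0)"

lemma density_measurable [measurable]: "density \<in> borel_measurable (borel \<Otimes>\<^sub>M borel)"
proof -
  have e: "density = (\<lambda>z. if 0 < fst z then 1 / (2 * pi) ^ DIM('a) * Re (\<integral>\<xi>. inversion_integrand (fst z) (snd z) \<xi> \<partial>lborel) else 0)"
    unfolding density_def by (rule ext) (simp add: density_eq_Re)
  have [measurable]: "(\<lambda>z. \<integral>\<xi>. inversion_integrand (fst z) (snd z) \<xi> \<partial>lborel) \<in> borel_measurable (borel \<Otimes>\<^sub>M borel)"
    using inversion_integrand_measurable(1) by measurable
  show ?thesis unfolding e by measurable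
qed

section \<open>Nonnegativity of the transition density\<close>

definition tent :: "real \<Rightarrow> 'a \<Rightarrow> real" where
  "tent R a = max 0 (1 - norm a / R)"

text \<open>A compactly supported weight of positive type. In the inversion integral it produces the
  mean of a squared modulus, and after normalization it tends to 1 as \<open>R\<close> grows;
  together this gives the sign of \<open>p\<close> at every point.\<close>

definition tent_correlation :: "real \<Rightarrow> 'a \<Rightarrow> real" where
  "tent_correlation R \<xi> = (\<integral>b. tent R (b + \<xi>) * tent R b \<partial>lborel)"

lemma tent_nonneg [simp]: "0 \<le> tent R a" and tent_le_one: "R > 0 \<Longrightarrow> tent R a \<le> 1"
  by (auto simp: tent_def)

lemma tent_measurable [measurable]: "tent R \<in> borel_measurable borel"
  unfolding tent_def by measurable

lemma tent_integrable: "R > 0 \<Longrightarrow> integrable lborel (tent R)"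
  by (rule integrable_compact_support[of _ R]) (auto simp: tent_def intro!: continuous_intros)

lemma tent_square_integrable: "R > 0 \<Longrightarrow> integrable lborel (\<lambda>b. (tent R b)\<^sup>2)"
  by (rule integrable_compact_support[of _ R]) (auto simp: tent_def intro!: continuous_intros)

text \<open>The tent is at most 1 on the ball of radius \<open>R\<close> and at least
  \<open>1 / 2\<close> on the ball of half the radius. The factor 4 comes from squaring
  \<open>1 / 2\<close>, the power of 2 from the ratio of the volumes.\<close>

lemma tent_integral_le:
  assumes R: "R > 0"
  shows "(\<integral>b. tent R b \<partial>lborel) \<le> 4 * 2 ^ DIM('a) * (\<integral>b. (tent R b)\<^sup>2 \<partial>lborel)" "(\<integral>b. (tent R b)\<^sup>2 \<partial>lborel) > 0"
proof -
  have v: "measure lborel (ball (0::'a) R) = 2 ^ DIM('a) * measure lborel (ball (0::'a) (R / 2))"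
    using content_ball_conv_unit_ball[of R "0::'a"] content_ball_conv_unit_ball[of "R / 2" "0::'a"] R by (simp add: power_divide)
  have vp: "measure lborel (ball (0::'a) (R / 2)) > 0" using R by (intro content_ball_pos) auto
  have ib: "integrable lborel (indicator (ball (0::'a) r) :: 'a \<Rightarrow> real)" for r
    by (intro integrable_real_indicator emeasure_bounded_finite) auto
  have "(\<integral>b. tent R b \<partial>lborel) \<le> (\<integral>b. indicator (ball (0::'a) R) b \<partial>lborel)"
  proof (rule integral_mono[OF tent_integrable[OF R] ib])
    fix b :: 'a
    show "tent R b \<le> indicator (ball 0 R) b" using R by (auto simp: tent_def indicator_def)
  qed
  then have 1: "(\<integral>b. tent R b \<partial>lborel) \<le> 2 ^ DIM('a) * measure lborel (ball (0::'a) (R / 2))" using v by simp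
  have "(\<integral>b. (1 / 4) * indicator (ball (0::'a) (R / 2)) b \<partial>lborel) \<le> (\<integral>b. (tent R b)\<^sup>2 \<partial>lborel)"
  proof (rule integral_mono[OF integrable_mult_right[OF ib] tent_square_integrable[OF R]])
    fix b :: 'a
    show "(1 / 4) * indicator (ball 0 (R / 2)) b \<le> (tent R b)\<^sup>2"
    proof (cases "norm b < R / 2")
      case True
      then have "1 / 2 \<le> tent R b" using R by (auto simp: tent_def field_simps max_def)
      then have "(1 / 2)\<^sup>2 \<le> (tent R b)\<^sup>2" by (intro power_mono) auto
      then show ?thesis using True by (simp add: power2_eq_square)
    qed (simp add: indicator_def)
  qed
  then have 2: "(1 / 4) * measure lborel (ball (0::'a) (R / 2)) \<le> (\<integral>b. (tent R b)\<^sup>2 \<partial>lborel)" by simp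
  show "(\<integral>b. (tent R b)\<^sup>2 \<partial>lborel) > 0" using 2 vp by linarith
  have "4 * 2 ^ DIM('a) * ((1 / 4) * measure lborel (ball (0::'a) (R / 2))) \<le> 4 * 2 ^ DIM('a) * (\<integral>b. (tent R b)\<^sup>2 \<partial>lborel)"
    using 2 by (intro mult_left_mono) auto
  moreover have "(\<integral>b. tent R b \<partial>lborel) \<le> 4 * 2 ^ DIM('a) * ((1 / 4) * measure lborel (ball (0::'a) (R / 2)))"
    using 1 by simp
  ultimately show "(\<integral>b. tent R b \<partial>lborel) \<le> 4 * 2 ^ DIM('a) * (\<integral>b. (tent R b)\<^sup>2 \<partial>lborel)" by (rule order_trans[rotated])
qed

lemma tent_lipschitz: "R > 0 \<Longrightarrow> \<bar>tent R (b + \<xi>) - tent R b\<bar> \<le> norm \<xi> / R"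
proof -
  assume R: "R > 0"
  have "\<bar>norm (b + \<xi>) - norm b\<bar> \<le> norm \<xi>" using norm_triangle_ineq3[of "b + \<xi>" b] by simp
  then have "\<bar>norm (b + \<xi>) / R - norm b / R\<bar> \<le> norm \<xi> / R"
    using R by (simp add: diff_divide_distrib[symmetric] divide_right_mono)
  then show ?thesis by (auto simp: tent_def max_def abs_le_iff)
qed

text \<open>After division by the integral of the squared tent, the two estimates become uniform
  boundedness and convergence to 1 with rate \<open>norm \<xi> / R\<close>.\<close>

lemma tent_correlation_bounds:
  assumes R: "R > 0"
  shows "\<bar>tent_correlation R \<xi>\<bar> \<le> (\<integral>b. tent R b \<partial>lborel)"
    "\<bar>tent_correlation R \<xi> - (\<integral>b. (tent R b)\<^sup>2 \<partial>lborel)\<bar> \<le> norm \<xi> / R * (\<integral>b. tent R b \<partial>lborel)"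
proof -
  have i: "integrable lborel (\<lambda>b. tent R (b + \<xi>) * tent R b)"
    by (rule Bochner_Integration.integrable_bound[OF tent_integrable[OF R]])
       (use tent_le_one[OF R] in \<open>auto simp: abs_mult intro!: mult_left_le_one_le\<close>)
  have "\<bar>tent_correlation R \<xi>\<bar> \<le> (\<integral>b. \<bar>tent R (b + \<xi>) * tent R b\<bar> \<partial>lborel)"
    unfolding tent_correlation_def by (rule integral_abs_bound)
  also have "\<dots> \<le> (\<integral>b. tent R b \<partial>lborel)"
    by (intro integral_mono integrable_abs i tent_integrable R) (use tent_le_one[OF R] in \<open>auto simp: abs_mult intro!: mult_left_le_one_le\<close>)
  finally show "\<bar>tent_correlation R \<xi>\<bar> \<le> (\<integral>b. tent R b \<partial>lborel)" .
  have "tent_correlation R \<xi> - (\<integral>b. (tent R b)\<^sup>2 \<partial>lborel) = (\<integral>b. tent R (b + \<xi>) * tent R b - (tent R b)\<^sup>2 \<partial>lborel)"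
    unfolding tent_correlation_def using i tent_square_integrable[OF R] by simp
  then have "\<bar>tent_correlation R \<xi> - (\<integral>b. (tent R b)\<^sup>2 \<partial>lborel)\<bar> \<le> (\<integral>b. \<bar>tent R (b + \<xi>) * tent R b - (tent R b)\<^sup>2\<bar> \<partial>lborel)"
    by (simp only: integral_abs_bound)
  also have "\<dots> \<le> (\<integral>b. norm \<xi> / R * tent R b \<partial>lborel)"
  proof (rule integral_mono)
    show "integrable lborel (\<lambda>b. \<bar>tent R (b + \<xi>) * tent R b - (tent R b)\<^sup>2\<bar>)"
      by (intro integrable_abs Bochner_Integration.integrable_diff i tent_square_integrable R)
    show "integrable lborel (\<lambda>b. norm \<xi> / R * tent R b)" by (intro integrable_mult_right tent_integrable R)
    fix b
    have "\<bar>tent R (b + \<xi>) * tent R b - (tent R b)\<^sup>2\<bar> = \<bar>tent R (b + \<xi>) - tent R b\<bar> * tent R b"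
      by (simp add: power2_eq_square left_diff_distrib[symmetric] abs_mult)
    also have "\<dots> \<le> norm \<xi> / R * tent R b" by (intro mult_right_mono tent_lipschitz R) simp
    finally show "\<bar>tent R (b + \<xi>) * tent R b - (tent R b)\<^sup>2\<bar> \<le> norm \<xi> / R * tent R b" .
  qed
  finally show "\<bar>tent_correlation R \<xi> - (\<integral>b. (tent R b)\<^sup>2 \<partial>lborel)\<bar> \<le> norm \<xi> / R * (\<integral>b. tent R b \<partial>lborel)" by simp
qed

text \<open>The integral is the expectation of \<open>\<bar>\<integral> tent R a * exp (i a \<bullet> (X t - x)) da\<bar>\<^sup>2\<close>.\<close>
lemma tent_inversion_nonneg:
  assumes R: "R > 0" and t: "t > 0"
  shows "0 \<le> Re (\<integral>\<xi>. inversion_integrand t x \<xi> * tent_correlation R \<xi> \<partial>lborel)"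
proof -
  have Xm[measurable]: "X t \<in> borel_measurable Q" using t by simp
  let ?L = "lborel \<Otimes>\<^sub>M lborel :: ('a \<times> 'a) measure"
  have sfL: "sigma_finite_measure ?L" by (simp add: lborel_prod lborel.sigma_finite_measure_axioms)
  interpret QL: pair_sigma_finite Q ?L
    by (intro pair_sigma_finite.intro sfL Q.sigma_finite_measure_axioms)
  let ?E = "\<lambda>a \<omega>. exp (\<i> * complex_of_real (a \<bullet> (X t \<omega> - x)))"
  define F where "F \<omega> y = complex_of_real (tent R (fst y) * tent R (snd y)) * ?E (fst y - snd y) \<omega>" for \<omega> y
  have iL: "integrable ?L (\<lambda>y. tent R (fst y) * tent R (snd y))"
    using lborel_pair.Fubini_integrable[of "\<lambda>y. tent R (fst y) * tent R (snd y)"] tent_integrable[OF R]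
    by (simp add: abs_mult)
  have nF: "norm (F \<omega> y) = tent R (fst y) * tent R (snd y)" for \<omega> y by (simp add: F_def norm_mult)
  have Fm: "(\<lambda>y. F \<omega> y) \<in> borel_measurable ?L" for \<omega> unfolding F_def by measurable
  have iFy: "integrable ?L (F \<omega>)" for \<omega>
    by (rule Bochner_Integration.integrable_bound[OF iL Fm]) (simp add: nF)
  have iF: "integrable (Q \<Otimes>\<^sub>M ?L) (\<lambda>(\<omega>, y). F \<omega> y)"
  proof (rule QL.Fubini_integrable)
    show "(\<lambda>(\<omega>, y). F \<omega> y) \<in> borel_measurable (Q \<Otimes>\<^sub>M ?L)" unfolding F_def by measurable
    show "integrable Q (\<lambda>\<omega>. \<integral>y. norm (case (\<omega>, y) of (\<omega>, y) \<Rightarrow> F \<omega> y) \<partial>?L)" by (simp add: nF)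
    show "AE \<omega> in Q. integrable ?L (\<lambda>y. case (\<omega>, y) of (\<omega>, y) \<Rightarrow> F \<omega> y)"
      using iFy by simp
  qed
  have sq: "(\<integral>y. F \<omega> y \<partial>?L) = complex_of_real ((norm (\<integral>a. tent R a * ?E a \<omega> \<partial>lborel))\<^sup>2)" for \<omega>
  proof -
    have i1: "integrable lborel (\<lambda>a. complex_of_real (tent R a) * ?E a \<omega>)"
      by (rule Bochner_Integration.integrable_bound[OF tent_integrable[OF R]]) (auto simp: norm_mult)
    have Ed: "?E (a - b) \<omega> = ?E a \<omega> * cnj (?E b \<omega>)" for a b
      by (simp add: exp_cnj exp_add[symmetric] inner_diff_left right_diff_distrib)
    have e: "F \<omega> (a, b) = (tent R a * ?E a \<omega>) * cnj (tent R b * ?E b \<omega>)" for a b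
      by (simp add: F_def Ed)
    have FX: "F \<omega> = (\<lambda>(a, b). (tent R a * ?E a \<omega>) * cnj (tent R b * ?E b \<omega>))"
    proof
      fix y show "F \<omega> y = (case y of (a, b) \<Rightarrow> (tent R a * ?E a \<omega>) * cnj (tent R b * ?E b \<omega>))"
        by (cases y) (simp only: e prod.case)
    qed
    have "(\<integral>y. F \<omega> y \<partial>?L) = (\<integral>a. \<integral>b. (tent R a * ?E a \<omega>) * cnj (tent R b * ?E b \<omega>) \<partial>lborel \<partial>lborel)"
      unfolding FX by (rule lborel_pair.integral_fst[OF iFy[of \<omega>, unfolded FX], symmetric])
    also have "\<dots> = (\<integral>a. tent R a * ?E a \<omega> \<partial>lborel) * cnj (\<integral>b. tent R b * ?E b \<omega> \<partial>lborel)"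
      by (simp only: integral_mult_right_zero integral_mult_left_zero Bochner_Integration.integral_cnj)
    finally show ?thesis by (simp only: complex_norm_square)
  qed
  \<comment> \<open>The expectation replaces the exponential by the characteristic function at the
    difference of the two frequencies, which is the inversion integrand there.\<close>
  have om: "(\<integral>\<omega>. F \<omega> y \<partial>Q) = complex_of_real (tent R (fst y) * tent R (snd y)) * inversion_integrand t x (fst y - snd y)" for y
  proof -
    have "?E a \<omega> = exp (- (\<i> * complex_of_real (x \<bullet> a))) * exp (\<i> * complex_of_real (a \<bullet> X t \<omega>))" for a \<omega>
      by (simp add: exp_add[symmetric] inner_diff_right inner_commute algebra_simps)
    then have "(\<integral>\<omega>. F \<omega> y \<partial>Q) = (\<integral>\<omega>. complex_of_real (tent R (fst y) * tent R (snd y)) * (exp (- (\<i> * complex_of_real (x \<bullet> (fst y - snd y)))) * exp (\<i> * complex_of_real ((fst y - snd y) \<bullet> X t \<omega>))) \<partial>Q)"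
      unfolding F_def by presburger
    then show ?thesis using t by (simp only: integral_mult_right_zero char_fun_real[OF less_imp_le] inversion_integrand_def)
  qed
  have k: "integrable lborel (inversion_integrand t x)"
    by (rule Bochner_Integration.integrable_bound[OF exp_\<psi>_integrable[OF t]]) (auto simp: norm_inversion_integrand)
  have "complex_of_real (\<integral>\<omega>. (norm (\<integral>a. tent R a * ?E a \<omega> \<partial>lborel))\<^sup>2 \<partial>Q) = (\<integral>\<omega>. \<integral>y. F \<omega> y \<partial>?L \<partial>Q)"
    by (simp only: sq integral_complex_of_real)
  also have "\<dots> = (\<integral>y. \<integral>\<omega>. F \<omega> y \<partial>Q \<partial>?L)"
    using QL.integral_fst[OF iF] QL.integral_snd[OF iF] by simp
  also have "\<dots> = (\<integral>b. \<integral>a. complex_of_real (tent R a * tent R b) * inversion_integrand t x (a - b) \<partial>lborel \<partial>lborel)"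
  proof -
    have "integrable ?L (\<lambda>(a, b). complex_of_real (tent R a * tent R b) * inversion_integrand t x (a - b))"
      using QL.integrable_snd[OF iF] by (simp add: om case_prod_unfold)
    from lborel_pair.integral_snd[OF this] show ?thesis by (simp add: om case_prod_unfold)
  qed
  also have "\<dots> = (\<integral>b. \<integral>\<xi>. complex_of_real (tent R (b + \<xi>) * tent R b) * inversion_integrand t x \<xi> \<partial>lborel \<partial>lborel)"
  proof (rule Bochner_Integration.integral_cong[OF refl])
    fix b :: 'a
    show "(\<integral>a. complex_of_real (tent R a * tent R b) * inversion_integrand t x (a - b) \<partial>lborel) =
      (\<integral>\<xi>. complex_of_real (tent R (b + \<xi>) * tent R b) * inversion_integrand t x \<xi> \<partial>lborel)"
      using lborel_integral_translate[of "\<lambda>a. complex_of_real (tent R a * tent R b) * inversion_integrand t x (a - b)" b] by simp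
  qed
  also have "\<dots> = (\<integral>\<xi>. \<integral>b. complex_of_real (tent R (b + \<xi>) * tent R b) * inversion_integrand t x \<xi> \<partial>lborel \<partial>lborel)"
  proof -
    have ip: "integrable ?L (\<lambda>y. tent R (fst y) * norm (inversion_integrand t x (snd y)))"
      using lborel_pair.Fubini_integrable[of "\<lambda>y. tent R (fst y) * norm (inversion_integrand t x (snd y))"] tent_integrable[OF R] k
      by (simp add: abs_mult)
    have "integrable ?L (\<lambda>(b, \<xi>). complex_of_real (tent R (b + \<xi>) * tent R b) * inversion_integrand t x \<xi>)"
    proof (rule Bochner_Integration.integrable_bound[OF ip])
      show "AE y in ?L. norm (case y of (b, \<xi>) \<Rightarrow> complex_of_real (tent R (b + \<xi>) * tent R b) * inversion_integrand t x \<xi>) \<le> norm (tent R (fst y) * norm (inversion_integrand t x (snd y)))"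
        by (intro AE_I2) (use tent_le_one[OF R] in \<open>auto simp: norm_mult abs_mult intro!: mult_right_mono mult_left_le_one_le\<close>)
    qed measurable
    from lborel_pair.integral_fst[OF this] lborel_pair.integral_snd[OF this] show ?thesis by simp
  qed
  also have "\<dots> = (\<integral>\<xi>. inversion_integrand t x \<xi> * tent_correlation R \<xi> \<partial>lborel)"
    unfolding tent_correlation_def integral_mult_left_zero integral_complex_of_real by (simp only: mult.commute)
  finally have "(\<integral>\<xi>. inversion_integrand t x \<xi> * tent_correlation R \<xi> \<partial>lborel) = complex_of_real (\<integral>\<omega>. (norm (\<integral>a. tent R a * ?E a \<omega> \<partial>lborel))\<^sup>2 \<partial>Q)" ..
  then show ?thesis by simp
qed

text \<open>The normalized correlations are bounded and tend to 1, so by dominated convergence the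
  inversion integral is a limit of nonnegative numbers.\<close>

lemma density_nonneg:
  assumes t: "t > 0" shows "0 \<le> p t x"
proof -
  define R where "R n = real (Suc n)" for n
  have R: "R n > 0" for n by (simp add: R_def)
  define W where "W n = (\<integral>b. (tent (R n) b)\<^sup>2 \<partial>lborel)" for n
  have W: "W n > 0" and WL: "(\<integral>b. tent (R n) b \<partial>lborel) \<le> 4 * 2 ^ DIM('a) * W n" for n
    using tent_integral_le[OF R[of n]] by (auto simp: W_def)
  define w where "w n \<xi> = tent_correlation (R n) \<xi> / W n" for n \<xi>
  have wb: "\<bar>w n \<xi>\<bar> \<le> 4 * 2 ^ DIM('a)" for n \<xi>
    using order_trans[OF tent_correlation_bounds(1)[OF R[of n], of \<xi>] WL[of n]] W[of n] by (simp add: w_def abs_divide divide_le_eq)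
  have w1: "\<bar>w n \<xi> - 1\<bar> \<le> norm \<xi> * (4 * 2 ^ DIM('a)) / R n" for n \<xi>
  proof -
    have "\<bar>tent_correlation (R n) \<xi> - W n\<bar> \<le> norm \<xi> / R n * (4 * 2 ^ DIM('a) * W n)"
      using order_trans[OF tent_correlation_bounds(2)[OF R[of n], of \<xi>] mult_left_mono[OF WL[of n]]] R[of n] by (simp add: W_def)
    moreover have "w n \<xi> - 1 = (tent_correlation (R n) \<xi> - W n) / W n" using W[of n] by (simp add: w_def diff_divide_distrib)
    ultimately show ?thesis using W[of n] R[of n] by (simp add: abs_divide divide_le_eq)
  qed
  have wl: "(\<lambda>n. w n \<xi>) \<longlonglongrightarrow> 1" for \<xi>
  proof -
    have "(\<lambda>n. norm \<xi> * (4 * 2 ^ DIM('a)) / R n) \<longlonglongrightarrow> 0" unfolding R_def by real_asymp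
    then have "(\<lambda>n. \<bar>w n \<xi> - 1\<bar>) \<longlonglongrightarrow> 0"
      by (rule tendsto_sandwich[OF _ _ tendsto_const, rotated 2]) (use w1 in auto)
    then show ?thesis by (simp add: tendsto_rabs_zero_iff LIM_zero_iff)
  qed
  have k: "integrable lborel (inversion_integrand t x)"
    by (rule Bochner_Integration.integrable_bound[OF exp_\<psi>_integrable[OF t]]) (auto simp: norm_inversion_integrand)
  have [measurable]: "w n \<in> borel_measurable borel" for n unfolding w_def tent_correlation_def by measurable
  have "(\<lambda>n. \<integral>\<xi>. inversion_integrand t x \<xi> * w n \<xi> \<partial>lborel) \<longlonglongrightarrow> (\<integral>\<xi>. inversion_integrand t x \<xi> \<partial>lborel)"
  proof (rule integral_dominated_convergence[where w="\<lambda>\<xi>. exp (- (t * \<psi> \<xi>)) * (4 * 2 ^ DIM('a))"])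
    show "integrable lborel (\<lambda>\<xi>. exp (- (t * \<psi> \<xi>)) * (4 * 2 ^ DIM('a)))" using exp_\<psi>_integrable[OF t] by simp
    show "AE \<xi> in lborel. norm (inversion_integrand t x \<xi> * w n \<xi>) \<le> exp (- (t * \<psi> \<xi>)) * (4 * 2 ^ DIM('a))" for n
      using wb by (intro AE_I2) (simp add: norm_mult norm_inversion_integrand)
    show "AE \<xi> in lborel. (\<lambda>n. inversion_integrand t x \<xi> * w n \<xi>) \<longlonglongrightarrow> inversion_integrand t x \<xi>"
    proof (rule AE_I2)
      fix \<xi>
      have "(\<lambda>n. inversion_integrand t x \<xi> * complex_of_real (w n \<xi>)) \<longlonglongrightarrow> inversion_integrand t x \<xi> * complex_of_real 1"
        by (intro tendsto_mult tendsto_const tendsto_of_real wl)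
      then show "(\<lambda>n. inversion_integrand t x \<xi> * complex_of_real (w n \<xi>)) \<longlonglongrightarrow> inversion_integrand t x \<xi>" by simp
    qed
  qed measurable
  then have "(\<lambda>n. Re (\<integral>\<xi>. inversion_integrand t x \<xi> * w n \<xi> \<partial>lborel)) \<longlonglongrightarrow> Re (\<integral>\<xi>. inversion_integrand t x \<xi> \<partial>lborel)"
    by (rule tendsto_Re)
  moreover have "0 \<le> Re (\<integral>\<xi>. inversion_integrand t x \<xi> * w n \<xi> \<partial>lborel)" for n
  proof -
    have "(\<integral>\<xi>. inversion_integrand t x \<xi> * w n \<xi> \<partial>lborel) = (\<integral>\<xi>. inversion_integrand t x \<xi> * tent_correlation (R n) \<xi> \<partial>lborel) / complex_of_real (W n)"
      unfolding w_def by (simp only: of_real_divide times_divide_eq_right integral_divide_zero)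
    then show ?thesis using tent_inversion_nonneg[OF R[of n] t, of x] W[of n] by (simp add: Re_divide_of_real)
  qed
  ultimately have "0 \<le> Re (\<integral>\<xi>. inversion_integrand t x \<xi> \<partial>lborel)" by (intro LIMSEQ_le_const) auto
  then show ?thesis unfolding density_eq_Re[OF t] by simp
qed

section \<open>Integrals against the transition density\<close>

lemma p_measurable: "t > 0 \<Longrightarrow> p t \<in> borel_measurable borel"
  using measurable_compose[of "\<lambda>x. (t, x)" borel "borel \<Otimes>\<^sub>M borel" density] density_measurable by (simp add: density_def)

lemma density_distr: "t > 0 \<Longrightarrow> distr Q lborel (X t) = Nonnegative_Lebesgue_Integration.density lborel (\<lambda>x. ennreal (p t x))"
  using densities by (simp add: has_transition_densities_def distributed_def)

lemma density_integral:
  fixes g :: "'a \<Rightarrow> 'b::{banach, second_countable_topology}"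
  assumes t: "t > 0" and [measurable]: "g \<in> borel_measurable borel"
  shows "(\<integral>x. p t x *\<^sub>R g x \<partial>lborel) = (\<integral>\<omega>. g (X t \<omega>) \<partial>Q)"
proof -
  note [measurable] = p_measurable[OF t]
  have [measurable]: "X t \<in> borel_measurable Q" using t by simp
  have "(\<integral>\<omega>. g (X t \<omega>) \<partial>Q) = (\<integral>x. g x \<partial>distr Q lborel (X t))" by (rule integral_distr[symmetric]) auto
  also have "\<dots> = (\<integral>x. p t x *\<^sub>R g x \<partial>lborel)"
    unfolding density_distr[OF t] by (rule Bochner_Integration.integral_density) (use density_nonneg[OF t] in auto)
  finally show ?thesis ..
qed

lemma density_integrable:
  assumes t: "t > 0" shows "integrable lborel (p t)" "(\<integral>x. p t x \<partial>lborel) = 1"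
proof -
  note [measurable] = p_measurable[OF t]
  show 1: "(\<integral>x. p t x \<partial>lborel) = 1" using density_integral[OF t, of "\<lambda>_. 1::real"] by (simp add: Q.prob_space)
  \<comment> \<open>A non-integrable function has Bochner integral 0 by default, so the value 1
    already forces integrability.\<close>
  show "integrable lborel (p t)" using 1 not_integrable_integral_eq by fastforce
qed

lemma fourier_density:
  assumes t: "t > 0" shows "(\<integral>x. exp (\<i> * complex_of_real (\<xi> \<bullet> x)) * p t x \<partial>lborel) = complex_of_real (exp (- (t * \<psi> \<xi>)))"
  using density_integral[OF t, of "\<lambda>x. exp (\<i> * complex_of_real (\<xi> \<bullet> x))"] char_fun_real[of t \<xi>] t
  by (simp add: scaleR_conv_of_real mult.commute)

end

section \<open>The heat kernel\<close>

lemma lborel_distr_reflect: "distr lborel borel (\<lambda>y. a - y) = (lborel :: 'a::euclidean_space measure)"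
  using lborel_affine[of "-1" a] by (simp add: density_1)

lemma lborel_integral_reflect:
  fixes F :: "'a::euclidean_space \<Rightarrow> 'b::{banach, second_countable_topology}"
  assumes [measurable]: "F \<in> borel_measurable borel"
  shows "(\<integral>y. F (a - y) \<partial>lborel) = (\<integral>y. F y \<partial>lborel)"
proof -
  have "(\<integral>x. F x \<partial>distr lborel borel (\<lambda>y. a - y)) = (\<integral>x. F (a - x) \<partial>lborel)"
    by (rule integral_distr) auto
  then show ?thesis by (simp add: lborel_distr_reflect)
qed

lemma lborel_integrable_reflect:
  fixes F :: "'a::euclidean_space \<Rightarrow> 'b::{banach, second_countable_topology}"
  assumes "integrable lborel F"
  shows "integrable lborel (\<lambda>y. F (a - y))"
proof -
  have "integrable (distr lborel borel (\<lambda>y. a - y)) F" using assms by (simp add: lborel_distr_reflect)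
  then show ?thesis by (rule integrable_distr[rotated]) simp
qed

text \<open>The integrability hypothesis is taken at \<open>t = T\<close>, the length of the time
  interval.\<close>

locale heat = noise T H c \<mu> P B + symmetric_levy Q X \<Psi> p
  for T H c :: real and \<mu> :: "'a::euclidean_space measure" and P :: "'w measure" and B
    and Q :: "'v measure" and X :: "real \<Rightarrow> 'v \<Rightarrow> 'a" and \<Psi> p +
  assumes dalang: "(\<integral>\<^sup>+\<xi>. ennreal (1 / (T powr (- 2 * H) + \<psi> \<xi> powr (2 * H))) \<partial>\<mu>) < \<infinity>"
begin

text \<open>Up to constants \<open>cap \<xi> powr (2 * H)\<close> is the integrand of the hypothesis, and it bounds the time form of a heat profile.\<close>
definition cap :: "'a \<Rightarrow> real" where
  "cap \<xi> = (if \<psi> \<xi> * T \<le> 1 then T else 1 / \<psi> \<xi>)"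

lemma cap_nonneg [simp]: "0 \<le> cap \<xi>"
  using T \<psi>_nonneg by (simp add: cap_def)

lemma cap_measurable [measurable]: "cap \<in> borel_measurable borel"
  unfolding cap_def by measurable

text \<open>The case distinction in \<open>cap\<close> decides which summand of the denominator is
  larger. The denominator is at most twice that summand, hence the factor 2.\<close>

lemma cap_powr_le: "cap \<xi> powr (2 * H) \<le> 2 * (1 / (T powr (- 2 * H) + \<psi> \<xi> powr (2 * H)))"
proof (cases "\<psi> \<xi> * T \<le> 1")
  case True
  have Tp: "T powr (- 2 * H) = 1 / T powr (2 * H)" using T by (simp add: powr_minus_divide)
  have "\<psi> \<xi> \<le> 1 / T" using True T by (simp add: pos_le_divide_eq)
  then have "\<psi> \<xi> powr (2 * H) \<le> (1 / T) powr (2 * H)" using \<psi>_nonneg H by (intro powr_mono2) auto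
  also have "\<dots> = T powr (- 2 * H)" using T unfolding Tp by (simp add: powr_divide)
  finally have "T powr (- 2 * H) + \<psi> \<xi> powr (2 * H) \<le> 2 / T powr (2 * H)" unfolding Tp by simp
  moreover have "T powr (- 2 * H) + \<psi> \<xi> powr (2 * H) > 0" using T by (simp add: add_pos_nonneg)
  ultimately have "2 / (2 / T powr (2 * H)) \<le> 2 / (T powr (- 2 * H) + \<psi> \<xi> powr (2 * H))"
    using T by (intro divide_left_mono mult_pos_pos) auto
  then show ?thesis using True by (simp add: cap_def)
next
  case False
  then have p: "\<psi> \<xi> > 0" using T \<psi>_nonneg[of \<xi>] by (cases "\<psi> \<xi> = 0") auto
  have "1 / T \<le> \<psi> \<xi>" using False T by (simp add: pos_divide_le_eq)
  then have "(1 / T) powr (2 * H) \<le> \<psi> \<xi> powr (2 * H)" using T H by (intro powr_mono2) auto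
  moreover have "T powr (- 2 * H) = (1 / T) powr (2 * H)" using T by (simp add: powr_divide powr_minus_divide)
  ultimately have "T powr (- 2 * H) + \<psi> \<xi> powr (2 * H) \<le> 2 * \<psi> \<xi> powr (2 * H)" by simp
  moreover have "T powr (- 2 * H) + \<psi> \<xi> powr (2 * H) > 0" using T by (simp add: add_pos_nonneg)
  ultimately have "2 / (2 * \<psi> \<xi> powr (2 * H)) \<le> 2 / (T powr (- 2 * H) + \<psi> \<xi> powr (2 * H))"
    using p by (intro divide_left_mono mult_pos_pos) auto
  then show ?thesis using False p by (simp add: cap_def powr_divide)
qed

lemma cap_integrable: "integrable \<mu> (\<lambda>\<xi>. cap \<xi> powr (2 * H))"
proof (rule Bochner_Integration.integrable_bound)
  have "integrable \<mu> (\<lambda>\<xi>. 1 / (T powr (- 2 * H) + \<psi> \<xi> powr (2 * H)))"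
    by (rule integrableI_nonneg) (use dalang in \<open>auto intro!: AE_I2 divide_nonneg_nonneg\<close>)
  then show "integrable \<mu> (\<lambda>\<xi>. 2 * (1 / (T powr (- 2 * H) + \<psi> \<xi> powr (2 * H))))" by (rule integrable_mult_right)
  show "AE \<xi> in \<mu>. norm (cap \<xi> powr (2 * H)) \<le> norm (2 * (1 / (T powr (- 2 * H) + \<psi> \<xi> powr (2 * H))))"
    unfolding real_norm_def using cap_powr_le by (intro AE_I2 order_trans[OF _ abs_ge_self]) simp
qed measurable

text \<open>The profile of the heat kernel, as \<open>profile_heat_kernel\<close> confirms: a
  translation phase times the characteristic function of the process after the remaining
  time.\<close>

definition heat_profile :: "real \<times> 'a \<Rightarrow> 'a \<Rightarrow> real \<Rightarrow> complex" where
  "heat_profile z \<xi> u = (if 0 < u \<and> u < T \<and> u < fst z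
     then exp (- (\<i> * complex_of_real (\<xi> \<bullet> snd z))) * complex_of_real (exp (- ((fst z - u) * \<psi> \<xi>))) else 0)"

lemma norm_heat_profile: "norm (heat_profile z \<xi> u) = (if 0 < u \<and> u < T \<and> u < fst z then exp (- ((fst z - u) * \<psi> \<xi>)) else 0)"
  by (simp add: heat_profile_def norm_mult)

lemma norm_heat_profile_le: "norm (heat_profile z \<xi> u) \<le> 1"
  using \<psi>_nonneg[of \<xi>] by (simp add: norm_heat_profile)

lemma heat_profile_measurable [measurable (raw)]:
  assumes [measurable]: "f \<in> borel_measurable M" "f' \<in> borel_measurable M" "g \<in> borel_measurable M" "h \<in> borel_measurable M"
  shows "(\<lambda>w. heat_profile (f w, f' w) (g w) (h w)) \<in> borel_measurable M"
  unfolding heat_profile_def by measurable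

text \<open>The modulus is at most 1 on an interval of length \<open>T\<close>, and it is an
  exponential of total mass \<open>1 / \<psi> \<xi>\<close>; \<open>cap\<close> picks the smaller of
  the two bounds.\<close>

lemma nn_integral_heat_profile: "(\<integral>\<^sup>+u. ennreal (in_window 0 T u * norm (heat_profile z \<xi> u)) \<partial>lborel) \<le> ennreal (cap \<xi>)"
proof (cases "\<psi> \<xi> * T \<le> 1")
  case True
  have "(\<integral>\<^sup>+u. ennreal (in_window 0 T u * norm (heat_profile z \<xi> u)) \<partial>lborel) \<le> (\<integral>\<^sup>+u. ennreal (in_window 0 T u * 1) \<partial>lborel)"
    by (intro nn_integral_mono ennreal_leI mult_left_mono norm_heat_profile_le) simp
  then show ?thesis using nn_integral_window_const[of 1] True by (simp add: cap_def)
next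
  case False
  then have p: "\<psi> \<xi> > 0" using T \<psi>_nonneg[of \<xi>] by (cases "\<psi> \<xi> = 0") auto
  have "(\<integral>\<^sup>+u. ennreal (in_window 0 T u * norm (heat_profile z \<xi> u)) \<partial>lborel) \<le>
    (\<integral>\<^sup>+u. ennreal (exp (- \<psi> \<xi> * (fst z - u))) * indicator {0..} (fst z - u) \<partial>lborel)"
    by (intro nn_integral_mono) (auto simp: norm_heat_profile in_window_def indicator_def mult.commute)
  also have "\<dots> = (\<integral>\<^sup>+x. ennreal (exp (- \<psi> \<xi> * x)) * indicator {0..} x \<partial>lborel)"
    by (subst nn_integral_real_affine[where c="-1" and t="fst z"]) auto
  also have "\<dots> = ennreal (1 / \<psi> \<xi>)"
    using nn_integral_has_integral_lebesgue'[OF _ has_integral_exp_minus_to_infinity[OF p, of 0]] by simp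
  finally show ?thesis using False by (simp add: cap_def)
qed

lemma heat_profile_in_profiles: "heat_profile z \<in> profiles"
proof (rule profilesI[where M=1 and m=cap])
  show "(\<lambda>x. heat_profile z (fst x) (snd x)) \<in> borel_measurable (borel \<Otimes>\<^sub>M borel)"
    using heat_profile_measurable[of "\<lambda>_. fst z" _ "\<lambda>_. snd z" fst snd] by simp
qed (use norm_heat_profile_le nn_integral_heat_profile cap_integrable in auto)

lemma heat_kernel_eq_density: "heat_kernel_at p t x (s, y) = density (t - s, x - y)"
  by (simp add: heat_kernel_at_def density_def)

lemma density_ge_0: "0 \<le> density z"
  using density_nonneg by (simp add: density_def)

lemma heat_kernel_slice:
  shows "integrable lborel (\<lambda>y. heat_kernel_at p t x (s, y))" "(\<integral>y. \<bar>heat_kernel_at p t x (s, y)\<bar> \<partial>lborel) \<le> 1"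
proof -
  have "integrable lborel (\<lambda>y. heat_kernel_at p t x (s, y)) \<and> (\<integral>y. \<bar>heat_kernel_at p t x (s, y)\<bar> \<partial>lborel) \<le> 1"
  proof (cases "s < t")
    case True
    then have ts: "t - s > 0" by simp
    note d = density_integrable[OF ts]
    have "(\<integral>y. p (t - s) (x - y) \<partial>lborel) = 1"
      using lborel_integral_reflect[OF p_measurable[OF ts], of x] d(2) by simp
    then show ?thesis using lborel_integrable_reflect[OF d(1), of x] density_nonneg[OF ts] True by (simp add: heat_kernel_at_def)
  qed (simp add: heat_kernel_at_def)
  then show "integrable lborel (\<lambda>y. heat_kernel_at p t x (s, y))" "(\<integral>y. \<bar>heat_kernel_at p t x (s, y)\<bar> \<partial>lborel) \<le> 1" by auto
qed

lemma profile_heat_kernel: "profile T (heat_kernel_at p t x) = heat_profile (t, x)"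
proof (intro ext)
  fix \<xi> u
  show "profile T (heat_kernel_at p t x) \<xi> u = heat_profile (t, x) \<xi> u"
  proof (cases "0 < u \<and> u < T \<and> u < t")
    case True
    then have tu: "t - u > 0" by simp
    note [measurable] = p_measurable[OF tu]
    let ?F = "\<lambda>y. exp (- (\<i> * complex_of_real (\<xi> \<bullet> (x - y)))) * complex_of_real (p (t - u) y)"
    have "space_fourier (heat_kernel_at p t x) u \<xi> = (\<integral>y. ?F (x - y) \<partial>lborel)"
      unfolding space_fourier_def fourier_def using True by (simp add: heat_kernel_at_def)
    also have "\<dots> = (\<integral>y. ?F y \<partial>lborel)" by (rule lborel_integral_reflect) measurable
    also have "\<dots> = (\<integral>y. exp (- (\<i> * complex_of_real (\<xi> \<bullet> x))) * (exp (\<i> * complex_of_real (\<xi> \<bullet> y)) * complex_of_real (p (t - u) y)) \<partial>lborel)"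
    proof (rule Bochner_Integration.integral_cong[OF refl])
      fix y
      have "exp (- (\<i> * complex_of_real (\<xi> \<bullet> (x - y)))) = exp (- (\<i> * complex_of_real (\<xi> \<bullet> x))) * exp (\<i> * complex_of_real (\<xi> \<bullet> y))"
        by (simp add: exp_add[symmetric] inner_diff_right right_diff_distrib)
      then show "?F y = exp (- (\<i> * complex_of_real (\<xi> \<bullet> x))) * (exp (\<i> * complex_of_real (\<xi> \<bullet> y)) * complex_of_real (p (t - u) y))"
        by (simp only: mult.assoc)
    qed
    also have "\<dots> = exp (- (\<i> * complex_of_real (\<xi> \<bullet> x))) * complex_of_real (exp (- ((t - u) * \<psi> \<xi>)))"
      by (simp only: integral_mult_right_zero fourier_density[OF tu])
    finally show ?thesis using True by (simp add: profile_def heat_profile_def)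
  next
    case False
    then consider "\<not> (0 < u \<and> u < T)" | "\<not> u < t" by blast
    then show ?thesis
    proof cases
      case 2
      then show ?thesis by (simp add: profile_def heat_profile_def space_fourier_def fourier_def heat_kernel_at_def)
    qed (auto simp: profile_def heat_profile_def)
  qed
qed

lemma heat_kernel_admissible: "heat_kernel_at p t x \<in> admissible"
proof -
  have [measurable]: "heat_kernel_at p t x \<in> borel_measurable (borel \<Otimes>\<^sub>M borel)"
  proof -
    have "heat_kernel_at p t x = (\<lambda>w. density (t - fst w, x - snd w))"
      by (rule ext) (metis heat_kernel_eq_density surjective_pairing)
    then show ?thesis by simp
  qed
  have "open ({0<..<T} \<times> (UNIV :: 'a set))" by (intro open_Times) auto
  then have [measurable]: "{0<..<T} \<times> (UNIV :: 'a set) \<in> sets (borel \<Otimes>\<^sub>M borel)" by (simp add: borel_prod borel_open)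
  have "set_borel_measurable borel ({0<..<T} \<times> UNIV) (heat_kernel_at p t x)"
    unfolding set_borel_measurable_def borel_prod[symmetric] by measurable
  then have "heat_kernel_at p t x \<in> regular"
    using heat_kernel_slice(1) heat_profile_in_profiles by (simp add: regular_def profile_heat_kernel)
  then show ?thesis using heat_kernel_slice(2) by (auto simp: admissible_def)
qed

abbreviation "gk z \<equiv> heat_kernel_at p (fst z) (snd z)"

lemma gk_admissible: "gk z \<in> admissible" and gk_regular: "gk z \<in> regular"
  using heat_kernel_admissible admissible_regular by auto

lemma profile_gk: "profile T (gk z) = heat_profile z"
  using profile_heat_kernel[of "fst z" "snd z"] by simp

lemma heat_profile_bounded_borel: "bounded_borel (heat_profile z \<xi>)"
  by (rule profiles_bounded_borel[OF heat_profile_in_profiles])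

lemma heat_profile_window_measurable: "(\<lambda>u. ennreal (in_window 0 T u * norm (heat_profile z \<xi> u))) \<in> borel_measurable lborel"
proof -
  note [measurable] = bounded_borel_measurable[OF heat_profile_bounded_borel, of z \<xi>]
  show ?thesis by measurable
qed

lemma time_form_heat_profile_le: "tf (nm (heat_profile z \<xi>)) (nm (heat_profile z \<xi>)) \<le> time_bound H * cap \<xi> powr (2 * H)"
  using time_form_norm_bound[OF H heat_profile_bounded_borel norm_heat_profile_le _ cap_nonneg, of T z \<xi>]
    nn_integral_heat_profile[of z \<xi>] by simp

definition variance_bound :: real where
  "variance_bound = hp_const * (time_bound H * (\<integral>\<xi>. cap \<xi> powr (2 * H) \<partial>\<mu>))"

lemma hp_gk_le: "hp (gk z) (gk z) \<le> variance_bound"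
proof -
  have "profile_form (heat_profile z) (heat_profile z) \<le> (\<integral>\<xi>. time_bound H * cap \<xi> powr (2 * H) \<partial>\<mu>)"
    unfolding profile_form_def
  proof (rule integral_mono)
    show "integrable \<mu> (\<lambda>\<xi>. tf (heat_profile z \<xi>) (heat_profile z \<xi>))" by (intro integrable_profile_form heat_profile_in_profiles)
    show "integrable \<mu> (\<lambda>\<xi>. time_bound H * cap \<xi> powr (2 * H))" by (intro integrable_mult_right cap_integrable)
    show "tf (heat_profile z \<xi>) (heat_profile z \<xi>) \<le> time_bound H * cap \<xi> powr (2 * H)" for \<xi>
      using order_trans[OF order_trans[OF abs_ge_self abs_time_form_le[OF H heat_profile_bounded_borel heat_profile_bounded_borel]] time_form_heat_profile_le] .
  qed
  then have "hp_const * profile_form (heat_profile z) (heat_profile z) \<le> hp_const * (time_bound H * (\<integral>\<xi>. cap \<xi> powr (2 * H) \<partial>\<mu>))"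
    using hp_const_pos by (intro mult_left_mono) auto
  then show ?thesis by (simp only: hp_inner_eq_profile_form[OF gk_regular gk_regular] profile_gk variance_bound_def)
qed

lemma heat_profile_tendsto:
  assumes z: "z \<longlonglongrightarrow> w" and u: "u \<noteq> fst w"
  shows "(\<lambda>k. heat_profile (z k) \<xi> u) \<longlonglongrightarrow> heat_profile w \<xi> u"
proof -
  have f: "(\<lambda>k. fst (z k)) \<longlonglongrightarrow> fst w" and s: "(\<lambda>k. snd (z k)) \<longlonglongrightarrow> snd w"
    using z by (auto intro: tendsto_fst tendsto_snd)
  show ?thesis
  proof (cases "u < fst w")
    case True
    have "\<forall>\<^sub>F k in sequentially. u < fst (z k)" using order_tendstoD(1)[OF f True] .
    then have "\<forall>\<^sub>F k in sequentially. (if 0 < u \<and> u < T then exp (- (\<i> * complex_of_real (\<xi> \<bullet> snd (z k)))) * complex_of_real (exp (- ((fst (z k) - u) * \<psi> \<xi>))) else 0) = heat_profile (z k) \<xi> u"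
      by eventually_elim (simp add: heat_profile_def)
    moreover have "(\<lambda>k. (if 0 < u \<and> u < T then exp (- (\<i> * complex_of_real (\<xi> \<bullet> snd (z k)))) * complex_of_real (exp (- ((fst (z k) - u) * \<psi> \<xi>))) else 0)) \<longlonglongrightarrow> heat_profile w \<xi> u"
    proof (cases "0 < u \<and> u < T")
      case True': True
      have "(\<lambda>k. exp (- (\<i> * complex_of_real (\<xi> \<bullet> snd (z k)))) * complex_of_real (exp (- ((fst (z k) - u) * \<psi> \<xi>)))) \<longlonglongrightarrow>
         exp (- (\<i> * complex_of_real (\<xi> \<bullet> snd w))) * complex_of_real (exp (- ((fst w - u) * \<psi> \<xi>)))"
        by (intro tendsto_intros f s)
      then show ?thesis using True True' by (simp add: heat_profile_def)
    qed (auto simp: heat_profile_def)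
    ultimately show ?thesis by (rule Lim_transform_eventually[rotated])
  next
    case False
    then have "fst w < u" using u by simp
    then have "\<forall>\<^sub>F k in sequentially. fst (z k) < u" using f by (rule order_tendstoD(2)[rotated])
    then have ev: "\<forall>\<^sub>F k in sequentially. 0 = heat_profile (z k) \<xi> u" by eventually_elim (simp add: heat_profile_def)
    have w0: "heat_profile w \<xi> u = 0" using False by (simp add: heat_profile_def)
    show ?thesis unfolding w0 by (rule Lim_transform_eventually[OF tendsto_const ev])
  qed
qed

text \<open>Mean square continuity of the field in disguise. At each frequency the profiles converge
  in time off the jump at \<open>u = fst w\<close>, so their \<open>L1\<close> distance
  \<open>a k \<xi>\<close> tends to 0, and so does the form. Its bound by a multiple of
  \<open>cap \<xi> powr (2 * H)\<close> is the \<mu>-integrable majorant.\<close>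

lemma gk_continuous:
  assumes z: "z \<longlonglongrightarrow> w" shows "(\<lambda>k. hpd (gk (z k)) (gk w)) \<longlonglongrightarrow> 0"
proof -
  define D where "D k \<xi> u = heat_profile (z k) \<xi> u - heat_profile w \<xi> u" for k \<xi> u
  have Dp: "D k \<in> profiles" for k unfolding D_def[abs_def] by (intro profiles_diff heat_profile_in_profiles)
  note Db = profiles_bounded_borel[OF Dp]
  have Dn: "norm (D k \<xi> u) \<le> 2" for k \<xi> u
    unfolding D_def using norm_triangle_ineq4[of "heat_profile (z k) \<xi> u" "heat_profile w \<xi> u"]
      norm_heat_profile_le[of "z k" \<xi> u] norm_heat_profile_le[of w \<xi> u] by linarith
  have Dm[measurable]: "D k \<xi> \<in> borel_measurable borel" for k \<xi> by (rule bounded_borel_measurable[OF Db])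
  define a where "a k \<xi> = (\<integral>u. in_window 0 T u * norm (D k \<xi> u) \<partial>lborel)" for k \<xi>
  have nD: "norm ((in_window 0 T u * in_window 0 T u) *\<^sub>R D k \<xi> u) = in_window 0 T u * norm (D k \<xi> u)" for k \<xi> u
    by (simp add: in_window_def)
  have iD: "integrable lborel (\<lambda>u. in_window 0 T u * norm (D k \<xi> u))" for k \<xi>
    using integrable_norm[OF integrable_window[OF Db, of T 0 T k \<xi>]] unfolding nD .
  have a0: "0 \<le> a k \<xi>" for k \<xi> unfolding a_def by simp
  have an: "(\<integral>\<^sup>+u. ennreal (in_window 0 T u * norm (D k \<xi> u)) \<partial>lborel) = ennreal (a k \<xi>)" for k \<xi>
    unfolding a_def by (rule nn_integral_eq_integral[OF iD]) simp
  have al: "(\<lambda>k. a k \<xi>) \<longlonglongrightarrow> 0" for \<xi>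
  proof -
    have "(\<lambda>k. a k \<xi>) \<longlonglongrightarrow> (\<integral>u. 0 \<partial>(lborel :: real measure))"
      unfolding a_def
    proof (rule integral_dominated_convergence[where w="\<lambda>u. 2 * indicator {0..T} u"])
      show "integrable lborel (\<lambda>u. 2 * indicator {0..T} u :: real)"
        by (intro integrable_mult_right integrable_real_indicator) (auto simp: emeasure_lborel_Icc_eq)
      have "AE u in lborel. u \<noteq> fst w" by (rule AE_lborel_singleton)
      then show "AE u in lborel. (\<lambda>k. in_window 0 T u * norm (D k \<xi> u)) \<longlonglongrightarrow> 0"
      proof eventually_elim
        case (elim u)
        have "(\<lambda>k. D k \<xi> u) \<longlonglongrightarrow> 0"
          using tendsto_diff[OF heat_profile_tendsto[OF z elim, of \<xi>] tendsto_const[of "heat_profile w \<xi> u"]] by (simp add: D_def)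
        then show ?case by (intro tendsto_mult_right_zero tendsto_norm_zero)
      qed
      show "AE u in lborel. norm (in_window 0 T u * norm (D k \<xi> u)) \<le> 2 * indicator {0..T} u" for k
        using Dn by (intro AE_I2) (auto simp: in_window_def indicator_def)
    qed measurable
    then show ?thesis by simp
  qed
  have ac: "a k \<xi> \<le> 2 * cap \<xi>" for k \<xi>
  proof -
    have "ennreal (a k \<xi>) \<le> (\<integral>\<^sup>+u. ennreal (in_window 0 T u * norm (heat_profile (z k) \<xi> u)) + ennreal (in_window 0 T u * norm (heat_profile w \<xi> u)) \<partial>lborel)"
      unfolding an[symmetric] D_def
      by (intro nn_integral_mono) (simp add: ennreal_plus[symmetric] distrib_left[symmetric] ennreal_leI mult_left_mono norm_triangle_ineq4 del: ennreal_plus)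
    also have "\<dots> = (\<integral>\<^sup>+u. ennreal (in_window 0 T u * norm (heat_profile (z k) \<xi> u)) \<partial>lborel) + (\<integral>\<^sup>+u. ennreal (in_window 0 T u * norm (heat_profile w \<xi> u)) \<partial>lborel)"
      by (intro nn_integral_add heat_profile_window_measurable)
    also have "\<dots> \<le> ennreal (cap \<xi>) + ennreal (cap \<xi>)" by (intro add_mono nn_integral_heat_profile)
    also have "\<dots> = ennreal (2 * cap \<xi>)" by (simp add: ennreal_plus[symmetric] del: ennreal_plus)
    finally show ?thesis by (simp add: ennreal_le_iff)
  qed
  have tb0: "0 \<le> time_bound H" using H by (simp add: time_bound_def)
  \<comment> \<open>The supremum bound is 2, so a mass \<open>a k \<xi>\<close> has the form
    \<open>M * m\<close> with \<open>m = a k \<xi> / 2\<close>.\<close>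
  have t1: "tf (D k \<xi>) (D k \<xi>) \<le> time_bound H * 2\<^sup>2 * (a k \<xi> / 2) powr (2 * H)" for k \<xi>
    by (rule time_form_bound[OF H Db Dn]) (use a0 an in auto)
  have t0: "0 \<le> tf (D k \<xi>) (D k \<xi>)" for k \<xi> by (rule time_form_nonneg[OF H Db])
  have "(\<lambda>k. profile_form (D k) (D k)) \<longlonglongrightarrow> (\<integral>\<xi>. 0 \<partial>\<mu>)"
    unfolding profile_form_def
  proof (rule integral_dominated_convergence[where w="\<lambda>\<xi>. time_bound H * 2\<^sup>2 * cap \<xi> powr (2 * H)"])
    show "integrable \<mu> (\<lambda>\<xi>. time_bound H * 2\<^sup>2 * cap \<xi> powr (2 * H))" by (intro integrable_mult_right cap_integrable)
    show "AE \<xi> in \<mu>. norm (tf (D k \<xi>) (D k \<xi>)) \<le> time_bound H * 2\<^sup>2 * cap \<xi> powr (2 * H)" for k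
    proof (rule AE_I2)
      fix \<xi>
      have "(a k \<xi> / 2) powr (2 * H) \<le> cap \<xi> powr (2 * H)" using ac[of k \<xi>] a0[of k \<xi>] H by (intro powr_mono2) auto
      then have "time_bound H * 2\<^sup>2 * (a k \<xi> / 2) powr (2 * H) \<le> time_bound H * 2\<^sup>2 * cap \<xi> powr (2 * H)" using tb0 by (intro mult_left_mono) auto
      then show "norm (tf (D k \<xi>) (D k \<xi>)) \<le> time_bound H * 2\<^sup>2 * cap \<xi> powr (2 * H)" using t1[of k \<xi>] t0[of k \<xi>] by simp
    qed
    show "AE \<xi> in \<mu>. (\<lambda>k. tf (D k \<xi>) (D k \<xi>)) \<longlonglongrightarrow> 0"
    proof (rule AE_I2)
      fix \<xi>
      have "(\<lambda>k. (a k \<xi> / 2) powr (2 * H)) \<longlonglongrightarrow> 0"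
        using tendsto_divide[OF al tendsto_const[of 2]] H a0 by (intro tendsto_zero_powrI[of _ _ _ "2 * H"]) auto
      then have "(\<lambda>k. time_bound H * 2\<^sup>2 * (a k \<xi> / 2) powr (2 * H)) \<longlonglongrightarrow> 0" by (rule tendsto_mult_right_zero)
      then show "(\<lambda>k. tf (D k \<xi>) (D k \<xi>)) \<longlonglongrightarrow> 0"
        by (rule tendsto_sandwich[OF _ _ tendsto_const, rotated 2]) (use t0 t1 in auto)
    qed
    show "(\<lambda>\<xi>. tf (D k \<xi>) (D k \<xi>)) \<in> borel_measurable \<mu>" for k
      by (intro time_form_profile_measurable profiles_measurable Dp)
  qed simp
  then have "(\<lambda>k. hp_const * profile_form (D k) (D k)) \<longlonglongrightarrow> 0" by (intro tendsto_mult_right_zero) simp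
  moreover have "hpd (gk (z k)) (gk w) = hp_const * profile_form (D k) (D k)" for k
    unfolding hp_inner_eq_profile_form[OF regular_diff[OF gk_regular gk_regular] regular_diff[OF gk_regular gk_regular]]
      profile_diff[OF gk_regular gk_regular] profile_gk D_def ..
  ultimately show ?thesis by simp
qed

text \<open>Makes the choice of a grid point near \<open>z\<close> measurable in
  \<open>z\<close>.\<close>

lemma hpd_gk_measurable: "(\<lambda>z. hpd (gk z) (gk w)) \<in> borel_measurable (borel \<Otimes>\<^sub>M borel)"
proof -
  have hm: "(\<lambda>y. heat_profile w (f y) (g y)) \<in> borel_measurable N" if "f \<in> borel_measurable N" "g \<in> borel_measurable N"
    for f g and N :: "'n measure"
    using heat_profile_measurable[of "\<lambda>_. fst w" N "\<lambda>_. snd w" f g] that by simp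
  have hm': "(\<lambda>y. heat_profile (h y) (f y) (g y)) \<in> borel_measurable N" if "h \<in> N \<rightarrow>\<^sub>M borel \<Otimes>\<^sub>M borel" "f \<in> borel_measurable N" "g \<in> borel_measurable N"
    for f g h and N :: "'n measure"
    using heat_profile_measurable[of "\<lambda>y. fst (h y)" N "\<lambda>y. snd (h y)" f g] that by simp
  note [measurable (raw)] = hm hm'
  have "hpd (gk z) (gk w) = hp_const * (\<integral>\<xi>. \<integral>y. time_kernel T H y * Re ((heat_profile z \<xi> (fst y) - heat_profile w \<xi> (fst y)) * cnj (heat_profile z \<xi> (snd y) - heat_profile w \<xi> (snd y))) \<partial>lborel2 \<partial>\<mu>)" for z
    unfolding hp_inner_eq_profile_form[OF regular_diff[OF gk_regular gk_regular] regular_diff[OF gk_regular gk_regular]]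
      profile_diff[OF gk_regular gk_regular] profile_gk profile_form_def time_form_def ..
  moreover have "(\<lambda>z. (\<integral>\<xi>. \<integral>y. time_kernel T H y * Re ((heat_profile z \<xi> (fst y) - heat_profile w \<xi> (fst y)) * cnj (heat_profile z \<xi> (snd y) - heat_profile w \<xi> (snd y))) \<partial>lborel2 \<partial>\<mu>)) \<in> borel_measurable (borel \<Otimes>\<^sub>M borel)"
  proof (rule \<mu>.borel_measurable_lebesgue_integral)
    have "(\<lambda>x. \<integral>y. time_kernel T H y * Re ((heat_profile (fst x) (snd x) (fst y) - heat_profile w (snd x) (fst y)) * cnj (heat_profile (fst x) (snd x) (snd y) - heat_profile w (snd x) (snd y))) \<partial>lborel2) \<in> borel_measurable ((borel \<Otimes>\<^sub>M borel) \<Otimes>\<^sub>M \<mu>)"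
      by (rule sigma_finite_measure.borel_measurable_lebesgue_integral[OF sigma_finite_lborel2]) measurable
    then show "(\<lambda>(z, \<xi>). \<integral>y. time_kernel T H y * Re ((heat_profile z \<xi> (fst y) - heat_profile w \<xi> (fst y)) * cnj (heat_profile z \<xi> (snd y) - heat_profile w \<xi> (snd y))) \<partial>lborel2) \<in> borel_measurable ((borel \<Otimes>\<^sub>M borel) \<Otimes>\<^sub>M \<mu>)"
      by (simp only: case_prod_unfold)
  qed
  ultimately show ?thesis by simp
qed

section \<open>The backward convolution of a test function\<close>

context
  fixes \<eta> :: "real \<times> 'a \<Rightarrow> real"
  assumes \<eta>: "\<eta> \<in> test_functions T"
begin

lemma \<eta>_measurable [measurable]: "\<eta> \<in> borel_measurable (borel \<Otimes>\<^sub>M borel)"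
  unfolding borel_prod using \<eta> by (intro smooth_imp_borel) (simp add: test_functions_def)

lemma \<eta>_support: "\<not> (0 < t \<and> t < T) \<Longrightarrow> \<eta> (t, x) = 0"
proof (rule ccontr)
  assume t: "\<not> (0 < t \<and> t < T)" and "\<eta> (t, x) \<noteq> 0"
  then have "(t, x) \<in> closure {z. \<eta> z \<noteq> 0}" by (intro subsetD[OF closure_subset]) simp
  moreover have "closure {z. \<eta> z \<noteq> 0} \<subseteq> {0<..<T} \<times> UNIV" using \<eta> by (simp add: test_functions_def)
  ultimately have "(t, x) \<in> {0<..<T} \<times> UNIV" by (rule subsetD[rotated])
  then show False using t by simp
qed

lemma \<eta>_bounded: "\<exists>M\<ge>0. \<forall>z. \<bar>\<eta> z\<bar> \<le> M"
proof -
  obtain R where R: "\<And>z. norm z > R \<Longrightarrow> \<eta> z = 0" using test_function_bounded_support[OF \<eta>] by blast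
  have "smooth \<eta>" using \<eta> by (simp add: test_functions_def)
  from smooth_compact_support_bounded[OF smooth_imp_continuous_on[OF this] R] show ?thesis
    unfolding real_norm_def .
qed

lemma \<eta>_integrable: "integrable (lborel \<Otimes>\<^sub>M lborel) \<eta>"
proof -
  obtain R where R: "\<And>z. norm z > R \<Longrightarrow> \<eta> z = 0" using test_function_bounded_support[OF \<eta>] by blast
  have "smooth \<eta>" using \<eta> by (simp add: test_functions_def)
  from integrable_compact_support[OF smooth_imp_continuous_on[OF this] R] show ?thesis
    unfolding lborel_prod .
qed

abbreviation "L1 \<equiv> lborel \<Otimes>\<^sub>M lborel :: (real \<times> 'a) measure"

lemma sigma_finite_L1: "sigma_finite_measure L1"
  by (simp add: lborel_prod lborel.sigma_finite_measure_axioms)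

definition \<eta>_norm :: real where "\<eta>_norm = (\<integral>z. \<bar>\<eta> z\<bar> \<partial>L1)"

lemma \<eta>_norm_nonneg: "0 \<le> \<eta>_norm" by (simp add: \<eta>_norm_def)

lemma \<eta>_density_integrable: "integrable L1 (\<lambda>z. \<eta> z * density (fst z - s, snd z - y))"
proof -
  obtain M where M: "M \<ge> 0" "\<And>z. \<bar>\<eta> z\<bar> \<le> M" using \<eta>_bounded by blast
  have d: "integrable lborel (\<lambda>x. density (t - s, x - y))" "(\<integral>x. density (t - s, x - y) \<partial>lborel) \<le> 1" for t
  proof -
    have "integrable lborel (\<lambda>x. density (t - s, x - y)) \<and> (\<integral>x. density (t - s, x - y) \<partial>lborel) \<le> 1"
    proof (cases "t - s > 0")
      case True
      note di = density_integrable[OF True]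
      have "(\<integral>x. p (t - s) (x - y) \<partial>lborel) = 1"
        using lborel_integral_translate[OF p_measurable[OF True], of "- y"] di(2) by simp
      then show ?thesis using lborel_integrable_translate[OF di(1), of "- y"] True by (simp add: density_def)
    qed (simp add: density_def)
    then show "integrable lborel (\<lambda>x. density (t - s, x - y))" "(\<integral>x. density (t - s, x - y) \<partial>lborel) \<le> 1" by auto
  qed
  have sl: "integrable lborel (\<lambda>x. \<eta> (t, x) * density (t - s, x - y))" for t
    using integrable_mult_bounded[OF d(1), of "\<lambda>x. \<eta> (t, x)" M t] M by (simp add: mult.commute)
  show ?thesis
  proof (rule lborel_pair.Fubini_integrable)
    show "integrable lborel (\<lambda>t. \<integral>x. norm (\<eta> (t, x) * density (fst (t, x) - s, snd (t, x) - y)) \<partial>lborel)"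
    proof (rule Bochner_Integration.integrable_bound)
      show "integrable lborel (\<lambda>t. M * indicator {0..T} t)"
        by (intro integrable_mult_right integrable_real_indicator) (auto simp: emeasure_lborel_Icc_eq)
      show "AE t in lborel. norm (\<integral>x. norm (\<eta> (t, x) * density (fst (t, x) - s, snd (t, x) - y)) \<partial>lborel) \<le> norm (M * indicator {0..T} t)"
      proof (rule AE_I2)
        fix t
        show "norm (\<integral>x. norm (\<eta> (t, x) * density (fst (t, x) - s, snd (t, x) - y)) \<partial>lborel) \<le> norm (M * indicator {0..T} t)"
        proof (cases "0 < t \<and> t < T")
          case True
          have "(\<integral>x. norm (\<eta> (t, x) * density (t - s, x - y)) \<partial>lborel) \<le> (\<integral>x. M * density (t - s, x - y) \<partial>lborel)"
            using M density_ge_0 by (intro integral_mono integrable_norm sl integrable_mult_right d(1)) (simp add: abs_mult mult_right_mono)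
          also have "\<dots> \<le> M * 1" using d(2)[of t] M(1) by (simp add: mult_left_le)
          finally show ?thesis using True M(1) by (simp add: indicator_def)
        qed (simp add: \<eta>_support)
      qed
    qed measurable
    show "AE t in lborel. integrable lborel (\<lambda>x. \<eta> (t, x) * density (fst (t, x) - s, snd (t, x) - y))" using sl by simp
  qed measurable
qed

lemma backward_conv_eq: "backward_conv T p \<eta> (s, y) = (\<integral>z. \<eta> z * density (fst z - s, snd z - y) \<partial>L1)"
proof -
  have "(\<integral>z. \<eta> z * density (fst z - s, snd z - y) \<partial>L1) = (\<integral>t. \<integral>x. \<eta> (t, x) * density (t - s, x - y) \<partial>lborel \<partial>lborel)"
    using lborel_pair.integral_fst'[OF \<eta>_density_integrable[of s y]] by simp
  \<comment> \<open>At \<open>t = s\<close> the definition evaluates \<open>p 0\<close>, about which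
    nothing is known; this single time is discarded.\<close>
  also have "\<dots> = (\<integral>t. indicator {s..T} t *\<^sub>R (\<integral>x. \<eta> (t, x) * p (t - s) (x - y) \<partial>lborel) \<partial>lborel)"
  proof (rule integral_discrete_difference[of "{s}"])
    fix t assume "t \<notin> {s}"
    show "(\<integral>x. \<eta> (t, x) * density (t - s, x - y) \<partial>lborel) = indicator {s..T} t *\<^sub>R (\<integral>x. \<eta> (t, x) * p (t - s) (x - y) \<partial>lborel)"
    proof (cases "t > T")
      case True
      then show ?thesis by (simp add: \<eta>_support)
    next
      case False
      then show ?thesis using \<open>t \<notin> {s}\<close> by (auto simp: density_def indicator_def)
    qed
  qed auto
  finally show ?thesis unfolding backward_conv_def by (simp add: set_lebesgue_integral_def)
qed

lemma \<eta>_kernel_Fubini: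
  assumes u: "0 < u" "u < T"
  shows "integrable (L1 \<Otimes>\<^sub>M lborel) (\<lambda>(z, y). exp (- (\<i> * complex_of_real (\<xi> \<bullet> y))) * complex_of_real (\<eta> z * density (fst z - u, snd z - y)))"
    "integrable lborel (\<lambda>y. backward_conv T p \<eta> (u, y))"
    "(\<integral>y. \<bar>backward_conv T p \<eta> (u, y)\<bar> \<partial>lborel) \<le> \<eta>_norm"
proof -
  interpret LL: pair_sigma_finite L1 "lborel :: 'a measure"
    by (intro pair_sigma_finite.intro sigma_finite_L1 lborel.sigma_finite_measure_axioms)
  have g: "integrable lborel (\<lambda>y. density (fst z - u, snd z - y))" "(\<integral>y. density (fst z - u, snd z - y) \<partial>lborel) \<le> 1" for z
    using heat_kernel_slice[of "fst z" "snd z" u] density_ge_0 by (simp_all add: heat_kernel_eq_density)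
  have nn: "norm (exp (- (\<i> * complex_of_real (\<xi> \<bullet> y))) * complex_of_real (\<eta> z * density (fst z - u, snd z - y))) = \<bar>\<eta> z\<bar> * density (fst z - u, snd z - y)" for \<xi> z y
    using density_ge_0 by (simp add: norm_mult abs_mult)
  have n1: "integrable L1 (\<lambda>z. \<integral>y. \<bar>\<eta> z\<bar> * density (fst z - u, snd z - y) \<partial>lborel)"
  proof (rule Bochner_Integration.integrable_bound[OF integrable_abs[OF \<eta>_integrable]])
    show "AE z in L1. norm (\<integral>y. \<bar>\<eta> z\<bar> * density (fst z - u, snd z - y) \<partial>lborel) \<le> norm \<bar>\<eta> z\<bar>"
      using g(2) density_ge_0 by (intro AE_I2) (simp add: abs_mult mult_left_le)
  qed measurable
  have int: "integrable (L1 \<Otimes>\<^sub>M lborel) (\<lambda>(z, y). exp (- (\<i> * complex_of_real (\<xi> \<bullet> y))) * complex_of_real (\<eta> z * density (fst z - u, snd z - y)))" for \<xi>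
  proof (rule LL.Fubini_integrable)
    show "integrable L1 (\<lambda>z. \<integral>y. norm (case (z, y) of (z, y) \<Rightarrow> exp (- (\<i> * complex_of_real (\<xi> \<bullet> y))) * complex_of_real (\<eta> z * density (fst z - u, snd z - y))) \<partial>lborel)"
      unfolding prod.case nn by (rule n1)
    show "AE z in L1. integrable lborel (\<lambda>y. case (z, y) of (z, y) \<Rightarrow> exp (- (\<i> * complex_of_real (\<xi> \<bullet> y))) * complex_of_real (\<eta> z * density (fst z - u, snd z - y)))"
      unfolding prod.case by (intro AE_I2 integrable_fourier_kernel integrable_of_real integrable_mult_right g(1))
  qed measurable
  show "integrable (L1 \<Otimes>\<^sub>M lborel) (\<lambda>(z, y). exp (- (\<i> * complex_of_real (\<xi> \<bullet> y))) * complex_of_real (\<eta> z * density (fst z - u, snd z - y)))" by (rule int)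
  \<comment> \<open>At frequency 0 the exponential is 1, so the real-valued statement is the case
    \<open>\<xi> = 0\<close> of the complex one.\<close>
  have int0: "integrable (L1 \<Otimes>\<^sub>M lborel) (\<lambda>(z, y). \<eta> z * density (fst z - u, snd z - y))"
    using integrable_Re[OF int[of 0]] by (simp add: case_prod_unfold)
  show "integrable lborel (\<lambda>y. backward_conv T p \<eta> (u, y))"
    unfolding backward_conv_eq by (rule LL.integrable_snd[OF int0])
  have int1: "integrable (L1 \<Otimes>\<^sub>M lborel) (\<lambda>(z, y). \<bar>\<eta> z\<bar> * density (fst z - u, snd z - y))"
    using integrable_norm[OF int[of 0]] unfolding case_prod_unfold nn .
  have "(\<integral>y. \<bar>backward_conv T p \<eta> (u, y)\<bar> \<partial>lborel) \<le> (\<integral>y. \<integral>z. \<bar>\<eta> z\<bar> * density (fst z - u, snd z - y) \<partial>L1 \<partial>lborel)"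
  proof (rule integral_mono)
    show "integrable lborel (\<lambda>y. \<bar>backward_conv T p \<eta> (u, y)\<bar>)"
      unfolding backward_conv_eq by (intro integrable_abs LL.integrable_snd[OF int0])
    show "integrable lborel (\<lambda>y. \<integral>z. \<bar>\<eta> z\<bar> * density (fst z - u, snd z - y) \<partial>L1)" by (rule LL.integrable_snd[OF int1])
    show "\<bar>backward_conv T p \<eta> (u, y)\<bar> \<le> (\<integral>z. \<bar>\<eta> z\<bar> * density (fst z - u, snd z - y) \<partial>L1)" for y
      unfolding backward_conv_eq using integral_abs_bound[of L1 "\<lambda>z. \<eta> z * density (fst z - u, snd z - y)"] density_ge_0
      by (simp add: abs_mult)
  qed
  also have "\<dots> = (\<integral>z. \<integral>y. \<bar>\<eta> z\<bar> * density (fst z - u, snd z - y) \<partial>lborel \<partial>L1)"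
    using LL.integral_fst[OF int1] LL.integral_snd[OF int1] by simp
  also have "\<dots> \<le> \<eta>_norm"
    unfolding \<eta>_norm_def using g(2) by (intro integral_mono n1 integrable_abs \<eta>_integrable) (simp add: mult_left_le)
  finally show "(\<integral>y. \<bar>backward_conv T p \<eta> (u, y)\<bar> \<partial>lborel) \<le> \<eta>_norm" .
qed

lemma heat_profile_z_measurable [measurable (raw)]:
  "h \<in> N \<rightarrow>\<^sub>M borel \<Otimes>\<^sub>M borel \<Longrightarrow> f \<in> borel_measurable N \<Longrightarrow> g \<in> borel_measurable N \<Longrightarrow>
    (\<lambda>y. heat_profile (h y) (f y) (g y)) \<in> borel_measurable N"
  using heat_profile_measurable[of "\<lambda>y. fst (h y)" N "\<lambda>y. snd (h y)" f g] by simp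

lemma \<eta>_heat_profile_integrable: "integrable L1 (\<lambda>z. complex_of_real (\<eta> z) * heat_profile z \<xi> u)"
  by (rule integrable_mult_bounded[OF integrable_of_real[OF \<eta>_integrable] _ norm_heat_profile_le]) measurable

text \<open>The backward convolution is a superposition of heat kernels with weights
  \<open>\<eta> z\<close>, so the same superposition holds for the profiles.\<close>

lemma profile_backward_conv: "profile T (backward_conv T p \<eta>) \<xi> u = (\<integral>z. complex_of_real (\<eta> z) * heat_profile z \<xi> u \<partial>L1)"
proof (cases "0 < u \<and> u < T")
  case True
  interpret LL: pair_sigma_finite L1 "lborel :: 'a measure"
    by (intro pair_sigma_finite.intro sigma_finite_L1 lborel.sigma_finite_measure_axioms)
  note int = \<eta>_kernel_Fubini(1)[of u \<xi>]
  let ?e = "\<lambda>y. exp (- (\<i> * complex_of_real (\<xi> \<bullet> y)))"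
  have "space_fourier (backward_conv T p \<eta>) u \<xi> = (\<integral>y. \<integral>z. ?e y * complex_of_real (\<eta> z * density (fst z - u, snd z - y)) \<partial>L1 \<partial>lborel)"
    unfolding space_fourier_def fourier_def backward_conv_eq
    by (simp only: integral_complex_of_real[symmetric] integral_mult_right_zero)
  also have "\<dots> = (\<integral>z. \<integral>y. ?e y * complex_of_real (\<eta> z * density (fst z - u, snd z - y)) \<partial>lborel \<partial>L1)"
    using LL.integral_fst[OF int] LL.integral_snd[OF int] True by simp
  also have "\<dots> = (\<integral>z. complex_of_real (\<eta> z) * heat_profile z \<xi> u \<partial>L1)"
  proof (rule Bochner_Integration.integral_cong[OF refl])
    fix z
    have "(\<integral>y. ?e y * complex_of_real (\<eta> z * density (fst z - u, snd z - y)) \<partial>lborel) =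
      (\<integral>y. complex_of_real (\<eta> z) * (?e y * complex_of_real (gk z (u, y))) \<partial>lborel)"
      by (intro Bochner_Integration.integral_cong) (simp_all add: heat_kernel_eq_density)
    also have "\<dots> = complex_of_real (\<eta> z) * profile T (gk z) \<xi> u"
      using True by (simp add: profile_def space_fourier_def fourier_def)
    finally show "(\<integral>y. ?e y * complex_of_real (\<eta> z * density (fst z - u, snd z - y)) \<partial>lborel) = complex_of_real (\<eta> z) * heat_profile z \<xi> u"
      by (simp only: profile_gk)
  qed
  finally show ?thesis using True by (simp add: profile_def)
next
  case False
  then have "heat_profile z \<xi> u = 0" for z by (auto simp: heat_profile_def)
  then show ?thesis by (simp only: profile_def False if_False mult_zero_right Bochner_Integration.integral_zero)
qed

text \<open>The modulus of the profile is at most the superposition of the moduli of heat profiles,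
  so by Tonelli its time mass inherits the bound by \<open>cap\<close>, times the \<open>L1\<close>
  norm of \<eta>. The 1 added to that norm keeps the bound positive.\<close>

lemma backward_conv_admissible: "backward_conv T p \<eta> \<in> admissible"
proof -
  have "open ({0<..<T} \<times> (UNIV :: 'a set))" by (intro open_Times) auto
  then have [measurable]: "{0<..<T} \<times> (UNIV :: 'a set) \<in> sets (borel \<Otimes>\<^sub>M borel)" by (simp add: borel_prod borel_open)
  have e: "backward_conv T p \<eta> = (\<lambda>w. \<integral>z. \<eta> z * density (fst z - fst w, snd z - snd w) \<partial>L1)"
    by (rule ext) (metis backward_conv_eq surjective_pairing)
  have bm: "backward_conv T p \<eta> \<in> borel_measurable (borel \<Otimes>\<^sub>M borel)"
    unfolding e by (rule sigma_finite_measure.borel_measurable_lebesgue_integral[OF sigma_finite_L1]) measurable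
  have sm: "set_borel_measurable borel ({0<..<T} \<times> UNIV) (backward_conv T p \<eta>)"
    unfolding set_borel_measurable_def borel_prod[symmetric] using bm by measurable
  have pn: "norm (profile T (backward_conv T p \<eta>) \<xi> u) \<le> (\<integral>z. \<bar>\<eta> z\<bar> * norm (heat_profile z \<xi> u) \<partial>L1)" for \<xi> u
    unfolding profile_backward_conv
    using integral_norm_bound[of L1 "\<lambda>z. complex_of_real (\<eta> z) * heat_profile z \<xi> u"] by (simp add: norm_mult)
  have ie: "integrable L1 (\<lambda>z. \<bar>\<eta> z\<bar> * norm (heat_profile z \<xi> u))" for \<xi> u
    using integrable_norm[OF \<eta>_heat_profile_integrable[of \<xi> u]] by (simp add: norm_mult)
  have "profile T (backward_conv T p \<eta>) \<in> profiles"
  proof (rule profilesI[where M="\<eta>_norm + 1" and m=cap])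
    show "(\<lambda>x. profile T (backward_conv T p \<eta>) (fst x) (snd x)) \<in> borel_measurable (borel \<Otimes>\<^sub>M borel)"
      by (rule space_fourier_measurable[OF sm])
    show "norm (profile T (backward_conv T p \<eta>) \<xi> u) \<le> \<eta>_norm + 1" for \<xi> u
    proof -
      have "(\<integral>z. \<bar>\<eta> z\<bar> * norm (heat_profile z \<xi> u) \<partial>L1) \<le> \<eta>_norm"
        unfolding \<eta>_norm_def using norm_heat_profile_le
        by (intro integral_mono ie integrable_abs \<eta>_integrable) (simp add: mult_left_le)
      then show ?thesis using pn[of \<xi> u] by linarith
    qed
    show "(\<integral>\<^sup>+u. ennreal (in_window 0 T u * norm (profile T (backward_conv T p \<eta>) \<xi> u)) \<partial>lborel) \<le> ennreal ((\<eta>_norm + 1) * cap \<xi>)" for \<xi>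
    proof -
      interpret LL: pair_sigma_finite L1 "lborel :: real measure"
        by (intro pair_sigma_finite.intro sigma_finite_L1 lborel.sigma_finite_measure_axioms)
      have "(\<integral>\<^sup>+u. ennreal (in_window 0 T u * norm (profile T (backward_conv T p \<eta>) \<xi> u)) \<partial>lborel) \<le>
        (\<integral>\<^sup>+u. \<integral>\<^sup>+z. ennreal \<bar>\<eta> z\<bar> * ennreal (in_window 0 T u * norm (heat_profile z \<xi> u)) \<partial>L1 \<partial>lborel)"
      proof (rule nn_integral_mono)
        fix u :: real
        have "in_window 0 T u * norm (profile T (backward_conv T p \<eta>) \<xi> u) \<le> (\<integral>z. in_window 0 T u * (\<bar>\<eta> z\<bar> * norm (heat_profile z \<xi> u)) \<partial>L1)"
          using pn[of \<xi> u] by (simp add: mult_left_mono)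
        then have "ennreal (in_window 0 T u * norm (profile T (backward_conv T p \<eta>) \<xi> u)) \<le> (\<integral>\<^sup>+z. ennreal (in_window 0 T u * (\<bar>\<eta> z\<bar> * norm (heat_profile z \<xi> u))) \<partial>L1)"
          by (subst nn_integral_eq_integral) (auto intro!: integrable_mult_right ie ennreal_leI)
        also have "\<dots> = (\<integral>\<^sup>+z. ennreal \<bar>\<eta> z\<bar> * ennreal (in_window 0 T u * norm (heat_profile z \<xi> u)) \<partial>L1)"
          by (intro nn_integral_cong) (simp add: ennreal_mult[symmetric] mult_ac)
        finally show "ennreal (in_window 0 T u * norm (profile T (backward_conv T p \<eta>) \<xi> u)) \<le> \<dots>" .
      qed
      also have "\<dots> = (\<integral>\<^sup>+z. \<integral>\<^sup>+u. ennreal \<bar>\<eta> z\<bar> * ennreal (in_window 0 T u * norm (heat_profile z \<xi> u)) \<partial>lborel \<partial>L1)"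
        by (rule LL.Fubini') measurable
      also have "\<dots> = (\<integral>\<^sup>+z. ennreal \<bar>\<eta> z\<bar> * (\<integral>\<^sup>+u. ennreal (in_window 0 T u * norm (heat_profile z \<xi> u)) \<partial>lborel) \<partial>L1)"
        by (intro nn_integral_cong nn_integral_cmult heat_profile_window_measurable)
      also have "\<dots> \<le> (\<integral>\<^sup>+z. ennreal \<bar>\<eta> z\<bar> * ennreal (cap \<xi>) \<partial>L1)"
        by (intro nn_integral_mono mult_left_mono nn_integral_heat_profile) simp
      also have "\<dots> = ennreal \<eta>_norm * ennreal (cap \<xi>)"
        by (subst nn_integral_multc) (auto simp: \<eta>_norm_def nn_integral_eq_integral[OF integrable_abs[OF \<eta>_integrable]])
      also have "\<dots> \<le> ennreal ((\<eta>_norm + 1) * cap \<xi>)"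
        using \<eta>_norm_nonneg by (simp add: ennreal_mult[symmetric] ennreal_leI mult_right_mono)
      finally show ?thesis .
    qed
  qed (use \<eta>_norm_nonneg cap_integrable in auto)
  then have "backward_conv T p \<eta> \<in> regular"
    using sm \<eta>_kernel_Fubini(2) by (auto simp: regular_def)
  then show ?thesis using \<eta>_kernel_Fubini(3) by (auto simp: admissible_def)
qed

lemma backward_conv_regular: "backward_conv T p \<eta> \<in> regular"
  by (rule admissible_regular[OF backward_conv_admissible])

text \<open>Pulls the superposition of heat kernels out of the inner product, through the time form
  at fixed frequency and then through \<mu>. Combined with the isometry, this is what computes
  covariances of weak integrals.\<close>

lemma hp_backward_conv:
  assumes \<phi>: "\<phi> \<in> regular"
  shows "hp \<phi> (backward_conv T p \<eta>) = (\<integral>z. \<eta> z * hp \<phi> (gk z) \<partial>L1)"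
proof -
  let ?F = "profile T \<phi>" and ?G = "profile T (backward_conv T p \<eta>)"
  have F: "?F \<in> profiles" using \<phi> by (simp add: regular_def)
  note Fb = profiles_bounded_borel[OF F]
  obtain M where M: "\<And>\<xi> u. norm (?F \<xi> u) \<le> M" using F by (auto simp: profiles_def)
  have Fm: "(\<lambda>y. ?F (f y) (g y)) \<in> borel_measurable N" if "f \<in> borel_measurable N" "g \<in> borel_measurable N" for f g and N :: "'n measure"
    using measurable_compose[of "\<lambda>y. (f y, g y)" N "borel \<Otimes>\<^sub>M borel" "\<lambda>x. ?F (fst x) (snd x)"] profiles_measurable[OF F] that by simp
  note [measurable (raw)] = Fm
  interpret L2: pair_sigma_finite lborel2 L1
    by (intro pair_sigma_finite.intro sigma_finite_lborel2 sigma_finite_L1)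
  interpret LM: pair_sigma_finite \<mu> L1
    by (intro pair_sigma_finite.intro sigma_finite_\<mu> sigma_finite_L1)
  have step1: "tf (?F \<xi>) (?G \<xi>) = (\<integral>z. \<eta> z * tf (?F \<xi>) (heat_profile z \<xi>) \<partial>L1)" for \<xi>
  proof -
    let ?J = "\<lambda>y z. \<eta> z * (time_kernel T H y * Re (?F \<xi> (fst y) * cnj (heat_profile z \<xi> (snd y))))"
    \<comment> \<open>A heat profile has modulus at most 1, so the integrand is dominated by a
      product of the time kernel and \<open>|\<eta>|\<close>, integrable in each factor.\<close>
    have Jb: "\<bar>?J y z\<bar> \<le> time_kernel T H y * M * \<bar>\<eta> z\<bar>" for y z
    proof -
      have "\<bar>Re (?F \<xi> (fst y) * cnj (heat_profile z \<xi> (snd y)))\<bar> \<le> M * 1"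
        by (rule abs_Re_mult_cnj_le[OF M norm_heat_profile_le])
      then have "\<bar>\<eta> z\<bar> * (time_kernel T H y * \<bar>Re (?F \<xi> (fst y) * cnj (heat_profile z \<xi> (snd y)))\<bar>) \<le> \<bar>\<eta> z\<bar> * (time_kernel T H y * (M * 1))"
        by (intro mult_left_mono) auto
      then show ?thesis unfolding abs_mult[of "\<eta> z"] abs_mult[of "time_kernel T H y"] by (simp add: mult_ac)
    qed
    have M0: "M \<ge> 0" using order_trans[OF norm_ge_zero M] .
    have iJ: "integrable (lborel2 \<Otimes>\<^sub>M L1) (\<lambda>(y, z). ?J y z)"
    proof (rule Bochner_Integration.integrable_bound)
      show "integrable (lborel2 \<Otimes>\<^sub>M L1) (\<lambda>(y, z). time_kernel T H y * M * \<bar>\<eta> z\<bar>)"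
      proof (rule L2.Fubini_integrable)
        show "integrable lborel2 (\<lambda>y. \<integral>z. norm (case (y, z) of (y, z) \<Rightarrow> time_kernel T H y * M * \<bar>\<eta> z\<bar>) \<partial>L1)"
          using integrable_time_kernel[OF H, of T] M0 by (simp add: abs_mult)
        show "AE y in lborel2. integrable L1 (\<lambda>z. case (y, z) of (y, z) \<Rightarrow> time_kernel T H y * M * \<bar>\<eta> z\<bar>)"
          using \<eta>_integrable by simp
      qed measurable
      show "AE x in lborel2 \<Otimes>\<^sub>M L1. norm (case x of (y, z) \<Rightarrow> ?J y z) \<le> norm (case x of (y, z) \<Rightarrow> time_kernel T H y * M * \<bar>\<eta> z\<bar>)"
        unfolding case_prod_unfold real_norm_def by (intro AE_I2 order_trans[OF Jb abs_ge_self])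
    qed measurable
    have "tf (?F \<xi>) (?G \<xi>) = (\<integral>y. \<integral>z. ?J y z \<partial>L1 \<partial>lborel2)"
      unfolding time_form_def
    proof (rule Bochner_Integration.integral_cong[OF refl])
      fix y :: "real \<times> real"
      have i: "integrable L1 (\<lambda>z. ?F \<xi> (fst y) * cnj (complex_of_real (\<eta> z) * heat_profile z \<xi> (snd y)))"
        by (intro integrable_mult_right integrable_cnj \<eta>_heat_profile_integrable)
      have "Re (?F \<xi> (fst y) * cnj (?G \<xi> (snd y))) = Re (\<integral>z. ?F \<xi> (fst y) * cnj (complex_of_real (\<eta> z) * heat_profile z \<xi> (snd y)) \<partial>L1)"
        unfolding profile_backward_conv by (simp only: integral_mult_right_zero Bochner_Integration.integral_cnj)
      also have "\<dots> = (\<integral>z. Re (?F \<xi> (fst y) * cnj (complex_of_real (\<eta> z) * heat_profile z \<xi> (snd y))) \<partial>L1)"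
        by (rule integral_Re[OF i, symmetric])
      also have "\<dots> = (\<integral>z. \<eta> z * Re (?F \<xi> (fst y) * cnj (heat_profile z \<xi> (snd y))) \<partial>L1)"
        by (intro Bochner_Integration.integral_cong refl) (simp add: algebra_simps)
      finally have e: "Re (?F \<xi> (fst y) * cnj (?G \<xi> (snd y))) = (\<integral>z. \<eta> z * Re (?F \<xi> (fst y) * cnj (heat_profile z \<xi> (snd y))) \<partial>L1)" .
      show "time_kernel T H y * Re (?F \<xi> (fst y) * cnj (?G \<xi> (snd y))) = (\<integral>z. ?J y z \<partial>L1)"
        unfolding e integral_mult_right_zero[symmetric] by (simp only: mult.left_commute[of "time_kernel T H y"])
    qed
    also have "\<dots> = (\<integral>z. \<integral>y. ?J y z \<partial>lborel2 \<partial>L1)"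
      using L2.integral_fst[OF iJ] L2.integral_snd[OF iJ] by simp
    finally show ?thesis unfolding time_form_def by (simp only: integral_mult_right_zero)
  qed
  have hz: "(\<lambda>x. tf (?F (fst x)) (heat_profile (snd x) (fst x))) \<in> borel_measurable (\<mu> \<Otimes>\<^sub>M L1)"
    unfolding time_form_def by (rule sigma_finite_measure.borel_measurable_lebesgue_integral[OF sigma_finite_lborel2]) measurable
  \<comment> \<open>A majorant in \<xi> alone: the mixed term is at most the sum of two forms, and
    the form of a heat profile is bounded by \<open>cap\<close> uniformly in
    \<open>z\<close>.\<close>
  define W where "W \<xi> = tf (nm (?F \<xi>)) (nm (?F \<xi>)) + time_bound H * cap \<xi> powr (2 * H)" for \<xi>
  have Wi: "integrable \<mu> W" unfolding W_def using F cap_integrable by (simp add: profiles_def)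
  have Wb: "\<bar>tf (?F \<xi>) (heat_profile z \<xi>)\<bar> \<le> W \<xi>" for \<xi> z
    using time_form_cross_le(1)[OF Fb[of \<xi>] heat_profile_bounded_borel[of z \<xi>]] time_form_heat_profile_le[of z \<xi>] by (simp add: W_def)
  have iW: "integrable (\<mu> \<Otimes>\<^sub>M L1) (\<lambda>(\<xi>, z). \<eta> z * tf (?F \<xi>) (heat_profile z \<xi>))"
  proof (rule Bochner_Integration.integrable_bound)
    have [measurable]: "W \<in> borel_measurable \<mu>" using Wi by simp
    show "integrable (\<mu> \<Otimes>\<^sub>M L1) (\<lambda>(\<xi>, z). W \<xi> * \<bar>\<eta> z\<bar>)"
    proof (rule LM.Fubini_integrable)
      show "integrable \<mu> (\<lambda>\<xi>. \<integral>z. norm (case (\<xi>, z) of (\<xi>, z) \<Rightarrow> W \<xi> * \<bar>\<eta> z\<bar>) \<partial>L1)"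
        using integrable_norm[OF Wi] by (simp add: abs_mult)
      show "AE \<xi> in \<mu>. integrable L1 (\<lambda>z. case (\<xi>, z) of (\<xi>, z) \<Rightarrow> W \<xi> * \<bar>\<eta> z\<bar>)" using \<eta>_integrable by simp
    qed measurable
    show "AE x in \<mu> \<Otimes>\<^sub>M L1. norm (case x of (\<xi>, z) \<Rightarrow> \<eta> z * tf (?F \<xi>) (heat_profile z \<xi>)) \<le> norm (case x of (\<xi>, z) \<Rightarrow> W \<xi> * \<bar>\<eta> z\<bar>)"
    proof (intro AE_I2, unfold case_prod_unfold real_norm_def)
      fix x :: "'a \<times> real \<times> 'a"
      have "\<bar>\<eta> (snd x)\<bar> * \<bar>tf (?F (fst x)) (heat_profile (snd x) (fst x))\<bar> \<le> \<bar>\<eta> (snd x)\<bar> * \<bar>W (fst x)\<bar>"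
        using Wb[of "fst x" "snd x"] by (intro mult_left_mono) auto
      then show "\<bar>\<eta> (snd x) * tf (?F (fst x)) (heat_profile (snd x) (fst x))\<bar> \<le> \<bar>W (fst x) * \<bar>\<eta> (snd x)\<bar>\<bar>"
        by (simp add: abs_mult mult.commute)
    qed
    show "(\<lambda>(\<xi>, z). \<eta> z * tf (?F \<xi>) (heat_profile z \<xi>)) \<in> borel_measurable (\<mu> \<Otimes>\<^sub>M L1)"
      using hz unfolding case_prod_unfold by measurable
  qed
  have "profile_form ?F ?G = (\<integral>\<xi>. \<integral>z. \<eta> z * tf (?F \<xi>) (heat_profile z \<xi>) \<partial>L1 \<partial>\<mu>)"
    unfolding profile_form_def step1 ..
  also have "\<dots> = (\<integral>z. \<integral>\<xi>. \<eta> z * tf (?F \<xi>) (heat_profile z \<xi>) \<partial>\<mu> \<partial>L1)"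
    using LM.integral_fst[OF iW] LM.integral_snd[OF iW] by simp
  also have "\<dots> = (\<integral>z. \<eta> z * profile_form ?F (heat_profile z) \<partial>L1)" unfolding profile_form_def by (simp only: integral_mult_right_zero)
  finally have e: "profile_form ?F ?G = (\<integral>z. \<eta> z * profile_form ?F (heat_profile z) \<partial>L1)" .
  show ?thesis
    unfolding hp_inner_eq_profile_form[OF \<phi> backward_conv_regular] hp_inner_eq_profile_form[OF \<phi> gk_regular] profile_gk e
      integral_mult_right_zero[symmetric] by (simp only: mult.left_commute[of _ hp_const])
qed

end

section \<open>The solution\<close>

text \<open>Noise integrals are only defined up to null sets. A jointly measurable choice is the almost sure limit
  of integrals at points of a countable dense set, chosen measurably in \<open>z\<close> so close to \<open>z\<close> that the limit exists.\<close>
definition grid :: "nat \<Rightarrow> real \<times> 'a" where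
  "grid = (SOME g. \<forall>U. open U \<and> U \<noteq> {} \<longrightarrow> (\<exists>k. g k \<in> U))"

lemma grid_dense: "open U \<Longrightarrow> U \<noteq> {} \<Longrightarrow> \<exists>k. grid k \<in> U"
proof -
  obtain D :: "(real \<times> 'a) set" where D: "countable D" "\<And>U. open U \<Longrightarrow> U \<noteq> {} \<Longrightarrow> \<exists>d\<in>D. d \<in> U"
    using countable_dense_setE by blast
  have "D \<noteq> {}" using D(2)[of UNIV] by auto
  have "\<exists>k. from_nat_into D k \<in> U" if U: "open U" "U \<noteq> {}" for U
  proof -
    obtain d where d: "d \<in> D" "d \<in> U" using D(2)[OF U] by blast
    then show ?thesis using from_nat_into_surj[OF D(1) d(1)] by metis
  qed
  then have "\<exists>g::nat \<Rightarrow> real \<times> 'a. \<forall>U. open U \<and> U \<noteq> {} \<longrightarrow> (\<exists>k. g k \<in> U)" by blast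
  from someI_ex[OF this] show "open U \<Longrightarrow> U \<noteq> {} \<Longrightarrow> \<exists>k. grid k \<in> U" unfolding grid_def by blast
qed

lemma grid_approx:
  assumes "e > 0" shows "\<exists>k. hpd (gk z) (gk (grid k)) < e"
proof -
  have "\<exists>k. grid k \<in> ball z (1 / real (Suc n))" for n by (rule grid_dense) auto
  then obtain k where k: "\<And>n. dist z (grid (k n)) < 1 / real (Suc n)" unfolding mem_ball by metis
  have "(\<lambda>n. 1 / real (Suc n)) \<longlonglongrightarrow> 0" by real_asymp
  then have "(\<lambda>n. dist (grid (k n)) z) \<longlonglongrightarrow> 0"
    by (rule tendsto_sandwich[OF _ _ tendsto_const, rotated 2])
       (use k in \<open>auto simp: dist_commute intro!: always_eventually less_imp_le\<close>)
  then have "(\<lambda>n. grid (k n)) \<longlonglongrightarrow> z" by (rule tendsto_dist_iff[THEN iffD2])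
  from order_tendstoD(2)[OF gk_continuous[OF this] assms]
  obtain n where "hpd (gk (grid (k n))) (gk z) < e" by (auto simp: eventually_sequentially)
  then show ?thesis using hpd_commute[OF gk_regular[of z] gk_regular[of "grid (k n)"]] by metis
qed

text \<open>The accuracy \<open>(1 / 4) ^ n\<close> is the rate at which
  \<open>square_integrable_lim\<close> yields almost sure convergence; the least index makes the
  choice measurable.\<close>

definition grid_index :: "nat \<Rightarrow> real \<times> 'a \<Rightarrow> nat" where
  "grid_index n z = (LEAST k. hpd (gk z) (gk (grid k)) < (1 / 4) ^ n)"

definition grid_integral :: "nat \<Rightarrow> 'w \<Rightarrow> real" where
  "grid_integral k = (SOME Z. hni (gk (grid k)) Z)"

definition field :: "real \<times> 'a \<Rightarrow> 'w \<Rightarrow> real" where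
  "field z \<omega> = lim (\<lambda>n. grid_integral (grid_index n z) \<omega>)"

lemma grid_index: "hpd (gk z) (gk (grid (grid_index n z))) < (1 / 4) ^ n"
  unfolding grid_index_def by (rule LeastI_ex[OF grid_approx]) simp

lemma grid_integral: "hni (gk (grid k)) (grid_integral k)"
  unfolding grid_integral_def by (rule someI_ex[OF noise_integral_exists[OF gk_admissible]])

lemma grid_integral_square_integrable: "grid_integral k \<in> square_integrable P"
  by (rule noise_integral_square_integrable[OF grid_integral])

lemma grid_integral_Cauchy:
  assumes "n \<le> m"
  shows "(\<integral>\<omega>. (grid_integral (grid_index n z) \<omega> - grid_integral (grid_index m z) \<omega>)\<^sup>2 \<partial>P) \<le> 4 * (1 / 4) ^ n"
proof -
  let ?a = "gk (grid (grid_index n z))" and ?b = "gk (grid (grid_index m z))"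
  have "(1 / 4 :: real) ^ m \<le> (1 / 4) ^ n" using assms by (intro power_decreasing) auto
  moreover have "hpd ?a ?b \<le> 2 * hpd ?a (gk z) + 2 * hpd (gk z) ?b" by (intro hp_inner_triangle gk_regular)
  moreover have "hpd ?a (gk z) = hpd (gk z) ?a" by (intro hpd_commute gk_regular)
  ultimately have "hpd ?a ?b \<le> 4 * (1 / 4) ^ n"
    using grid_index[of z n] grid_index[of z m] by linarith
  then show ?thesis unfolding noise_integral_isometry(1)[OF grid_integral gk_regular grid_integral gk_regular] .
qed

lemma field_limit:
  shows field_square_integrable: "field z \<in> square_integrable P"
    and "(\<integral>\<omega>. (grid_integral (grid_index n z) \<omega> - field z \<omega>)\<^sup>2 \<partial>P) \<le> 4 * (1 / 4) ^ n"
  using square_integrable_lim[of "\<lambda>n. grid_integral (grid_index n z)" 4, OF grid_integral_square_integrable _ grid_integral_Cauchy]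
  unfolding field_def[abs_def] by simp_all

lemma quarter_power_tendsto: "(\<lambda>n. a * (1 / 4 :: real) ^ n) \<longlonglongrightarrow> 0"
  by (intro tendsto_mult_right_zero LIMSEQ_realpow_zero) auto

lemma field_integral: "hni (gk z) (field z)"
proof (rule noise_integral_limit[OF gk_admissible field_square_integrable grid_integral gk_regular])
  have "(\<lambda>n. (1 / 4 :: real) ^ n) \<longlonglongrightarrow> 0" using quarter_power_tendsto[of 1] by simp
  then have "(\<lambda>n. hpd (gk z) (gk (grid (grid_index n z)))) \<longlonglongrightarrow> 0"
    by (rule tendsto_sandwich[OF _ _ tendsto_const, rotated 2])
       (intro always_eventually allI less_imp_le grid_index hpd_nonneg gk_regular)+
  then show "(\<lambda>n. hpd (gk (grid (grid_index n z))) (gk z)) \<longlonglongrightarrow> 0"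
    unfolding hpd_commute[OF gk_regular[of z] gk_regular] .
  show "(\<lambda>n. \<integral>\<omega>. (grid_integral (grid_index n z) \<omega> - field z \<omega>)\<^sup>2 \<partial>P) \<longlonglongrightarrow> 0"
    by (rule tendsto_sandwich[OF _ _ tendsto_const quarter_power_tendsto[of 4]]) (use field_limit(2) in auto)
qed

lemma field_measurable: "(\<lambda>y. field (fst y) (snd y)) \<in> borel_measurable ((borel \<Otimes>\<^sub>M borel) \<Otimes>\<^sub>M P)"
proof -
  have [measurable]: "grid_index n \<in> (borel \<Otimes>\<^sub>M borel) \<rightarrow>\<^sub>M count_space UNIV" for n
    unfolding grid_index_def[abs_def]
  proof (rule measurable_Least)
    fix k
    note [measurable] = hpd_gk_measurable[of "grid k"]
    show "Measurable.pred (borel \<Otimes>\<^sub>M borel) (\<lambda>z. hpd (gk z) (gk (grid k)) < (1 / 4) ^ n)" by measurable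
  qed
  note [measurable] = square_integrable_measurable[OF grid_integral_square_integrable]
  \<comment> \<open>Each \<open>grid_integral k\<close> is an arbitrary choice, measurable in
    \<omega> only. Joint measurability survives because the index takes countably many values and
    depends measurably on \<open>z\<close>.\<close>
  have [measurable]: "(\<lambda>y. grid_integral (grid_index n (fst y)) (snd y)) \<in> borel_measurable ((borel \<Otimes>\<^sub>M borel) \<Otimes>\<^sub>M P)" for n
    by (rule measurable_compose_countable[where f="\<lambda>k y. grid_integral k (snd y)" and g="\<lambda>y. grid_index n (fst y)"]) measurable
  show ?thesis unfolding field_def by measurable
qed

lemma field_second_moment: "(\<integral>\<omega>. (field z \<omega>)\<^sup>2 \<partial>P) \<le> variance_bound"
  unfolding noise_integral_square[OF field_integral gk_regular] by (rule hp_gk_le)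

section \<open>The weak equation for one test function\<close>

context
  fixes \<eta> :: "real \<times> 'a \<Rightarrow> real"
  assumes \<eta>: "\<eta> \<in> test_functions T"
begin

interpretation LP: pair_sigma_finite L1 P
  by (intro pair_sigma_finite.intro sigma_finite_L1[OF \<eta>] sigma_finite_measure_axioms)

lemmas \<eta>_m [measurable] = \<eta>_measurable[OF \<eta>]

definition weak_integral :: "'w \<Rightarrow> real" where
  "weak_integral \<omega> = (\<integral>z. \<eta> z * field z \<omega> \<partial>L1)"

text \<open>Second moments of the field are bounded uniformly in \<open>z\<close>, which leaves
  integrability of \<eta>. The weight \<open>V\<close> is later the constant 1, the field at a
  point, the noise integral \<open>Z\<close>, and the weak integral itself.\<close>

lemma weighted_field_integrable:
  assumes V: "V \<in> square_integrable P"
  shows "integrable (L1 \<Otimes>\<^sub>M P) (\<lambda>(z, \<omega>). \<eta> z * (V \<omega> * field z \<omega>))"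
proof (rule LP.Fubini_integrable)
  note [measurable] = square_integrable_measurable[OF V] field_measurable
  show "(\<lambda>(z, \<omega>). \<eta> z * (V \<omega> * field z \<omega>)) \<in> borel_measurable (L1 \<Otimes>\<^sub>M P)"
    unfolding case_prod_unfold by measurable
  have i: "integrable P (\<lambda>\<omega>. V \<omega> * field z \<omega>)" for z by (rule square_integrable_mult[OF V field_square_integrable])
  show "AE z in L1. integrable P (\<lambda>\<omega>. case (z, \<omega>) of (z, \<omega>) \<Rightarrow> \<eta> z * (V \<omega> * field z \<omega>))"
    using i by simp
  define K where "K = (\<integral>\<omega>. (V \<omega>)\<^sup>2 \<partial>P) + variance_bound"
  have b: "(\<integral>\<omega>. \<bar>V \<omega> * field z \<omega>\<bar> \<partial>P) \<le> K" for z
  proof -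
    have i2: "integrable P (\<lambda>\<omega>. (V \<omega>)\<^sup>2)" "integrable P (\<lambda>\<omega>. (field z \<omega>)\<^sup>2)"
      using V field_square_integrable[of z] by (auto simp: square_integrable_def)
    have "(\<integral>\<omega>. \<bar>V \<omega> * field z \<omega>\<bar> \<partial>P) \<le> (\<integral>\<omega>. (V \<omega>)\<^sup>2 + (field z \<omega>)\<^sup>2 \<partial>P)"
      by (intro integral_mono integrable_abs i Bochner_Integration.integrable_add i2 abs_mult_le_squares)
    then show ?thesis using field_second_moment[of z] i2 by (simp add: K_def)
  qed
  show "integrable L1 (\<lambda>z. \<integral>\<omega>. norm (case (z, \<omega>) of (z, \<omega>) \<Rightarrow> \<eta> z * (V \<omega> * field z \<omega>)) \<partial>P)"
  proof (rule Bochner_Integration.integrable_bound)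
    show "integrable L1 (\<lambda>z. \<bar>\<eta> z\<bar> * K)" by (intro integrable_mult_left integrable_abs \<eta>_integrable[OF \<eta>])
    show "AE z in L1. norm (\<integral>\<omega>. norm (case (z, \<omega>) of (z, \<omega>) \<Rightarrow> \<eta> z * (V \<omega> * field z \<omega>)) \<partial>P) \<le> norm (\<bar>\<eta> z\<bar> * K)"
    proof (rule AE_I2)
      fix z
      have "(\<integral>\<omega>. norm (case (z, \<omega>) of (z, \<omega>) \<Rightarrow> \<eta> z * (V \<omega> * field z \<omega>)) \<partial>P) = \<bar>\<eta> z\<bar> * (\<integral>\<omega>. \<bar>V \<omega> * field z \<omega>\<bar> \<partial>P)"
        unfolding prod.case real_norm_def abs_mult[of "\<eta> z"] by (rule integral_mult_right_zero)
      moreover have "\<dots> \<le> \<bar>\<eta> z\<bar> * K" by (intro mult_left_mono b) simp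
      moreover have "0 \<le> \<bar>\<eta> z\<bar> * (\<integral>\<omega>. \<bar>V \<omega> * field z \<omega>\<bar> \<partial>P)" by simp
      ultimately show "norm (\<integral>\<omega>. norm (case (z, \<omega>) of (z, \<omega>) \<Rightarrow> \<eta> z * (V \<omega> * field z \<omega>)) \<partial>P) \<le> norm (\<bar>\<eta> z\<bar> * K)"
        unfolding real_norm_def by linarith
    qed
    show "(\<lambda>z. \<integral>\<omega>. norm (case (z, \<omega>) of (z, \<omega>) \<Rightarrow> \<eta> z * (V \<omega> * field z \<omega>)) \<partial>P) \<in> borel_measurable L1"
      unfolding prod.case
      by (rule sigma_finite_measure.borel_measurable_lebesgue_integral[OF sigma_finite_measure_axioms])
         (unfold case_prod_unfold, measurable)
  qed
qed

lemma weak_integral_covariance: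
  assumes V: "V \<in> square_integrable P"
  shows "(\<integral>\<omega>. V \<omega> * weak_integral \<omega> \<partial>P) = (\<integral>z. \<eta> z * (\<integral>\<omega>. V \<omega> * field z \<omega> \<partial>P) \<partial>L1)"
proof -
  note i = weighted_field_integrable[OF V]
  have "(\<integral>\<omega>. V \<omega> * weak_integral \<omega> \<partial>P) = (\<integral>\<omega>. \<integral>z. \<eta> z * (V \<omega> * field z \<omega>) \<partial>L1 \<partial>P)"
    unfolding weak_integral_def integral_mult_right_zero[symmetric] by (simp only: mult.left_commute)
  also have "\<dots> = (\<integral>z. \<integral>\<omega>. \<eta> z * (V \<omega> * field z \<omega>) \<partial>P \<partial>L1)"
    using LP.integral_fst[OF i] LP.integral_snd[OF i] by simp
  finally show ?thesis by (simp only: integral_mult_right_zero)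
qed

lemma one_square_integrable: "(\<lambda>_. 1) \<in> square_integrable P"
  by (simp add: square_integrable_def)

lemma AE_field_integrable: "AE \<omega> in P. integrable L1 (\<lambda>z. \<eta> z * field z \<omega>)"
  using LP.AE_integrable_snd[OF weighted_field_integrable[OF one_square_integrable]] by simp

text \<open>Required before the weak integral can be tested against itself. Cauchy-Schwarz with
  weight \<open>|\<eta>|\<close> bounds its square by the \<open>|\<eta>|\<close>-average of the
  squared field, which has finite mean by Fubini.\<close>

lemma weak_integral_square_integrable: "weak_integral \<in> square_integrable P"
proof -
  note [measurable] = field_measurable
  have Ym[measurable]: "weak_integral \<in> borel_measurable P"
    using borel_measurable_integrable[OF LP.integrable_snd[OF weighted_field_integrable[OF one_square_integrable]]]
    unfolding weak_integral_def[abs_def] by simp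
  define a where "a \<omega> = (\<integral>z. \<bar>\<eta> z\<bar> * (field z \<omega>)\<^sup>2 \<partial>L1)" for \<omega>
  have i2: "integrable (L1 \<Otimes>\<^sub>M P) (\<lambda>(z, \<omega>). \<bar>\<eta> z\<bar> * (field z \<omega>)\<^sup>2)"
  proof (rule LP.Fubini_integrable)
    show "(\<lambda>(z, \<omega>). \<bar>\<eta> z\<bar> * (field z \<omega>)\<^sup>2) \<in> borel_measurable (L1 \<Otimes>\<^sub>M P)"
      unfolding case_prod_unfold by measurable
    show "AE z in L1. integrable P (\<lambda>\<omega>. case (z, \<omega>) of (z, \<omega>) \<Rightarrow> \<bar>\<eta> z\<bar> * (field z \<omega>)\<^sup>2)"
      using field_square_integrable by (simp add: square_integrable_def)
    show "integrable L1 (\<lambda>z. \<integral>\<omega>. norm (case (z, \<omega>) of (z, \<omega>) \<Rightarrow> \<bar>\<eta> z\<bar> * (field z \<omega>)\<^sup>2) \<partial>P)"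
    proof (rule Bochner_Integration.integrable_bound)
      show "integrable L1 (\<lambda>z. \<bar>\<eta> z\<bar> * variance_bound)" by (intro integrable_mult_left integrable_abs \<eta>_integrable[OF \<eta>])
      show "AE z in L1. norm (\<integral>\<omega>. norm (case (z, \<omega>) of (z, \<omega>) \<Rightarrow> \<bar>\<eta> z\<bar> * (field z \<omega>)\<^sup>2) \<partial>P) \<le> norm (\<bar>\<eta> z\<bar> * variance_bound)"
      proof (rule AE_I2)
        fix z
        have "(\<integral>\<omega>. norm (case (z, \<omega>) of (z, \<omega>) \<Rightarrow> \<bar>\<eta> z\<bar> * (field z \<omega>)\<^sup>2) \<partial>P) = \<bar>\<eta> z\<bar> * (\<integral>\<omega>. (field z \<omega>)\<^sup>2 \<partial>P)"
          by simp
        moreover have "\<dots> \<le> \<bar>\<eta> z\<bar> * variance_bound" by (intro mult_left_mono field_second_moment) simp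
        moreover have "0 \<le> \<bar>\<eta> z\<bar> * (\<integral>\<omega>. (field z \<omega>)\<^sup>2 \<partial>P)" by simp
        ultimately show "norm (\<integral>\<omega>. norm (case (z, \<omega>) of (z, \<omega>) \<Rightarrow> \<bar>\<eta> z\<bar> * (field z \<omega>)\<^sup>2) \<partial>P) \<le> norm (\<bar>\<eta> z\<bar> * variance_bound)"
          unfolding real_norm_def by linarith
      qed
      show "(\<lambda>z. \<integral>\<omega>. norm (case (z, \<omega>) of (z, \<omega>) \<Rightarrow> \<bar>\<eta> z\<bar> * (field z \<omega>)\<^sup>2) \<partial>P) \<in> borel_measurable L1"
        unfolding prod.case
        by (rule sigma_finite_measure.borel_measurable_lebesgue_integral[OF sigma_finite_measure_axioms])
           (unfold case_prod_unfold, measurable)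
    qed
  qed
  have ai: "integrable P a" unfolding a_def by (rule LP.integrable_snd[OF i2])
  have "AE \<omega> in P. (weak_integral \<omega>)\<^sup>2 \<le> a \<omega> * \<eta>_norm \<eta>"
    using AE_field_integrable LP.AE_integrable_snd[OF i2]
  proof eventually_elim
    case (elim \<omega>)
    define b where "b = (\<integral>z. \<bar>\<eta> z\<bar> * \<bar>field z \<omega>\<bar> \<partial>L1)"
    have ib: "integrable L1 (\<lambda>z. \<bar>\<eta> z\<bar> * \<bar>field z \<omega>\<bar>)" using integrable_abs[OF elim(1)] by (simp add: abs_mult)
    have ia: "integrable L1 (\<lambda>z. \<bar>\<eta> z\<bar> * (field z \<omega>)\<^sup>2)" using elim(2) .
    have ic: "integrable L1 (\<lambda>z. \<bar>\<eta> z\<bar>)" by (intro integrable_abs \<eta>_integrable[OF \<eta>])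
    have "b\<^sup>2 \<le> a \<omega> * \<eta>_norm \<eta>"
    proof (rule quadratic_nonneg_imp)
      fix t
      have e: "\<bar>\<eta> z\<bar> * (\<bar>field z \<omega>\<bar> + t)\<^sup>2 = \<bar>\<eta> z\<bar> * (field z \<omega>)\<^sup>2 + 2 * t * (\<bar>\<eta> z\<bar> * \<bar>field z \<omega>\<bar>) + t\<^sup>2 * \<bar>\<eta> z\<bar>" for z
        by (simp add: power2_sum algebra_simps)
      have "0 \<le> (\<integral>z. \<bar>\<eta> z\<bar> * (\<bar>field z \<omega>\<bar> + t)\<^sup>2 \<partial>L1)" by (intro Bochner_Integration.integral_nonneg) simp
      also have "\<dots> = a \<omega> + 2 * t * b + t\<^sup>2 * \<eta>_norm \<eta>"
        unfolding e a_def b_def \<eta>_norm_def[OF \<eta>] using ia ib ic by simp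
      finally show "0 \<le> a \<omega> + 2 * t * b + t\<^sup>2 * \<eta>_norm \<eta>" .
    qed
    moreover have "\<bar>weak_integral \<omega>\<bar> \<le> b"
      unfolding weak_integral_def b_def using integral_abs_bound[of L1 "\<lambda>z. \<eta> z * field z \<omega>"] by (simp add: abs_mult)
    then have "(weak_integral \<omega>)\<^sup>2 \<le> b\<^sup>2" by (rule abs_le_square_iff[THEN iffD1, OF order_trans[OF _ abs_ge_self]])
    ultimately show ?case by linarith
  qed
  then have "AE \<omega> in P. norm ((weak_integral \<omega>)\<^sup>2) \<le> norm (a \<omega> * \<eta>_norm \<eta>)" by eventually_elim simp
  then have "integrable P (\<lambda>\<omega>. (weak_integral \<omega>)\<^sup>2)"
    by (intro Bochner_Integration.integrable_bound[OF integrable_mult_left[OF ai]]) auto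
  then show ?thesis by (simp add: square_integrable_def)
qed

lemma weak_integral_eq:
  assumes Z: "hni (backward_conv T p \<eta>) Z"
  shows "AE \<omega> in P. weak_integral \<omega> = Z \<omega>"
proof (rule AE_eq_of_square_zero)
  let ?bc = "backward_conv T p \<eta>"
  note bc = backward_conv_regular[OF \<eta>]
  note ZL = noise_integral_square_integrable[OF Z] and YL = weak_integral_square_integrable
  have ZU: "(\<integral>\<omega>. Z \<omega> * field z \<omega> \<partial>P) = hp ?bc (gk z)" for z
    by (rule noise_integral_isometry(2)[OF Z bc field_integral gk_regular])
  have ZY: "(\<integral>\<omega>. Z \<omega> * weak_integral \<omega> \<partial>P) = hp ?bc ?bc"
    unfolding weak_integral_covariance[OF ZL] ZU hp_backward_conv[OF \<eta> bc] ..
  \<comment> \<open>The weak integral and \<open>Z\<close> have the same covariance with the field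
    at every point.\<close>
  have UY: "(\<integral>\<omega>. weak_integral \<omega> * field z \<omega> \<partial>P) = (\<integral>\<omega>. Z \<omega> * field z \<omega> \<partial>P)" for z
  proof -
    have "(\<integral>\<omega>. field z \<omega> * weak_integral \<omega> \<partial>P) = (\<integral>w. \<eta> w * hp (gk z) (gk w) \<partial>L1)"
      unfolding weak_integral_covariance[OF field_square_integrable]
        noise_integral_isometry(2)[OF field_integral gk_regular field_integral gk_regular] ..
    also have "\<dots> = hp ?bc (gk z)"
      unfolding hp_backward_conv[OF \<eta> gk_regular, symmetric] by (rule hp_inner_commute[OF gk_regular bc])
    finally show ?thesis by (simp only: ZU mult.commute)
  qed
  \<comment> \<open>Both sides are the \<eta>-average of covariances with the field, with weight
    \<open>V\<close> equal to the weak integral on the left and to \<open>Z\<close> on the right;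
    these covariances agree pointwise.\<close>
  have YY: "(\<integral>\<omega>. weak_integral \<omega> * weak_integral \<omega> \<partial>P) = (\<integral>\<omega>. Z \<omega> * weak_integral \<omega> \<partial>P)"
    unfolding weak_integral_covariance[OF YL] UY weak_integral_covariance[OF ZL] ..
  show "(\<integral>\<omega>. (weak_integral \<omega> - Z \<omega>)\<^sup>2 \<partial>P) = 0"
    unfolding square_integrable_diff(2)[OF YL ZL] noise_integral_square[OF Z bc]
    using YY ZY by (simp add: power2_eq_square mult.commute)
qed (use noise_integral_square_integrable[OF Z] weak_integral_square_integrable in auto)

lemma weak_equation:
  "\<exists>Z. hni (backward_conv T p \<eta>) Z \<and>
    (AE \<omega> in P. set_integrable lborel ({0..T} \<times> UNIV) (\<lambda>(t, x). field (t, x) \<omega> * \<eta> (t, x)) \<and>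
       (LBINT t:{0..T}. (\<integral>x. field (t, x) \<omega> * \<eta> (t, x) \<partial>lborel)) = Z \<omega>)"
proof -
  obtain Z where Z: "hni (backward_conv T p \<eta>) Z" using noise_integral_exists[OF backward_conv_admissible[OF \<eta>]] by blast
  have "AE \<omega> in P. set_integrable lborel ({0..T} \<times> UNIV) (\<lambda>(t, x). field (t, x) \<omega> * \<eta> (t, x)) \<and>
       (LBINT t:{0..T}. (\<integral>x. field (t, x) \<omega> * \<eta> (t, x) \<partial>lborel)) = Z \<omega>"
    using AE_field_integrable weak_integral_eq[OF Z]
  proof eventually_elim
    case (elim \<omega>)
    have e: "indicator ({0..T} \<times> UNIV) z *\<^sub>R (case z of (t, x) \<Rightarrow> field (t, x) \<omega> * \<eta> (t, x)) = \<eta> z * field z \<omega>" for z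
    proof (cases z)
      case (Pair t x)
      then show ?thesis using \<eta>_support[OF \<eta>, of t x] by (cases "0 < t \<and> t < T") (auto simp: indicator_def)
    qed
    have 1: "set_integrable lborel ({0..T} \<times> UNIV) (\<lambda>(t, x). field (t, x) \<omega> * \<eta> (t, x))"
      using elim(1) unfolding set_integrable_def e lborel_prod .
    have s: "indicator {0..T} t *\<^sub>R (\<integral>x. field (t, x) \<omega> * \<eta> (t, x) \<partial>lborel) = (\<integral>x. \<eta> (t, x) * field (t, x) \<omega> \<partial>lborel)" for t
      using \<eta>_support[OF \<eta>, of t] by (cases "0 < t \<and> t < T") (auto simp: indicator_def mult.commute)
    have "(LBINT t:{0..T}. (\<integral>x. field (t, x) \<omega> * \<eta> (t, x) \<partial>lborel)) = (\<integral>t. \<integral>x. \<eta> (t, x) * field (t, x) \<omega> \<partial>lborel \<partial>lborel)"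
      unfolding set_lebesgue_integral_def s ..
    also have "\<dots> = weak_integral \<omega>"
      unfolding weak_integral_def by (rule lborel_pair.integral_fst'[OF elim(1)])
    finally show ?case using 1 elim(2) by simp
  qed
  then show ?thesis using Z by blast
qed

end

lemma field_is_solution: "heat_solution P T H c \<mu> B p (\<lambda>t x. field (t, x))"
  unfolding heat_solution_def
proof (intro conjI ballI weak_equation)
  have "(\<lambda>y. (fst y, snd y)) \<in> restrict_space borel ({0..T} \<times> (UNIV :: 'a set)) \<Otimes>\<^sub>M P \<rightarrow>\<^sub>M (borel \<Otimes>\<^sub>M borel) \<Otimes>\<^sub>M P"
  proof (rule measurable_Pair)
    show "fst \<in> restrict_space borel ({0..T} \<times> (UNIV :: 'a set)) \<Otimes>\<^sub>M P \<rightarrow>\<^sub>M borel \<Otimes>\<^sub>M borel"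
      by (rule measurable_compose[OF measurable_fst measurable_restrict_space1]) (simp add: borel_prod)
  qed simp
  from measurable_compose[OF this field_measurable]
  show "(\<lambda>((t, x), \<omega>). field (t, x) \<omega>) \<in> borel_measurable (restrict_space borel ({0..T} \<times> UNIV) \<Otimes>\<^sub>M P)"
    by (simp add: case_prod_unfold)
qed

end

theorem theorem2p5:
  fixes T H c :: real
    and Q :: "'v measure" and X :: "real \<Rightarrow> 'v \<Rightarrow> 'a::euclidean_space"
    and \<Psi> :: "'a \<Rightarrow> complex" and p :: "real \<Rightarrow> 'a \<Rightarrow> real"
    and \<mu> :: "'a measure" and f :: "'a \<Rightarrow> real"
    and P :: "'w measure" and B :: "(real \<times> 'a \<Rightarrow> real) \<Rightarrow> 'w \<Rightarrow> real"
  assumes "0 < T" and "1 / 2 < H" and "H < 1" and "0 < c"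
    and "levy_process Q X"
    and "has_char_exponent Q X \<Psi>"
    and "\<forall>\<xi>. \<Psi> (- \<xi>) = \<Psi> \<xi>"
    and "has_transition_densities Q X \<Psi> p"
    and "tempered_measure \<mu>"
    and "is_fourier_transform_of f \<mu>"
    and "fractional_colored_noise P T H c \<mu> B"
    and "\<forall>t>0. (\<integral>\<^sup>+\<xi>. ennreal (1 / (t powr (- 2 * H) + Re (\<Psi> \<xi>) powr (2 * H))) \<partial>\<mu>) < \<infinity>"
  shows "\<exists>u. heat_solution P T H c \<mu> B p u \<and>
           (\<forall>t\<in>{0..T}. \<forall>x. has_noise_integral P T H c \<mu> B (heat_kernel_at p t x) (u t x))"
proof -
  interpret symmetric_levy Q X \<Psi> p
    using assms by unfold_locales auto
  interpret heat T H c \<mu> P B Q X \<Psi> p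
    using assms by unfold_locales (auto simp: \<psi>_def)
  have "has_noise_integral P T H c \<mu> B (heat_kernel_at p t x) (field (t, x))" for t x
    using field_integral[of "(t, x)"] by simp
  then show ?thesis using field_is_solution by blast
qed

end
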